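(* Let $p\in[1,\infty)$, $s>0$ with $sp>d$, $\gamma\in(-\infty,d]$, $\beta=2^{\gamma-d}$, let $a=\exp(b_{T,\mathcal D})$ where $b_{T,\mathcal D}$ is the restriction to $\mathcal D$ of a $B^s_p$-random variable $b_T$ with wavelet density $\beta$ (see context), and let $f\in V'$. Then: 1.) There exists almost surely a unique weak solution $u(\omega)\in V$ to $\int_{\mathcal D}a(\omega)\nabla u(\omega)\cdot\nabla v\,dx=\langle f,v\rangle$ for all $v\in V$, and $u:\Omega\to V$ is strongly measurable. 2.) For sufficiently small $\kappa>0$ (the scaling parameter in the density of the coefficients $X_{j,k}^l$) there is $\overline q\in(1,\infty)$ such that, for every $q\in[1,\overline q)$ if $p=1$, and for every $q\in[1,\infty)$ if $p>1$, there is a constant $C>0$ with $$\|u\|_{L^q(\Omega;V)}\le C\|f\|_{V'}<\infty .$$ 3.) Let $r\in(0,s-\frac dp)\cap(0,1]$ and $f\in H$. For sufficiently small $\kappa>0$ there is $\overline q\in(1,\infty)$ such that, for every $q\in[1,\overline q)$ if $p=1$, and for every $q\in[1,\infty)$ if $p>1$, there is a constant $C>0$ with $$\|u\|_{L^q(\Omega;W^r)}\le C\|f\|_H<\infty .$$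
   Context: Domain and spaces. $d\in\{1,2,3\}$; $\mathcal D\subseteq\mathbb T^d=[0,1]^d$ is a convex polytopal domain (a finite interval if $d=1$). $H=L^2(\mathcal D)$, $V=H^1_0(\mathcal D)$ with $\|v\|_V=\|\nabla v\|_H$, $V'$ the dual of $V$, $\langle\cdot,\cdot\rangle$ the $V'$–$V$ pairing. $W=\{v\in V:\Delta v\in H\}$ with $\|v\|_W=\|\Delta v\|_H$; $W^1=W$ and, for $r\in(0,1)$, $W^r=[V,W]_{r,\infty}$ is the real ($K$-method) interpolation space with norm $\sup_{z>0}z^{-r}\inf_{w\in W}\{\|v-w\|_V+z\|w\|_W\}$. $L^q(\Omega;\mathcal X)$ denotes the Lebesgue–Bochner space. Wavelets. Functions on the torus $\mathbb T^d$ are identified with one-periodic functions on $\mathbb R^d$. Let $\phi,\psi\in \mathrm C^{\alpha}(\mathbb R)$, $\alpha\ge1$, $\alpha\ge s$, be compactly supported scaling and wavelet functions of an orthonormal multiresolution analysis of $L^2(\mathbb R)$, with $\|\phi\|_{L^2}=\|\psi\|_{L^2}=1$ and $\int_{\mathbb R}\psi(x)x^m\,dx=0$ for $m\in\mathbb N_0$, $m<\alpha$. Put $\psi_{j,k,0}(x)=\phi(2^jx-k)$, $\psi_{j,k,1}(x)=\psi(2^jx-k)$. Let $\mathcal L_0=\{0,1\}^d$, $\mathcal L_j=\mathcal L_0\setminus\{(0,\dots,0)\}$ for $j\ge1$, $K_j=\{k\in\mathbb Z^d: 0\le k_1,\dots,k_d<2^j\}$, $\psi_{j,k,l}(x)=2^{dj/2}\prod_{i=1}^d\psi_{j,k_i,l(i)}(x_i)$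 and $\psi_{j,k}^l(x)=\sum_{n\in\mathbb Z^d}\psi_{j,k,l}(x-n)$. With $\mathcal I_{\mathbf\Psi}=\{(j,k,l): j\in\mathbb N_0,k\in K_j,l\in\mathcal L_j\}$, $(\psi_{j,k}^l)_{(j,k,l)\in\mathcal I_{\mathbf\Psi}}$ is an orthonormal basis of $L^2(\mathbb T^d)$. Galton–Watson trees. Let $\mathcal U=\bigcup_{n\ge0}\mathbb N^n$, $\varrho=()$ the empty sequence, $|\mathfrak n|$ the length of $\mathfrak n$. A tree is a subset $\mathbf t\subset\mathcal U$ that contains $\varrho$, contains every proper prefix of each of its elements, and such that for each $\mathfrak n\in\mathbf t$ there is $\mathfrak K_{\mathfrak n}(\mathbf t)\in\mathbb N_0\cup\{\infty\}$ with: for $i\in\mathbb N$, $\mathfrak n i\in\mathbf t$ iff $1\le i\le\mathfrak K_{\mathfrak n}(\mathbf t)$. $\mathfrak T$ is the set of all trees with all $\mathfrak K_{\mathfrak n}(\mathbf t)<\infty$, with metric $\delta_{\mathfrak T}(\mathbf t,\mathbf t')=2^{-\sup\{n\in\mathbb N_0:\ \mathfrak r_n(\mathbf t)=\mathfrak r_n(\mathbf t')\}}$, $\mathfrak r_n(\mathbf t)=\{\mathfrak n\in\mathbf t:|\mathfrak n|\le n\}$, and its Borel $\sigma$-algebra. A Galton–Watson (GW) tree with offspring distribution $\mathcal P$ is a $\mathfrak T$-valued random variable $T$ with $\mathfrak K_\varrho(T)\sim\mathcal P$ and such that, conditionally on $\mathfrak K_\varrho(T)=n$, the sub-trees $\{\mathfrak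 m\in\mathcal U: i\mathfrak m\in T\}$, $i=1,\dots,n$, are independent and distributed as $T$. Besov random tree prior. Let $(\Omega,\mathcal A,P)$ be a complete probability space, $\kappa>0$, $X=(X_{j,k}^l)_{(j,k,l)\in\mathcal I_{\mathbf\Psi}}$ i.i.d. real random variables with density $c_p^{-1}\exp(-|x|^p/\kappa)$, $c_p=\int_{\mathbb R}\exp(-|x|^p/\kappa)dx$, and $T$ a GW tree with offspring distribution $\mathrm{Bin}(2^d,\beta)$, independent of $X$. For $\mathfrak n\in\{1,\dots,2^d\}^j$ put $\mathfrak I^1_{d,j}(\mathfrak n)=1+\sum_{i=1}^j2^{d(j-i)}(\mathfrak n_i-1)$, $\mathfrak I^2_{d,j}(n)=\big(\lfloor (n-1)/2^{j(i-1)}\rfloor \bmod 2^j\big)_{i=1,\dots,d}\in K_j$, and $\mathfrak I_{d,j}=\mathfrak I^2_{d,j}\circ\mathfrak I^1_{d,j}$, a bijection $\{1,\dots,2^d\}^j\to K_j$. Set $\mathcal I_T=\{(j,k,l): (j,k)=(|\mathfrak n|,\mathfrak I_{d,|\mathfrak n|}(\mathfrak n))\text{ for some }\mathfrak n\in T,\ l\in\mathcal L_j\}$. The $B^s_p$-random variable with wavelet density $\beta$ is $b_T(\omega)=\sum_{(j,k,l)\in\mathcal I_T(\omega)}\eta_jX_{j,k}^l(\omega)\psi_{j,k}^l$ with $\eta_j=2^{-j(s+\frac d2-\frac dp)}$. $b_{T,\mathcal D}(\omega)$ is the restriction to $\mathcal D$ of (the one-periodic extension of) $b_T(\omega)$.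 "Sufficiently small $\kappa$" means $\kappa\in(0,\kappa_0)$ for some $\kappa_0>0$ depending on the other fixed data. *)

theory Defs
  imports "HOL-Probability.Probability"
begin

text \<open>
  Function spaces on a domain D are sets of representatives, two of which are identified when
  they agree almost everywhere; all norms below depend on the class only. The representatives are
  functions on the whole space of which only the restriction to D matters.
\<close>

section \<open>Square integrable functions\<close>

definition L2_space :: "'a measure \<Rightarrow> ('a \<Rightarrow> 'b::euclidean_space) set" where
  "L2_space M = {f \<in> borel_measurable M. integrable M (\<lambda>x. (norm (f x))\<^sup>2)}"

definition L2_norm :: "'a measure \<Rightarrow> ('a \<Rightarrow> 'b::euclidean_space) \<Rightarrow> real" where
  "L2_norm M f = sqrt (LINT x|M. (norm (f x))\<^sup>2)"

definition L2_closed_span :: "'a measure \<Rightarrow> ('a \<Rightarrow> real) set \<Rightarrow> ('a \<Rightarrow> real) set" where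
  "L2_closed_span M S = {f \<in> L2_space M. \<forall>\<epsilon>>0. \<exists>F c. finite F \<and> F \<subseteq> S \<and>
     L2_norm M (\<lambda>x. f x - (\<Sum>g\<in>F. c g * g x)) < \<epsilon>}"


section \<open>Domain, test functions and Sobolev spaces\<close>

definition convex_polytopal_domain :: "'a::euclidean_space set \<Rightarrow> bool" where
  "convex_polytopal_domain D \<longleftrightarrow> open D \<and> D \<noteq> {} \<and> convex D \<and> polytope (closure D)"

definition partial_deriv :: "'a::euclidean_space \<Rightarrow> ('a \<Rightarrow> real) \<Rightarrow> 'a \<Rightarrow> real" where
  "partial_deriv b f x = frechet_derivative f (at x) b"

primrec times_cont_diff :: "nat \<Rightarrow> ('a::euclidean_space \<Rightarrow> real) \<Rightarrow> bool" where
  "times_cont_diff 0 f \<longleftrightarrow> continuous_on UNIV f"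
| "times_cont_diff (Suc n) f \<longleftrightarrow>
     (\<forall>x. f differentiable (at x)) \<and> (\<forall>b\<in>Basis. times_cont_diff n (partial_deriv b f))"

definition test_functions :: "'a::euclidean_space set \<Rightarrow> ('a \<Rightarrow> real) set" where
  "test_functions D = {f. (\<forall>n. times_cont_diff n f) \<and>
     compact (closure {x. f x \<noteq> 0}) \<and> closure {x. f x \<noteq> 0} \<subseteq> D}"

definition laplacian :: "('a::euclidean_space \<Rightarrow> real) \<Rightarrow> 'a \<Rightarrow> real" where
  "laplacian f x = (\<Sum>b\<in>Basis. partial_deriv b (partial_deriv b f) x)"

definition is_weak_gradient ::
    "'a::euclidean_space set \<Rightarrow> ('a \<Rightarrow> real) \<Rightarrow> ('a \<Rightarrow> 'a) \<Rightarrow> bool" where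
  "is_weak_gradient D v g \<longleftrightarrow> g \<in> L2_space (lebesgue_on D) \<and>
     (\<forall>\<theta>\<in>test_functions D. \<forall>b\<in>Basis.
        (LINT x|lebesgue_on D. v x * partial_deriv b \<theta> x) = - (LINT x|lebesgue_on D. (g x \<bullet> b) * \<theta> x))"

definition weak_gradient :: "'a::euclidean_space set \<Rightarrow> ('a \<Rightarrow> real) \<Rightarrow> 'a \<Rightarrow> 'a" where
  "weak_gradient D v = (SOME g. is_weak_gradient D v g)"

definition is_weak_laplacian ::
    "'a::euclidean_space set \<Rightarrow> ('a \<Rightarrow> real) \<Rightarrow> ('a \<Rightarrow> real) \<Rightarrow> bool" where
  "is_weak_laplacian D v g \<longleftrightarrow> g \<in> L2_space (lebesgue_on D) \<and>
     (\<forall>\<theta>\<in>test_functions D.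
        (LINT x|lebesgue_on D. v x * laplacian \<theta> x) = (LINT x|lebesgue_on D. g x * \<theta> x))"

definition weak_laplacian :: "'a::euclidean_space set \<Rightarrow> ('a \<Rightarrow> real) \<Rightarrow> 'a \<Rightarrow> real" where
  "weak_laplacian D v = (SOME g. is_weak_laplacian D v g)"

definition H_space :: "'a::euclidean_space set \<Rightarrow> ('a \<Rightarrow> real) set" where
  "H_space D = L2_space (lebesgue_on D)"

definition H_norm :: "'a::euclidean_space set \<Rightarrow> ('a \<Rightarrow> real) \<Rightarrow> real" where
  "H_norm D f = L2_norm (lebesgue_on D) f"

definition H1_space :: "'a::euclidean_space set \<Rightarrow> ('a \<Rightarrow> real) set" where
  "H1_space D = {v \<in> L2_space (lebesgue_on D). \<exists>g. is_weak_gradient D v g}"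

definition H1_norm :: "'a::euclidean_space set \<Rightarrow> ('a \<Rightarrow> real) \<Rightarrow> real" where
  "H1_norm D v = sqrt ((L2_norm (lebesgue_on D) v)\<^sup>2 + (L2_norm (lebesgue_on D) (weak_gradient D v))\<^sup>2)"

text \<open>V is the closure of the test functions in the Sobolev space of order one.\<close>

definition V_space :: "'a::euclidean_space set \<Rightarrow> ('a \<Rightarrow> real) set" where
  "V_space D = {v \<in> H1_space D. \<forall>\<epsilon>>0. \<exists>\<theta>\<in>test_functions D. H1_norm D (\<lambda>x. v x - \<theta> x) < \<epsilon>}"

definition V_norm :: "'a::euclidean_space set \<Rightarrow> ('a \<Rightarrow> real) \<Rightarrow> real" where
  "V_norm D v = L2_norm (lebesgue_on D) (weak_gradient D v)"

definition V_dual :: "'a::euclidean_space set \<Rightarrow> (('a \<Rightarrow> real) \<Rightarrow> real) set" where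
  "V_dual D = {F.
     (\<forall>v\<in>V_space D. \<forall>w\<in>V_space D. \<forall>c c'. F (\<lambda>x. c * v x + c' * w x) = c * F v + c' * F w) \<and>
     (\<exists>C. \<forall>v\<in>V_space D. \<bar>F v\<bar> \<le> C * V_norm D v)}"

definition V_dual_norm :: "'a::euclidean_space set \<Rightarrow> (('a \<Rightarrow> real) \<Rightarrow> real) \<Rightarrow> real" where
  "V_dual_norm D F = (SUP v\<in>{v \<in> V_space D. V_norm D v \<le> 1}. \<bar>F v\<bar>)"

text \<open>The embedding of H into the dual of V.\<close>

definition H_functional :: "'a::euclidean_space set \<Rightarrow> ('a \<Rightarrow> real) \<Rightarrow> ('a \<Rightarrow> real) \<Rightarrow> real" where
  "H_functional D f v = (LINT x|lebesgue_on D. f x * v x)"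

definition W_space :: "'a::euclidean_space set \<Rightarrow> ('a \<Rightarrow> real) set" where
  "W_space D = {v \<in> V_space D. \<exists>g. is_weak_laplacian D v g}"

definition W_norm :: "'a::euclidean_space set \<Rightarrow> ('a \<Rightarrow> real) \<Rightarrow> real" where
  "W_norm D v = L2_norm (lebesgue_on D) (weak_laplacian D v)"

definition K_functional :: "'a::euclidean_space set \<Rightarrow> ('a \<Rightarrow> real) \<Rightarrow> real \<Rightarrow> real" where
  "K_functional D v z = (INF w\<in>W_space D. V_norm D (\<lambda>x. v x - w x) + z * W_norm D w)"

definition Wr_space :: "'a::euclidean_space set \<Rightarrow> real \<Rightarrow> ('a \<Rightarrow> real) set" where
  "Wr_space D r = (if r = 1 then W_space D else
     {v \<in> V_space D. bdd_above ((\<lambda>z. z powr (- r) * K_functional D v z) ` {0<..})})"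

definition Wr_norm :: "'a::euclidean_space set \<Rightarrow> real \<Rightarrow> ('a \<Rightarrow> real) \<Rightarrow> real" where
  "Wr_norm D r v = (if r = 1 then W_norm D v else
     (SUP z\<in>{0<..}. z powr (- r) * K_functional D v z))"

definition weak_solution ::
    "'a::euclidean_space set \<Rightarrow> ('a \<Rightarrow> real) \<Rightarrow> (('a \<Rightarrow> real) \<Rightarrow> real) \<Rightarrow> ('a \<Rightarrow> real) \<Rightarrow> bool" where
  "weak_solution D a F u \<longleftrightarrow> u \<in> V_space D \<and>
     (\<forall>v\<in>V_space D. has_bochner_integral (lebesgue_on D)
        (\<lambda>x. a x * (weak_gradient D u x \<bullet> weak_gradient D v x)) (F v))"


section \<open>Lebesgue--Bochner spaces\<close>

text \<open>
  The target space is given by a set S of functions and a norm N on it. Random variables need only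
  take values in S almost surely.
\<close>

definition strongly_measurable ::
    "'w measure \<Rightarrow> ('a \<Rightarrow> real) set \<Rightarrow> (('a \<Rightarrow> real) \<Rightarrow> real) \<Rightarrow> ('w \<Rightarrow> 'a \<Rightarrow> real) \<Rightarrow> bool" where
  "strongly_measurable M S N u \<longleftrightarrow> (\<exists>g :: nat \<Rightarrow> 'w \<Rightarrow> 'a \<Rightarrow> real.
     (\<forall>n. simple_function M (g n) \<and> g n ` space M \<subseteq> S) \<and>
     (AE \<omega> in M. u \<omega> \<in> S \<and> (\<lambda>n. N (\<lambda>x. u \<omega> x - g n \<omega> x)) \<longlonglongrightarrow> 0))"

definition bochner_Lq ::
    "real \<Rightarrow> 'w measure \<Rightarrow> ('a \<Rightarrow> real) set \<Rightarrow> (('a \<Rightarrow> real) \<Rightarrow> real) \<Rightarrow> ('w \<Rightarrow> 'a \<Rightarrow> real) set" where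
  "bochner_Lq q M S N =
     {u. strongly_measurable M S N u \<and> integrable M (\<lambda>\<omega>. N (u \<omega>) powr q)}"

definition bochner_Lq_norm ::
    "real \<Rightarrow> 'w measure \<Rightarrow> (('a \<Rightarrow> real) \<Rightarrow> real) \<Rightarrow> ('w \<Rightarrow> 'a \<Rightarrow> real) \<Rightarrow> real" where
  "bochner_Lq_norm q M N u = (LINT \<omega>|M. N (u \<omega>) powr q) powr (1 / q)"


section \<open>Wavelets\<close>

text \<open>
  For integer exponents the last conjunct says that the top derivative has bounded oscillation,
  which is no restriction for compactly supported functions.
\<close>

definition Holder_smooth :: "real \<Rightarrow> (real \<Rightarrow> real) \<Rightarrow> bool" where
  "Holder_smooth \<alpha> f \<longleftrightarrow> (let n = nat \<lfloor>\<alpha>\<rfloor> in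
     (\<forall>m<n. \<forall>x. (deriv ^^ m) f field_differentiable (at x)) \<and>
     continuous_on UNIV ((deriv ^^ n) f) \<and>
     (\<exists>C. \<forall>x y. \<bar>(deriv ^^ n) f x - (deriv ^^ n) f y\<bar> \<le> C * \<bar>x - y\<bar> powr (\<alpha> - real n)))"

definition integer_translates :: "(real \<Rightarrow> real) \<Rightarrow> (real \<Rightarrow> real) set" where
  "integer_translates f = range (\<lambda>k::int. \<lambda>x. f (x - of_int k))"

definition orthonormal_translates :: "(real \<Rightarrow> real) \<Rightarrow> bool" where
  "orthonormal_translates f \<longleftrightarrow> f \<in> L2_space lebesgue \<and>
     (\<forall>k k' :: int. (LINT x|lebesgue. f (x - of_int k) * f (x - of_int k')) = (if k = k' then 1 else 0))"

definition orthonormal_MRA :: "(int \<Rightarrow> (real \<Rightarrow> real) set) \<Rightarrow> (real \<Rightarrow> real) \<Rightarrow> bool" where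
  "orthonormal_MRA U \<phi> \<longleftrightarrow>
     (\<forall>j. U j = L2_closed_span lebesgue (U j)) \<and>
     (\<forall>j. U j \<subseteq> U (j + 1)) \<and>
     (\<forall>j f. f \<in> U j \<longleftrightarrow> (\<lambda>x. f (2 * x)) \<in> U (j + 1)) \<and>
     (\<forall>f\<in>(\<Inter>j. U j). AE x in lebesgue. f x = 0) \<and>
     L2_closed_span lebesgue (\<Union>j. U j) = L2_space lebesgue \<and>
     orthonormal_translates \<phi> \<and>
     U 0 = L2_closed_span lebesgue (integer_translates \<phi>)"

text \<open>The translates of the wavelet span the orthogonal complement of U 0 in U 1.\<close>

definition MRA_wavelet :: "(int \<Rightarrow> (real \<Rightarrow> real) set) \<Rightarrow> (real \<Rightarrow> real) \<Rightarrow> bool" where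
  "MRA_wavelet U \<psi> \<longleftrightarrow> orthonormal_translates \<psi> \<and>
     L2_closed_span lebesgue (integer_translates \<psi>) =
       {f \<in> U 1. \<forall>g\<in>U 0. (LINT x|lebesgue. f x * g x) = 0}"

definition wavelet_system :: "real \<Rightarrow> (real \<Rightarrow> real) \<Rightarrow> (real \<Rightarrow> real) \<Rightarrow> bool" where
  "wavelet_system \<alpha> \<phi> \<psi> \<longleftrightarrow>
     Holder_smooth \<alpha> \<phi> \<and> Holder_smooth \<alpha> \<psi> \<and>
     compact (closure {x. \<phi> x \<noteq> 0}) \<and> compact (closure {x. \<psi> x \<noteq> 0}) \<and>
     (\<exists>U. orthonormal_MRA U \<phi> \<and> MRA_wavelet U \<psi>) \<and>
     L2_norm lebesgue \<phi> = 1 \<and> L2_norm lebesgue \<psi> = 1 \<and>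
     (\<forall>m::nat. real m < \<alpha> \<longrightarrow> (LINT x|lebesgue. \<psi> x * x ^ m) = 0)"

type_synonym 'd wavelet_index = "nat \<times> (int ^ 'd) \<times> (nat ^ 'd)"

definition wavelet_types :: "nat \<Rightarrow> (nat ^ 'd) set" where
  "wavelet_types j = {l. \<forall>i. l $ i \<in> {0, 1}} - (if j = 0 then {} else {0})"

definition wavelet_positions :: "nat \<Rightarrow> (int ^ 'd) set" where
  "wavelet_positions j = {k. \<forall>i. 0 \<le> k $ i \<and> k $ i < 2 ^ j}"

definition wavelet_indices :: "('d::finite) wavelet_index set" where
  "wavelet_indices = {(j, k, l). k \<in> wavelet_positions j \<and> l \<in> wavelet_types j}"

definition tensor_wavelet ::
    "(real \<Rightarrow> real) \<Rightarrow> (real \<Rightarrow> real) \<Rightarrow> ('d::finite) wavelet_index \<Rightarrow> real ^ 'd \<Rightarrow> real" where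
  "tensor_wavelet \<phi> \<psi> = (\<lambda>(j, k, l) x. 2 powr (real CARD('d) * real j / 2) *
     (\<Prod>i\<in>UNIV. (if l $ i = 0 then \<phi> else \<psi>) (2 ^ j * x $ i - of_int (k $ i))))"

definition periodic_wavelet ::
    "(real \<Rightarrow> real) \<Rightarrow> (real \<Rightarrow> real) \<Rightarrow> ('d::finite) wavelet_index \<Rightarrow> real ^ 'd \<Rightarrow> real" where
  "periodic_wavelet \<phi> \<psi> \<iota> x =
     (\<Sum>\<^sub>\<infinity>n\<in>(UNIV :: (int ^ 'd) set). tensor_wavelet \<phi> \<psi> \<iota> (\<chi> i. x $ i - of_int (n $ i)))"


section \<open>Galton--Watson trees\<close>

text \<open>Nodes are finite sequences of positive integers.\<close>

definition tree_space :: "nat list set set" where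
  "tree_space = {t. (\<forall>\<nn>\<in>t. \<forall>i\<in>set \<nn>. 1 \<le> i) \<and> [] \<in> t \<and>
     (\<forall>\<nn> \<mm>. \<nn> @ \<mm> \<in> t \<longrightarrow> \<nn> \<in> t) \<and>
     (\<forall>\<nn>\<in>t. \<exists>K::nat. \<forall>i\<ge>1. \<nn> @ [i] \<in> t \<longleftrightarrow> i \<le> K)}"

definition num_children :: "nat list \<Rightarrow> nat list set \<Rightarrow> nat" where
  "num_children \<nn> t = (THE K. \<forall>i\<ge>1. \<nn> @ [i] \<in> t \<longleftrightarrow> i \<le> K)"

definition tree_trunc :: "nat \<Rightarrow> nat list set \<Rightarrow> nat list set" where
  "tree_trunc n t = {\<nn> \<in> t. length \<nn> \<le> n}"

text \<open>For equal trees the supremum in the exponent is infinite.\<close>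

definition tree_dist :: "nat list set \<Rightarrow> nat list set \<Rightarrow> real" where
  "tree_dist t t' = (if t = t' then 0 else
     2 powr (- real (Sup {n. tree_trunc n t = tree_trunc n t'})))"

lemma tree_trunc_mono:
  assumes "tree_trunc n t = tree_trunc n t'" "m \<le> n"
  shows "tree_trunc m t = tree_trunc m t'"
proof -
  have "tree_trunc m t = {\<nn> \<in> tree_trunc n t. length \<nn> \<le> m}" for t
    using assms(2) by (auto simp: tree_trunc_def)
  then show ?thesis using assms(1) by simp
qed

lemma tree_trunc_agree_finite:
  assumes "t \<noteq> t'"
  shows "finite {n. tree_trunc n t = tree_trunc n t'}"
proof -
  obtain \<nn> where n: "(\<nn> \<in> t) \<noteq> (\<nn> \<in> t')" using assms by blast
  have "n < length \<nn>" if "tree_trunc n t = tree_trunc n t'" for n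
  proof (rule ccontr)
    assume "\<not> n < length \<nn>"
    then have "\<nn> \<in> tree_trunc n t \<longleftrightarrow> \<nn> \<in> t" "\<nn> \<in> tree_trunc n t' \<longleftrightarrow> \<nn> \<in> t'"
      by (auto simp: tree_trunc_def)
    then show False using n that by simp
  qed
  then show ?thesis by (auto intro: finite_subset[of _ "{..<length \<nn>}"])
qed

lemma tree_trunc_0: "t \<in> tree_space \<Longrightarrow> tree_trunc 0 t = {[]}"
  by (auto simp: tree_trunc_def tree_space_def)

lemma Metric_space_tree: "Metric_space tree_space tree_dist"
proof
  fix x y z
  show "0 \<le> tree_dist x y" by (simp add: tree_dist_def)
  show "tree_dist x y = tree_dist y x" by (simp add: tree_dist_def eq_commute)
  show "(tree_dist x y = 0) = (x = y)" by (simp add: tree_dist_def)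
  assume xyz: "x \<in> tree_space" "y \<in> tree_space" "z \<in> tree_space"
  show "tree_dist x z \<le> tree_dist x y + tree_dist y z"
  proof (cases "x = y \<or> y = z \<or> x = z")
    case True
    then show ?thesis by (auto simp: tree_dist_def)
  next
    case False
    let ?A = "\<lambda>u v. {n. tree_trunc n u = tree_trunc n v}"
    have Sup: "Sup (?A u v) \<in> ?A u v" if "u \<noteq> v" "u \<in> tree_space" "v \<in> tree_space" for u v
      using tree_trunc_agree_finite[OF that(1)] tree_trunc_0[OF that(2)] tree_trunc_0[OF that(3)]
        Max_in[of "?A u v"] by (auto simp: Sup_nat_def)
    define m where "m = min (Sup (?A x y)) (Sup (?A y z))"
    have "tree_trunc m x = tree_trunc m y" "tree_trunc m y = tree_trunc m z"
      using Sup[of x y] Sup[of y z] False xyz tree_trunc_mono[of "Sup (?A x y)" x y m]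
        tree_trunc_mono[of "Sup (?A y z)" y z m] by (simp_all add: m_def)
    then have "m \<in> ?A x z" by simp
    then have "m \<le> Sup (?A x z)"
      using tree_trunc_agree_finite[of x z] False by (auto simp: Sup_nat_def)
    then have "tree_dist x z \<le> 2 powr (- real m)"
      using False by (simp add: tree_dist_def)
    also have "\<dots> \<le> tree_dist x y + tree_dist y z"
      using False by (auto simp: m_def tree_dist_def min_def)
    finally show ?thesis .
  qed
qed

definition tree_borel :: "nat list set measure" where
  "tree_borel = sigma tree_space {B. openin (Metric_space.mtopology tree_space tree_dist) B}"

definition subtree :: "nat \<Rightarrow> nat list set \<Rightarrow> nat list set" where
  "subtree i t = {\<mm>. i # \<mm> \<in> t}"

text \<open>
  Conditioning on an event E is done on the trace space over E, since the subtrees of the first n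
  children are trees only where the root has at least n children.
\<close>

definition cond_measure :: "'w measure \<Rightarrow> 'w set \<Rightarrow> 'w measure" where
  "cond_measure M E = uniform_measure (restrict_space M E) E"

definition GW_tree :: "'w measure \<Rightarrow> nat pmf \<Rightarrow> ('w \<Rightarrow> nat list set) \<Rightarrow> bool" where
  "GW_tree M offspring T \<longleftrightarrow> T \<in> measurable M tree_borel \<and>
     distr M (count_space UNIV) (\<lambda>\<omega>. num_children [] (T \<omega>)) = measure_pmf offspring \<and>
     (\<forall>n. let E = {\<omega> \<in> space M. num_children [] (T \<omega>) = n} in
        measure M E > 0 \<longrightarrow>
          prob_space.indep_vars (cond_measure M E) (\<lambda>_. tree_borel) (\<lambda>i \<omega>. subtree i (T \<omega>)) {1..n} \<and>
          (\<forall>i\<in>{1..n}. distr (cond_measure M E) tree_borel (\<lambda>\<omega>. subtree i (T \<omega>)) = distr M tree_borel T))"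


section \<open>Besov random tree priors\<close>

definition coeff_density :: "real \<Rightarrow> real \<Rightarrow> real \<Rightarrow> real" where
  "coeff_density p \<kappa> x =
     exp (- (\<bar>x\<bar> powr p) / \<kappa>) / (LINT y|lborel. exp (- (\<bar>y\<bar> powr p) / \<kappa>))"

text \<open>
  The coefficients X and the tree T of a prior; the coordinate directions are the elements of the
  linearly ordered type of cardinality d.
\<close>

definition besov_tree_data :: "'w measure \<Rightarrow> real \<Rightarrow> real \<Rightarrow> real \<Rightarrow>
    (('d::finite) wavelet_index \<Rightarrow> 'w \<Rightarrow> real) \<Rightarrow> ('w \<Rightarrow> nat list set) \<Rightarrow> bool" where
  "besov_tree_data M p \<kappa> \<beta> X T \<longleftrightarrow>
     prob_space.indep_vars M (\<lambda>_. borel) X wavelet_indices \<and>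
     (\<forall>\<iota>\<in>wavelet_indices. distributed M lborel (X \<iota>) (\<lambda>x. ennreal (coeff_density p \<kappa> x))) \<and>
     GW_tree M (binomial_pmf (2 ^ CARD('d)) \<beta>) T \<and>
     prob_space.indep_set M (sets (vimage_algebra (space M) T tree_borel))
       (sets (vimage_algebra (space M) (\<lambda>\<omega>. \<lambda>\<iota>\<in>wavelet_indices. X \<iota> \<omega>)
          (Pi\<^sub>M (wavelet_indices :: 'd wavelet_index set) (\<lambda>_. borel))))"

text \<open>
  The node is a list, whose entries are numbered from 0, and the coordinate with number i (counted
  from 1) is the one with exactly i - 1 smaller coordinates.
\<close>

definition node_number :: "nat \<Rightarrow> nat list \<Rightarrow> nat" where
  "node_number d \<nn> = 1 + (\<Sum>i<length \<nn>. 2 ^ (d * (length \<nn> - Suc i)) * (\<nn> ! i - 1))"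

definition number_position :: "nat \<Rightarrow> nat \<Rightarrow> int ^ ('d::{finite,linorder})" where
  "number_position j m = (\<chi> i. int ((m - 1) div 2 ^ (j * card {i'. i' < i}) mod 2 ^ j))"

definition tree_indices :: "nat list set \<Rightarrow> ('d::{finite,linorder}) wavelet_index set" where
  "tree_indices t = {(j, k, l). l \<in> wavelet_types j \<and>
     (\<exists>\<nn>\<in>t. j = length \<nn> \<and> k = number_position j (node_number CARD('d) \<nn>))}"

text \<open>
  The series is summed pointwise; for sp > d it almost surely converges absolutely and uniformly.
  The result is one-periodic on the whole space.
\<close>

definition besov_tree_field :: "(real \<Rightarrow> real) \<Rightarrow> (real \<Rightarrow> real) \<Rightarrow> real \<Rightarrow> real \<Rightarrow>
    ('d wavelet_index \<Rightarrow> 'w \<Rightarrow> real) \<Rightarrow> ('w \<Rightarrow> nat list set) \<Rightarrow>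
    'w \<Rightarrow> real ^ ('d::{finite,linorder}) \<Rightarrow> real" where
  "besov_tree_field \<phi> \<psi> p s X T \<omega> x =
     (\<Sum>\<^sub>\<infinity>\<iota>\<in>tree_indices (T \<omega>).
        2 powr (- real (fst \<iota>) * (s + real CARD('d) / 2 - real CARD('d) / p)) *
        X \<iota> \<omega> * periodic_wavelet \<phi> \<psi> \<iota> x)"

end

theory Submission
  imports Defs "HOL-Computational_Algebra.Polynomial"
begin

text \<open>
  On a level-j wavelet the random coefficients are at most (ln Z + O(j)) / t with an integrable Z, for
  every exponent t with finite exponential moment. Hence b is almost surely a series of continuously
  differentiable level functions b_j with sup-norm c_j and gradient bound 2^j c_j, where the sum of the
  2^(jr) c_j is at most (const + const ln Z) / t for every r < s - d/p, and all exponentials of that sum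
  are integrable as long as t can be taken large enough. The tree only switches
  coefficients off.

  Existence and the bound in V are Lax-Milgram. For a differentiable exponent b the equation can be
  solved for the Laplacian, which equals - (f exp (- b) + grad b . grad u).
  For r < 1 the K-functional of u at z is bounded by comparing u with the solution w for the
  series truncated at level J, where z is of the order 2^(-J): the distance in V is O(z^r), and w lies in W
  with norm O(z^(r-1)).

  Truncating the series and replacing the coefficients by simple random variables gives simple
  functions that converge to u in V and stay bounded in the interpolation space of an exponent larger than
  r; by interpolation they converge in the one of exponent r, although that space is not separable.
\<close>

section \<open>Square integrable functions\<close>

text \<open>The obstacle is exponential integrability. The exponent is controlled only through ln (1
  + Z), so the q-th power of exp (k * norm of the exponent) is, up to a constant, the power q * k *
  A2 / t of 1 + Z, and only the first power is known to be integrable. Hence t must reach q * k *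
  A2, where k is the factor in the deterministic bound: 1 in V, and 5 + 2 d in the interpolation
  spaces. For p > 1 the density has all exponential moments and every t is admissible. For p = 1 it
  forces t < 1/\<kappa>; this is why \<kappa> has to be below 1/(k * A2) and why the limiting q is
  1/(\<kappa> * k * A2). Function spaces consist of representatives and \<open>weak_gradient\<close>
  is a choice, so identities between weak gradients hold almost everywhere only. Choice also settles
  measurability: a solution selected as a function of a simple random coefficient family takes
  finitely many values, however the selection is made.\<close>

lemma L2_measurable [measurable_dest]: "f \<in> L2_space M \<Longrightarrow> f \<in> borel_measurable M"
  by (simp add: L2_space_def)

lemma L2_dominated:
  fixes f :: "'a \<Rightarrow> 'b::euclidean_space" and g :: "'a \<Rightarrow> 'c::euclidean_space"
  assumes "f \<in> borel_measurable M" "g \<in> L2_space M" "AE x in M. norm (f x) \<le> C * norm (g x)"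
  shows "f \<in> L2_space M"
proof -
  have "integrable M (\<lambda>x. C\<^sup>2 * (norm (g x))\<^sup>2)"
    using assms by (auto simp: L2_space_def)
  then have "integrable M (\<lambda>x. (norm (f x))\<^sup>2)"
  proof (rule Bochner_Integration.integrable_bound)
    show "AE x in M. norm ((norm (f x))\<^sup>2) \<le> norm (C\<^sup>2 * (norm (g x))\<^sup>2)"
      using assms(3)
    proof eventually_elim
      case (elim x)
      then have "(norm (f x))\<^sup>2 \<le> (C * norm (g x))\<^sup>2" by (intro power_mono) auto
      then show ?case by (simp add: power_mult_distrib)
    qed
  qed (use assms(1) in measurable)
  with assms(1) show ?thesis by (simp add: L2_space_def)
qed

lemma L2_scale: "f \<in> L2_space M \<Longrightarrow> (\<lambda>x. c *\<^sub>R f x) \<in> L2_space M"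
  by (rule L2_dominated[where g=f and C="\<bar>c\<bar>"]) (auto simp: L2_space_def)

lemma L2_add:
  assumes "f \<in> L2_space M" "g \<in> L2_space M"
  shows "(\<lambda>x. f x + g x) \<in> L2_space M"
proof -
  have [measurable]: "f \<in> borel_measurable M" "g \<in> borel_measurable M"
    using assms by (auto simp: L2_space_def)
  have "integrable M (\<lambda>x. 2 * (norm (f x))\<^sup>2 + 2 * (norm (g x))\<^sup>2)"
    using assms by (auto simp: L2_space_def)
  then have "integrable M (\<lambda>x. (norm (f x + g x))\<^sup>2)"
  proof (rule Bochner_Integration.integrable_bound)
    show "AE x in M. norm ((norm (f x + g x))\<^sup>2) \<le> norm (2 * (norm (f x))\<^sup>2 + 2 * (norm (g x))\<^sup>2)"
    proof (rule AE_I2)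
      fix x
      have "(norm (f x + g x))\<^sup>2 \<le> (norm (f x) + norm (g x))\<^sup>2"
        by (intro power_mono norm_triangle_ineq) auto
      also have "\<dots> \<le> 2 * (norm (f x))\<^sup>2 + 2 * (norm (g x))\<^sup>2"
        using sum_squares_bound[of "norm (f x)" "norm (g x)"] by (simp add: power2_sum)
      finally show "norm ((norm (f x + g x))\<^sup>2) \<le> norm (2 * (norm (f x))\<^sup>2 + 2 * (norm (g x))\<^sup>2)"
        by simp
    qed
  qed measurable
  then show ?thesis by (simp add: L2_space_def)
qed

lemma L2_lincomb:
  "f \<in> L2_space M \<Longrightarrow> g \<in> L2_space M \<Longrightarrow> (\<lambda>x. c *\<^sub>R f x + e *\<^sub>R g x) \<in> L2_space M"
  by (intro L2_add L2_scale)

lemma L2_diff: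
  "f \<in> L2_space M \<Longrightarrow> g \<in> L2_space M \<Longrightarrow> (\<lambda>x. f x - g x) \<in> L2_space M"
  using L2_lincomb[of f M g 1 "-1"] by simp

lemma L2_zero: "(\<lambda>x. 0) \<in> L2_space M"
  by (simp add: L2_space_def)

lemma L2_norm_fun: "f \<in> L2_space M \<Longrightarrow> (\<lambda>x. norm (f x)) \<in> L2_space M"
  by (auto simp: L2_space_def)

lemma L2_norm_nonneg [simp]: "0 \<le> L2_norm M f"
  by (simp add: L2_norm_def)

lemma L2_norm_power2: "(L2_norm M f)\<^sup>2 = (LINT x|M. (norm (f x))\<^sup>2)"
  by (simp add: L2_norm_def)

lemma L2_norm_cong_AE:
  assumes "f \<in> borel_measurable M" "g \<in> borel_measurable M" "AE x in M. f x = g x"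
  shows "L2_norm M f = L2_norm M g"
  unfolding L2_norm_def
  by (rule arg_cong[where f=sqrt], rule integral_cong_AE) (use assms in auto)

lemma L2_norm_le:
  fixes f :: "'a \<Rightarrow> 'b::euclidean_space" and g :: "'a \<Rightarrow> 'c::euclidean_space"
  assumes "f \<in> borel_measurable M" "g \<in> L2_space M" "AE x in M. norm (f x) \<le> C * norm (g x)" "C \<ge> 0"
  shows "L2_norm M f \<le> C * L2_norm M g"
proof -
  have f: "f \<in> L2_space M" by (rule L2_dominated[OF assms(1,2,3)])
  have "(L2_norm M f)\<^sup>2 \<le> (LINT x|M. (C * norm (g x))\<^sup>2)"
    unfolding L2_norm_power2
  proof (rule integral_mono_AE)
    show "integrable M (\<lambda>x. (norm (f x))\<^sup>2)" using f by (simp add: L2_space_def)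
    show "integrable M (\<lambda>x. (C * norm (g x))\<^sup>2)"
      using assms(2) by (simp add: L2_space_def power_mult_distrib)
    show "AE x in M. (norm (f x))\<^sup>2 \<le> (C * norm (g x))\<^sup>2"
      using assms(3) by eventually_elim (auto intro: power_mono)
  qed
  also have "\<dots> = (C * L2_norm M g)\<^sup>2"
    by (simp add: power_mult_distrib L2_norm_power2)
  finally show ?thesis using assms(4) by (auto intro: power2_le_imp_le)
qed

lemma L2_norm_scale: "L2_norm M (\<lambda>x. c *\<^sub>R f x) = \<bar>c\<bar> * L2_norm M f"
  by (simp add: L2_norm_def power_mult_distrib real_sqrt_mult)

lemma L2_inner_integrable:
  assumes "f \<in> L2_space M" "g \<in> L2_space M"
  shows "integrable M (\<lambda>x. f x \<bullet> g x)"
proof -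
  have [measurable]: "f \<in> borel_measurable M" "g \<in> borel_measurable M"
    using assms by (auto simp: L2_space_def)
  have "integrable M (\<lambda>x. (norm (f x))\<^sup>2 + (norm (g x))\<^sup>2)"
    using assms by (auto simp: L2_space_def)
  then show ?thesis
  proof (rule Bochner_Integration.integrable_bound)
    show "AE x in M. norm (f x \<bullet> g x) \<le> norm ((norm (f x))\<^sup>2 + (norm (g x))\<^sup>2)"
    proof (rule AE_I2)
      fix x
      have "\<bar>f x \<bullet> g x\<bar> \<le> norm (f x) * norm (g x)" by (rule Cauchy_Schwarz_ineq2)
      also have "\<dots> \<le> (norm (f x))\<^sup>2 + (norm (g x))\<^sup>2"
        using sum_squares_bound[of "norm (f x)" "norm (g x)"] mult_nonneg_nonneg[of "norm (f x)" "norm (g x)"]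
        by (simp del: mult_nonneg_nonneg)
      finally show "norm (f x \<bullet> g x) \<le> norm ((norm (f x))\<^sup>2 + (norm (g x))\<^sup>2)" by simp
    qed
  qed measurable
qed

lemma L2_mult_integrable:
  fixes f g :: "'a \<Rightarrow> real"
  shows "f \<in> L2_space M \<Longrightarrow> g \<in> L2_space M \<Longrightarrow> integrable M (\<lambda>x. f x * g x)"
  using L2_inner_integrable[of f M g] by simp

lemma L2_norm_lincomb_power2:
  assumes "f \<in> L2_space M" "g \<in> L2_space M"
  shows "(L2_norm M (\<lambda>x. c *\<^sub>R f x + e *\<^sub>R g x))\<^sup>2 =
     c\<^sup>2 * (L2_norm M f)\<^sup>2 + 2 * c * e * (LINT x|M. f x \<bullet> g x) + e\<^sup>2 * (L2_norm M g)\<^sup>2"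
proof -
  have "(norm (c *\<^sub>R f x + e *\<^sub>R g x))\<^sup>2 = c\<^sup>2 * (norm (f x))\<^sup>2 + 2 * c * e * (f x \<bullet> g x) + e\<^sup>2 * (norm (g x))\<^sup>2" for x
    by (simp only: power2_norm_eq_inner)
      (simp add: inner_simps inner_commute power2_eq_square algebra_simps)
  then show ?thesis
    using assms L2_inner_integrable[OF assms] by (simp add: L2_norm_power2 L2_space_def)
qed

text \<open>The common source of the Cauchy-Schwarz inequalities for L2 and for abstract bilinear
  forms, and of the Euler-Lagrange equation in the Riesz theorem, where C = 0 forces B = 0.\<close>

lemma quadratic_nonneg_discriminant:
  fixes A B C :: real
  assumes "\<And>t. A * t\<^sup>2 + 2 * B * t + C \<ge> 0" "A \<ge> 0"
  shows "B\<^sup>2 \<le> A * C"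
proof (cases "A = 0")
  case True
  have "B = 0"
  proof (rule ccontr)
    assume "B \<noteq> 0"
    \<comment> \<open>This t makes the affine function 2 * B * t + C equal to -1.\<close>
    then show False using assms(1)[of "(- C - 1) / (2 * B)"] True by (simp add: field_simps)
  qed
  then show ?thesis using True by simp
next
  case False
  then have A: "A > 0" using assms by simp
  \<comment> \<open>The value at the minimiser - B / A of the parabola, multiplied by A.\<close>
  have "A * (A * (- B / A)\<^sup>2 + 2 * B * (- B / A) + C) \<ge> 0"
    using assms(1)[of "- B / A"] A by simp
  also have "A * (A * (- B / A)\<^sup>2 + 2 * B * (- B / A) + C) = A * C - B\<^sup>2"
    using A by (simp add: field_simps power2_eq_square)
  finally show ?thesis by simp
qed

lemma L2_Cauchy_Schwarz:
  assumes "f \<in> L2_space M" "g \<in> L2_space M"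
  shows "\<bar>LINT x|M. f x \<bullet> g x\<bar> \<le> L2_norm M f * L2_norm M g"
proof -
  have "(LINT x|M. f x \<bullet> g x)\<^sup>2 \<le> (L2_norm M f)\<^sup>2 * (L2_norm M g)\<^sup>2"
  proof (rule quadratic_nonneg_discriminant)
    fix t
    show "0 \<le> (L2_norm M f)\<^sup>2 * t\<^sup>2 + 2 * (LINT x|M. f x \<bullet> g x) * t + (L2_norm M g)\<^sup>2"
      using L2_norm_lincomb_power2[OF assms, of t 1] zero_le_power2[of "L2_norm M (\<lambda>x. t *\<^sub>R f x + 1 *\<^sub>R g x)"]
      by (simp add: mult.commute mult.left_commute)
  qed simp
  then have "\<bar>LINT x|M. f x \<bullet> g x\<bar>\<^sup>2 \<le> (L2_norm M f * L2_norm M g)\<^sup>2"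
    by (simp add: power_mult_distrib)
  then show ?thesis by (rule power2_le_imp_le) simp
qed

lemma L2_triangle:
  assumes "f \<in> L2_space M" "g \<in> L2_space M"
  shows "L2_norm M (\<lambda>x. f x + g x) \<le> L2_norm M f + L2_norm M g"
proof (rule power2_le_imp_le)
  show "(L2_norm M (\<lambda>x. f x + g x))\<^sup>2 \<le> (L2_norm M f + L2_norm M g)\<^sup>2"
    using L2_norm_lincomb_power2[OF assms, of 1 1] L2_Cauchy_Schwarz[OF assms]
    by (simp add: power2_sum)
qed simp

lemma L2_norm_minus_commute: "L2_norm M (\<lambda>x. f x - g x) = L2_norm M (\<lambda>x. g x - f x)"
  by (simp add: L2_norm_def norm_minus_commute)

lemma L2_triangle_rev:
  assumes "f \<in> L2_space M" "g \<in> L2_space M"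
  shows "\<bar>L2_norm M f - L2_norm M g\<bar> \<le> L2_norm M (\<lambda>x. f x - g x)"
  using L2_triangle[OF L2_diff[OF assms] assms(2)] L2_triangle[OF L2_diff[OF assms(2,1)] assms(1)]
    L2_norm_minus_commute[of M f g] by simp

lemma L2_norm_eq_0:
  assumes "f \<in> L2_space M" "L2_norm M f = 0"
  shows "AE x in M. f x = 0"
proof -
  have "(LINT x|M. (norm (f x))\<^sup>2) = 0" using assms(2) L2_norm_power2[of M f] by simp
  then have "AE x in M. (norm (f x))\<^sup>2 = 0"
    using assms(1) by (subst (asm) integral_nonneg_eq_0_iff_AE) (auto simp: L2_space_def)
  then show ?thesis by simp
qed

lemma L2_nn_integral:
  assumes "f \<in> L2_space M"
  shows "(\<integral>\<^sup>+x. ennreal ((norm (f x))\<^sup>2) \<partial>M) = ennreal ((L2_norm M f)\<^sup>2)"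
  unfolding L2_norm_power2 using assms by (intro nn_integral_eq_integral) (auto simp: L2_space_def)

text \<open>Riesz-Fischer: the increments of a fast subsequence are dominated by a geometric series
  almost everywhere, and Fatou's lemma carries the Cauchy estimate over to the pointwise
  limit.\<close>

lemma L2_complete:
  fixes f :: "nat \<Rightarrow> 'a \<Rightarrow> 'b::euclidean_space"
  assumes f: "\<And>n. f n \<in> L2_space M"
    and Cauchy: "\<And>e. e > 0 \<Longrightarrow> \<exists>N. \<forall>m\<ge>N. \<forall>n\<ge>N. L2_norm M (\<lambda>x. f m x - f n x) < e"
  shows "\<exists>g\<in>L2_space M. (\<lambda>n. L2_norm M (\<lambda>x. f n x - g x)) \<longlonglongrightarrow> 0"
proof -
  note [measurable] = L2_measurable[OF f]
  have "\<exists>N. \<forall>k. \<forall>m\<ge>N k. \<forall>n\<ge>N k. L2_norm M (\<lambda>x. f m x - f n x) < (1/2)^k"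
    by (intro choice allI Cauchy) simp
  then obtain N where N: "\<And>k m n. m \<ge> N k \<Longrightarrow> n \<ge> N k \<Longrightarrow> L2_norm M (\<lambda>x. f m x - f n x) < (1/2)^k"
    by blast
  \<comment> \<open>Summing the thresholds gives one index that lies beyond \<open>N j\<close> for
    all j \<le> k.\<close>
  define h where "h k = (\<Sum>i\<le>k. N i)" for k
  have hN: "h k \<ge> N j" if "j \<le> k" for j k
    unfolding h_def using that by (intro member_le_sum) auto
  define \<delta> where "\<delta> k x = f (h (Suc k)) x - f (h k) x" for k x
  have \<delta>: "\<delta> k \<in> L2_space M" for k
    unfolding \<delta>_def by (intro L2_diff f)
  have \<delta>n: "L2_norm M (\<delta> k) \<le> (1/2)^k" for k
    unfolding \<delta>_def using N[OF hN hN, of k "Suc k" k] by (simp add: less_imp_le)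
  note [measurable] = L2_measurable[OF \<delta>]
  have "(\<integral>\<^sup>+x. (\<Sum>k. ennreal (2^k * (norm (\<delta> k x))\<^sup>2)) \<partial>M) =
      (\<Sum>k. \<integral>\<^sup>+x. ennreal (2^k * (norm (\<delta> k x))\<^sup>2) \<partial>M)"
    by (intro nn_integral_suminf) measurable
  also have "\<dots> \<le> (\<Sum>k. ennreal ((1/2)^k))"
  proof (rule suminf_le)
    fix k
    have "(\<integral>\<^sup>+x. ennreal (2^k * (norm (\<delta> k x))\<^sup>2) \<partial>M) = ennreal (2^k) * ennreal ((L2_norm M (\<delta> k))\<^sup>2)"
      by (subst L2_nn_integral[OF \<delta>, symmetric], subst nn_integral_cmult[symmetric])
        (auto simp: ennreal_mult' intro!: nn_integral_cong)
    also have "\<dots> = ennreal (2^k * (L2_norm M (\<delta> k))\<^sup>2)" by (simp add: ennreal_mult')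
    also have "\<dots> \<le> ennreal (2^k * ((1/2)^k)\<^sup>2)"
      using \<delta>n[of k] by (intro ennreal_leI mult_left_mono power_mono) auto
    also have "2^k * ((1/2::real)^k)\<^sup>2 = (1/2)^k"
      by (simp add: power2_eq_square power_divide)
    finally show "(\<integral>\<^sup>+x. ennreal (2^k * (norm (\<delta> k x))\<^sup>2) \<partial>M) \<le> ennreal ((1/2)^k)" .
  qed auto
  also have "\<dots> < \<infinity>"
    by (subst suminf_ennreal2) auto
  finally have fin: "(\<integral>\<^sup>+x. (\<Sum>k. ennreal (2^k * (norm (\<delta> k x))\<^sup>2)) \<partial>M) \<noteq> \<infinity>" by auto
  \<comment> \<open>The weight 2^k is affordable because the increments have L2 norm at most 2^(-k).
    Finiteness at x bounds the increments by a multiple of 2^(-k/2), which is summable.\<close>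
  have "AE x in M. (\<Sum>k. ennreal (2^k * (norm (\<delta> k x))\<^sup>2)) \<noteq> \<infinity>"
    by (rule nn_integral_PInf_AE[OF _ fin]) measurable
  then have conv: "AE x in M. convergent (\<lambda>k. f (h k) x)"
  proof eventually_elim
    case (elim x)
    have s: "summable (\<lambda>k. 2^k * (norm (\<delta> k x))\<^sup>2)"
      by (rule summable_suminf_not_top) (use elim in auto)
    then have "(\<lambda>k. 2^k * (norm (\<delta> k x))\<^sup>2) \<longlonglongrightarrow> 0" by (rule summable_LIMSEQ_zero)
    then have "Bseq (\<lambda>k. 2^k * (norm (\<delta> k x))\<^sup>2)" by (intro convergent_imp_Bseq convergentI)
    then obtain C where C: "C > 0" "\<And>k. norm (2^k * (norm (\<delta> k x))\<^sup>2) \<le> C" by (rule BseqE) blast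
    have b: "norm (\<delta> k x) \<le> sqrt C * (sqrt (1/2))^k" for k
    proof (rule power2_le_imp_le)
      have "2^k * (norm (\<delta> k x))\<^sup>2 \<le> C" using C(2)[of k] by simp
      then have "(norm (\<delta> k x))\<^sup>2 \<le> C * (1/2)^k" by (simp add: field_simps power_divide)
      also have "\<dots> = (sqrt C * (sqrt (1/2))^k)\<^sup>2"
        using C(1) by (simp add: power_mult_distrib power_mult[symmetric] mult.commute[of k 2])
          (simp add: power_mult power_divide)
      finally show "(norm (\<delta> k x))\<^sup>2 \<le> (sqrt C * (sqrt (1/2))^k)\<^sup>2" .
    qed (use C in auto)
    have "summable (\<lambda>k. sqrt C * (sqrt (1/2))^k)"
      by (intro summable_mult summable_geometric) (simp add: real_sqrt_divide)
    then have "summable (\<lambda>k. \<delta> k x)"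
      by (rule summable_comparison_test'[where N=0]) (use b in auto)
    then have "convergent (\<lambda>n. \<Sum>k<n. \<delta> k x)" by (simp add: summable_iff_convergent)
    moreover have "(\<Sum>k<n. \<delta> k x) = f (h n) x - f (h 0) x" for n
      unfolding \<delta>_def by (rule sum_lessThan_telescope)
    ultimately have "convergent (\<lambda>n. (f (h n) x - f (h 0) x) + f (h 0) x)"
      by (intro convergent_add) (auto simp: convergent_const)
    then show ?case by simp
  qed
  define g where "g x = lim (\<lambda>k. f (h k) x)" for x
  have [measurable]: "g \<in> borel_measurable M" unfolding g_def by measurable
  have lim: "AE x in M. (\<lambda>k. f (h k) x) \<longlonglongrightarrow> g x"
    using conv by eventually_elim (simp add: g_def convergent_LIMSEQ_iff)
  have bound: "(\<integral>\<^sup>+x. ennreal ((norm (f n x - g x))\<^sup>2) \<partial>M) \<le> ennreal (((1/2)^k)\<^sup>2)" if n: "n \<ge> N k" for n k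
  proof -
    have "(\<integral>\<^sup>+x. ennreal ((norm (f n x - g x))\<^sup>2) \<partial>M) =
        (\<integral>\<^sup>+x. liminf (\<lambda>i. ennreal ((norm (f n x - f (h i) x))\<^sup>2)) \<partial>M)"
    proof (rule nn_integral_cong_AE, use lim in eventually_elim)
      case (elim x)
      have "(\<lambda>i. ennreal ((norm (f n x - f (h i) x))\<^sup>2)) \<longlonglongrightarrow> ennreal ((norm (f n x - g x))\<^sup>2)"
        by (intro tendsto_intros elim)
      from lim_imp_Liminf[OF _ this] show ?case by simp
    qed
    also have "\<dots> \<le> liminf (\<lambda>i. \<integral>\<^sup>+x. ennreal ((norm (f n x - f (h i) x))\<^sup>2) \<partial>M)"
      by (rule nn_integral_liminf) measurable
    also have "\<dots> \<le> liminf (\<lambda>i. ennreal (((1/2)^k)\<^sup>2))"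
    proof (rule Liminf_mono, rule eventually_sequentiallyI)
      fix i assume "i \<ge> k"
      have "(\<integral>\<^sup>+x. ennreal ((norm (f n x - f (h i) x))\<^sup>2) \<partial>M) = ennreal ((L2_norm M (\<lambda>x. f n x - f (h i) x))\<^sup>2)"
        by (rule L2_nn_integral) (intro L2_diff f)
      also have "\<dots> \<le> ennreal (((1/2)^k)\<^sup>2)"
        using N[OF n hN[OF \<open>i \<ge> k\<close>]] by (intro ennreal_leI power_mono) auto
      finally show "(\<integral>\<^sup>+x. ennreal ((norm (f n x - f (h i) x))\<^sup>2) \<partial>M) \<le> ennreal (((1/2)^k)\<^sup>2)" .
    qed
    finally show ?thesis by (simp add: Liminf_const)
  qed
  have diff: "(\<lambda>x. f n x - g x) \<in> L2_space M" if "n \<ge> N k" for n k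
  proof -
    have "integrable M (\<lambda>x. (norm (f n x - g x))\<^sup>2)"
      using bound[OF that] by (intro integrableI_bounded) (auto simp: le_less_trans)
    then show ?thesis by (simp add: L2_space_def)
  qed
  \<comment> \<open>Only differences to \<open>g\<close> are known to be square integrable;
    \<open>g\<close> is recovered from one of them.\<close>
  have "(\<lambda>x. f (N 0) x - (f (N 0) x - g x)) \<in> L2_space M"
    by (intro L2_diff f diff[of 0]) simp
  then have "g \<in> L2_space M" by simp
  moreover have "(\<lambda>n. L2_norm M (\<lambda>x. f n x - g x)) \<longlonglongrightarrow> 0"
  proof (rule LIMSEQ_I)
    fix e :: real assume "e > 0"
    then obtain k where k: "(1/2)^k < e" using real_arch_pow_inv[of e "1/2"] by auto
    have "norm (L2_norm M (\<lambda>x. f n x - g x) - 0) < e" if "n \<ge> N k" for n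
    proof -
      have "(L2_norm M (\<lambda>x. f n x - g x))\<^sup>2 \<le> ((1/2)^k)\<^sup>2"
        using bound[OF that] L2_nn_integral[OF diff[OF that]] by (simp add: ennreal_le_iff)
      then have "L2_norm M (\<lambda>x. f n x - g x) \<le> (1/2)^k" by (rule power2_le_imp_le) simp
      then show ?thesis using k by simp
    qed
    then show "\<exists>no. \<forall>n\<ge>no. norm (L2_norm M (\<lambda>x. f n x - g x) - 0) < e" by blast
  qed
  ultimately show ?thesis by blast
qed

section \<open>Smooth functions\<close>

lemma partial_deriv_eq: "(f has_derivative f') (at x) \<Longrightarrow> partial_deriv b f x = f' b"
  using frechet_derivative_at[of f f' x] by (simp add: partial_deriv_def)

lemma tcd_continuous: "times_cont_diff n f \<Longrightarrow> continuous_on UNIV f"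
  by (cases n) (auto intro!: continuous_at_imp_continuous_on differentiable_imp_continuous_within)

lemma tcd_Suc_D: "times_cont_diff (Suc n) f \<Longrightarrow> times_cont_diff n f"
proof (induction n arbitrary: f)
  case 0
  then show ?case using tcd_continuous[of "Suc 0" f] by simp
next
  case (Suc n)
  show ?case
    unfolding times_cont_diff.simps(2)[of n]
    using Suc.prems Suc.IH by (subst (asm) times_cont_diff.simps(2)) blast
qed

lemma tcd_1_differentiable: "times_cont_diff 1 f \<Longrightarrow> f differentiable (at x)"
  by simp

lemma tcd_partial: "times_cont_diff (Suc n) f \<Longrightarrow> b \<in> Basis \<Longrightarrow> times_cont_diff n (partial_deriv b f)"
  by simp

lemma partial_deriv_const: "partial_deriv b (\<lambda>x. c) = (\<lambda>x. 0)"
  by (auto simp: partial_deriv_def)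

lemma tcd_const: "times_cont_diff n (\<lambda>x. c)"
  by (induction n arbitrary: c) (auto simp: partial_deriv_const)

lemma has_derivative_partial:
  assumes "f differentiable (at x)"
  shows "(f has_derivative (\<lambda>h. \<Sum>b\<in>Basis. (h \<bullet> b) * partial_deriv b f x)) (at x)"
proof -
  let ?f = "frechet_derivative f (at x)"
  have d: "(f has_derivative ?f) (at x)" using assms by (simp add: frechet_derivative_works)
  then interpret bounded_linear ?f by (rule has_derivative_bounded_linear)
  have "?f h = (\<Sum>b\<in>Basis. (h \<bullet> b) * partial_deriv b f x)" for h
    by (subst euclidean_representation[of h, symmetric]) (simp add: sum scale partial_deriv_def)
  then have "?f = (\<lambda>h. \<Sum>b\<in>Basis. (h \<bullet> b) * partial_deriv b f x)" by (rule ext)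
  with d show ?thesis by simp
qed

lemma partial_deriv_add:
  assumes "f differentiable (at x)" "g differentiable (at x)"
  shows "partial_deriv b (\<lambda>x. f x + g x) x = partial_deriv b f x + partial_deriv b g x"
  using assms unfolding frechet_derivative_works partial_deriv_def[of b f] partial_deriv_def[of b g]
  by (intro partial_deriv_eq) (rule has_derivative_add)

lemma partial_deriv_mult:
  assumes "f differentiable (at x)" "g differentiable (at x)"
  shows "partial_deriv b (\<lambda>x. f x * g x) x = partial_deriv b f x * g x + f x * partial_deriv b g x"
  using partial_deriv_eq[OF has_derivative_mult[OF assms[unfolded frechet_derivative_works]], of b]
  by (simp add: partial_deriv_def add.commute)

lemma tcd_add:
  assumes "times_cont_diff n f" "times_cont_diff n g"
  shows "times_cont_diff n (\<lambda>x. f x + g x)"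
  using assms
proof (induction n arbitrary: f g)
  case 0
  then show ?case by (auto intro: continuous_intros)
next
  case (Suc n)
  then have "partial_deriv b (\<lambda>x. f x + g x) = (\<lambda>x. partial_deriv b f x + partial_deriv b g x)" for b
    by (auto simp: partial_deriv_add)
  with Suc show ?case by auto
qed

lemma tcd_mult:
  assumes "times_cont_diff n f" "times_cont_diff n g"
  shows "times_cont_diff n (\<lambda>x. f x * g x)"
  using assms
proof (induction n arbitrary: f g)
  case 0
  then show ?case by (auto intro: continuous_intros)
next
  case (Suc n)
  have "partial_deriv b (\<lambda>x. f x * g x) = (\<lambda>x. partial_deriv b f x * g x + f x * partial_deriv b g x)" for b
    using Suc.prems by (auto simp: partial_deriv_mult)
  moreover have "times_cont_diff n f" "times_cont_diff n g"
    using Suc.prems by (blast dest: tcd_Suc_D)+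
  ultimately show ?case using Suc by (auto intro!: tcd_add)
qed

lemma tcd_scale: "times_cont_diff n f \<Longrightarrow> times_cont_diff n (\<lambda>x. c * f x)"
  by (intro tcd_mult tcd_const)

lemma partial_deriv_scale:
  assumes "f differentiable (at x)"
  shows "partial_deriv b (\<lambda>x. c * f x) x = c * partial_deriv b f x"
  using partial_deriv_mult[of "\<lambda>x. c" x f b] assms by (simp add: partial_deriv_const)

lemma tcd_prod: "(\<And>i. i \<in> I \<Longrightarrow> times_cont_diff n (f i)) \<Longrightarrow> times_cont_diff n (\<lambda>x. \<Prod>i\<in>I. f i x)"
  by (induction I rule: infinite_finite_induct) (auto intro: tcd_const tcd_mult)

lemma tcd_sum: "(\<And>i. i \<in> I \<Longrightarrow> times_cont_diff n (f i)) \<Longrightarrow> times_cont_diff n (\<lambda>x. \<Sum>i\<in>I. f i x)"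
  by (induction I rule: infinite_finite_induct) (auto intro: tcd_const tcd_add)

lemma partial_deriv_sum:
  "(\<And>i. i \<in> I \<Longrightarrow> f i differentiable (at x)) \<Longrightarrow>
    partial_deriv b (\<lambda>x. \<Sum>i\<in>I. f i x) x = (\<Sum>i\<in>I. partial_deriv b (f i) x)"
  by (induction I rule: infinite_finite_induct) (auto simp: partial_deriv_const partial_deriv_add)

lemma has_derivative_along:
  fixes e :: "'a::euclidean_space"
  assumes "(g has_real_derivative g') (at (c * (x \<bullet> e) + d))"
  shows "((\<lambda>x. g (c * (x \<bullet> e) + d)) has_derivative (\<lambda>h. c * (h \<bullet> e) * g')) (at x)"
proof -
  have "((\<lambda>x. c * (x \<bullet> e) + d) has_derivative (\<lambda>h. c * (h \<bullet> e))) (at x)"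
    by (auto intro!: derivative_eq_intros)
  from has_derivative_compose[OF this assms[unfolded has_field_derivative_def]]
  show ?thesis by (simp add: mult.commute)
qed

text \<open>The whole family \<open>h\<close> of successive derivatives is carried along, so that
  the induction can pass from \<open>h m\<close> to \<open>h (Suc m)\<close>; its instance is
  \<open>bump_deriv\<close>.\<close>

lemma tcd_along:
  fixes e :: "'a::euclidean_space"
  assumes "\<And>m t. (h m has_real_derivative h (Suc m) t) (at t)"
  shows "times_cont_diff n (\<lambda>x. h m (c * (x \<bullet> e) + d))"
proof (induction n arbitrary: m)
  case 0
  have "continuous_on UNIV (h m)"
    using assms by (meson DERIV_isCont continuous_at_imp_continuous_on)
  then show ?case
    by (auto intro!: continuous_on_compose2[where f="\<lambda>x. c * (x \<bullet> e) + d"] continuous_intros)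
next
  case (Suc n)
  note D = has_derivative_along[OF assms]
  have "partial_deriv b (\<lambda>x. h m (c * (x \<bullet> e) + d)) = (\<lambda>x. c * (b \<bullet> e) * h (Suc m) (c * (x \<bullet> e) + d))" for b
    by (rule ext) (rule partial_deriv_eq[OF D])
  moreover have "(\<lambda>x. h m (c * (x \<bullet> e) + d)) differentiable (at x)" for x
    using D unfolding differentiable_def by blast
  ultimately show ?case using Suc by (auto intro!: tcd_scale)
qed

definition grad :: "('a::euclidean_space \<Rightarrow> real) \<Rightarrow> 'a \<Rightarrow> 'a" where
  "grad f x = (\<Sum>b\<in>Basis. partial_deriv b f x *\<^sub>R b)"

lemma grad_inner: "b \<in> Basis \<Longrightarrow> grad f x \<bullet> b = partial_deriv b f x"
  by (simp add: grad_def inner_sum_left inner_Basis if_distrib cong: if_cong)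

lemma has_derivative_grad:
  "f differentiable (at x) \<Longrightarrow> (f has_derivative (\<lambda>h. h \<bullet> grad f x)) (at x)"
  using has_derivative_partial[of f x] by (simp add: grad_def inner_sum_right mult.commute)

lemma grad_eqI:
  assumes "(f has_derivative (\<lambda>h. h \<bullet> g)) (at x)"
  shows "grad f x = g"
  by (rule euclidean_eqI) (simp add: grad_inner partial_deriv_eq[OF assms] inner_commute[of g])

lemma continuous_grad: "times_cont_diff 1 f \<Longrightarrow> continuous_on UNIV (grad f)"
  unfolding grad_def by (intro continuous_intros) auto

lemma tcd_1I:
  assumes "\<And>x. (f has_derivative (\<lambda>h. h \<bullet> g x)) (at x)" "continuous_on UNIV g"
  shows "times_cont_diff 1 f"
proof -
  have "partial_deriv b f = (\<lambda>x. b \<bullet> g x)" for b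
    by (rule ext) (rule partial_deriv_eq[OF assms(1)])
  moreover have "f differentiable (at x)" for x
    using assms(1) unfolding differentiable_def by blast
  ultimately show ?thesis using assms(2) by (auto intro!: continuous_intros)
qed

lemma grad_exp:
  assumes "f differentiable (at x)"
  shows "((\<lambda>x. exp (f x)) has_derivative (\<lambda>h. h \<bullet> (exp (f x) *\<^sub>R grad f x))) (at x)"
  using has_derivative_exp[OF has_derivative_grad[OF assms]] by (simp add: mult.commute)

lemma tcd_exp:
  assumes "times_cont_diff 1 f"
  shows "times_cont_diff 1 (\<lambda>x. exp (f x))"
proof (rule tcd_1I)
  show "((\<lambda>x. exp (f x)) has_derivative (\<lambda>h. h \<bullet> (exp (f x) *\<^sub>R grad f x))) (at x)" for x
    using assms by (intro grad_exp) simp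
  show "continuous_on UNIV (\<lambda>x. exp (f x) *\<^sub>R grad f x)"
    using assms tcd_continuous[OF assms] by (intro continuous_intros continuous_grad)
qed

lemma grad_mult:
  assumes "f differentiable (at x)" "g differentiable (at x)"
  shows "grad (\<lambda>x. f x * g x) x = g x *\<^sub>R grad f x + f x *\<^sub>R grad g x"
  using assms by (simp add: grad_def partial_deriv_mult scaleR_add_left sum.distrib scaleR_sum_right mult.commute)

section \<open>Compactly supported C1 functions and integration by parts\<close>

lemma partial_deriv_supp:
  "{x. partial_deriv b f x \<noteq> 0} \<subseteq> closure {x. f x \<noteq> 0}"
proof (rule subsetI, rule ccontr)
  fix x assume x: "x \<in> {x. partial_deriv b f x \<noteq> 0}" "x \<notin> closure {x. f x \<noteq> 0}"
  have "(f has_derivative (\<lambda>h. 0)) (at x)"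
  proof (rule has_derivative_transform_within_open[of "\<lambda>x. 0" _ _ _ "- closure {x. f x \<noteq> 0}"])
    show "0 = f y" if "y \<in> - closure {x. f x \<noteq> 0}" for y
      using that closure_subset[of "{x. f x \<noteq> 0}"] by auto
  qed (use x in auto)
  from partial_deriv_eq[OF this, of b] x show False by simp
qed

text \<open>A class between test functions and V: unlike the test functions it is stable under
  multiplication by exp (- b) for a merely C1 function b.\<close>

definition C1c :: "'a::euclidean_space set \<Rightarrow> ('a \<Rightarrow> real) set" where
  "C1c D = {f. times_cont_diff 1 f \<and> compact (closure {x. f x \<noteq> 0}) \<and> closure {x. f x \<noteq> 0} \<subseteq> D}"

lemma C1cD: "f \<in> C1c D \<Longrightarrow> times_cont_diff 1 f"
  by (simp add: C1c_def)

lemma C1c_mono: "D \<subseteq> E \<Longrightarrow> C1c D \<subseteq> C1c E"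
  by (auto simp: C1c_def)

lemma test_functions_C1c: "test_functions D \<subseteq> C1c D"
  by (auto simp: C1c_def test_functions_def simp del: times_cont_diff.simps)

lemma supp_subset_compact:
  assumes "{x. g x \<noteq> (0::real)} \<subseteq> closure {x. f x \<noteq> (0::real)}" "compact (closure {x. f x \<noteq> 0})"
  shows "compact (closure {x. g x \<noteq> 0})" "closure {x. g x \<noteq> 0} \<subseteq> closure {x. f x \<noteq> 0}"
proof -
  show *: "closure {x. g x \<noteq> 0} \<subseteq> closure {x. f x \<noteq> 0}"
    using assms(1) by (simp add: closure_minimal)
  show "compact (closure {x. g x \<noteq> 0})"
    using compact_Int_closed[OF assms(2) closed_closure, of "{x. g x \<noteq> 0}"] * by (simp add: Int_absorb1)
qed

lemma C1c_mult:
  assumes "f \<in> C1c D" "times_cont_diff 1 g"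
  shows "(\<lambda>x. f x * g x) \<in> C1c D"
proof -
  have s: "{x. f x * g x \<noteq> 0} \<subseteq> closure {x. f x \<noteq> 0}"
    using closure_subset[of "{x. f x \<noteq> 0}"] by auto
  show ?thesis
    using supp_subset_compact[OF s] tcd_mult[OF _ assms(2), of f] assms(1) by (auto simp: C1c_def simp del: times_cont_diff.simps)
qed

lemma test_functions_partial:
  assumes "\<theta> \<in> test_functions D" "b \<in> Basis"
  shows "partial_deriv b \<theta> \<in> test_functions D"
proof -
  have "times_cont_diff n (partial_deriv b \<theta>)" for n
    using assms tcd_partial[of n \<theta> b] by (auto simp: test_functions_def simp del: times_cont_diff.simps)
  then show ?thesis
    using supp_subset_compact[OF partial_deriv_supp, of \<theta> b] assms by (auto simp: test_functions_def)
qed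

lemma test_functions_lincomb:
  assumes "\<theta> \<in> test_functions D" "\<eta> \<in> test_functions D"
  shows "(\<lambda>x. c * \<theta> x + e * \<eta> x) \<in> test_functions D"
proof -
  let ?S = "closure {x. \<theta> x \<noteq> 0} \<union> closure {x. \<eta> x \<noteq> 0}"
  have "{x. c * \<theta> x + e * \<eta> x \<noteq> 0} \<subseteq> ?S"
    using closure_subset[of "{x. \<theta> x \<noteq> 0}"] closure_subset[of "{x. \<eta> x \<noteq> 0}"] by fastforce
  then have *: "closure {x. c * \<theta> x + e * \<eta> x \<noteq> 0} \<subseteq> ?S"
    by (intro closure_minimal) auto
  moreover have "compact ?S" using assms by (auto simp: test_functions_def)
  ultimately have "compact (closure {x. c * \<theta> x + e * \<eta> x \<noteq> 0})"
    using compact_Int_closed[of ?S "closure {x. c * \<theta> x + e * \<eta> x \<noteq> 0}"] by (simp add: Int_absorb1)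
  then show ?thesis
    using * assms by (auto simp: test_functions_def intro!: tcd_add tcd_scale)
qed

lemma compact_support_bounded:
  fixes f :: "'a::euclidean_space \<Rightarrow> 'b::real_normed_vector"
  assumes "continuous_on UNIV f" "compact K" "\<And>x. x \<notin> K \<Longrightarrow> f x = 0"
  shows "\<exists>C\<ge>0. \<forall>x. norm (f x) \<le> C"
proof -
  have "bounded (f ` K)"
    using assms by (intro compact_imp_bounded compact_continuous_image) (auto intro: continuous_on_subset)
  then obtain C where "\<And>x. x \<in> K \<Longrightarrow> norm (f x) \<le> C" by (auto simp: bounded_iff)
  then have "\<forall>x. norm (f x) \<le> max C 0" using assms(3) by (metis linear max.absorb1 max.coboundedI1 max.cobounded2 norm_zero)
  then show ?thesis by (intro exI[of _ "max C 0"]) auto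
qed

lemma compact_support_integrable:
  fixes f :: "'a::euclidean_space \<Rightarrow> 'b::euclidean_space"
  assumes "continuous_on UNIV f" "compact K" "\<And>x. x \<notin> K \<Longrightarrow> f x = 0"
  shows "integrable lborel f"
proof -
  have "set_integrable lborel K f"
    using borel_integrable_compact[of K f] assms by (auto simp: set_integrable_def intro: continuous_on_subset)
  moreover have "(\<lambda>x. indicat_real K x *\<^sub>R f x) = f"
    using assms(3) by (auto simp: indicator_def fun_eq_iff)
  ultimately show ?thesis by (simp add: set_integrable_def)
qed

text \<open>The two signs of c cover translations, needed for difference quotients, and reflections
  y -> x - y, needed for mollifiers.\<close>

lemma lborel_integral_shift:
  fixes f :: "'a::euclidean_space \<Rightarrow> real"
  assumes "f \<in> borel_measurable borel" "\<bar>c\<bar> = 1"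
  shows "(LINT x|lborel. f (t + c *\<^sub>R x)) = (LINT x|lborel. f x)"
proof -
  have "c \<noteq> 0" using assms by auto
  have [measurable]: "f \<in> borel_measurable borel" by fact
  have "lborel = density (distr lborel borel (\<lambda>x::'a. t + c *\<^sub>R x)) (\<lambda>_. \<bar>c\<bar>^DIM('a))"
    by (rule lborel_affine[OF \<open>c \<noteq> 0\<close>])
  also have "\<dots> = distr lborel borel (\<lambda>x::'a. t + c *\<^sub>R x)"
    using assms by (simp add: density_1)
  finally have "(LINT x|lborel. f x) = (LINT x|distr lborel borel (\<lambda>x::'a. t + c *\<^sub>R x). f x)" by simp
  also have "\<dots> = (LINT x|lborel. f (t + c *\<^sub>R x))" by (subst integral_distr) auto
  finally show ?thesis by simp
qed

lemma mvt_along: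
  fixes f :: "'a::euclidean_space \<Rightarrow> real"
  assumes "\<And>x. f differentiable (at x)" "\<And>x. \<bar>partial_deriv b f x\<bar> \<le> C" "t \<ge> 0"
  shows "\<bar>f (x + t *\<^sub>R b) - f x\<bar> \<le> C * t"
proof -
  have D: "((\<lambda>t. f (x + t *\<^sub>R b)) has_derivative (\<lambda>h. h * partial_deriv b f (x + t *\<^sub>R b))) (at t)" for t
  proof -
    have "((\<lambda>t. x + t *\<^sub>R b) has_derivative (\<lambda>h. h *\<^sub>R b)) (at t)"
      by (auto intro!: derivative_eq_intros)
    from has_derivative_compose[OF this assms(1)[unfolded frechet_derivative_works]]
    show ?thesis
      using linear_simps(5)[OF has_derivative_bounded_linear[OF assms(1)[unfolded frechet_derivative_works]]]
      by (simp add: partial_deriv_def)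
  qed
  have "norm (f (x + t *\<^sub>R b) - f (x + 0 *\<^sub>R b)) \<le> C * norm (t - 0)"
  proof (rule differentiable_bound[where S=UNIV and f'="\<lambda>t h. h * partial_deriv b f (x + t *\<^sub>R b)"])
    show "onorm (\<lambda>h. h * partial_deriv b f (x + t *\<^sub>R b)) \<le> C" for t
      proof (rule onorm_le)
      fix h :: real
      show "norm (h * partial_deriv b f (x + t *\<^sub>R b)) \<le> C * norm h"
        using mult_left_mono[OF assms(2)[of "x + t *\<^sub>R b"], of "\<bar>h\<bar>"] by (simp add: abs_mult mult.commute)
    qed
  qed (use D in auto)
  then show ?thesis using assms(3) by simp
qed

text \<open>Translation invariance: the difference quotients have integral zero.\<close>

lemma integral_partial_deriv_zero:
  fixes f :: "'a::euclidean_space \<Rightarrow> real"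
  assumes f: "f \<in> C1c UNIV" and b: "b \<in> Basis"
  shows "(LINT x|lborel. partial_deriv b f x) = 0"
proof -
  let ?S = "closure {x. f x \<noteq> 0}"
  have S: "compact ?S" and t: "times_cont_diff 1 f" using f by (auto simp: C1c_def)
  have d: "f differentiable (at x)" for x using t by simp
  have cf: "continuous_on UNIV f" by (rule tcd_continuous[OF t])
  then have [measurable]: "f \<in> borel_measurable borel" by (rule borel_measurable_continuous_onI)
  have cp: "continuous_on UNIV (partial_deriv b f)" using t b by simp
  then have [measurable]: "partial_deriv b f \<in> borel_measurable borel" by (rule borel_measurable_continuous_onI)
  have supp: "f x = 0" if "x \<notin> ?S" for x using that closure_subset[of "{x. f x \<noteq> 0}"] by auto
  have suppp: "partial_deriv b f x = 0" if "x \<notin> ?S" for x using that partial_deriv_supp[of b f] by auto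
  obtain C where C: "C \<ge> 0" "\<And>x. \<bar>partial_deriv b f x\<bar> \<le> C"
    using compact_support_bounded[OF cp S suppp] by auto
  obtain R where R: "R > 0" "\<And>x. x \<in> ?S \<Longrightarrow> norm x \<le> R"
    using compact_imp_bounded[OF S] by (auto simp: bounded_pos)
  define F where "F n x = real (Suc n) * (f (x + inverse (real (Suc n)) *\<^sub>R b) - f x)" for n x
  have intf: "integrable lborel f" by (rule compact_support_integrable[OF cf S supp])
  have intfs: "integrable lborel (\<lambda>x. f (x + s *\<^sub>R b))" if "0 \<le> s" "s \<le> 1" for s
  proof (rule compact_support_integrable[of _ "cball 0 (R + 1)"])
    show "continuous_on UNIV (\<lambda>x. f (x + s *\<^sub>R b))"
      by (intro continuous_on_compose2[OF cf] continuous_intros) auto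
    show "f (x + s *\<^sub>R b) = 0" if "x \<notin> cball 0 (R + 1)" for x
    proof (rule supp, rule notI)
      assume "x + s *\<^sub>R b \<in> ?S"
      then have "norm (x + s *\<^sub>R b) \<le> R" by (rule R)
      then have "norm x \<le> R + norm (s *\<^sub>R b)"
        using norm_triangle_ineq4[of "x + s *\<^sub>R b" "s *\<^sub>R b"] by simp
      then show False using that \<open>0 \<le> s\<close> \<open>s \<le> 1\<close> b by simp
    qed
  qed simp
  have "(\<lambda>n. LINT x|lborel. F n x) \<longlonglongrightarrow> (LINT x|lborel. partial_deriv b f x)"
  \<comment> \<open>The mean value theorem bounds the quotients by C; since the steps are at most 1,
    they vanish outside the ball of radius R + 1.\<close>
  proof (rule integral_dominated_convergence[where w="\<lambda>x. C * indicator (cball 0 (R+1)) x"])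
    show "integrable lborel (\<lambda>x. C * indicator (cball 0 (R+1)) x)"
      by (intro integrable_mult_right integrable_real_indicator) (auto simp flip: infinity_ennreal_def intro: emeasure_bounded_finite)
    show "AE x in lborel. (\<lambda>n. F n x) \<longlonglongrightarrow> partial_deriv b f x"
    proof (rule AE_I2)
      fix x
      have "((\<lambda>t. f (x + t *\<^sub>R b)) has_real_derivative partial_deriv b f x) (at 0)"
      proof -
        have "((\<lambda>t. x + t *\<^sub>R b) has_derivative (\<lambda>h. h *\<^sub>R b)) (at 0)"
          by (auto intro!: derivative_eq_intros)
        from has_derivative_compose[OF this, of f] d[unfolded frechet_derivative_works]
        have "((\<lambda>t. f (x + t *\<^sub>R b)) has_derivative (\<lambda>h. frechet_derivative f (at x) (h *\<^sub>R b))) (at 0)"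
          by simp
        then show ?thesis
          unfolding has_field_derivative_def
          using linear_simps(5)[OF has_derivative_bounded_linear[OF d[unfolded frechet_derivative_works]]]
          by (simp add: partial_deriv_def mult_commute_abs)
      qed
      then have lim: "((\<lambda>h. (f (x + h *\<^sub>R b) - f x) / h) \<longlongrightarrow> partial_deriv b f x) (at 0)"
        by (simp add: DERIV_def)
      have "filterlim (\<lambda>n. inverse (real (Suc n))) (at 0) sequentially"
        unfolding filterlim_at using LIMSEQ_inverse_real_of_nat by auto
      from filterlim_compose[OF lim this]
      show "(\<lambda>n. F n x) \<longlonglongrightarrow> partial_deriv b f x"
        by (simp add: F_def field_simps)
    qed
    show "AE x in lborel. norm (F n x) \<le> C * indicator (cball 0 (R+1)) x" for n
    proof (rule AE_I2)
      fix x
      show "norm (F n x) \<le> C * indicator (cball 0 (R+1)) x"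
      proof (cases "x \<in> cball 0 (R+1)")
        case True
        have "\<bar>f (x + inverse (real (Suc n)) *\<^sub>R b) - f x\<bar> \<le> C * inverse (real (Suc n))"
          by (rule mvt_along[OF d C(2)]) simp
        then have "real (Suc n) * \<bar>f (x + inverse (real (Suc n)) *\<^sub>R b) - f x\<bar> \<le> real (Suc n) * (C * inverse (real (Suc n)))"
          by (rule mult_left_mono) simp
        also have "\<dots> = C" by simp
        finally show ?thesis using True by (simp add: F_def abs_mult)
      next
        case False
        let ?s = "inverse (real (Suc n))"
        have "x \<notin> ?S" using False R by fastforce
        moreover have "x + ?s *\<^sub>R b \<notin> ?S"
        proof
          assume "x + ?s *\<^sub>R b \<in> ?S"
          then have "norm (x + ?s *\<^sub>R b) \<le> R" by (rule R)
          then have "norm x \<le> R + norm (?s *\<^sub>R b)"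
            using norm_triangle_ineq4[of "x + ?s *\<^sub>R b" "?s *\<^sub>R b"] by simp
          moreover have "norm (?s *\<^sub>R b) \<le> 1" using b by (simp add: field_simps)
          ultimately show False using False by simp
        qed
        ultimately have "f x = 0" "f (x + ?s *\<^sub>R b) = 0" by (blast intro: supp)+
        then have "F n x = 0" unfolding F_def by (simp only: diff_self mult_zero_right)
        then show ?thesis using False by simp
      qed
    qed
  qed (auto simp: F_def)
  moreover have "(LINT x|lborel. F n x) = 0" for n
  proof -
    let ?s = "inverse (real (Suc n))"
    have s: "0 \<le> ?s" "?s \<le> 1" by (auto simp: field_simps)
    have "(LINT x|lborel. F n x) = real (Suc n) * ((LINT x|lborel. f (x + ?s *\<^sub>R b)) - (LINT x|lborel. f x))"
      unfolding F_def using intf intfs[OF s] by simp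
    also have "(LINT x|lborel. f (x + ?s *\<^sub>R b)) = (LINT x|lborel. f x)"
      using lborel_integral_shift[of f 1 "?s *\<^sub>R b"] by (simp add: add.commute)
    finally show ?thesis by simp
  qed
  ultimately show ?thesis by (simp add: LIMSEQ_const_iff)
qed

lemma C1c_partial_integrable:
  assumes "f \<in> C1c UNIV" "times_cont_diff 1 g" "b \<in> Basis"
  shows "integrable lborel (\<lambda>x. f x * partial_deriv b g x)"
    "integrable lborel (\<lambda>x. partial_deriv b f x * g x)"
proof -
  define S where "S = closure {x. f x \<noteq> 0}"
  have t: "times_cont_diff 1 f" and S: "compact S" using assms(1) by (auto simp: C1c_def S_def)
  have supp: "f x = 0" "partial_deriv b f x = 0" if "x \<notin> S" for x
    using that closure_subset[of "{x. f x \<noteq> 0}"] partial_deriv_supp[of b f] by (auto simp: S_def)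
  have c: "continuous_on UNIV f" "continuous_on UNIV g"
    "continuous_on UNIV (partial_deriv b f)" "continuous_on UNIV (partial_deriv b g)"
    using tcd_continuous[OF t] tcd_continuous[OF assms(2)] t assms(2,3) by simp_all
  show "integrable lborel (\<lambda>x. f x * partial_deriv b g x)"
    "integrable lborel (\<lambda>x. partial_deriv b f x * g x)"
    by (rule compact_support_integrable[OF _ S]; use c supp in \<open>auto intro: continuous_intros\<close>)+
qed

lemma integral_by_parts_C1c:
  assumes "f \<in> C1c UNIV" "times_cont_diff 1 g" "b \<in> Basis"
  shows "(LINT x|lborel. f x * partial_deriv b g x) = - (LINT x|lborel. partial_deriv b f x * g x)"
proof -
  have "partial_deriv b (\<lambda>x. f x * g x) x = partial_deriv b f x * g x + f x * partial_deriv b g x" for x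
    using C1cD[OF assms(1)] assms(2) by (intro partial_deriv_mult) auto
  then show ?thesis
    using integral_partial_deriv_zero[OF C1c_mult[OF assms(1,2)] assms(3)] C1c_partial_integrable[OF assms]
    by simp
qed

section \<open>Bump functions and mollification\<close>

text \<open>The m-th derivative of exp (-1/t) is P m (1/t) exp (-1/t) with the following polynomials.\<close>

primrec bump_poly :: "nat \<Rightarrow> real poly" where
  "bump_poly 0 = 1"
| "bump_poly (Suc m) = [:0, 0, 1:] * (bump_poly m - pderiv (bump_poly m))"

definition bump_deriv :: "nat \<Rightarrow> real \<Rightarrow> real" where
  "bump_deriv m t = (if t > 0 then poly (bump_poly m) (1/t) * exp (- (1/t)) else 0)"

lemma poly_times_exp_minus: "((\<lambda>y. poly P y * exp (- y)) \<longlongrightarrow> 0) at_top" for P :: "real poly"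
proof -
  have "((\<lambda>y. \<Sum>i\<le>degree P. coeff P i * (y ^ i / exp y)) \<longlongrightarrow> (\<Sum>i\<le>degree P. coeff P i * 0)) at_top"
    by (intro tendsto_sum tendsto_mult tendsto_const tendsto_power_div_exp_0)
  moreover have "(\<Sum>i\<le>degree P. coeff P i * (y ^ i / exp y)) = poly P y * exp (- y)" for y
    unfolding poly_altdef sum_distrib_right by (intro sum.cong) (auto simp: exp_minus inverse_eq_divide)
  ultimately show ?thesis by simp
qed

lemma bump_deriv_has_derivative: "(bump_deriv m has_real_derivative bump_deriv (Suc m) t) (at t)"
proof -
  consider "t > 0" | "t < 0" | "t = 0" by linarith
  then show ?thesis
  proof cases
    case 1
    let ?P = "bump_poly m"
    have "((\<lambda>t. poly ?P (1/t) * exp (- (1/t))) has_real_derivative bump_deriv (Suc m) t) (at t)"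
      using 1 by (auto intro!: derivative_eq_intros simp: bump_deriv_def power2_eq_square field_simps)
    then show ?thesis
      by (rule DERIV_cong_ev[THEN iffD1, rotated 3])
        (use 1 in \<open>auto simp: bump_deriv_def eventually_nhds intro!: exI[of _ "{0<..}"]\<close>)
  next
    case 2
    have "((\<lambda>t. 0) has_real_derivative 0) (at t)" by simp
    then show ?thesis
      by (rule DERIV_cong_ev[THEN iffD1, rotated 3])
        (use 2 in \<open>auto simp: bump_deriv_def eventually_nhds intro!: exI[of _ "{..<0}"]\<close>)
  next
    case 3
    \<comment> \<open>The difference quotient at 0 contributes one more factor 1/t, which
      \<open>pCons 0\<close> adds to the polynomial.\<close>
    have "((\<lambda>t. poly (pCons 0 (bump_poly m)) (1/t) * exp (- (1/t))) \<longlongrightarrow> 0) (at_right 0)"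
      by (rule filterlim_compose[OF poly_times_exp_minus])
        (use filterlim_inverse_at_top_right in \<open>simp add: inverse_eq_divide\<close>)
    then have R: "((\<lambda>h. (bump_deriv m (0 + h) - bump_deriv m 0) / h) \<longlongrightarrow> 0) (at_right 0)"
      by (rule Lim_transform_eventually)
        (auto simp: bump_deriv_def eventually_at_filter)
    have L: "((\<lambda>h. (bump_deriv m (0 + h) - bump_deriv m 0) / h) \<longlongrightarrow> 0) (at_left 0)"
      by (rule Lim_transform_eventually[of "\<lambda>h. 0"])
        (auto simp: bump_deriv_def eventually_at_filter)
    show ?thesis
      using filterlim_split_at_real[OF L R] 3 by (simp add: DERIV_def bump_deriv_def)
  qed
qed

lemma bump_0_nonneg: "0 \<le> bump_deriv 0 t" and bump_0_le_1: "bump_deriv 0 t \<le> 1"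
  and bump_0_pos: "t > 0 \<Longrightarrow> bump_deriv 0 t > 0" and bump_0_zero: "t \<le> 0 \<Longrightarrow> bump_deriv 0 t = 0"
  by (auto simp: bump_deriv_def)

text \<open>Two one-sided bumps exp (- 1/t) per coordinate make the product positive exactly inside
  the open box when k > 0. Here k is a steepness: as it grows, the indicator of the box is
  approximated. The affine arguments are written in the form that \<open>tcd_along\<close>
  expects.\<close>

definition box_bump :: "'a::euclidean_space \<Rightarrow> 'a \<Rightarrow> real \<Rightarrow> 'a \<Rightarrow> real" where
  "box_bump a b k x =
     (\<Prod>i\<in>Basis. bump_deriv 0 (k * (x \<bullet> i) + - k * (a \<bullet> i)) * bump_deriv 0 (- k * (x \<bullet> i) + k * (b \<bullet> i)))"

lemma box_bump_smooth: "times_cont_diff n (box_bump a b k)"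
  unfolding box_bump_def
  by (intro tcd_prod tcd_mult tcd_along bump_deriv_has_derivative)

lemma box_bump_nonneg: "0 \<le> box_bump a b k x"
  unfolding box_bump_def by (intro prod_nonneg mult_nonneg_nonneg bump_0_nonneg)

lemma box_bump_le_1: "box_bump a b k x \<le> 1"
  unfolding box_bump_def
  by (intro prod_le_1 conjI mult_nonneg_nonneg mult_le_one bump_0_nonneg bump_0_le_1)

lemma box_bump_pos:
  assumes "x \<in> box a b" "k > 0"
  shows "box_bump a b k x > 0"
  unfolding box_bump_def
proof (intro prod_pos mult_pos_pos bump_0_pos)
  fix i :: 'a assume "i \<in> Basis"
  then have "k * (x \<bullet> i - a \<bullet> i) > 0" "k * (b \<bullet> i - x \<bullet> i) > 0"
    using assms by (auto simp: mem_box)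
  then show "k * (x \<bullet> i) + - k * (a \<bullet> i) > 0" "- k * (x \<bullet> i) + k * (b \<bullet> i) > 0"
    by (auto simp: algebra_simps)
qed

lemma box_bump_zero:
  assumes "x \<notin> box a b" "k > 0"
  shows "box_bump a b k x = 0"
proof -
  obtain i where i: "i \<in> Basis" "x \<bullet> i \<le> a \<bullet> i \<or> b \<bullet> i \<le> x \<bullet> i"
    using assms by (auto simp: mem_box not_less)
  then have "k * (x \<bullet> i - a \<bullet> i) \<le> 0 \<or> k * (b \<bullet> i - x \<bullet> i) \<le> 0"
    using assms(2) by (auto simp: mult_le_0_iff)
  then have "k * (x \<bullet> i) + - k * (a \<bullet> i) \<le> 0 \<or> - k * (x \<bullet> i) + k * (b \<bullet> i) \<le> 0"
    by (simp add: algebra_simps)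
  then have "bump_deriv 0 (k * (x \<bullet> i) + - k * (a \<bullet> i)) = 0 \<or> bump_deriv 0 (- k * (x \<bullet> i) + k * (b \<bullet> i)) = 0"
    using bump_0_zero by blast
  then have "bump_deriv 0 (k * (x \<bullet> i) + - k * (a \<bullet> i)) * bump_deriv 0 (- k * (x \<bullet> i) + k * (b \<bullet> i)) = 0"
    by (simp only: mult_eq_0_iff)
  then show ?thesis
    unfolding box_bump_def by (intro prod_zero[OF finite_Basis] bexI[where x=i] i(1))
qed

lemma box_bump_supp: "k > 0 \<Longrightarrow> closure {x. box_bump a b k x \<noteq> 0} \<subseteq> cbox a b"
  using box_bump_zero[of _ a b k] box_subset_cbox[of a b] by (intro closure_minimal) auto

lemma box_bump_test:
  assumes "cbox a b \<subseteq> D" "k > 0"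
  shows "box_bump a b k \<in> test_functions D"
proof -
  have "compact (closure {x. box_bump a b k x \<noteq> 0})"
    using compact_Int_closed[OF compact_cbox closed_closure] box_bump_supp[OF assms(2)]
    by (metis inf.absorb2)
  then show ?thesis
    using assms box_bump_supp[OF assms(2), of a b] by (auto simp: test_functions_def box_bump_smooth)
qed

lemma box_bump_limit: "(\<lambda>k. box_bump a b (real (Suc k)) x) \<longlonglongrightarrow> indicator (box a b) x"
proof (cases "x \<in> box a b")
  case True
  have l: "(\<lambda>k. bump_deriv 0 (real (Suc k) * u)) \<longlonglongrightarrow> 1" if "u > 0" for u
  proof -
    have "(\<lambda>k. exp (- (inverse (real (Suc k)) * (1/u)))) \<longlonglongrightarrow> exp (- (0 * (1/u)))"
      by (intro tendsto_intros LIMSEQ_inverse_real_of_nat)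
    moreover have "bump_deriv 0 (real (Suc k) * u) = exp (- (inverse (real (Suc k)) * (1/u)))" for k
      using that by (simp add: bump_deriv_def field_simps add_pos_nonneg)
    ultimately show ?thesis by simp
  qed
  have eq: "k * (x \<bullet> i) + - k * (a \<bullet> i) = k * (x \<bullet> i - a \<bullet> i)"
    "- k * (x \<bullet> i) + k * (b \<bullet> i) = k * (b \<bullet> i - x \<bullet> i)" for k i
    by (auto simp: algebra_simps)
  have "(\<lambda>k. box_bump a b (real (Suc k)) x) \<longlonglongrightarrow> (\<Prod>i\<in>(Basis::'a set). 1 * 1)"
    unfolding box_bump_def eq
    by (intro tendsto_prod tendsto_mult l) (use True in \<open>auto simp: mem_box\<close>)
  then show ?thesis using True by simp
next
  case False
  then show ?thesis using box_bump_zero[of x a b] by simp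
qed

lemma lebesgue_on_lborel:
  fixes h :: "'a::euclidean_space \<Rightarrow> 'b::euclidean_space"
  assumes "D \<in> sets lebesgue" "\<And>x. x \<notin> D \<Longrightarrow> h x = 0" "h \<in> borel_measurable borel"
  shows "(LINT x|lebesgue_on D. h x) = (LINT x|lborel. h x)"
    "integrable (lebesgue_on D) h \<longleftrightarrow> integrable lborel h"
proof -
  have e: "(\<lambda>x. indicat_real D x *\<^sub>R h x) = h" using assms(2) by (auto simp: indicator_def fun_eq_iff)
  show "(LINT x|lebesgue_on D. h x) = (LINT x|lborel. h x)"
    using assms by (simp add: integral_restrict_space e integral_completion)
  show "integrable (lebesgue_on D) h \<longleftrightarrow> integrable lborel h"
    using assms by (simp add: integrable_restrict_space e integrable_completion)
qed

lemma test_function_bounded: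
  assumes "\<theta> \<in> test_functions D"
  obtains C where "C \<ge> 0" "\<And>x. \<bar>\<theta> x\<bar> \<le> C"
proof -
  define S where "S = closure {x. \<theta> x \<noteq> 0}"
  have 1: "\<And>x. x \<notin> S \<Longrightarrow> \<theta> x = 0"
    unfolding S_def using closure_subset[of "{x. \<theta> x \<noteq> 0}"] by auto
  have "times_cont_diff 0 \<theta>" and 2: "compact S"
    using assms unfolding test_functions_def S_def by blast+
  then have 3: "continuous_on UNIV \<theta>" by simp
  obtain C where "C \<ge> 0" "\<forall>x. norm (\<theta> x) \<le> C"
    using compact_support_bounded[OF 3 2 1] by blast
  then show ?thesis by (intro that) auto
qed

text \<open>Lebesgue differentiation along cubes.\<close>

lemma fundamental_lemma:
  fixes g :: "'a::euclidean_space \<Rightarrow> real"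
  assumes D: "open D" and g: "integrable (lebesgue_on D) g"
    and orth: "\<And>\<theta>. \<theta> \<in> test_functions D \<Longrightarrow> (LINT x|lebesgue_on D. g x * \<theta> x) = 0"
  shows "AE x in lebesgue_on D. g x = 0"
proof -
  have DL: "D \<in> sets lebesgue" using D by auto
  define G where "G x = indicat_real D x *\<^sub>R g x" for x
  have G: "integrable lebesgue G"
    using g DL by (simp add: integrable_restrict_space G_def[abs_def])
  have [measurable]: "G \<in> borel_measurable lebesgue" using G by auto
  have int: "G absolutely_integrable_on cbox a b" for a b
    using G by (intro set_integrable_subset[of lebesgue UNIV G "cbox a b"]) (auto simp: set_integrable_def)
  \<comment> \<open>The bumps of a box inside D are test functions and converge to the indicator of
    the open box, so orthogonality passes to boxes.\<close>
  have box0: "integral (cbox a b) G = 0" if ab: "cbox a b \<subseteq> D" for a b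
  proof -
    have "(\<lambda>k. LINT x|lebesgue. G x * box_bump a b (real (Suc k)) x) \<longlonglongrightarrow> (LINT x|lebesgue. G x * indicator (box a b) x)"
    proof (rule integral_dominated_convergence[where w="\<lambda>x. norm (G x)"])
      show "AE x in lebesgue. (\<lambda>k. G x * box_bump a b (real (Suc k)) x) \<longlonglongrightarrow> G x * indicator (box a b) x"
        by (intro AE_I2 tendsto_mult tendsto_const box_bump_limit)
      show "AE x in lebesgue. norm (G x * box_bump a b (real (Suc k)) x) \<le> norm (G x)" for k
        using box_bump_nonneg[of a b "real (Suc k)"] box_bump_le_1[of a b "real (Suc k)"]
        by (intro AE_I2) (simp add: abs_mult mult_left_le)
      show "(\<lambda>x. G x * box_bump a b (real (Suc k)) x) \<in> borel_measurable lebesgue" for k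
        using tcd_continuous[OF box_bump_smooth[of 0 a b "real (Suc k)"]]
        by (intro borel_measurable_times) (auto intro!: continuous_imp_measurable_on_sets_lebesgue measurable_completion borel_measurable_continuous_onI)
      show "(\<lambda>x. G x * indicator (box a b) x) \<in> borel_measurable lebesgue"
        by (intro borel_measurable_times borel_measurable_indicator) auto
    qed (use G in auto)
    moreover have "(LINT x|lebesgue. G x * box_bump a b (real (Suc k)) x) = 0" for k
      using orth[OF box_bump_test[OF ab, of "real (Suc k)"]] DL
      by (simp add: integral_restrict_space G_def mult.assoc)
    ultimately have "(LINT x|lebesgue. G x * indicator (box a b) x) = 0"
      by (simp add: LIMSEQ_const_iff)
    then have "set_lebesgue_integral lebesgue (box a b) G = 0"
      by (simp add: set_lebesgue_integral_def mult.commute)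
    moreover have "G absolutely_integrable_on box a b"
      by (rule set_integrable_subset[OF int[of a b]]) (auto simp: box_subset_cbox)
    ultimately have "integral (box a b) G = 0"
      by (simp add: set_lebesgue_integral_eq_integral)
    then show ?thesis by (simp add: integral_open_interval)
  qed
  have "\<And>a b. G integrable_on cbox a b"
    using int set_lebesgue_integral_eq_integral(1) by blast
  then obtain N where N: "negligible N"
    and lim: "\<And>x e. x \<notin> N \<Longrightarrow> 0 < e \<Longrightarrow>
      \<exists>d>0. \<forall>h. 0 < h \<and> h < d \<longrightarrow> norm (integral (cbox x (x + h *\<^sub>R One)) G /\<^sub>R h ^ DIM('a) - G x) < e"
    by (rule integrable_ccontinuous_explicit) (rule that)
  have "G x = 0" if x: "x \<notin> N" "x \<in> D" for x
  proof (rule ccontr)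
    assume "G x \<noteq> 0"
    then obtain d where d: "d > 0"
      "\<And>h. 0 < h \<Longrightarrow> h < d \<Longrightarrow> norm (integral (cbox x (x + h *\<^sub>R One)) G /\<^sub>R h ^ DIM('a) - G x) < norm (G x)"
      using lim[OF x(1), of "norm (G x)"] by auto
    obtain e where e: "e > 0" "ball x e \<subseteq> D" using D x(2) by (auto simp: open_contains_ball)
    \<comment> \<open>A cube of side h with h * DIM < e lies in the ball of radius e, since a norm
      is at most the sum of the absolute coordinates.\<close>
    define h where "h = min d (e / DIM('a)) / 2"
    have h: "0 < h" "h < d" "h * DIM('a) < e" using d(1) e(1) by (auto simp: h_def field_simps min_def)
    have "cbox x (x + h *\<^sub>R One) \<subseteq> D"
    proof
      fix y assume y: "y \<in> cbox x (x + h *\<^sub>R One)"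
      have "norm (y - x) \<le> (\<Sum>i\<in>Basis. \<bar>(y - x) \<bullet> i\<bar>)" by (rule norm_le_l1)
      also have "\<dots> \<le> (\<Sum>i\<in>(Basis::'a set). h)"
        using y by (intro sum_mono) (auto simp: mem_box inner_simps)
      also have "\<dots> < e" using h(3) by (simp add: mult.commute)
      finally show "y \<in> D" using e(2) by (auto simp: dist_norm norm_minus_commute)
    qed
    from d(2)[OF h(1,2)] box0[OF this] show False by simp
  qed
  then have "AE x in lebesgue. x \<in> D \<longrightarrow> g x = 0"
    using N by (intro AE_I'[of N]) (auto simp: G_def negligible_iff_null_sets)
  then show ?thesis using DL by (simp add: AE_restrict_space_iff)
qed

text \<open>The integral runs over a set \<open>K\<close>, in use a box containing the support of
  \<open>v\<close>, because differentiation under the integral sign is applied on a compact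
  box.\<close>

definition conv :: "'a::euclidean_space set \<Rightarrow> ('a \<Rightarrow> real) \<Rightarrow> ('a \<Rightarrow> real) \<Rightarrow> 'a \<Rightarrow> real" where
  "conv K v \<theta> x = integral K (\<lambda>y. v y * \<theta> (x - y))"

lemma conv_has_derivative:
  fixes a b :: "'a::euclidean_space"
  assumes v: "continuous_on (UNIV :: 'a set) v" and \<theta>: "times_cont_diff 1 \<theta>"
  shows "(conv (cbox a b) v \<theta> has_derivative (\<lambda>h. \<Sum>i\<in>Basis. (h \<bullet> i) * conv (cbox a b) v (partial_deriv i \<theta>) x)) (at x)"
proof -
  \<comment> \<open>The x-derivative of the integrand, packed as a bounded linear map as
    \<open>leibniz_rule\<close> requires.\<close>
  define F :: "'a \<Rightarrow> 'a \<Rightarrow> 'a \<Rightarrow>\<^sub>L real" where "F = (\<lambda>x y. v y *\<^sub>R blinfun_inner_left (grad \<theta> (x - y)))"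
  have cg: "continuous_on UNIV (grad \<theta>)" by (rule continuous_grad[OF \<theta>])
  have c\<theta>: "continuous_on UNIV \<theta>" by (rule tcd_continuous[OF \<theta>])
  have Fc: "continuous_on (UNIV \<times> cbox a b) (\<lambda>(x, y). F x y)"
    unfolding F_def split_beta
    by (intro continuous_intros continuous_on_compose2[OF v] continuous_on_compose2[OF cg]
        bounded_linear.continuous_on[OF bounded_linear_blinfun_inner_left]) auto
  have D: "((\<lambda>x. integral (cbox a b) (\<lambda>y. v y * \<theta> (x - y))) has_derivative integral (cbox a b) (F x)) (at x within UNIV)"
  proof (rule leibniz_rule[OF _ _ Fc])
    fix x y :: 'a
    have 1: "((\<lambda>x. x - y) has_derivative (\<lambda>h. h)) (at x)"
      by (auto intro!: derivative_eq_intros)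
    have "(\<theta> has_derivative (\<lambda>h. h \<bullet> grad \<theta> (x - y))) (at (x - y))"
      using \<theta> by (intro has_derivative_grad) simp
    from has_derivative_compose[OF 1 this]
    have "((\<lambda>x. v y * \<theta> (x - y)) has_derivative (\<lambda>h. v y * (h \<bullet> grad \<theta> (x - y)))) (at x)"
      by (intro has_derivative_mult_right) simp
    then show "((\<lambda>x. v y * \<theta> (x - y)) has_derivative blinfun_apply (F x y)) (at x within UNIV)"
      by (simp add: F_def scaleR_blinfun.rep_eq)
  next
    fix x
    show "(\<lambda>y. v y * \<theta> (x - y)) integrable_on cbox a b"
      by (intro integrable_continuous continuous_intros continuous_on_compose2[OF v] continuous_on_compose2[OF c\<theta>]) auto
  qed auto
  have Fi: "F x integrable_on cbox a b"
    by (intro integrable_continuous continuous_on_compose2[OF Fc, of _ "\<lambda>y. (x, y)", unfolded split_beta fst_conv snd_conv]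
        continuous_intros) auto
  have "blinfun_apply (integral (cbox a b) (F x)) h = (\<Sum>i\<in>Basis. (h \<bullet> i) * conv (cbox a b) v (partial_deriv i \<theta>) x)" for h
  proof -
    have "blinfun_apply (integral (cbox a b) (F x)) h = integral (cbox a b) (\<lambda>y. blinfun_apply (F x y) h)"
      using integral_linear[OF Fi blinfun.bounded_linear_left[of h]] by (simp add: o_def)
    also have "\<dots> = integral (cbox a b) (\<lambda>y. \<Sum>i\<in>Basis. (h \<bullet> i) * (v y * partial_deriv i \<theta> (x - y)))"
      by (simp add: F_def scaleR_blinfun.rep_eq grad_def inner_sum_right sum_distrib_left mult.left_commute mult.commute)
    also have "\<dots> = (\<Sum>i\<in>Basis. integral (cbox a b) (\<lambda>y. (h \<bullet> i) * (v y * partial_deriv i \<theta> (x - y))))"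
    proof (rule integral_sum)
      fix i :: 'a assume "i \<in> Basis"
      then have cp: "continuous_on UNIV (partial_deriv i \<theta>)" using \<theta> by simp
      show "(\<lambda>y. (h \<bullet> i) * (v y * partial_deriv i \<theta> (x - y))) integrable_on cbox a b"
        by (intro integrable_continuous continuous_intros continuous_on_compose2[OF v] continuous_on_compose2[OF cp]) auto
    qed simp
    finally show ?thesis by (simp add: conv_def)
  qed
  then have "blinfun_apply (integral (cbox a b) (F x)) = (\<lambda>h. \<Sum>i\<in>Basis. (h \<bullet> i) * conv (cbox a b) v (partial_deriv i \<theta>) x)"
    by (rule ext)
  with D show ?thesis by (simp add: conv_def[abs_def])
qed

lemma conv_partial:
  fixes a b :: "'a::euclidean_space"
  assumes "continuous_on UNIV v" "times_cont_diff 1 \<theta>" "i \<in> Basis"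
  shows "partial_deriv i (conv (cbox a b) v \<theta>) = conv (cbox a b) v (partial_deriv i \<theta>)"
proof
  fix x
  have "partial_deriv i (conv (cbox a b) v \<theta>) x = (\<Sum>j\<in>Basis. (i \<bullet> j) * conv (cbox a b) v (partial_deriv j \<theta>) x)"
    by (rule partial_deriv_eq[OF conv_has_derivative[OF assms(1,2)]])
  also have "\<dots> = conv (cbox a b) v (partial_deriv i \<theta>) x"
    using assms(3) by (simp add: inner_Basis if_distrib if_distribR sum.delta cong: if_cong)
  finally show "partial_deriv i (conv (cbox a b) v \<theta>) x = conv (cbox a b) v (partial_deriv i \<theta>) x" .
qed

lemma conv_smooth:
  fixes a b :: "'a::euclidean_space"
  assumes v: "continuous_on UNIV v" and "\<And>m. times_cont_diff m \<theta>"
  shows "times_cont_diff n (conv (cbox a b) v \<theta>)"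
  using assms(2)
proof (induction n arbitrary: \<theta>)
  case 0
  show ?case
    unfolding times_cont_diff.simps(1)
    by (rule has_derivative_continuous_on) (rule has_derivative_at_withinI[OF conv_has_derivative[OF v 0]])
next
  case (Suc n)
  have "conv (cbox a b) v \<theta> differentiable (at x)" for x
    using conv_has_derivative[OF v Suc.prems] unfolding differentiable_def by blast
  moreover have "times_cont_diff n (partial_deriv i (conv (cbox a b) v \<theta>))" if i: "i \<in> Basis" for i
  proof -
    have "times_cont_diff m (partial_deriv i \<theta>)" for m using Suc.prems[of "Suc m"] i by simp
    then show ?thesis unfolding conv_partial[OF v Suc.prems i] by (rule Suc.IH)
  qed
  ultimately show ?case by simp
qed


lemma compact_support_uniform:
  fixes f :: "'a::euclidean_space \<Rightarrow> real"
  assumes f: "continuous_on UNIV f" and S: "compact S" "\<And>x. x \<notin> S \<Longrightarrow> f x = 0" and e: "e > 0"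
  shows "\<exists>\<delta>>0. \<forall>x y. dist x y < \<delta> \<longrightarrow> \<bar>f x - f y\<bar> < e"
proof -
  obtain R where R: "\<And>x. x \<in> S \<Longrightarrow> norm x \<le> R"
    using compact_imp_bounded[OF S(1)] by (auto simp: bounded_iff)
  have "uniformly_continuous_on (cball 0 (R + 1)) f"
    by (intro compact_uniformly_continuous continuous_on_subset[OF f]) auto
  then obtain d where d: "d > 0"
    "\<And>x y. x \<in> cball 0 (R+1) \<Longrightarrow> y \<in> cball 0 (R+1) \<Longrightarrow> dist y x < d \<Longrightarrow> dist (f y) (f x) < e"
    unfolding uniformly_continuous_on_def using e by meson
  have "\<bar>f x - f y\<bar> < e" if xy: "dist x y < min d 1" for x y
  proof (cases "x \<in> cball 0 (R+1) \<and> y \<in> cball 0 (R+1)")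
    case True
    then show ?thesis using d(2)[of y x] xy by (auto simp: dist_real_def)
  next
    case False
    have "norm x \<le> norm y + dist x y" "norm y \<le> norm x + dist x y"
      using norm_triangle_ineq2[of x y] norm_triangle_ineq2[of y x] by (auto simp: dist_norm norm_minus_commute)
    then have "norm x > R" "norm y > R" using False xy by auto
    then have "f x = 0" "f y = 0" using R S(2) by (meson not_le)+
    then show ?thesis using e by simp
  qed
  then show ?thesis using d(1) by (intro exI[of _ "min d 1"]) auto
qed

lemma mollifier_exists:
  fixes r :: real
  assumes "r > 0"
  shows "\<exists>\<eta> :: 'a::euclidean_space \<Rightarrow> real. (\<forall>n. times_cont_diff n \<eta>) \<and> (\<forall>x. 0 \<le> \<eta> x) \<and>
    (\<forall>x. norm x \<ge> r \<longrightarrow> \<eta> x = 0) \<and> (LINT x|lborel. \<eta> x) = 1"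
proof -
  \<comment> \<open>The absolute coordinates of a point of the cube sum to at most DIM * h = r/2, so
    the cube lies inside the ball of radius r.\<close>
  define h where "h = r / (2 * DIM('a))"
  have h: "h > 0" using assms by (simp add: h_def)
  define \<theta> where "\<theta> = box_bump (- h *\<^sub>R One) (h *\<^sub>R One :: 'a) 1"
  have smooth: "times_cont_diff n \<theta>" for n unfolding \<theta>_def by (rule box_bump_smooth)
  have z: "\<theta> x = 0" if "norm x \<ge> r" for x
    unfolding \<theta>_def
  proof (rule box_bump_zero, rule notI)
    assume x: "x \<in> box (- h *\<^sub>R One) (h *\<^sub>R One)"
    have "norm x \<le> (\<Sum>i\<in>Basis. \<bar>x \<bullet> i\<bar>)" by (rule norm_le_l1)
    also have "\<dots> \<le> (\<Sum>i\<in>(Basis::'a set). h)"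
      using x by (intro sum_mono) (force simp: mem_box)
    also have "\<dots> < r" using assms by (simp add: h_def)
    finally show False using that by simp
  qed simp
  have c: "continuous_on UNIV \<theta>" using smooth[of 0] by simp
  have int: "integrable lborel \<theta>"
    by (rule compact_support_integrable[OF c compact_cball[of 0 r]]) (auto intro!: z)
  have pos: "0 \<le> \<theta> x" for x unfolding \<theta>_def by (rule box_bump_nonneg)
  have "(LINT x|lborel. \<theta> x) > 0"
  proof -
    have "(LINT x|lborel. \<theta> x) \<noteq> 0"
    proof
      assume "(LINT x|lborel. \<theta> x) = 0"
      then have "AE x in lborel. \<theta> x = 0"
        using int pos by (subst (asm) integral_nonneg_eq_0_iff_AE) auto
      then have "emeasure lborel {x \<in> space lborel. \<theta> x \<noteq> 0} = 0"
        by (rule AE_iff_measurable[THEN iffD1, rotated -1])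
          (use borel_measurable_continuous_onI[OF c] in \<open>auto intro!: borel_measurable_neq\<close>)
      moreover have "box (- h *\<^sub>R One) (h *\<^sub>R One) \<subseteq> {x \<in> space lborel. \<theta> x \<noteq> 0}"
        unfolding \<theta>_def using box_bump_pos[of _ "- h *\<^sub>R One" "h *\<^sub>R One" 1] by force
      moreover have "{x \<in> space lborel. \<theta> x \<noteq> 0} \<in> sets lborel"
        using borel_measurable_continuous_onI[OF c] by (auto intro!: borel_measurable_neq)
      ultimately have "emeasure lborel (box (- h *\<^sub>R One) (h *\<^sub>R One :: 'a)) = 0"
        by (metis emeasure_mono le_zero_eq)
      then show False using h by (simp add: emeasure_lborel_box_eq inner_simps prod_zero_iff)
    qed
    moreover have "(LINT x|lborel. \<theta> x) \<ge> 0" using pos by simp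
    ultimately show ?thesis by simp
  qed
  then show ?thesis
    using smooth pos z by (intro exI[of _ "\<lambda>x. inverse (LINT x|lborel. \<theta> x) * \<theta> x"])
      (auto intro!: tcd_scale)
qed

text \<open>Mollification approximates a function and its first derivatives uniformly at the same
  time, because the derivative of the mollification is the mollification of the derivative.\<close>

lemma C1c_approx:
  fixes v :: "'a::euclidean_space \<Rightarrow> real"
  assumes v: "v \<in> C1c D" and D: "open D" and e: "e > 0"
  shows "\<exists>\<theta>\<in>test_functions D. (\<forall>x. \<bar>v x - \<theta> x\<bar> \<le> e) \<and>
    (\<forall>b\<in>Basis. \<forall>x. \<bar>partial_deriv b v x - partial_deriv b \<theta> x\<bar> \<le> e)"
proof -
  define S where "S = closure {x. v x \<noteq> 0}"
  have S: "compact S" "S \<subseteq> D" and t: "times_cont_diff 1 v" using v by (auto simp: C1c_def S_def)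
  have sv: "v x = 0" if "x \<notin> S" for x
    using that closure_subset[of "{x. v x \<noteq> 0}"] unfolding S_def by auto
  have sp: "partial_deriv b v x = 0" if "x \<notin> S" for x b
    using that partial_deriv_supp[of b v] unfolding S_def by auto
  have cv: "continuous_on UNIV v" by (rule tcd_continuous[OF t])
  have cp: "continuous_on UNIV (partial_deriv b v)" if "b \<in> Basis" for b using t that by simp
  obtain a where a: "S \<subseteq> cbox (- a) a" using bounded_subset_cbox_symmetric[OF compact_imp_bounded[OF S(1)]] by blast
  obtain e0 where e0: "e0 > 0" "(\<Union>x\<in>S. cball x e0) \<subseteq> D"
    using compact_subset_open_imp_cball_epsilon_subset[OF S(1) D S(2)] by blast
  obtain d0 where d0: "d0 > 0" "\<And>x y. dist x y < d0 \<Longrightarrow> \<bar>v x - v y\<bar> < e"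
    using compact_support_uniform[OF cv S(1) sv e] by blast
  have "\<forall>b\<in>Basis. \<exists>d>0. \<forall>x y. dist x y < d \<longrightarrow> \<bar>partial_deriv b v x - partial_deriv b v y\<bar> < e"
    using compact_support_uniform[OF cp S(1) sp e] by blast
  then obtain d where d: "\<And>b. b \<in> Basis \<Longrightarrow> d b > 0"
    "\<And>b x y. b \<in> Basis \<Longrightarrow> dist x y < d b \<Longrightarrow> \<bar>partial_deriv b v x - partial_deriv b v y\<bar> < e"
    by metis
  \<comment> \<open>The radius stays below \<open>e0\<close>, so that the mollified support remains
    in D, and below the moduli of continuity of v and of its partial derivatives.\<close>
  define r where "r = Min (insert e0 (insert d0 (d ` Basis)))"
  have "r > 0" unfolding r_def using e0(1) d0(1) d(1) by (subst Min_gr_iff) auto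
  moreover have "r \<le> z" if "z \<in> insert e0 (insert d0 (d ` Basis))" for z
    unfolding r_def using that by (intro Min_le) auto
  ultimately have r: "r > 0" "r \<le> e0" "r \<le> d0" "\<And>b. b \<in> Basis \<Longrightarrow> r \<le> d b" by auto
  obtain \<eta> :: "'a \<Rightarrow> real" where \<eta>: "\<And>n. times_cont_diff n \<eta>" "\<And>x. 0 \<le> \<eta> x" "\<And>x. norm x \<ge> r \<Longrightarrow> \<eta> x = 0"
    "(LINT x|lborel. \<eta> x) = 1"
    using mollifier_exists[OF r(1), where 'a='a] by blast
  have c\<eta>: "continuous_on UNIV \<eta>" using \<eta>(1)[of 0] by simp
  then have m\<eta>: "\<eta> \<in> borel_measurable borel" by (rule borel_measurable_continuous_onI)
  have c\<eta>': "continuous_on UNIV (\<lambda>y. \<eta> (x - y))" for x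
    by (intro continuous_on_compose2[OF c\<eta>] continuous_intros) auto
  have i\<eta>: "integrable lborel (\<lambda>y. \<eta> (x - y))" for x
    by (rule compact_support_integrable[OF c\<eta>' compact_cball[of x r]]) (auto intro!: \<eta>(3) simp: dist_norm)
  have I\<eta>: "(LINT y|lborel. \<eta> (x - y)) = 1" for x
    using lborel_integral_shift[OF m\<eta>, of "-1" x] \<eta>(4) by simp
  let ?K = "cbox (- a) a"
  have conv_eq: "conv ?K f g x = (LINT y|lborel. f y * g (x - y))"
    and conv_int: "integrable lborel (\<lambda>y. f y * g (x - y))"
    if "continuous_on UNIV f" "continuous_on UNIV g" "\<And>x. x \<notin> S \<Longrightarrow> f x = 0" for f g x
  proof -
    have c: "continuous_on UNIV (\<lambda>y. f y * g (x - y))"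
      using that(1) by (intro continuous_intros continuous_on_compose2[OF that(2)]) auto
    show i: "integrable lborel (\<lambda>y. f y * g (x - y))"
      by (rule compact_support_integrable[OF c S(1)]) (simp add: that(3))
    have e: "(\<lambda>y. indicat_real ?K y *\<^sub>R (f y * g (x - y))) = (\<lambda>y. f y * g (x - y))"
      using that(3) a by (auto simp: indicator_def fun_eq_iff)
    have "set_integrable lborel ?K (\<lambda>y. f y * g (x - y))"
      unfolding set_integrable_def e by (rule i)
    from set_borel_integral_eq_integral(2)[OF this]
    show "conv ?K f g x = (LINT y|lborel. f y * g (x - y))"
      by (simp only: conv_def set_lebesgue_integral_def e)
  qed
  have approx: "\<bar>f x - conv ?K f \<eta> x\<bar> \<le> e"
    if f: "continuous_on UNIV f" "\<And>x. x \<notin> S \<Longrightarrow> f x = 0" "\<And>x y. dist x y < r \<Longrightarrow> \<bar>f x - f y\<bar> < e" for f x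
  proof -
    have "f x - conv ?K f \<eta> x = (LINT y|lborel. f x * \<eta> (x - y)) - (LINT y|lborel. f y * \<eta> (x - y))"
      using I\<eta>[of x] conv_eq[OF f(1) c\<eta> f(2), of x] by simp
    also have "\<dots> = (LINT y|lborel. f x * \<eta> (x - y) - f y * \<eta> (x - y))"
      using i\<eta>[of x] conv_int[OF f(1) c\<eta> f(2), of x] by simp
    also have "\<bar>\<dots>\<bar> \<le> (LINT y|lborel. e * \<eta> (x - y))"
    proof (rule order_trans[OF integral_abs_bound], rule integral_mono)
      show "integrable lborel (\<lambda>y. \<bar>f x * \<eta> (x - y) - f y * \<eta> (x - y)\<bar>)"
        using i\<eta>[of x] conv_int[OF f(1) c\<eta> f(2), of x] by (intro integrable_abs) simp
      show "integrable lborel (\<lambda>y. e * \<eta> (x - y))" using i\<eta>[of x] by simp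
      fix y
      show "\<bar>f x * \<eta> (x - y) - f y * \<eta> (x - y)\<bar> \<le> e * \<eta> (x - y)"
      proof (cases "norm (x - y) \<ge> r")
        case True
        then show ?thesis by (simp add: \<eta>(3))
      next
        case False
        then have "\<bar>f x - f y\<bar> * \<eta> (x - y) \<le> e * \<eta> (x - y)"
          using f(3)[of x y] \<eta>(2)[of "x - y"] by (intro mult_right_mono) (auto simp: dist_norm)
        then show ?thesis using \<eta>(2)[of "x - y"] by (simp add: left_diff_distrib[symmetric] abs_mult)
      qed
    qed
    also have "\<dots> = e" using I\<eta>[of x] by simp
    finally show ?thesis .
  qed
  define w where "w = conv ?K v \<eta>"
  have w_smooth: "times_cont_diff n w" for n
    unfolding w_def by (rule conv_smooth[OF cv \<eta>(1)])
  \<comment> \<open>\<open>conv_partial\<close> puts the derivative on the mollifier and integration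
    by parts moves it to v. The sign from reflecting the argument and the sign from integrating by
    parts cancel.\<close>
  have wp: "partial_deriv b w = conv ?K (partial_deriv b v) \<eta>" if b: "b \<in> Basis" for b
  proof
    fix x
    let ?g = "\<lambda>y. \<eta> (x - y)"
    have c\<eta>p: "continuous_on UNIV (partial_deriv b \<eta>)" using \<eta>(1)[of 1] b by simp
    have D\<eta>: "(?g has_derivative (\<lambda>h. h \<bullet> - grad \<eta> (x - y))) (at y)" for y
    proof -
      have 1: "((\<lambda>y. x - y) has_derivative (\<lambda>h. - h)) (at y)"
        by (auto intro!: derivative_eq_intros)
      have "(\<eta> has_derivative (\<lambda>h. h \<bullet> grad \<eta> (x - y))) (at (x - y))"
        using \<eta>(1)[of 1] by (intro has_derivative_grad) simp
      from has_derivative_compose[OF 1 this] show ?thesis by simp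
    qed
    have cg: "continuous_on UNIV (grad \<eta>)" by (rule continuous_grad[OF \<eta>(1)])
    have tg: "times_cont_diff 1 ?g"
      by (rule tcd_1I[OF D\<eta>]) (intro continuous_intros continuous_on_compose2[OF cg], auto)
    have pg: "partial_deriv b ?g y = - partial_deriv b \<eta> (x - y)" for y
      using partial_deriv_eq[OF D\<eta>, of b y] grad_inner[OF b, of \<eta> "x - y"] by (simp add: inner_commute)
    have v1: "v \<in> C1c UNIV" using v C1c_mono[of D UNIV] by auto
    have "partial_deriv b w x = conv ?K v (partial_deriv b \<eta>) x"
      unfolding w_def by (simp add: conv_partial[OF cv \<eta>(1) b])
    also have "\<dots> = - (LINT y|lborel. v y * partial_deriv b ?g y)"
      by (subst conv_eq[OF cv c\<eta>p sv]) (auto simp: pg)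
    also have "\<dots> = (LINT y|lborel. partial_deriv b v y * ?g y)"
      by (subst integral_by_parts_C1c[OF v1 tg b]) simp
    also have "\<dots> = conv ?K (partial_deriv b v) \<eta> x"
      by (rule conv_eq[OF cp[OF b] c\<eta> sp, symmetric])
    finally show "partial_deriv b w x = conv ?K (partial_deriv b v) \<eta> x" .
  qed
  define T where "T = {y + z |y z. y \<in> S \<and> z \<in> cball 0 e0}"
  have T: "compact T" unfolding T_def by (rule compact_sums[OF S(1) compact_cball])
  have TD: "T \<subseteq> D" unfolding T_def using e0(2) by (force simp: dist_norm)
  have "{x. w x \<noteq> 0} \<subseteq> T"
  proof (rule subsetI, rule ccontr)
    fix x assume x: "x \<in> {x. w x \<noteq> 0}" "x \<notin> T"
    have 0: "v y * \<eta> (x - y) = 0" for y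
    proof (cases "y \<in> S")
      case True
      then have "x - y \<notin> cball 0 e0" using x(2) by (force simp: T_def)
      then show ?thesis using r(2) by (simp add: \<eta>(3))
    qed (simp add: sv)
    have "w x = (LINT y|lborel. v y * \<eta> (x - y))" unfolding w_def by (rule conv_eq[OF cv c\<eta> sv])
    then have "w x = 0" unfolding 0 by simp
    then show False using x(1) by simp
  qed
  then have *: "closure {x. w x \<noteq> 0} \<subseteq> T" using T by (intro closure_minimal compact_imp_closed)
  then have "compact (closure {x. w x \<noteq> 0})"
    using compact_Int_closed[OF T closed_closure, of "{x. w x \<noteq> 0}"] by (simp add: Int_absorb1)
  then have "w \<in> test_functions D" using * TD w_smooth by (auto simp: test_functions_def)
  moreover have "\<bar>v x - w x\<bar> \<le> e" for x
    unfolding w_def using d0(2) r(3) by (intro approx[OF cv sv]) auto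
  moreover have "\<bar>partial_deriv b v x - partial_deriv b w x\<bar> \<le> e" if b: "b \<in> Basis" for b x
    unfolding wp[OF b] using d(2)[OF b] r(4)[OF b] by (intro approx[OF cp[OF b] sp]) auto
  ultimately show ?thesis by blast
qed

section \<open>The Riesz representation theorem\<close>

text \<open>The minimiser of the energy B v v / 2 - F v represents F; minimising sequences are Cauchy by
  the parallelogram identity.\<close>

lemma riesz_representation:
  fixes S :: "('a \<Rightarrow> real) set" and B :: "('a \<Rightarrow> real) \<Rightarrow> ('a \<Rightarrow> real) \<Rightarrow> real" and N F :: "('a \<Rightarrow> real) \<Rightarrow> real"
  assumes S0: "S \<noteq> {}"
    and S: "\<And>v w c e. v \<in> S \<Longrightarrow> w \<in> S \<Longrightarrow> (\<lambda>x. c * v x + e * w x) \<in> S"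
    and Bl: "\<And>v w z c e. v \<in> S \<Longrightarrow> w \<in> S \<Longrightarrow> z \<in> S \<Longrightarrow> B (\<lambda>x. c * v x + e * w x) z = c * B v z + e * B w z"
    and Bs: "\<And>v w. v \<in> S \<Longrightarrow> w \<in> S \<Longrightarrow> B v w = B w v"
    and Bc: "\<alpha> > 0" "\<And>v. v \<in> S \<Longrightarrow> \<alpha> * (N v)\<^sup>2 \<le> B v v"
    and Bb: "\<And>v. v \<in> S \<Longrightarrow> B v v \<le> \<beta> * (N v)\<^sup>2"
    and N: "\<And>v. N v \<ge> 0"
    and Fl: "\<And>v w c e. v \<in> S \<Longrightarrow> w \<in> S \<Longrightarrow> F (\<lambda>x. c * v x + e * w x) = c * F v + e * F w"
    and Fb: "\<And>v. v \<in> S \<Longrightarrow> \<bar>F v\<bar> \<le> C * N v"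
    and complete: "\<And>f :: nat \<Rightarrow> _. (\<And>n. f n \<in> S) \<Longrightarrow>
      (\<And>e. e > 0 \<Longrightarrow> \<exists>k. \<forall>m\<ge>k. \<forall>n\<ge>k. N (\<lambda>x. f m x - f n x) < e) \<Longrightarrow>
      \<exists>u\<in>S. (\<lambda>n. N (\<lambda>x. f n x - u x)) \<longlonglongrightarrow> 0"
  shows "\<exists>u\<in>S. \<forall>v\<in>S. B u v = F v"
proof -
  have Sd: "(\<lambda>x. v x - w x) \<in> S" if "v \<in> S" "w \<in> S" for v w
    using S[OF that, of 1 "-1"] by simp
  have Bd: "B (\<lambda>x. v x - w x) z = B v z - B w z" if "v \<in> S" "w \<in> S" "z \<in> S" for v w z
    using Bl[OF that, of 1 "-1"] by simp
  have Bq: "B (\<lambda>x. c * v x + e * w x) (\<lambda>x. c * v x + e * w x) = c\<^sup>2 * B v v + 2 * c * e * B v w + e\<^sup>2 * B w w"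
    if "v \<in> S" "w \<in> S" for v w c e
  proof -
    let ?z = "\<lambda>x. c * v x + e * w x"
    have z: "?z \<in> S" by (rule S[OF that])
    have "B ?z ?z = c * B v ?z + e * B w ?z" by (rule Bl[OF that z])
    also have "B v ?z = c * B v v + e * B w v" using Bs[OF that(1) z] Bl[OF that that(1)] by simp
    also have "B w ?z = c * B v w + e * B w w" using Bs[OF that(2) z] Bl[OF that that(2)] by simp
    also have "B w v = B v w" by (rule Bs[OF that(2,1)])
    finally show ?thesis by (simp add: algebra_simps power2_eq_square)
  qed
  have Bp: "B v v \<ge> 0" if "v \<in> S" for v
    using Bc(2)[OF that] Bc(1) by (meson mult_nonneg_nonneg less_imp_le order_trans zero_le_power2)
  have CS: "(B v w)\<^sup>2 \<le> B v v * B w w" if "v \<in> S" "w \<in> S" for v w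
  proof (rule quadratic_nonneg_discriminant)
    fix t
    show "0 \<le> B v v * t\<^sup>2 + 2 * B v w * t + B w w"
      using Bp[OF S[OF that, of t 1]] Bq[OF that, of t 1] by (simp add: algebra_simps)
  qed (rule Bp[OF that(1)])
  define J where "J v = B v v / 2 - F v" for v
  \<comment> \<open>Completing the square in \<open>N v\<close>.\<close>
  have J_lower: "J v \<ge> - C\<^sup>2 / (2 * \<alpha>)" if "v \<in> S" for v
  proof -
    have "0 \<le> (\<alpha> * N v - C)\<^sup>2 / (2 * \<alpha>)" using Bc(1) by simp
    also have "\<dots> = \<alpha> * (N v)\<^sup>2 / 2 - C * N v + C\<^sup>2 / (2 * \<alpha>)"
      using Bc(1) by (simp add: power2_diff power2_eq_square field_simps)
    finally show ?thesis
      unfolding J_def using Bc(2)[OF that] Fb[OF that] by simp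
  qed
  define I where "I = Inf (J ` S)"
  have bdd: "bdd_below (J ` S)" using J_lower by (intro bdd_belowI2)
  have I: "I \<le> J v" if "v \<in> S" for v unfolding I_def by (rule cINF_lower[OF bdd that])
  have "\<exists>v\<in>S. J v < I + inverse (real (Suc n))" for n
    using cInf_lessD[of "J ` S" "I + inverse (real (Suc n))"] S0 unfolding I_def by auto
  then obtain f where f: "\<And>n. f n \<in> S" "\<And>n. J (f n) < I + inverse (real (Suc n))"
    by metis
  have gap: "\<alpha> * (N (\<lambda>x. f m x - f n x))\<^sup>2 \<le> 4 * inverse (real (Suc m)) + 4 * inverse (real (Suc n))" for m n
  proof -
    note fm = f(1)[of m] and fn = f(1)[of n]
    have "J (\<lambda>x. (1/2) * f m x + (1/2) * f n x) = (B (f m) (f m) / 4 + B (f m) (f n) / 2 + B (f n) (f n) / 4) / 2 - (F (f m) + F (f n)) / 2"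
      unfolding J_def Bq[OF fm fn] Fl[OF fm fn] by (simp add: power2_eq_square field_simps)
    moreover have "B (\<lambda>x. 1 * f m x + (-1) * f n x) (\<lambda>x. 1 * f m x + (-1) * f n x) = B (f m) (f m) - 2 * B (f m) (f n) + B (f n) (f n)"
      unfolding Bq[OF fm fn] by simp
    ultimately have "B (\<lambda>x. f m x - f n x) (\<lambda>x. f m x - f n x) =
        4 * (J (f m) + J (f n) - 2 * J (\<lambda>x. (1/2) * f m x + (1/2) * f n x))"
      unfolding J_def by (simp add: field_simps)
    also have "\<dots> \<le> 4 * inverse (real (Suc m)) + 4 * inverse (real (Suc n))"
    proof -
      have "4 * (p + q - 2 * t) \<le> 4 * x + 4 * y" if "p < I + x" "q < I + y" "I \<le> t" for p q t x y
        using that by (simp add: algebra_simps)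
      from this[OF f(2)[of m] f(2)[of n] I[OF S[OF fm fn, of "1/2" "1/2"]]] show ?thesis .
    qed
    finally show ?thesis using Bc(2)[OF Sd[OF fm fn]] by simp
  qed
  have "\<exists>k. \<forall>m\<ge>k. \<forall>n\<ge>k. N (\<lambda>x. f m x - f n x) < e" if e: "e > 0" for e
  proof -
    have "\<alpha> * e\<^sup>2 / 8 > 0" using e Bc(1) by simp
    then obtain k where k: "inverse (real (Suc k)) < \<alpha> * e\<^sup>2 / 8" using reals_Archimedean by blast
    have "N (\<lambda>x. f m x - f n x) < e" if "m \<ge> k" "n \<ge> k" for m n
    proof -
      have "inverse (real (Suc m)) \<le> inverse (real (Suc k))" "inverse (real (Suc n)) \<le> inverse (real (Suc k))"
        using that by (auto intro: le_imp_inverse_le)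
      moreover have "4 * p + 4 * q < t" if "p \<le> c" "q \<le> c" "c < t / 8" for p q c t :: real
        using that by simp
      ultimately have "\<alpha> * (N (\<lambda>x. f m x - f n x))\<^sup>2 < \<alpha> * e\<^sup>2"
        using k by (intro le_less_trans[OF gap[of m n]]) blast
      then have "(N (\<lambda>x. f m x - f n x))\<^sup>2 < e\<^sup>2" using Bc(1) by simp
      then show ?thesis using e by (simp add: power2_less_imp_less)
    qed
    then show ?thesis by blast
  qed
  from complete[OF f(1) this] obtain u where u: "u \<in> S" "(\<lambda>n. N (\<lambda>x. f n x - u x)) \<longlonglongrightarrow> 0" by blast
  have "B u v = F v" if v: "v \<in> S" for v
  proof -
    have lim: "(\<lambda>n. B (f n) v) \<longlonglongrightarrow> B u v"
    proof -
      have "(\<lambda>n. (B (\<lambda>x. f n x - u x) v)\<^sup>2) \<longlonglongrightarrow> 0"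
      proof (rule tendsto_sandwich[OF _ _ tendsto_const])
        show "\<forall>\<^sub>F n in sequentially. (B (\<lambda>x. f n x - u x) v)\<^sup>2 \<le> \<beta> * (N (\<lambda>x. f n x - u x))\<^sup>2 * B v v"
          using CS[OF Sd[OF f(1) u(1)] v] mult_right_mono[OF Bb[OF Sd[OF f(1) u(1)]] Bp[OF v]]
          by (intro always_eventually allI) (meson order_trans)
        have "(\<lambda>n. \<beta> * (N (\<lambda>x. f n x - u x))\<^sup>2 * B v v) \<longlonglongrightarrow> \<beta> * 0\<^sup>2 * B v v"
          by (intro tendsto_intros u)
        then show "(\<lambda>n. \<beta> * (N (\<lambda>x. f n x - u x))\<^sup>2 * B v v) \<longlonglongrightarrow> 0" by simp
      qed simp
      then have "(\<lambda>n. \<bar>B (\<lambda>x. f n x - u x) v\<bar>) \<longlonglongrightarrow> 0"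
        using tendsto_real_sqrt by fastforce
      then have "(\<lambda>n. B (f n) v - B u v) \<longlonglongrightarrow> 0"
        unfolding tendsto_rabs_zero_iff Bd[OF f(1) u(1) v] .
      then show ?thesis by (simp add: LIM_zero_cancel)
    qed
    \<comment> \<open>Moving from the minimiser u in direction v cannot lower the energy, so t * (B
      u v - F v) + t^2 / 2 * B v v is nonnegative for all t. Its constant term is 0, hence the
      discriminant forces the linear coefficient to vanish.\<close>
    have "((B u v - F v) / 2)\<^sup>2 \<le> B v v / 2 * 0"
    proof (rule quadratic_nonneg_discriminant)
      fix t
      have "t * (B (f n) v - F v) + t\<^sup>2 / 2 * B v v \<ge> - inverse (real (Suc n))" for n
      proof -
        have "J (\<lambda>x. 1 * f n x + t * v x) \<ge> I" by (intro I S f v)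
        moreover have "J (\<lambda>x. 1 * f n x + t * v x) = J (f n) + (t * (B (f n) v - F v) + t\<^sup>2 / 2 * B v v)"
          unfolding J_def Bq[OF f(1) v] Fl[OF f(1) v] by (simp add: field_simps)
        ultimately show ?thesis using f(2)[of n] by simp
      qed
      moreover have "(\<lambda>n. t * (B (f n) v - F v) + t\<^sup>2 / 2 * B v v) \<longlonglongrightarrow> t * (B u v - F v) + t\<^sup>2 / 2 * B v v"
        by (intro tendsto_intros lim)
      moreover have "(\<lambda>n. - inverse (real (Suc n))) \<longlonglongrightarrow> - 0"
        by (intro tendsto_intros LIMSEQ_inverse_real_of_nat)
      ultimately have "t * (B u v - F v) + t\<^sup>2 / 2 * B v v \<ge> - 0"
        by (intro LIMSEQ_le[of "\<lambda>n. - inverse (real (Suc n))"]) auto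
      then show "0 \<le> B v v / 2 * t\<^sup>2 + 2 * ((B u v - F v) / 2) * t + 0" by (simp add: field_simps)
    qed (use Bp[OF v] in simp)
    then show ?thesis by simp
  qed
  then show ?thesis using u(1) by blast
qed

section \<open>Sobolev spaces on bounded domains\<close>

text \<open>The coordinate bound 1 makes the measure of D finite and produces the Poincare constant
  2.\<close>

locale unit_domain =
  fixes D :: "'a::euclidean_space set"
  assumes open_D: "open D" and D_bound: "\<And>x b. x \<in> D \<Longrightarrow> b \<in> Basis \<Longrightarrow> \<bar>x \<bullet> b\<bar> \<le> 1"
begin

abbreviation "L \<equiv> lebesgue_on D"
abbreviation "wgrad \<equiv> weak_gradient D"

lemma D_lebesgue: "D \<in> sets lebesgue" using open_D by auto

lemma space_L [simp]: "space L = D" by (simp add: space_restrict_space)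

lemma finite_L: "emeasure L D < \<infinity>"
proof -
  have "D \<subseteq> cbox (- One) One"
    using D_bound by (auto simp: mem_box abs_le_iff)
  then have "emeasure lebesgue D \<le> emeasure lebesgue (cbox (- One) (One :: 'a))"
    by (intro emeasure_mono) auto
  also have "\<dots> < \<infinity>" by (simp add: emeasure_lborel_cbox_eq)
  finally show ?thesis using D_lebesgue by (simp add: emeasure_restrict_space)
qed

lemma integrable_const_L: "integrable L (\<lambda>x. c :: 'b::euclidean_space)"
  using finite_L by (intro finite_measure.integrable_const finite_measureI) auto

lemma continuous_measurable_L:
  fixes f :: "'a \<Rightarrow> 'b::euclidean_space"
  shows "continuous_on UNIV f \<Longrightarrow> f \<in> borel_measurable L"
  using D_lebesgue by (intro continuous_imp_measurable_on_sets_lebesgue) (auto intro: continuous_on_subset)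

lemma const_L2: "(\<lambda>x. c) \<in> L2_space L"
  using integrable_const_L by (auto simp: L2_space_def)

lemma bounded_L2:
  fixes f :: "'a \<Rightarrow> 'b::euclidean_space"
  assumes "f \<in> borel_measurable L" "\<And>x. x \<in> D \<Longrightarrow> norm (f x) \<le> C"
  shows "f \<in> L2_space L"
proof (rule L2_dominated[where g="\<lambda>x. 1 :: real" and C=C])
  show "AE x in L. norm (f x) \<le> C * norm (1::real)"
    using assms(2) by (intro AE_I2) simp
qed (use assms(1) const_L2 in auto)

lemma L2_integrable: "f \<in> L2_space L \<Longrightarrow> integrable L f" for f :: "'a \<Rightarrow> real"
  using L2_mult_integrable[OF _ const_L2, of f 1] by simp

lemma L2_mult_bounded:
  fixes f :: "'a \<Rightarrow> 'b::euclidean_space"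
  assumes "f \<in> L2_space L" "m \<in> borel_measurable L" "\<And>x. x \<in> D \<Longrightarrow> \<bar>m x\<bar> \<le> C" "C \<ge> 0"
  shows "(\<lambda>x. m x *\<^sub>R f x) \<in> L2_space L" "L2_norm L (\<lambda>x. m x *\<^sub>R f x) \<le> C * L2_norm L f"
proof -
  have 1: "AE x in L. norm (m x *\<^sub>R f x) \<le> C * norm (f x)"
    using assms(3) by (intro AE_I2) (auto intro: mult_right_mono)
  have 2: "(\<lambda>x. m x *\<^sub>R f x) \<in> borel_measurable L"
    using assms(1,2) by (intro borel_measurable_scaleR) (auto simp: L2_space_def)
  show "(\<lambda>x. m x *\<^sub>R f x) \<in> L2_space L" by (rule L2_dominated[OF 2 assms(1) 1])
  show "L2_norm L (\<lambda>x. m x *\<^sub>R f x) \<le> C * L2_norm L f" by (rule L2_norm_le[OF 2 assms(1) 1 assms(4)])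
qed

lemma C1c_L2:
  assumes "v \<in> C1c D"
  shows "v \<in> L2_space L" "b \<in> Basis \<Longrightarrow> partial_deriv b v \<in> L2_space L" "grad v \<in> L2_space L"
proof -
  define S where "S = closure {x. v x \<noteq> 0}"
  have S: "compact S" and t: "times_cont_diff 1 v" using assms by (auto simp: C1c_def S_def)
  have sv: "v x = 0" if "x \<notin> S" for x
    using that closure_subset[of "{x. v x \<noteq> 0}"] unfolding S_def by auto
  have sp: "partial_deriv b v x = 0" if "x \<notin> S" for x b
    using that partial_deriv_supp[of b v] unfolding S_def by auto
  have cv: "continuous_on UNIV v" by (rule tcd_continuous[OF t])
  have cg: "continuous_on UNIV (grad v)" by (rule continuous_grad[OF t])
  show "v \<in> L2_space L"
    using compact_support_bounded[OF cv S sv] bounded_L2[OF continuous_measurable_L[OF cv]] by blast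
  show "grad v \<in> L2_space L"
    using compact_support_bounded[OF cg S] bounded_L2[OF continuous_measurable_L[OF cg]] sp
    by (auto simp: grad_def)
  show "partial_deriv b v \<in> L2_space L" if "b \<in> Basis"
  proof -
    have cp: "continuous_on UNIV (partial_deriv b v)" using t that by simp
    show ?thesis
      using compact_support_bounded[OF cp S sp] bounded_L2[OF continuous_measurable_L[OF cp]] by blast
  qed
qed

lemma test_C1c: "\<theta> \<in> test_functions D \<Longrightarrow> \<theta> \<in> C1c D"
  using test_functions_C1c by blast

lemma test_zero: "(\<lambda>x. 0) \<in> test_functions D"
  by (simp add: test_functions_def tcd_const)

lemma test_bounded_measurable:
  assumes "\<theta> \<in> test_functions D"
  shows "\<theta> \<in> borel_measurable L"
  using C1c_L2(1)[OF test_C1c[OF assms]] by (rule L2_measurable)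

text \<open>Extension by zero turns the integrals over D into integrals over the whole space, where
  integration by parts for compactly supported C1 functions applies.\<close>

lemma C1c_weak_gradient:
  assumes "v \<in> C1c D"
  shows "is_weak_gradient D v (grad v)"
  unfolding is_weak_gradient_def
proof (intro conjI ballI)
  fix \<theta> and b :: 'a assume \<theta>: "\<theta> \<in> test_functions D" and b: "b \<in> Basis"
  have v1: "v \<in> C1c UNIV" using assms C1c_mono[of D UNIV] by auto
  define S where "S = closure {x. v x \<noteq> 0}"
  have S: "S \<subseteq> D" and t: "times_cont_diff 1 v" using assms by (auto simp: C1c_def S_def)
  have sv: "v x = 0" if "x \<notin> D" for x
    using that closure_subset[of "{x. v x \<noteq> 0}"] S unfolding S_def by auto
  have sp: "partial_deriv b v x = 0" if "x \<notin> D" for x b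
    using that partial_deriv_supp[of b v] S unfolding S_def by auto
  have t\<theta>: "times_cont_diff 1 \<theta>" using C1cD[OF test_C1c[OF \<theta>]] .
  have c: "continuous_on UNIV v" "continuous_on UNIV \<theta>"
    "continuous_on UNIV (partial_deriv b v)" "continuous_on UNIV (partial_deriv b \<theta>)"
    using tcd_continuous[OF t] tcd_continuous[OF t\<theta>] t t\<theta> b by simp_all
  have "(LINT x|L. v x * partial_deriv b \<theta> x) = (LINT x|lborel. v x * partial_deriv b \<theta> x)"
    using sv c by (intro lebesgue_on_lborel D_lebesgue) (auto intro!: borel_measurable_continuous_onI continuous_intros)
  also have "\<dots> = - (LINT x|lborel. partial_deriv b v x * \<theta> x)"
    by (rule integral_by_parts_C1c[OF v1 t\<theta> b])
  also have "(LINT x|lborel. partial_deriv b v x * \<theta> x) = (LINT x|L. partial_deriv b v x * \<theta> x)"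
    using sp c by (intro lebesgue_on_lborel[symmetric] D_lebesgue) (auto intro!: borel_measurable_continuous_onI continuous_intros)
  finally show "(LINT x|L. v x * partial_deriv b \<theta> x) = - (LINT x|L. (grad v x \<bullet> b) * \<theta> x)"
    by (simp add: grad_inner[OF b])
qed (rule C1c_L2[OF assms])

lemma orthogonal_test_AE_zero:
  assumes "g \<in> L2_space L" "\<And>\<theta>. \<theta> \<in> test_functions D \<Longrightarrow> (LINT x|L. g x * \<theta> x) = 0"
  shows "AE x in L. g x = (0::real)"
  by (rule fundamental_lemma[OF open_D L2_integrable]) (use assms in auto)

lemma L2_inner_Basis: "g \<in> L2_space L \<Longrightarrow> (\<lambda>x. g x \<bullet> b) \<in> L2_space L" if "b \<in> Basis"
  for g :: "'a \<Rightarrow> 'a"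
  by (rule L2_dominated[where g=g and C=1]) (use that in \<open>auto simp: L2_space_def Basis_le_norm\<close>)

lemma weak_gradient_unique:
  assumes g: "is_weak_gradient D v g" and h: "is_weak_gradient D v h"
  shows "AE x in L. g x = h x"
proof -
  have L2: "g \<in> L2_space L" "h \<in> L2_space L" using g h by (auto simp: is_weak_gradient_def)
  have "AE x in L. (g x - h x) \<bullet> b = 0" if b: "b \<in> Basis" for b
  proof (rule orthogonal_test_AE_zero[OF L2_inner_Basis[OF b L2_diff[OF L2]]])
    fix \<theta> assume \<theta>: "\<theta> \<in> test_functions D"
    have "(LINT x|L. ((g x - h x) \<bullet> b) * \<theta> x) = (LINT x|L. (g x \<bullet> b) * \<theta> x) - (LINT x|L. (h x \<bullet> b) * \<theta> x)"
      unfolding inner_diff_left left_diff_distrib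
      by (intro Bochner_Integration.integral_diff L2_mult_integrable L2_inner_Basis[OF b] L2 C1c_L2 test_C1c \<theta>)
    also have "\<dots> = 0" using g h \<theta> b by (auto simp: is_weak_gradient_def)
    finally show "(LINT x|L. ((g x - h x) \<bullet> b) * \<theta> x) = 0" .
  qed
  then have "AE x in L. \<forall>b\<in>Basis. (g x - h x) \<bullet> b = 0" by (intro AE_finite_allI) auto
  then show ?thesis by eventually_elim (simp add: euclidean_eq_iff[where 'a='a] inner_diff_left)
qed

lemma weak_gradient_lincomb:
  assumes "v \<in> L2_space L" "w \<in> L2_space L" and g: "is_weak_gradient D v g" and h: "is_weak_gradient D w h"
  shows "is_weak_gradient D (\<lambda>x. c * v x + e * w x) (\<lambda>x. c *\<^sub>R g x + e *\<^sub>R h x)"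
  unfolding is_weak_gradient_def
proof (intro conjI ballI)
  have L2: "g \<in> L2_space L" "h \<in> L2_space L" using g h by (auto simp: is_weak_gradient_def)
  then show "(\<lambda>x. c *\<^sub>R g x + e *\<^sub>R h x) \<in> L2_space L" by (rule L2_lincomb)
  fix \<theta> and b :: 'a assume \<theta>: "\<theta> \<in> test_functions D" and b: "b \<in> Basis"
  have "(LINT x|L. (c * v x + e * w x) * partial_deriv b \<theta> x) =
      c * (LINT x|L. v x * partial_deriv b \<theta> x) + e * (LINT x|L. w x * partial_deriv b \<theta> x)"
    using L2_mult_integrable[OF assms(1) C1c_L2(2)[OF test_C1c[OF \<theta>] b]]
      L2_mult_integrable[OF assms(2) C1c_L2(2)[OF test_C1c[OF \<theta>] b]]
    by (simp add: distrib_right mult.assoc)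
  also have "\<dots> = - (c * (LINT x|L. (g x \<bullet> b) * \<theta> x) + e * (LINT x|L. (h x \<bullet> b) * \<theta> x))"
    using g h \<theta> b by (auto simp: is_weak_gradient_def)
  also have "\<dots> = - (LINT x|L. ((c *\<^sub>R g x + e *\<^sub>R h x) \<bullet> b) * \<theta> x)"
    using L2_mult_integrable[OF L2_inner_Basis[OF b L2(1)] C1c_L2(1)[OF test_C1c[OF \<theta>]]]
      L2_mult_integrable[OF L2_inner_Basis[OF b L2(2)] C1c_L2(1)[OF test_C1c[OF \<theta>]]]
    by (simp add: inner_add_left distrib_right mult.assoc)
  finally show "(LINT x|L. (c * v x + e * w x) * partial_deriv b \<theta> x) =
      - (LINT x|L. ((c *\<^sub>R g x + e *\<^sub>R h x) \<bullet> b) * \<theta> x)" .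
qed

lemma weak_gradient_AE:
  assumes "is_weak_gradient D v g"
  shows "is_weak_gradient D v (wgrad v)" "AE x in L. wgrad v x = g x"
proof -
  show 1: "is_weak_gradient D v (wgrad v)"
    unfolding weak_gradient_def by (rule someI[of "is_weak_gradient D v", OF assms])
  show "AE x in L. wgrad v x = g x" by (rule weak_gradient_unique[OF 1 assms])
qed

lemma weak_gradient_L2: "is_weak_gradient D v g \<Longrightarrow> g \<in> L2_space L"
  by (simp add: is_weak_gradient_def)

lemma H1_norm_eq:
  assumes "is_weak_gradient D v g"
  shows "H1_norm D v = sqrt ((L2_norm L v)\<^sup>2 + (L2_norm L g)\<^sup>2)"
proof -
  have "L2_norm L (wgrad v) = L2_norm L g"
    by (rule L2_norm_cong_AE) (use weak_gradient_AE[OF assms] weak_gradient_L2[OF assms] in \<open>auto simp: is_weak_gradient_def L2_space_def\<close>)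
  then show ?thesis by (simp add: H1_norm_def)
qed

lemma V_norm_eq:
  assumes "is_weak_gradient D v g"
  shows "V_norm D v = L2_norm L g"
  unfolding V_norm_def
  by (rule L2_norm_cong_AE) (use weak_gradient_AE[OF assms] weak_gradient_L2[OF assms] in \<open>auto simp: is_weak_gradient_def L2_space_def\<close>)

lemma V_spaceI:
  assumes v: "v \<in> L2_space L" and g: "is_weak_gradient D v g"
    and ap: "\<And>e. e > 0 \<Longrightarrow> \<exists>\<theta>\<in>test_functions D. L2_norm L (\<lambda>x. v x - \<theta> x) < e \<and> L2_norm L (\<lambda>x. g x - grad \<theta> x) < e"
  shows "v \<in> V_space D"
  unfolding V_space_def H1_space_def
proof (intro CollectI conjI allI impI v exI[of _ g] g)
  fix e :: real assume e: "e > 0"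
  obtain \<theta> where \<theta>: "\<theta> \<in> test_functions D" "L2_norm L (\<lambda>x. v x - \<theta> x) < e/2" "L2_norm L (\<lambda>x. g x - grad \<theta> x) < e/2"
    using ap[of "e/2"] e by auto
  have "is_weak_gradient D (\<lambda>x. v x - \<theta> x) (\<lambda>x. g x - grad \<theta> x)"
    using weak_gradient_lincomb[OF v C1c_L2(1)[OF test_C1c[OF \<theta>(1)]] g C1c_weak_gradient[OF test_C1c[OF \<theta>(1)]], of 1 "-1"] by simp
  from H1_norm_eq[OF this] have "H1_norm D (\<lambda>x. v x - \<theta> x) \<le> L2_norm L (\<lambda>x. v x - \<theta> x) + L2_norm L (\<lambda>x. g x - grad \<theta> x)"
    using sqrt_sum_squares_le_sum[of "L2_norm L (\<lambda>x. v x - \<theta> x)" "L2_norm L (\<lambda>x. g x - grad \<theta> x)"] by simp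
  also have "\<dots> < e" using \<theta> by simp
  finally show "\<exists>\<theta>\<in>test_functions D. H1_norm D (\<lambda>x. v x - \<theta> x) < e" using \<theta>(1) by blast
qed

lemma V_weak_gradient: "v \<in> V_space D \<Longrightarrow> is_weak_gradient D v (wgrad v)"
  using weak_gradient_AE(1) by (auto simp: V_space_def H1_space_def)

lemma V_L2: "v \<in> V_space D \<Longrightarrow> v \<in> L2_space L"
  by (simp add: V_space_def H1_space_def)

lemma V_grad_L2: "v \<in> V_space D \<Longrightarrow> wgrad v \<in> L2_space L"
  using V_weak_gradient by (auto simp: is_weak_gradient_def)

lemma V_approx:
  assumes v: "v \<in> V_space D" and e: "e > 0"
  shows "\<exists>\<theta>\<in>test_functions D. L2_norm L (\<lambda>x. v x - \<theta> x) < e \<and> L2_norm L (\<lambda>x. wgrad v x - grad \<theta> x) < e"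
proof -
  obtain \<theta> where \<theta>: "\<theta> \<in> test_functions D" "H1_norm D (\<lambda>x. v x - \<theta> x) < e"
    using v e by (auto simp: V_space_def)
  have "is_weak_gradient D (\<lambda>x. v x - \<theta> x) (\<lambda>x. wgrad v x - grad \<theta> x)"
    using weak_gradient_lincomb[OF V_L2[OF v] C1c_L2(1)[OF test_C1c[OF \<theta>(1)]] V_weak_gradient[OF v] C1c_weak_gradient[OF test_C1c[OF \<theta>(1)]], of 1 "-1"] by simp
  from H1_norm_eq[OF this] \<theta>(2) have
    *: "sqrt ((L2_norm L (\<lambda>x. v x - \<theta> x))\<^sup>2 + (L2_norm L (\<lambda>x. wgrad v x - grad \<theta> x))\<^sup>2) < e" by simp
  have "L2_norm L (\<lambda>x. v x - \<theta> x) < e" "L2_norm L (\<lambda>x. wgrad v x - grad \<theta> x) < e"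
    using real_sqrt_sum_squares_ge1[of "L2_norm L (\<lambda>x. v x - \<theta> x)" "L2_norm L (\<lambda>x. wgrad v x - grad \<theta> x)"]
      real_sqrt_sum_squares_ge2[of "L2_norm L (\<lambda>x. wgrad v x - grad \<theta> x)" "L2_norm L (\<lambda>x. v x - \<theta> x)"] *
    by linarith+
  then show ?thesis using \<theta>(1) by blast
qed

lemma V_lincomb:
  assumes v: "v \<in> V_space D" and w: "w \<in> V_space D"
  shows "(\<lambda>x. c * v x + e * w x) \<in> V_space D"
    "AE x in L. wgrad (\<lambda>x. c * v x + e * w x) x = c *\<^sub>R wgrad v x + e *\<^sub>R wgrad w x"
    "V_norm D (\<lambda>x. c * v x + e * w x) = L2_norm L (\<lambda>x. c *\<^sub>R wgrad v x + e *\<^sub>R wgrad w x)"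
proof -
  have g: "is_weak_gradient D (\<lambda>x. c * v x + e * w x) (\<lambda>x. c *\<^sub>R wgrad v x + e *\<^sub>R wgrad w x)"
    by (intro weak_gradient_lincomb V_L2 V_weak_gradient v w)
  then show "AE x in L. wgrad (\<lambda>x. c * v x + e * w x) x = c *\<^sub>R wgrad v x + e *\<^sub>R wgrad w x"
    "V_norm D (\<lambda>x. c * v x + e * w x) = L2_norm L (\<lambda>x. c *\<^sub>R wgrad v x + e *\<^sub>R wgrad w x)"
    by (auto intro: weak_gradient_AE V_norm_eq)
  show "(\<lambda>x. c * v x + e * w x) \<in> V_space D"
  proof (rule V_spaceI[OF _ g])
    show "(\<lambda>x. c * v x + e * w x) \<in> L2_space L" using L2_lincomb[OF V_L2[OF v] V_L2[OF w]] by simp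
    fix d :: real assume d: "d > 0"
    define k where "k = d / (\<bar>c\<bar> + \<bar>e\<bar> + 1)"
    have k: "k > 0" using d by (auto simp: k_def intro!: divide_pos_pos)
    have kd: "\<bar>c\<bar> * k + \<bar>e\<bar> * k < d"
    proof -
      have "(\<bar>c\<bar> + \<bar>e\<bar> + 1) * k = d" by (simp add: k_def)
      then show ?thesis using k by (simp add: distrib_right)
    qed
    obtain \<theta> where \<theta>: "\<theta> \<in> test_functions D" "L2_norm L (\<lambda>x. v x - \<theta> x) < k" "L2_norm L (\<lambda>x. wgrad v x - grad \<theta> x) < k"
      using V_approx[OF v k] by blast
    obtain \<eta> where \<eta>: "\<eta> \<in> test_functions D" "L2_norm L (\<lambda>x. w x - \<eta> x) < k" "L2_norm L (\<lambda>x. wgrad w x - grad \<eta> x) < k"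
      using V_approx[OF w k] by blast
    have *: "L2_norm L (\<lambda>x. c *\<^sub>R f x + e *\<^sub>R h x) < d"
      if "f \<in> L2_space L" "h \<in> L2_space L" "L2_norm L f < k" "L2_norm L h < k"
      for f h :: "'a \<Rightarrow> 'z::euclidean_space"
    proof -
      have "L2_norm L (\<lambda>x. c *\<^sub>R f x + e *\<^sub>R h x) \<le> \<bar>c\<bar> * L2_norm L f + \<bar>e\<bar> * L2_norm L h"
        using L2_triangle[OF L2_scale[OF that(1), of c] L2_scale[OF that(2), of e]] by (simp add: L2_norm_scale)
      also have "\<dots> \<le> \<bar>c\<bar> * k + \<bar>e\<bar> * k" using that by (intro add_mono mult_left_mono) auto
      finally show ?thesis using kd by simp
    qed
    have gr: "grad (\<lambda>x. c * \<theta> x + e * \<eta> x) x = c *\<^sub>R grad \<theta> x + e *\<^sub>R grad \<eta> x" for x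
    proof -
      have "\<theta> differentiable (at x)" "\<eta> differentiable (at x)"
        using C1cD[OF test_C1c[OF \<theta>(1)]] C1cD[OF test_C1c[OF \<eta>(1)]] by auto
      then show ?thesis
        by (simp add: grad_def partial_deriv_add partial_deriv_scale scaleR_add_left sum.distrib scaleR_sum_right)
    qed
    show "\<exists>\<theta>\<in>test_functions D. L2_norm L (\<lambda>x. (c * v x + e * w x) - \<theta> x) < d \<and>
        L2_norm L (\<lambda>x. (c *\<^sub>R wgrad v x + e *\<^sub>R wgrad w x) - grad \<theta> x) < d"
    proof (rule bexI[OF _ test_functions_lincomb[OF \<theta>(1) \<eta>(1), of c e]], rule conjI)
      have "L2_norm L (\<lambda>x. c *\<^sub>R (v x - \<theta> x) + e *\<^sub>R (w x - \<eta> x)) < d"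
        by (intro * L2_diff V_L2 v w C1c_L2 test_C1c \<theta> \<eta>)
      then show "L2_norm L (\<lambda>x. (c * v x + e * w x) - (c * \<theta> x + e * \<eta> x)) < d"
        by (simp add: algebra_simps)
      have "L2_norm L (\<lambda>x. c *\<^sub>R (wgrad v x - grad \<theta> x) + e *\<^sub>R (wgrad w x - grad \<eta> x)) < d"
        by (intro * L2_diff V_grad_L2 v w C1c_L2 test_C1c \<theta> \<eta>)
      then show "L2_norm L (\<lambda>x. (c *\<^sub>R wgrad v x + e *\<^sub>R wgrad w x) - grad (\<lambda>x. c * \<theta> x + e * \<eta> x) x) < d"
        by (simp add: gr algebra_simps)
    qed
  qed
qed

lemma V_diff:
  assumes v: "v \<in> V_space D" and w: "w \<in> V_space D"
  shows "(\<lambda>x. v x - w x) \<in> V_space D"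
    "AE x in L. wgrad (\<lambda>x. v x - w x) x = wgrad v x - wgrad w x"
    "V_norm D (\<lambda>x. v x - w x) = L2_norm L (\<lambda>x. wgrad v x - wgrad w x)"
  using V_lincomb[OF assms, of 1 "-1"] by simp_all

lemma V_norm_nonneg [simp]: "0 \<le> V_norm D v"
  by (simp add: V_norm_def)

lemma test_V:
  assumes "\<theta> \<in> test_functions D"
  shows "\<theta> \<in> V_space D"
  by (rule V_spaceI[OF C1c_L2(1) C1c_weak_gradient])
    (use assms test_C1c in \<open>auto intro!: bexI[of _ \<theta>] simp: L2_norm_def\<close>)

lemma V_nonempty: "V_space D \<noteq> {}"
  using test_V[OF test_zero] by blast

lemma C1c_V:
  assumes v: "v \<in> C1c D"
  shows "v \<in> V_space D"
proof (rule V_spaceI[OF C1c_L2(1)[OF v] C1c_weak_gradient[OF v]])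
  fix e :: real assume e: "e > 0"
  \<comment> \<open>Sup-norm errors k in the function and its partial derivatives become L2 errors
    of k and DIM * k times the norm of the constant 1. The added ones keep the denominator positive
    and the final estimates strict.\<close>
  define k where "k = e / ((real DIM('a) + 1) * (L2_norm L (\<lambda>x. 1::real) + 1))"
  have k: "k > 0" unfolding k_def using e by (intro divide_pos_pos mult_pos_pos) (auto intro: add_nonneg_pos)
  have ke: "real DIM('a) * k * L2_norm L (\<lambda>x. 1::real) < e" "k * L2_norm L (\<lambda>x. 1::real) < e"
  proof -
    have n: "L2_norm L (\<lambda>x. 1::real) \<ge> 0" by simp
    have "(real DIM('a) + 1) * (L2_norm L (\<lambda>x. 1::real) + 1) * k = e"
    proof -
      have "L2_norm L (\<lambda>x. 1::real) + 1 \<noteq> 0" using n by linarith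
      then show ?thesis by (simp add: k_def)
    qed
    then have "e = real DIM('a) * k * L2_norm L (\<lambda>x. 1::real) + real DIM('a) * k + k * L2_norm L (\<lambda>x. 1::real) + k"
      by (simp add: algebra_simps)
    moreover have "real DIM('a) * k * L2_norm L (\<lambda>x. 1::real) \<ge> 0" "real DIM('a) * k \<ge> 0" "k * L2_norm L (\<lambda>x. 1::real) \<ge> 0"
      using n k by simp_all
    ultimately show "real DIM('a) * k * L2_norm L (\<lambda>x. 1::real) < e" "k * L2_norm L (\<lambda>x. 1::real) < e"
      using k by linarith+
  qed
  obtain \<theta> where \<theta>: "\<theta> \<in> test_functions D" "\<And>x. \<bar>v x - \<theta> x\<bar> \<le> k"
    "\<And>b x. b \<in> Basis \<Longrightarrow> \<bar>partial_deriv b v x - partial_deriv b \<theta> x\<bar> \<le> k"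
    using C1c_approx[OF v open_D k] by blast
  have m: "(\<lambda>x. v x - \<theta> x) \<in> borel_measurable L" "(\<lambda>x. grad v x - grad \<theta> x) \<in> borel_measurable L"
    by (intro L2_measurable L2_diff C1c_L2 v test_C1c \<theta>)+
  have "L2_norm L (\<lambda>x. v x - \<theta> x) \<le> k * L2_norm L (\<lambda>x. 1::real)"
    by (rule L2_norm_le[OF m(1) const_L2]) (use \<theta>(2) k in auto)
  moreover have "L2_norm L (\<lambda>x. grad v x - grad \<theta> x) \<le> (real DIM('a) * k) * L2_norm L (\<lambda>x. 1::real)"
  proof (rule L2_norm_le[OF m(2) const_L2])
    have "norm (grad v x - grad \<theta> x) \<le> real DIM('a) * k" for x
    proof -
      have "norm (grad v x - grad \<theta> x) \<le> (\<Sum>b\<in>Basis. \<bar>(grad v x - grad \<theta> x) \<bullet> b\<bar>)" by (rule norm_le_l1)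
      also have "\<dots> \<le> (\<Sum>b\<in>(Basis::'a set). k)"
        by (intro sum_mono) (simp add: inner_diff_left grad_inner \<theta>(3))
      finally show ?thesis by simp
    qed
    then show "AE x in L. norm (grad v x - grad \<theta> x) \<le> (real DIM('a) * k) * norm (1::real)" by simp
  qed (use k in auto)
  ultimately show "\<exists>\<theta>\<in>test_functions D. L2_norm L (\<lambda>x. v x - \<theta> x) < e \<and> L2_norm L (\<lambda>x. grad v x - grad \<theta> x) < e"
    using \<theta>(1) ke by (intro bexI[of _ \<theta>]) auto
qed

text \<open>Integrate the square of the function against the derivative of a coordinate, which is 1.\<close>

lemma poincare_test:
  assumes \<theta>: "\<theta> \<in> test_functions D"
  shows "L2_norm L \<theta> \<le> 2 * L2_norm L (grad \<theta>)"
proof -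
  obtain b :: 'a where b: "b \<in> Basis" using nonempty_Basis by blast
  have t: "times_cont_diff 1 \<theta>" by (rule C1cD[OF test_C1c[OF \<theta>]])
  have c: "continuous_on UNIV \<theta>" "continuous_on UNIV (partial_deriv b \<theta>)"
    using tcd_continuous[OF t] t b by simp_all
  have sub: "{x. \<theta> x \<noteq> 0} \<subseteq> D" using \<theta> closure_subset[of "{x. \<theta> x \<noteq> 0}"] by (auto simp: test_functions_def)
  have z: "\<theta> x = 0" if "x \<notin> D" for x using sub that by auto
  have sq: "(\<lambda>x. \<theta> x * \<theta> x) \<in> C1c UNIV"
    using C1c_mult[OF test_C1c[OF \<theta>] t] C1c_mono[of D UNIV] by auto
  have xd: "((\<lambda>x. x \<bullet> b) has_derivative (\<lambda>h. h \<bullet> b)) (at x)" for x :: 'a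
    by (auto intro!: derivative_eq_intros)
  have "times_cont_diff 1 (\<lambda>x. x \<bullet> b)" by (rule tcd_1I[OF xd]) simp
  from integral_by_parts_C1c[OF sq this b]
  have "(LINT x|lborel. \<theta> x * \<theta> x) = - (LINT x|lborel. 2 * (\<theta> x * partial_deriv b \<theta> x * (x \<bullet> b)))"
    using t b by (simp add: partial_deriv_eq[OF xd] partial_deriv_mult field_simps)
  then have "(L2_norm L \<theta>)\<^sup>2 = - (LINT x|L. 2 * (\<theta> x * partial_deriv b \<theta> x * (x \<bullet> b)))"
    unfolding L2_norm_power2 using c z
    by (subst (1 2) lebesgue_on_lborel[OF D_lebesgue])
      (auto simp: power2_eq_square intro!: borel_measurable_continuous_onI continuous_intros)
  also have "\<dots> \<le> 2 * \<bar>LINT x|L. \<theta> x \<bullet> ((x \<bullet> b) *\<^sub>R partial_deriv b \<theta> x)\<bar>"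
  proof -
    have "(\<lambda>x. 2 * (\<theta> x * partial_deriv b \<theta> x * (x \<bullet> b))) = (\<lambda>x. 2 * (\<theta> x \<bullet> ((x \<bullet> b) *\<^sub>R partial_deriv b \<theta> x)))"
      by (auto simp: mult_ac)
    then show ?thesis by simp
  qed
  also have "\<dots> \<le> 2 * (L2_norm L \<theta> * L2_norm L (\<lambda>x. (x \<bullet> b) *\<^sub>R partial_deriv b \<theta> x))"
    by (intro mult_left_mono L2_Cauchy_Schwarz C1c_L2 test_C1c \<theta>
        L2_mult_bounded(1)[where C=1] b continuous_measurable_L continuous_intros D_bound) auto
  also have "\<dots> \<le> 2 * (L2_norm L \<theta> * (1 * L2_norm L (grad \<theta>)))"
  proof (intro mult_left_mono)
    have "AE x in L. norm ((x \<bullet> b) *\<^sub>R partial_deriv b \<theta> x) \<le> 1 * norm (grad \<theta> x)"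
    proof (rule AE_I2)
      fix x assume "x \<in> space L"
      then have "\<bar>x \<bullet> b\<bar> * \<bar>grad \<theta> x \<bullet> b\<bar> \<le> 1 * norm (grad \<theta> x)"
        using D_bound[of x b] b by (intro mult_mono Basis_le_norm) auto
      then show "norm ((x \<bullet> b) *\<^sub>R partial_deriv b \<theta> x) \<le> 1 * norm (grad \<theta> x)"
        by (simp add: grad_inner[OF b] abs_mult)
    qed
    then show "L2_norm L (\<lambda>x. (x \<bullet> b) *\<^sub>R partial_deriv b \<theta> x) \<le> 1 * L2_norm L (grad \<theta>)"
      by (intro L2_norm_le C1c_L2 test_C1c \<theta> continuous_measurable_L continuous_intros c) auto
  qed auto
  finally have *: "L2_norm L \<theta> * L2_norm L \<theta> \<le> L2_norm L \<theta> * (2 * L2_norm L (grad \<theta>))"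
    by (simp add: power2_eq_square)
  show ?thesis
  proof (cases "L2_norm L \<theta> = 0")
    case False
    then have "L2_norm L \<theta> > 0" using L2_norm_nonneg[of L \<theta>] by linarith
    with * show ?thesis by simp
  qed simp
qed

lemma poincare:
  assumes v: "v \<in> V_space D"
  shows "L2_norm L v \<le> 2 * V_norm D v"
proof (rule field_le_epsilon)
  fix e :: real assume e: "e > 0"
  obtain \<theta> where \<theta>: "\<theta> \<in> test_functions D" "L2_norm L (\<lambda>x. v x - \<theta> x) < e/3" "L2_norm L (\<lambda>x. wgrad v x - grad \<theta> x) < e/3"
    using V_approx[OF v, of "e/3"] e by auto
  note L2 = V_L2[OF v] C1c_L2(1)[OF test_C1c[OF \<theta>(1)]]
  note L2g = V_grad_L2[OF v] C1c_L2(3)[OF test_C1c[OF \<theta>(1)]]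
  show "L2_norm L v \<le> 2 * V_norm D v + e"
    using L2_triangle_rev[OF L2] L2_triangle_rev[OF L2g] poincare_test[OF \<theta>(1)] \<theta>(2,3)
    unfolding V_norm_def by linarith
qed

text \<open>By the Poincare inequality the functions are Cauchy along with their gradients. The two
  L2 limits are linked by passing to the limit in the defining identity of the weak
  gradient.\<close>

lemma V_complete:
  fixes f :: "nat \<Rightarrow> 'a \<Rightarrow> real"
  assumes f: "\<And>n. f n \<in> V_space D"
    and Cauchy: "\<And>e. e > 0 \<Longrightarrow> \<exists>k. \<forall>m\<ge>k. \<forall>n\<ge>k. V_norm D (\<lambda>x. f m x - f n x) < e"
  shows "\<exists>u\<in>V_space D. (\<lambda>n. V_norm D (\<lambda>x. f n x - u x)) \<longlonglongrightarrow> 0"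
proof -
  have "\<exists>k. \<forall>m\<ge>k. \<forall>n\<ge>k. L2_norm L (\<lambda>x. wgrad (f m) x - wgrad (f n) x) < e" if "e > 0" for e
    using Cauchy[OF that] unfolding V_diff(3)[OF f f] .
  from L2_complete[OF V_grad_L2[OF f] this] obtain g where
    g: "g \<in> L2_space L" "(\<lambda>n. L2_norm L (\<lambda>x. wgrad (f n) x - g x)) \<longlonglongrightarrow> 0" by blast
  have "\<exists>k. \<forall>m\<ge>k. \<forall>n\<ge>k. L2_norm L (\<lambda>x. f m x - f n x) < e" if e: "e > 0" for e
  proof -
    obtain k where k: "\<And>m n. m \<ge> k \<Longrightarrow> n \<ge> k \<Longrightarrow> V_norm D (\<lambda>x. f m x - f n x) < e/2"
      using Cauchy[of "e/2"] e by auto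
    have "L2_norm L (\<lambda>x. f m x - f n x) < e" if "m \<ge> k" "n \<ge> k" for m n
      using poincare[OF V_diff(1)[OF f f], of m n] k[OF that] by linarith
    then show ?thesis by blast
  qed
  from L2_complete[OF V_L2[OF f] this] obtain u where
    u: "u \<in> L2_space L" "(\<lambda>n. L2_norm L (\<lambda>x. f n x - u x)) \<longlonglongrightarrow> 0" by blast
  have lim: "(\<lambda>n. LINT x|L. h n x * w x) \<longlonglongrightarrow> (LINT x|L. k x * w x)"
    if "\<And>n. h n \<in> L2_space L" "k \<in> L2_space L" "w \<in> L2_space L" "(\<lambda>n. L2_norm L (\<lambda>x. h n x - k x)) \<longlonglongrightarrow> 0"
    for h :: "nat \<Rightarrow> 'a \<Rightarrow> real" and k w
  proof -
    have "(\<lambda>n. (LINT x|L. h n x * w x) - (LINT x|L. k x * w x)) \<longlonglongrightarrow> 0"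
    proof (rule Lim_null_comparison)
      have "norm ((LINT x|L. h n x * w x) - (LINT x|L. k x * w x)) \<le> L2_norm L (\<lambda>x. h n x - k x) * L2_norm L w" for n
      proof -
        have "(LINT x|L. h n x * w x) - (LINT x|L. k x * w x) = (LINT x|L. (h n x - k x) \<bullet> w x)"
          using L2_mult_integrable[OF that(1,3), of n] L2_mult_integrable[OF that(2,3)] by (simp add: left_diff_distrib)
        then show ?thesis using L2_Cauchy_Schwarz[OF L2_diff[OF that(1,2)] that(3), of n] by simp
      qed
      then show "\<forall>\<^sub>F n in sequentially. norm ((LINT x|L. h n x * w x) - (LINT x|L. k x * w x)) \<le> L2_norm L (\<lambda>x. h n x - k x) * L2_norm L w"
        by simp
      show "(\<lambda>n. L2_norm L (\<lambda>x. h n x - k x) * L2_norm L w) \<longlonglongrightarrow> 0"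
        using tendsto_mult_right[OF that(4), of "L2_norm L w"] by simp
    qed
    then show ?thesis by (simp add: LIM_zero_cancel)
  qed
  have wg: "is_weak_gradient D u g"
    unfolding is_weak_gradient_def
  proof (intro conjI ballI g(1))
    fix \<theta> and b :: 'a assume \<theta>: "\<theta> \<in> test_functions D" and b: "b \<in> Basis"
    have 1: "(\<lambda>n. LINT x|L. f n x * partial_deriv b \<theta> x) \<longlonglongrightarrow> (LINT x|L. u x * partial_deriv b \<theta> x)"
      by (intro lim V_L2 f u C1c_L2 test_C1c \<theta> b)
    have "(\<lambda>n. L2_norm L (\<lambda>x. wgrad (f n) x \<bullet> b - g x \<bullet> b)) \<longlonglongrightarrow> 0"
    proof (rule Lim_null_comparison[OF _ g(2)], intro always_eventually allI)
      fix n
      have m: "(\<lambda>x. wgrad (f n) x \<bullet> b - g x \<bullet> b) \<in> borel_measurable L"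
        by (intro L2_measurable L2_diff L2_inner_Basis[OF b] V_grad_L2 f g)
      have "L2_norm L (\<lambda>x. wgrad (f n) x \<bullet> b - g x \<bullet> b) \<le> 1 * L2_norm L (\<lambda>x. wgrad (f n) x - g x)"
      proof (rule L2_norm_le[OF m L2_diff[OF V_grad_L2[OF f] g(1)]])
        show "AE x in L. norm (wgrad (f n) x \<bullet> b - g x \<bullet> b) \<le> 1 * norm (wgrad (f n) x - g x)"
          using Basis_le_norm[OF b] by (intro AE_I2) (simp add: inner_diff_left[symmetric])
      qed simp
      then show "norm (L2_norm L (\<lambda>x. wgrad (f n) x \<bullet> b - g x \<bullet> b)) \<le> L2_norm L (\<lambda>x. wgrad (f n) x - g x)" by simp
    qed
    then have 2: "(\<lambda>n. - (LINT x|L. (wgrad (f n) x \<bullet> b) * \<theta> x)) \<longlonglongrightarrow> - (LINT x|L. (g x \<bullet> b) * \<theta> x)"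
      by (intro tendsto_minus lim L2_inner_Basis[OF b] V_grad_L2 f g C1c_L2 test_C1c \<theta>)
    have "(LINT x|L. f n x * partial_deriv b \<theta> x) = - (LINT x|L. (wgrad (f n) x \<bullet> b) * \<theta> x)" for n
      using V_weak_gradient[OF f] \<theta> b by (auto simp: is_weak_gradient_def)
    then show "(LINT x|L. u x * partial_deriv b \<theta> x) = - (LINT x|L. (g x \<bullet> b) * \<theta> x)"
      using LIMSEQ_unique[OF 1] 2 by simp
  qed
  have "u \<in> V_space D"
  proof (rule V_spaceI[OF u(1) wg])
    fix e :: real assume e: "e > 0"
    have "\<forall>\<^sub>F n in sequentially. L2_norm L (\<lambda>x. f n x - u x) < e/2 \<and> L2_norm L (\<lambda>x. wgrad (f n) x - g x) < e/2"
      using order_tendstoD(2)[OF u(2), of "e/2"] order_tendstoD(2)[OF g(2), of "e/2"] e by (intro eventually_conj) auto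
    then obtain n where n: "L2_norm L (\<lambda>x. f n x - u x) < e/2" "L2_norm L (\<lambda>x. wgrad (f n) x - g x) < e/2"
      by (metis (mono_tags, lifting) eventually_sequentially order_refl)
    obtain \<theta> where \<theta>: "\<theta> \<in> test_functions D" "L2_norm L (\<lambda>x. f n x - \<theta> x) < e/2" "L2_norm L (\<lambda>x. wgrad (f n) x - grad \<theta> x) < e/2"
      using V_approx[OF f, of "e/2" n] e by auto
    have tri: "L2_norm L (\<lambda>x. h x - w x) \<le> L2_norm L (\<lambda>x. k x - h x) + L2_norm L (\<lambda>x. k x - w x)"
      if "h \<in> L2_space L" "k \<in> L2_space L" "w \<in> L2_space L" for h k w :: "'a \<Rightarrow> 'z::euclidean_space"
      using L2_triangle[OF L2_diff[OF that(1,2)] L2_diff[OF that(2,3)]] L2_norm_minus_commute[of L h k] by simp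
    have "L2_norm L (\<lambda>x. u x - \<theta> x) < e"
      using tri[OF u(1) V_L2[OF f] C1c_L2(1)[OF test_C1c[OF \<theta>(1)]], of n] n \<theta> by linarith
    moreover have "L2_norm L (\<lambda>x. g x - grad \<theta> x) < e"
      using tri[OF g(1) V_grad_L2[OF f] C1c_L2(3)[OF test_C1c[OF \<theta>(1)]], of n] n \<theta> by linarith
    ultimately show "\<exists>\<theta>\<in>test_functions D. L2_norm L (\<lambda>x. u x - \<theta> x) < e \<and> L2_norm L (\<lambda>x. g x - grad \<theta> x) < e"
      using \<theta>(1) by blast
  qed
  moreover have "V_norm D (\<lambda>x. f n x - u x) = L2_norm L (\<lambda>x. wgrad (f n) x - g x)" for n
    using weak_gradient_lincomb[OF V_L2[OF f[of n]] u(1) V_weak_gradient[OF f[of n]] wg, of 1 "-1"]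
    by (intro V_norm_eq) simp
  ultimately show ?thesis using g(2) by (intro bexI[of _ u]) simp_all
qed

end

context unit_domain
begin

section \<open>Weak solutions\<close>

definition elliptic :: "real \<Rightarrow> real \<Rightarrow> ('a \<Rightarrow> real) \<Rightarrow> bool" where
  "elliptic l m a \<longleftrightarrow> 0 < l \<and> a \<in> borel_measurable L \<and> (\<forall>x\<in>D. l \<le> a x \<and> a x \<le> m)"

definition energy :: "('a \<Rightarrow> real) \<Rightarrow> ('a \<Rightarrow> real) \<Rightarrow> ('a \<Rightarrow> real) \<Rightarrow> real" where
  "energy a v w = (LINT x|L. a x * (wgrad v x \<bullet> wgrad w x))"

lemma elliptic_abs_le: "elliptic l m a \<Longrightarrow> x \<in> D \<Longrightarrow> \<bar>a x\<bar> \<le> \<bar>m\<bar>"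
  unfolding elliptic_def by force

lemma elliptic_scale_L2:
  assumes "elliptic l m a" "f \<in> L2_space L"
  shows "(\<lambda>x. a x *\<^sub>R f x) \<in> L2_space L"
  using assms(1) by (intro L2_mult_bounded(1)[OF assms(2) _ elliptic_abs_le[OF assms(1)]]) (auto simp: elliptic_def)

lemma energy_integrable:
  assumes "elliptic l m a" "f \<in> L2_space L" "g \<in> L2_space L"
  shows "integrable L (\<lambda>x. a x * (f x \<bullet> g x))"
  using L2_inner_integrable[OF elliptic_scale_L2[OF assms(1,2)] assms(3)] by simp

lemma energy_lincomb:
  assumes a: "elliptic l m a" and v: "v \<in> V_space D" and w: "w \<in> V_space D" and z: "z \<in> V_space D"
  shows "energy a (\<lambda>x. c * v x + e * w x) z = c * energy a v z + e * energy a w z"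
proof -
  note L2 = V_grad_L2[OF v] V_grad_L2[OF w] V_grad_L2[OF z]
  have "energy a (\<lambda>x. c * v x + e * w x) z = (LINT x|L. c * (a x * (wgrad v x \<bullet> wgrad z x)) + e * (a x * (wgrad w x \<bullet> wgrad z x)))"
    unfolding energy_def
  proof (rule integral_cong_AE)
    show "(\<lambda>x. a x * (wgrad (\<lambda>x. c * v x + e * w x) x \<bullet> wgrad z x)) \<in> borel_measurable L"
      by (intro borel_measurable_integrable energy_integrable[OF a] V_grad_L2 V_lincomb v w z)
    show "(\<lambda>x. c * (a x * (wgrad v x \<bullet> wgrad z x)) + e * (a x * (wgrad w x \<bullet> wgrad z x))) \<in> borel_measurable L"
      by (intro borel_measurable_integrable Bochner_Integration.integrable_add integrable_mult_right energy_integrable[OF a] L2)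
    show "AE x in L. a x * (wgrad (\<lambda>x. c * v x + e * w x) x \<bullet> wgrad z x) =
        c * (a x * (wgrad v x \<bullet> wgrad z x)) + e * (a x * (wgrad w x \<bullet> wgrad z x))"
      using V_lincomb(2)[OF v w, of c e] by eventually_elim (simp add: inner_add_left algebra_simps)
  qed
  also have "\<dots> = c * energy a v z + e * energy a w z"
    unfolding energy_def using energy_integrable[OF a L2(1,3)] energy_integrable[OF a L2(2,3)] by simp
  finally show ?thesis .
qed

lemma energy_bounds:
  assumes a: "elliptic l m a" and v: "v \<in> V_space D"
  shows "l * (V_norm D v)\<^sup>2 \<le> energy a v v" "energy a v v \<le> m * (V_norm D v)\<^sup>2"
proof -
  note L2 = V_grad_L2[OF v]
  have eq: "c * (V_norm D v)\<^sup>2 = (LINT x|L. c * (wgrad v x \<bullet> wgrad v x))" for c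
    by (simp add: V_norm_def L2_norm_power2 power2_norm_eq_inner)
  have i: "integrable L (\<lambda>x. c * (wgrad v x \<bullet> wgrad v x))" for c
    using L2_inner_integrable[OF L2 L2] by simp
  show "l * (V_norm D v)\<^sup>2 \<le> energy a v v"
    unfolding eq energy_def using a
    by (intro integral_mono i energy_integrable[OF a] L2 mult_right_mono) (auto simp: elliptic_def)
  show "energy a v v \<le> m * (V_norm D v)\<^sup>2"
    unfolding eq energy_def using a
    by (intro integral_mono i energy_integrable[OF a] L2 mult_right_mono) (auto simp: elliptic_def)
qed

lemma weak_solution_iff:
  assumes "elliptic l m a"
  shows "weak_solution D a F u \<longleftrightarrow> u \<in> V_space D \<and> (\<forall>v\<in>V_space D. energy a u v = F v)"
  unfolding weak_solution_def energy_def has_bochner_integral_iff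
  using energy_integrable[OF assms V_grad_L2 V_grad_L2] by auto

lemma weak_solution_exists:
  assumes a: "elliptic l m a" and F: "F \<in> V_dual D"
  shows "\<exists>u. weak_solution D a F u"
proof -
  obtain C where C: "\<And>v. v \<in> V_space D \<Longrightarrow> \<bar>F v\<bar> \<le> C * V_norm D v"
    using F unfolding V_dual_def by blast
  have Fl: "F (\<lambda>x. c * v x + e * w x) = c * F v + e * F w" if "v \<in> V_space D" "w \<in> V_space D" for v w c e
    using F that unfolding V_dual_def by blast
  have l: "l > 0" using a by (simp add: elliptic_def)
  have sym: "energy a v w = energy a w v" for v w
    unfolding energy_def by (simp add: inner_commute)
  have "\<exists>u\<in>V_space D. \<forall>v\<in>V_space D. energy a u v = F v"
    by (rule riesz_representation[where N="V_norm D" and \<alpha>=l and \<beta>=m and C=C])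
      (use V_nonempty V_lincomb(1) energy_lincomb[OF a] sym l energy_bounds[OF a] Fl C V_complete in auto)
  then show ?thesis using weak_solution_iff[OF a] by blast
qed

text \<open>Testing the equation with the solution itself gives l * N^2 \<le> C * N for its norm
  N.\<close>

lemma weak_solution_bound:
  assumes a: "elliptic l m a" and u: "weak_solution D a F u"
    and F: "\<And>v. v \<in> V_space D \<Longrightarrow> \<bar>F v\<bar> \<le> C * V_norm D v" and C: "C \<ge> 0"
  shows "V_norm D u \<le> C / l"
proof -
  have V: "u \<in> V_space D" "energy a u u = F u" using u weak_solution_iff[OF a] by auto
  have l: "l > 0" using a by (simp add: elliptic_def)
  have "l * (V_norm D u)\<^sup>2 \<le> C * V_norm D u"
    using energy_bounds(1)[OF a V(1)] V(2) F[OF V(1)] by linarith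
  then have *: "V_norm D u * (l * V_norm D u) \<le> V_norm D u * C" by (simp add: power2_eq_square mult_ac)
  show ?thesis
  proof (cases "V_norm D u = 0")
    case False
    then have "V_norm D u > 0" using V_norm_nonneg[of u] by linarith
    then have "l * V_norm D u \<le> C" using * by simp
    then show ?thesis using l by (simp add: field_simps)
  qed (use C l in simp)
qed

text \<open>The difference w of the solutions satisfies energy a w w = integral of (a' - a) grad u'
  . grad w. Thus only the norm of the second solution and the ellipticity of the first coefficient
  enter the bound.\<close>

lemma weak_solution_stability:
  assumes a: "elliptic l m a" and a': "elliptic l' m' a'"
    and u: "weak_solution D a F u" and u': "weak_solution D a' F u'"
    and \<delta>: "\<And>x. x \<in> D \<Longrightarrow> \<bar>a x - a' x\<bar> \<le> \<delta>" "\<delta> \<ge> 0"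
  shows "V_norm D (\<lambda>x. u x - u' x) \<le> \<delta> * V_norm D u' / l"
proof -
  have V: "u \<in> V_space D" "u' \<in> V_space D" "\<And>v. v \<in> V_space D \<Longrightarrow> energy a u v = F v"
    "\<And>v. v \<in> V_space D \<Longrightarrow> energy a' u' v = F v"
    using u u' weak_solution_iff[OF a] weak_solution_iff[OF a'] by auto
  have l: "l > 0" using a by (simp add: elliptic_def)
  let ?w = "\<lambda>x. u x - u' x"
  have w: "?w \<in> V_space D" by (rule V_diff[OF V(1,2)])
  note L2 = V_grad_L2[OF V(2)] V_grad_L2[OF w]
  have "energy a ?w ?w = energy a u ?w - energy a u' ?w"
    using energy_lincomb[OF a V(1,2) w, of 1 "-1"] by simp
  also have "\<dots> = energy a' u' ?w - energy a u' ?w" using V w by simp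
  also have "\<dots> = (LINT x|L. ((a' x - a x) *\<^sub>R wgrad u' x) \<bullet> wgrad ?w x)"
    unfolding energy_def using energy_integrable[OF a L2] energy_integrable[OF a' L2]
    by (subst Bochner_Integration.integral_diff[symmetric]) (auto simp: left_diff_distrib)
  also have "\<dots> \<le> L2_norm L (\<lambda>x. (a' x - a x) *\<^sub>R wgrad u' x) * L2_norm L (wgrad ?w)"
  proof -
    have "(\<lambda>x. (a' x - a x) *\<^sub>R wgrad u' x) \<in> L2_space L"
      unfolding scaleR_left_diff_distrib by (intro L2_diff elliptic_scale_L2[OF a] elliptic_scale_L2[OF a'] L2)
    from L2_Cauchy_Schwarz[OF this L2(2)] show ?thesis by linarith
  qed
  also have "\<dots> \<le> (\<delta> * V_norm D u') * V_norm D ?w"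
    unfolding V_norm_def using a a' \<delta>
    by (intro mult_right_mono L2_mult_bounded(2)[OF L2(1)]) (auto simp: elliptic_def abs_minus_commute)
  finally have "l * (V_norm D ?w)\<^sup>2 \<le> \<delta> * V_norm D u' * V_norm D ?w"
    using energy_bounds(1)[OF a w] by linarith
  then have *: "V_norm D ?w * (l * V_norm D ?w) \<le> V_norm D ?w * (\<delta> * V_norm D u')"
    by (simp add: power2_eq_square mult_ac)
  show ?thesis
  proof (cases "V_norm D ?w = 0")
    case False
    then have "V_norm D ?w > 0" using V_norm_nonneg[of ?w] by linarith
    then have "l * V_norm D ?w \<le> \<delta> * V_norm D u'" using * by simp
    then show ?thesis using l by (simp add: field_simps)
  qed (use \<delta>(2) l in simp)
qed

lemma V_norm_zero_AE:
  assumes "v \<in> V_space D" "V_norm D v = 0"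
  shows "AE x in L. v x = 0"
proof -
  have "L2_norm L v = 0" using poincare[OF assms(1)] assms(2) L2_norm_nonneg[of L v] by linarith
  then show ?thesis by (rule L2_norm_eq_0[OF V_L2[OF assms(1)]])
qed

lemma weak_solution_unique:
  assumes a: "elliptic l m a" and u: "weak_solution D a F u" and u': "weak_solution D a F u'"
  shows "AE x in L. u' x = u x"
proof -
  have V: "u \<in> V_space D" "u' \<in> V_space D" using u u' by (auto simp: weak_solution_def)
  have "V_norm D (\<lambda>x. u x - u' x) \<le> 0 * V_norm D u' / l"
    by (rule weak_solution_stability[OF a a u u']) auto
  then have "V_norm D (\<lambda>x. u x - u' x) = 0" using V_norm_nonneg[of "\<lambda>x. u x - u' x"] by linarith
  from V_norm_zero_AE[OF V_diff(1)[OF V] this] show ?thesis by eventually_elim simp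
qed

lemma V_dual_norm_bound:
  assumes F: "F \<in> V_dual D"
  shows "0 \<le> V_dual_norm D F" "v \<in> V_space D \<Longrightarrow> \<bar>F v\<bar> \<le> V_dual_norm D F * V_norm D v"
proof -
  obtain C where C: "\<And>v. v \<in> V_space D \<Longrightarrow> \<bar>F v\<bar> \<le> C * V_norm D v"
    using F unfolding V_dual_def by blast
  have Fl: "F (\<lambda>x. c * v x + e * w x) = c * F v + e * F w" if "v \<in> V_space D" "w \<in> V_space D" for v w c e
    using F that unfolding V_dual_def by blast
  have bdd: "bdd_above ((\<lambda>v. \<bar>F v\<bar>) ` {v \<in> V_space D. V_norm D v \<le> 1})"
  proof (rule bdd_aboveI2)
    fix v assume "v \<in> {v \<in> V_space D. V_norm D v \<le> 1}"
    then have v: "v \<in> V_space D" "V_norm D v \<le> 1" by auto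
    have "C * V_norm D v \<le> \<bar>C\<bar> * 1" using v(2) by (intro mult_mono) auto
    then show "\<bar>F v\<bar> \<le> \<bar>C\<bar>" using C[OF v(1)] by simp
  qed
  have up: "\<bar>F v\<bar> \<le> V_dual_norm D F" if "v \<in> V_space D" "V_norm D v \<le> 1" for v
    unfolding V_dual_norm_def by (rule cSUP_upper[OF _ bdd]) (use that in auto)
  have z: "V_norm D (\<lambda>x. 0) = 0"
    using V_lincomb(3)[OF test_V[OF test_zero] test_V[OF test_zero], of 0 0] by (simp add: L2_norm_def)
  show "0 \<le> V_dual_norm D F" using up[OF test_V[OF test_zero]] z by simp
  assume v: "v \<in> V_space D"
  show "\<bar>F v\<bar> \<le> V_dual_norm D F * V_norm D v"
  proof (cases "V_norm D v = 0")
    case True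
    then show ?thesis using C[OF v] by simp
  next
    case False
    then have p: "V_norm D v > 0" using V_norm_nonneg[of v] by linarith
    let ?c = "inverse (V_norm D v)"
    let ?w = "\<lambda>x. ?c * v x + 0 * v x"
    have "V_norm D ?w = ?c * V_norm D v"
      using V_lincomb(3)[OF v v, of ?c 0] p by (simp add: L2_norm_scale V_norm_def)
    then have "V_norm D ?w = 1" using p by simp
    moreover have "?w \<in> V_space D" by (rule V_lincomb(1)[OF v v])
    moreover have "F ?w = ?c * F v" using Fl[OF v v, of ?c 0] by simp
    ultimately have "?c * \<bar>F v\<bar> \<le> V_dual_norm D F" using up[of ?w] p by (simp add: abs_mult)
    then show ?thesis using p by (simp add: field_simps)
  qed
qed

lemma H_functional_bound:
  assumes f: "f \<in> H_space D" and v: "v \<in> V_space D"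
  shows "\<bar>H_functional D f v\<bar> \<le> (2 * H_norm D f) * V_norm D v"
proof -
  have f2: "f \<in> L2_space L" using f by (simp add: H_space_def)
  have "\<bar>H_functional D f v\<bar> \<le> L2_norm L f * L2_norm L v"
    using L2_Cauchy_Schwarz[OF f2 V_L2[OF v]] by (simp add: H_functional_def)
  also have "\<dots> \<le> L2_norm L f * (2 * V_norm D v)"
    by (intro mult_left_mono poincare v) simp
  finally show ?thesis by (simp add: H_norm_def mult_ac)
qed

lemma H_functional_V_dual:
  assumes f: "f \<in> H_space D"
  shows "H_functional D f \<in> V_dual D"
proof -
  have f2: "f \<in> L2_space L" using f by (simp add: H_space_def)
  have "H_functional D f (\<lambda>x. c * v x + e * w x) = c * H_functional D f v + e * H_functional D f w"
    if "v \<in> V_space D" "w \<in> V_space D" for v w c e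
    unfolding H_functional_def
    using L2_mult_integrable[OF f2 V_L2[OF that(1)]] L2_mult_integrable[OF f2 V_L2[OF that(2)]]
    by (simp add: distrib_left mult.left_commute)
  then show ?thesis unfolding V_dual_def using H_functional_bound[OF f] by blast
qed

section \<open>The weak Laplacian of a solution\<close>

lemma laplacian_test: "\<theta> \<in> test_functions D \<Longrightarrow> laplacian \<theta> \<in> L2_space L"
proof -
  assume \<theta>: "\<theta> \<in> test_functions D"
  have "(\<lambda>x. \<Sum>b\<in>B. partial_deriv b (partial_deriv b \<theta>) x) \<in> L2_space L" if "finite B" "B \<subseteq> Basis" for B
    using that
  proof (induction B rule: finite_induct)
    case (insert b B)
    then have b: "b \<in> Basis" by auto
    have "partial_deriv b (partial_deriv b \<theta>) \<in> L2_space L"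
      using C1c_L2(1)[OF test_C1c[OF test_functions_partial[OF test_functions_partial[OF \<theta> b] b]]] .
    from L2_add[OF this] insert show ?case by simp
  qed (simp add: L2_zero)
  then show ?thesis unfolding laplacian_def[abs_def] by simp
qed

lemma weak_laplacian_unique:
  assumes g: "is_weak_laplacian D v g" and h: "is_weak_laplacian D v h"
  shows "AE x in L. g x = h x"
proof -
  have L2: "g \<in> L2_space L" "h \<in> L2_space L" using g h by (auto simp: is_weak_laplacian_def)
  have "AE x in L. g x - h x = 0"
  proof (rule orthogonal_test_AE_zero[OF L2_diff[OF L2]])
    fix \<theta> assume \<theta>: "\<theta> \<in> test_functions D"
    have "(LINT x|L. (g x - h x) * \<theta> x) = (LINT x|L. g x * \<theta> x) - (LINT x|L. h x * \<theta> x)"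
      unfolding left_diff_distrib
      by (intro Bochner_Integration.integral_diff L2_mult_integrable L2 C1c_L2 test_C1c \<theta>)
    also have "\<dots> = 0" using g h \<theta> by (auto simp: is_weak_laplacian_def)
    finally show "(LINT x|L. (g x - h x) * \<theta> x) = 0" .
  qed
  then show ?thesis by eventually_elim simp
qed

lemma weak_laplacian_AE:
  assumes "is_weak_laplacian D v g"
  shows "is_weak_laplacian D v (weak_laplacian D v)" "AE x in L. weak_laplacian D v x = g x"
proof -
  show 1: "is_weak_laplacian D v (weak_laplacian D v)"
    unfolding weak_laplacian_def by (rule someI[of "is_weak_laplacian D v", OF assms])
  show "AE x in L. weak_laplacian D v x = g x" by (rule weak_laplacian_unique[OF 1 assms])
qed

lemma W_norm_eq:
  assumes "is_weak_laplacian D v g"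
  shows "W_norm D v = L2_norm L g"
  unfolding W_norm_def
  by (rule L2_norm_cong_AE) (use weak_laplacian_AE[OF assms] assms in \<open>auto simp: is_weak_laplacian_def L2_space_def\<close>)

lemma weak_laplacian_lincomb:
  assumes "v \<in> L2_space L" "w \<in> L2_space L" and g: "is_weak_laplacian D v g" and h: "is_weak_laplacian D w h"
  shows "is_weak_laplacian D (\<lambda>x. c * v x + e * w x) (\<lambda>x. c * g x + e * h x)"
  unfolding is_weak_laplacian_def
proof (intro conjI ballI)
  have L2: "g \<in> L2_space L" "h \<in> L2_space L" using g h by (auto simp: is_weak_laplacian_def)
  then show "(\<lambda>x. c * g x + e * h x) \<in> L2_space L" using L2_lincomb[OF L2] by simp
  fix \<theta> assume \<theta>: "\<theta> \<in> test_functions D"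
  have "(LINT x|L. (c * v x + e * w x) * laplacian \<theta> x) =
      c * (LINT x|L. v x * laplacian \<theta> x) + e * (LINT x|L. w x * laplacian \<theta> x)"
    using L2_mult_integrable[OF assms(1) laplacian_test[OF \<theta>]]
      L2_mult_integrable[OF assms(2) laplacian_test[OF \<theta>]]
    by (simp add: distrib_right mult.assoc)
  also have "\<dots> = c * (LINT x|L. g x * \<theta> x) + e * (LINT x|L. h x * \<theta> x)"
    using g h \<theta> by (auto simp: is_weak_laplacian_def)
  also have "\<dots> = (LINT x|L. (c * g x + e * h x) * \<theta> x)"
    using L2_mult_integrable[OF L2(1) C1c_L2(1)[OF test_C1c[OF \<theta>]]]
      L2_mult_integrable[OF L2(2) C1c_L2(1)[OF test_C1c[OF \<theta>]]]
    by (simp add: distrib_right mult.assoc)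
  finally show "(LINT x|L. (c * v x + e * w x) * laplacian \<theta> x) = (LINT x|L. (c * g x + e * h x) * \<theta> x)" .
qed

lemma W_V: "v \<in> W_space D \<Longrightarrow> v \<in> V_space D"
  by (simp add: W_space_def)

lemma W_laplacian: "v \<in> W_space D \<Longrightarrow> is_weak_laplacian D v (weak_laplacian D v)"
  unfolding W_space_def using weak_laplacian_AE(1) by blast

lemma W_lincomb:
  assumes v: "v \<in> W_space D" and w: "w \<in> W_space D"
  shows "(\<lambda>x. c * v x + e * w x) \<in> W_space D"
    "W_norm D (\<lambda>x. c * v x + e * w x) \<le> \<bar>c\<bar> * W_norm D v + \<bar>e\<bar> * W_norm D w"
proof -
  have l: "is_weak_laplacian D (\<lambda>x. c * v x + e * w x) (\<lambda>x. c * weak_laplacian D v x + e * weak_laplacian D w x)"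
    by (intro weak_laplacian_lincomb V_L2 W_V W_laplacian v w)
  then show "(\<lambda>x. c * v x + e * w x) \<in> W_space D"
    using V_lincomb(1)[OF W_V[OF v] W_V[OF w]] by (auto simp: W_space_def)
  have L2: "weak_laplacian D v \<in> L2_space L" "weak_laplacian D w \<in> L2_space L"
    using W_laplacian[OF v] W_laplacian[OF w] by (auto simp: is_weak_laplacian_def)
  show "W_norm D (\<lambda>x. c * v x + e * w x) \<le> \<bar>c\<bar> * W_norm D v + \<bar>e\<bar> * W_norm D w"
    unfolding W_norm_eq[OF l] unfolding W_norm_def
    using L2_triangle[OF L2_scale[OF L2(1), of c] L2_scale[OF L2(2), of e]] L2_norm_scale[of L c "weak_laplacian D v"]
      L2_norm_scale[of L e "weak_laplacian D w"] by simp
qed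

lemma laplacian_by_parts:
  assumes v: "v \<in> V_space D" and \<theta>: "\<theta> \<in> test_functions D"
  shows "(LINT x|L. v x * laplacian \<theta> x) = - (LINT x|L. wgrad v x \<bullet> grad \<theta> x)"
proof -
  have p: "partial_deriv b \<theta> \<in> test_functions D" if "b \<in> Basis" for b
    by (rule test_functions_partial[OF \<theta> that])
  have "(LINT x|L. v x * laplacian \<theta> x) = (\<Sum>b\<in>Basis. LINT x|L. v x * partial_deriv b (partial_deriv b \<theta>) x)"
    unfolding laplacian_def sum_distrib_left
    by (intro Bochner_Integration.integral_sum L2_mult_integrable V_L2 v C1c_L2(1) test_C1c test_functions_partial p)
  also have "\<dots> = (\<Sum>b\<in>Basis. - (LINT x|L. (wgrad v x \<bullet> b) * partial_deriv b \<theta> x))"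
    using V_weak_gradient[OF v] p by (intro sum.cong) (auto simp: is_weak_gradient_def)
  also have "\<dots> = - (LINT x|L. (\<Sum>b\<in>Basis. (wgrad v x \<bullet> b) * partial_deriv b \<theta> x))"
  proof (subst Bochner_Integration.integral_sum)
    show "integrable L (\<lambda>x. (wgrad v x \<bullet> b) * partial_deriv b \<theta> x)" if "b \<in> Basis" for b
      by (rule L2_mult_integrable[OF L2_inner_Basis[OF that V_grad_L2[OF v]] C1c_L2(1)[OF test_C1c[OF p[OF that]]]])
  qed (simp add: sum_negf)
  finally show ?thesis by (simp add: grad_def inner_sum_right mult.commute)
qed

text \<open>Testing the equation with theta exp (- b_n) turns it into one for the Laplacian; b_n is
  continuously differentiable, whereas b only needs to be a limit of such functions.\<close>

lemma weak_solution_laplacian: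
  fixes G :: "'a \<Rightarrow> 'a"
  assumes f: "f \<in> H_space D" and u: "weak_solution D (\<lambda>x. exp (b x)) (H_functional D f) u"
    and b: "b \<in> borel_measurable L" "\<And>x. x \<in> D \<Longrightarrow> \<bar>b x\<bar> \<le> S"
    and B: "\<And>n. times_cont_diff 1 (B n)" "\<And>n x. x \<in> D \<Longrightarrow> \<bar>B n x - b x\<bar> \<le> \<epsilon> n"
    and G: "G \<in> borel_measurable L" "\<And>x. x \<in> D \<Longrightarrow> norm (G x) \<le> \<Gamma>"
      "\<And>n x. x \<in> D \<Longrightarrow> norm (grad (B n) x - G x) \<le> \<epsilon> n"
    and \<epsilon>: "\<epsilon> \<longlonglongrightarrow> 0" "\<And>n. \<epsilon> n \<le> E"
  shows "is_weak_laplacian D u (\<lambda>x. - (exp (- b x) * f x + G x \<bullet> wgrad u x))"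
proof -
  have f2: "f \<in> L2_space L" using f by (simp add: H_space_def)
  have ell: "elliptic (exp (- S)) (exp S) (\<lambda>x. exp (b x))"
    unfolding elliptic_def using b by (fastforce simp: abs_le_iff)
  have V: "u \<in> V_space D" and eq: "\<And>v. v \<in> V_space D \<Longrightarrow> energy (\<lambda>x. exp (b x)) u v = H_functional D f v"
    using u weak_solution_iff[OF ell] by auto
  have mB [measurable]: "B n \<in> borel_measurable L" for n
    by (rule continuous_measurable_L[OF tcd_continuous[OF B(1)]])
  have mg [measurable]: "grad (B n) \<in> borel_measurable L" for n
    by (rule continuous_measurable_L[OF continuous_grad[OF B(1)]])
  have mwu [measurable]: "wgrad u \<in> borel_measurable L" by (rule L2_measurable[OF V_grad_L2[OF V]])
  have mf [measurable]: "f \<in> borel_measurable L" by (rule L2_measurable[OF f2])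
  note [measurable] = b(1) G(1)
  have g1: "(\<lambda>x. exp (- b x) * f x) \<in> L2_space L"
    using L2_mult_bounded(1)[OF f2, of "\<lambda>x. exp (- b x)" "exp S"] b by (auto simp: abs_le_iff)
  have g2: "(\<lambda>x. G x \<bullet> wgrad u x) \<in> L2_space L"
  proof (rule L2_dominated[OF _ V_grad_L2[OF V], where C=\<Gamma>])
    show "AE x in L. norm (G x \<bullet> wgrad u x) \<le> \<Gamma> * norm (wgrad u x)"
      using G(2) by (intro AE_I2) (auto intro!: order_trans[OF Cauchy_Schwarz_ineq2] mult_right_mono)
  qed measurable
  have g: "(\<lambda>x. - (exp (- b x) * f x + G x \<bullet> wgrad u x)) \<in> L2_space L"
    using L2_scale[OF L2_add[OF g1 g2], of "-1"] by simp
  have E0: "E \<ge> 0" using \<epsilon> by (meson LIMSEQ_le_const2)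
  have "(LINT x|L. u x * laplacian \<theta> x) = (LINT x|L. - (exp (- b x) * f x + G x \<bullet> wgrad u x) * \<theta> x)"
    if \<theta>: "\<theta> \<in> test_functions D" for \<theta>
  proof -
    have t: "times_cont_diff 1 \<theta>" by (rule C1cD[OF test_C1c[OF \<theta>]])
    have cg: "continuous_on UNIV (grad \<theta>)" by (rule continuous_grad[OF t])
    have m\<theta> [measurable]: "\<theta> \<in> borel_measurable L" by (rule test_bounded_measurable[OF \<theta>])
    have mg\<theta> [measurable]: "grad \<theta> \<in> borel_measurable L" by (rule continuous_measurable_L[OF cg])
    obtain C where C: "C \<ge> 0" "\<And>x. \<bar>\<theta> x\<bar> \<le> C" using test_function_bounded[OF \<theta>] by blast
    obtain Cg where Cg: "Cg \<ge> 0" "\<And>x. norm (grad \<theta> x) \<le> Cg"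
    proof -
      define S where "S = closure {x. \<theta> x \<noteq> 0}"
      have S: "compact S" using \<theta> by (auto simp: test_functions_def S_def)
      have "partial_deriv b \<theta> x = 0" if "x \<notin> S" for x b
        using that partial_deriv_supp[of b \<theta>] by (auto simp: S_def)
      then have "grad \<theta> x = 0" if "x \<notin> S" for x
        using that by (simp add: grad_def)
      from compact_support_bounded[OF cg S this] show ?thesis using that by blast
    qed
    define v where "v n x = \<theta> x * exp (- B n x)" for n x
    have tB: "times_cont_diff 1 (\<lambda>x. - B n x)" for n using tcd_scale[OF B(1)[of n], of "-1"] by simp
    have vC: "v n \<in> C1c D" for n
      unfolding v_def by (intro C1c_mult test_C1c \<theta> tcd_exp tB)
    have gv: "grad (v n) x = exp (- B n x) *\<^sub>R (grad \<theta> x - \<theta> x *\<^sub>R grad (B n) x)" for n x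
    proof -
      have d: "\<theta> differentiable (at x)" "(\<lambda>x. - B n x) differentiable (at x)" using t tB[of n] by auto
      have dB: "B n differentiable (at x)" using B(1)[of n] by simp
      have "grad (\<lambda>x. - B n x) x = - grad (B n) x"
        using partial_deriv_scale[OF dB, of _ "-1"] by (simp add: grad_def sum_negf)
      with grad_eqI[OF grad_exp[OF d(2)]] have "grad (\<lambda>x. exp (- B n x)) x = - exp (- B n x) *\<^sub>R grad (B n) x" by simp
      moreover have "(\<lambda>x. exp (- B n x)) differentiable (at x)"
        using grad_exp[OF d(2)] unfolding differentiable_def by blast
      ultimately show ?thesis
        using grad_mult[OF d(1), of "\<lambda>x. exp (- B n x)"] by (simp add: v_def[abs_def] algebra_simps)
    qed
    \<comment> \<open>Coefficient and test function combine to the weight exp (b - B n), which tends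
      to 1, while the gradient of exp (- B n) produces the drift term. Dominated convergence on both
      sides then yields the equation with \<open>G\<close>.\<close>
    have key: "(LINT x|L. exp (b x - B n x) * (wgrad u x \<bullet> (grad \<theta> x - \<theta> x *\<^sub>R grad (B n) x))) = (LINT x|L. f x * (\<theta> x * exp (- B n x)))" for n
    proof -
      have wv: "AE x in L. wgrad (v n) x = grad (v n) x"
        by (rule weak_gradient_AE[OF C1c_weak_gradient[OF vC]])
      have mv: "wgrad (v n) \<in> borel_measurable L" by (rule L2_measurable[OF V_grad_L2[OF C1c_V[OF vC]]])
      have "energy (\<lambda>x. exp (b x)) u (v n) = (LINT x|L. exp (b x - B n x) * (wgrad u x \<bullet> (grad \<theta> x - \<theta> x *\<^sub>R grad (B n) x)))"
        unfolding energy_def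
      proof (rule integral_cong_AE)
        show "AE x in L. exp (b x) * (wgrad u x \<bullet> wgrad (v n) x) = exp (b x - B n x) * (wgrad u x \<bullet> (grad \<theta> x - \<theta> x *\<^sub>R grad (B n) x))"
          using wv
        proof eventually_elim
          case (elim x)
          show ?case unfolding elim gv inner_scaleR_right by (simp add: exp_diff exp_minus divide_inverse)
        qed
      qed (use mv in measurable)
      then show ?thesis using eq[OF C1c_V[OF vC], of n] by (simp add: H_functional_def v_def)
    qed
    have limB: "(\<lambda>n. B n x) \<longlonglongrightarrow> b x" and limG: "(\<lambda>n. grad (B n) x) \<longlonglongrightarrow> G x" if "x \<in> D" for x
    proof -
      have "(\<lambda>n. B n x - b x) \<longlonglongrightarrow> 0"
        by (rule Lim_null_comparison[OF _ \<epsilon>(1)]) (use B(2) that in auto)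
      then show "(\<lambda>n. B n x) \<longlonglongrightarrow> b x" by (simp add: LIM_zero_cancel)
      have "(\<lambda>n. grad (B n) x - G x) \<longlonglongrightarrow> 0"
        by (rule Lim_null_comparison[OF _ \<epsilon>(1)]) (use G(3) that in auto)
      then show "(\<lambda>n. grad (B n) x) \<longlonglongrightarrow> G x" by (simp add: LIM_zero_cancel)
    qed
    have bB: "exp (b x - B n x) \<le> exp E" if "x \<in> D" for x n
      using B(2)[OF that, of n] \<epsilon>(2)[of n] by simp
    have "(\<lambda>n. LINT x|L. f x * (\<theta> x * exp (- B n x))) \<longlonglongrightarrow> (LINT x|L. f x * (\<theta> x * exp (- b x)))"
    proof (rule integral_dominated_convergence[where w="\<lambda>x. (C * exp (S + E)) * norm (f x)"])
      show "integrable L (\<lambda>x. C * exp (S + E) * norm (f x))"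
        using L2_integrable[OF f2] by simp
      show "AE x in L. (\<lambda>n. f x * (\<theta> x * exp (- B n x))) \<longlonglongrightarrow> f x * (\<theta> x * exp (- b x))"
        by (intro AE_I2 tendsto_intros limB) simp
      show "AE x in L. norm (f x * (\<theta> x * exp (- B n x))) \<le> C * exp (S + E) * norm (f x)" for n
      proof (rule AE_I2)
        fix x assume "x \<in> space L"
        then have x: "x \<in> D" by simp
        have "- B n x \<le> S + E" using B(2)[OF x, of n] \<epsilon>(2)[of n] b(2)[OF x] by linarith
        then have "\<bar>\<theta> x\<bar> * exp (- B n x) \<le> C * exp (S + E)" using C by (intro mult_mono) auto
        then have "\<bar>f x\<bar> * (\<bar>\<theta> x\<bar> * exp (- B n x)) \<le> \<bar>f x\<bar> * (C * exp (S + E))" by (intro mult_left_mono) auto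
        then show "norm (f x * (\<theta> x * exp (- B n x))) \<le> C * exp (S + E) * norm (f x)" by (simp add: abs_mult mult.commute)
      qed
    qed measurable
    moreover have "(\<lambda>n. LINT x|L. exp (b x - B n x) * (wgrad u x \<bullet> (grad \<theta> x - \<theta> x *\<^sub>R grad (B n) x))) \<longlonglongrightarrow>
        (LINT x|L. exp (b x - b x) * (wgrad u x \<bullet> (grad \<theta> x - \<theta> x *\<^sub>R G x)))"
    proof (rule integral_dominated_convergence[where w="\<lambda>x. exp E * (Cg + C * (\<Gamma> + E)) * norm (wgrad u x)"])
      show "integrable L (\<lambda>x. exp E * (Cg + C * (\<Gamma> + E)) * norm (wgrad u x))"
        using L2_integrable[OF L2_norm_fun[OF V_grad_L2[OF V]]] by simp
      show "AE x in L. (\<lambda>n. exp (b x - B n x) * (wgrad u x \<bullet> (grad \<theta> x - \<theta> x *\<^sub>R grad (B n) x))) \<longlonglongrightarrow>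
          exp (b x - b x) * (wgrad u x \<bullet> (grad \<theta> x - \<theta> x *\<^sub>R G x))"
        by (intro AE_I2 tendsto_intros limB limG) simp_all
      show "AE x in L. norm (exp (b x - B n x) * (wgrad u x \<bullet> (grad \<theta> x - \<theta> x *\<^sub>R grad (B n) x))) \<le> exp E * (Cg + C * (\<Gamma> + E)) * norm (wgrad u x)" for n
      proof (rule AE_I2)
        fix x assume "x \<in> space L"
        then have x: "x \<in> D" by simp
        have "norm (grad (B n) x) \<le> norm (grad (B n) x - G x) + norm (G x)"
          using norm_triangle_ineq[of "grad (B n) x - G x" "G x"] by simp
        also have "\<dots> \<le> \<Gamma> + E" using G(2)[OF x] G(3)[OF x, of n] \<epsilon>(2)[of n] by linarith
        finally have *: "norm (\<theta> x *\<^sub>R grad (B n) x) \<le> C * (\<Gamma> + E)" using C by (auto intro: mult_mono)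
        have "norm (grad \<theta> x - \<theta> x *\<^sub>R grad (B n) x) \<le> Cg + C * (\<Gamma> + E)"
          using norm_triangle_ineq4[of "grad \<theta> x" "\<theta> x *\<^sub>R grad (B n) x"] * Cg(2)[of x] by linarith
        then have "\<bar>wgrad u x \<bullet> (grad \<theta> x - \<theta> x *\<^sub>R grad (B n) x)\<bar> \<le> norm (wgrad u x) * (Cg + C * (\<Gamma> + E))"
          by (intro order_trans[OF Cauchy_Schwarz_ineq2] mult_left_mono) auto
        then have "exp (b x - B n x) * \<bar>wgrad u x \<bullet> (grad \<theta> x - \<theta> x *\<^sub>R grad (B n) x)\<bar> \<le> exp E * (norm (wgrad u x) * (Cg + C * (\<Gamma> + E)))"
          using bB[OF x, of n] by (intro mult_mono) auto
        then show "norm (exp (b x - B n x) * (wgrad u x \<bullet> (grad \<theta> x - \<theta> x *\<^sub>R grad (B n) x))) \<le> exp E * (Cg + C * (\<Gamma> + E)) * norm (wgrad u x)"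
          by (simp add: abs_mult mult_ac)
      qed
    qed measurable
    ultimately have lim: "(LINT x|L. f x * (\<theta> x * exp (- b x))) = (LINT x|L. wgrad u x \<bullet> (grad \<theta> x - \<theta> x *\<^sub>R G x))"
      unfolding key by (simp add: LIMSEQ_unique)
    have i1: "integrable L (\<lambda>x. wgrad u x \<bullet> grad \<theta> x)"
      by (intro L2_inner_integrable V_grad_L2 V C1c_L2 test_C1c \<theta>)
    have i2: "integrable L (\<lambda>x. (G x \<bullet> wgrad u x) * \<theta> x)"
      by (intro L2_mult_integrable g2 C1c_L2 test_C1c \<theta>)
    have i3: "integrable L (\<lambda>x. (exp (- b x) * f x) * \<theta> x)"
      by (intro L2_mult_integrable g1 C1c_L2 test_C1c \<theta>)
    have "(LINT x|L. wgrad u x \<bullet> (grad \<theta> x - \<theta> x *\<^sub>R G x)) = (LINT x|L. wgrad u x \<bullet> grad \<theta> x - (G x \<bullet> wgrad u x) * \<theta> x)"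
      by (simp add: inner_diff_right inner_commute mult.commute)
    also have "\<dots> = (LINT x|L. wgrad u x \<bullet> grad \<theta> x) - (LINT x|L. (G x \<bullet> wgrad u x) * \<theta> x)"
      using i1 i2 by simp
    finally have "(LINT x|L. wgrad u x \<bullet> grad \<theta> x) = (LINT x|L. (exp (- b x) * f x) * \<theta> x) + (LINT x|L. (G x \<bullet> wgrad u x) * \<theta> x)"
      using lim by (simp add: mult_ac)
    also have "\<dots> = (LINT x|L. (exp (- b x) * f x + G x \<bullet> wgrad u x) * \<theta> x)"
      using i2 i3 by (simp add: distrib_right)
    finally show ?thesis
      unfolding laplacian_by_parts[OF V \<theta>] by (simp only: mult_minus_left Bochner_Integration.integral_minus)
  qed
  then show ?thesis unfolding is_weak_laplacian_def using g by blast
qed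

end

lemma (in unit_domain) weak_solution_cong:
  assumes "\<And>x. x \<in> D \<Longrightarrow> a x = a' x"
  shows "weak_solution D a F u \<longleftrightarrow> weak_solution D a' F u"
proof -
  have "has_bochner_integral L (\<lambda>x. a x * (wgrad u x \<bullet> wgrad v x)) z \<longleftrightarrow> has_bochner_integral L (\<lambda>x. a' x * (wgrad u x \<bullet> wgrad v x)) z" for v z
    by (rule has_bochner_integral_cong) (auto simp: assms)
  then show ?thesis by (simp add: weak_solution_def)
qed

lemma abs_exp_diff_le:
  fixes x y :: real
  assumes "x \<le> S" "y \<le> S"
  shows "\<bar>exp x - exp y\<bar> \<le> exp S * \<bar>x - y\<bar>"
proof -
  have *: "exp x - exp y \<le> exp S * \<bar>x - y\<bar>" if "y \<le> x" "x \<le> S" for x y :: real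
  proof -
    have "1 - exp (y - x) \<le> x - y" using exp_ge_add_one_self[of "y - x"] by linarith
    then have "exp x * (1 - exp (y - x)) \<le> exp S * \<bar>x - y\<bar>" using that by (intro mult_mono) auto
    then show ?thesis by (simp add: right_diff_distrib exp_add[symmetric])
  qed
  show ?thesis
  proof (cases "y \<le> x")
    case True
    then have "exp y \<le> exp x" by simp
    with *[OF True assms(1)] show ?thesis by linarith
  next
    case False
    then have "exp x \<le> exp y" "x \<le> y" by auto
    with *[of x y] assms(2) show ?thesis by (simp add: abs_minus_commute)
  qed
qed

context unit_domain
begin

section \<open>The interpolation spaces\<close>

lemma W_zero: "(\<lambda>x. 0) \<in> W_space D" "W_norm D (\<lambda>x. 0) = 0"
proof -
  have "is_weak_laplacian D (\<lambda>x. 0) (\<lambda>x. 0)" by (simp add: is_weak_laplacian_def L2_zero)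
  then show "(\<lambda>x. 0) \<in> W_space D" "W_norm D (\<lambda>x. 0) = 0"
    using test_V[OF test_zero] by (auto simp: W_space_def W_norm_eq L2_norm_def)
qed

lemma W_norm_nonneg [simp]: "0 \<le> W_norm D v"
  by (simp add: W_norm_def)

lemma K_le:
  assumes "w \<in> W_space D" "z \<ge> 0"
  shows "K_functional D v z \<le> V_norm D (\<lambda>x. v x - w x) + z * W_norm D w"
  unfolding K_functional_def
  by (rule cINF_lower[OF _ assms(1)]) (use assms(2) in \<open>auto intro!: bdd_belowI2[where m=0]\<close>)

lemma K_nonneg: "z \<ge> 0 \<Longrightarrow> 0 \<le> K_functional D v z"
  unfolding K_functional_def using W_zero by (intro cINF_greatest) auto

lemma K_le_V: "z \<ge> 0 \<Longrightarrow> K_functional D v z \<le> V_norm D v"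
  using K_le[OF W_zero(1), of z v] W_zero(2) by simp

text \<open>Competitors p for v and q for w combine to a competitor for the combination.
  Coefficients of modulus 1 cover sums and differences.\<close>

lemma K_triangle:
  assumes v: "v \<in> V_space D" and w: "w \<in> V_space D" and z: "z \<ge> 0" and ce: "\<bar>c\<bar> = 1" "\<bar>e\<bar> = 1"
  shows "K_functional D (\<lambda>x. c * v x + e * w x) z \<le> K_functional D v z + K_functional D w z"
proof -
  let ?u = "\<lambda>x. c * v x + e * w x"
  have *: "K_functional D ?u z \<le> (V_norm D (\<lambda>x. v x - p x) + z * W_norm D p) + (V_norm D (\<lambda>x. w x - q x) + z * W_norm D q)"
    if p: "p \<in> W_space D" and q: "q \<in> W_space D" for p q
  proof -
    let ?r = "\<lambda>x. c * p x + e * q x"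
    have 1: "(\<lambda>x. ?u x - ?r x) = (\<lambda>x. c * (v x - p x) + e * (w x - q x))" by (auto simp: algebra_simps)
    note V = V_diff(1)[OF v W_V[OF p]] V_diff(1)[OF w W_V[OF q]]
    have "V_norm D (\<lambda>x. ?u x - ?r x) \<le> V_norm D (\<lambda>x. v x - p x) + V_norm D (\<lambda>x. w x - q x)"
      unfolding 1 V_lincomb(3)[OF V] V_norm_def[of D "\<lambda>x. v x - p x"] V_norm_def[of D "\<lambda>x. w x - q x"]
      using L2_triangle[OF L2_scale[OF V_grad_L2[OF V(1)], of c] L2_scale[OF V_grad_L2[OF V(2)], of e]] ce
      by (simp add: L2_norm_scale)
    moreover have "z * W_norm D ?r \<le> z * (W_norm D p + W_norm D q)"
      using W_lincomb(2)[OF p q, of c e] ce z by (intro mult_left_mono) auto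
    ultimately show ?thesis
      using K_le[OF W_lincomb(1)[OF p q, of c e] z, of ?u] by (simp add: distrib_left)
  qed
  \<comment> \<open>The infima over p and q are taken one after the other.\<close>
  have "K_functional D ?u z - (V_norm D (\<lambda>x. w x - q x) + z * W_norm D q) \<le> K_functional D v z"
    if q: "q \<in> W_space D" for q
    unfolding K_functional_def[of D v] using W_zero(1) *[OF _ q] by (intro cINF_greatest) (auto simp: algebra_simps)
  then have "K_functional D ?u z - K_functional D v z \<le> K_functional D w z"
    unfolding K_functional_def[of D w] using W_zero(1) by (intro cINF_greatest) (auto simp: algebra_simps)
  then show ?thesis by simp
qed

lemma Wr_I:
  assumes r: "0 < r" "r < 1" and v: "v \<in> V_space D"
    and K: "\<And>z. z > 0 \<Longrightarrow> z powr (- r) * K_functional D v z \<le> C"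
  shows "v \<in> Wr_space D r" "Wr_norm D r v \<le> C"
proof -
  have "bdd_above ((\<lambda>z. z powr (- r) * K_functional D v z) ` {0<..})"
    using K by (intro bdd_aboveI2) auto
  then show "v \<in> Wr_space D r" using v r by (simp add: Wr_space_def)
  show "Wr_norm D r v \<le> C"
    unfolding Wr_norm_def using r K by (auto intro!: cSUP_least)
qed

lemma Wr_D:
  assumes r: "r < 1" and v: "v \<in> Wr_space D r" and z: "z > 0"
  shows "z powr (- r) * K_functional D v z \<le> Wr_norm D r v"
  using assms unfolding Wr_norm_def Wr_space_def by (auto intro!: cSUP_upper)

lemma Wr_V: "v \<in> Wr_space D r \<Longrightarrow> v \<in> V_space D"
  by (auto simp: Wr_space_def W_space_def split: if_splits)

lemma Wr_norm_nonneg: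
  assumes "v \<in> Wr_space D r"
  shows "0 \<le> Wr_norm D r v"
proof (cases "r = 1")
  case False
  then have bdd: "bdd_above ((\<lambda>z. z powr (- r) * K_functional D v z) ` {0<..})"
    using assms by (simp add: Wr_space_def)
  have "0 \<le> 1 powr (- r) * K_functional D v 1" using K_nonneg[of 1 v] by simp
  also have "\<dots> \<le> (SUP z\<in>{0<..}. z powr (- r) * K_functional D v z)"
    by (rule cSUP_upper[OF _ bdd]) simp
  finally show ?thesis using False by (simp add: Wr_norm_def)
qed (simp add: Wr_norm_def)

lemma Wr_triangle:
  assumes r: "0 < r" "r \<le> 1" and v: "v \<in> Wr_space D r" and w: "w \<in> Wr_space D r" and ce: "\<bar>c\<bar> = 1" "\<bar>e\<bar> = 1"
  shows "(\<lambda>x. c * v x + e * w x) \<in> Wr_space D r"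
    "Wr_norm D r (\<lambda>x. c * v x + e * w x) \<le> Wr_norm D r v + Wr_norm D r w"
proof -
  have "(\<lambda>x. c * v x + e * w x) \<in> Wr_space D r \<and> Wr_norm D r (\<lambda>x. c * v x + e * w x) \<le> Wr_norm D r v + Wr_norm D r w"
  proof (cases "r = 1")
    case True
    then show ?thesis using W_lincomb[of v w c e] v w ce by (simp add: Wr_space_def Wr_norm_def)
  next
    case False
    then have r1: "r < 1" using r by simp
    have "z powr (- r) * K_functional D (\<lambda>x. c * v x + e * w x) z \<le> Wr_norm D r v + Wr_norm D r w" if z: "z > 0" for z
    proof -
      have "z powr (- r) * K_functional D (\<lambda>x. c * v x + e * w x) z \<le> z powr (- r) * (K_functional D v z + K_functional D w z)"
        using z by (intro mult_left_mono K_triangle Wr_V[OF v] Wr_V[OF w] ce) auto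
      also have "\<dots> \<le> Wr_norm D r v + Wr_norm D r w"
        unfolding distrib_left by (intro add_mono Wr_D r1 v w z)
      finally show ?thesis .
    qed
    then show ?thesis using Wr_I[OF r(1) r1 V_lincomb(1)[OF Wr_V[OF v] Wr_V[OF w]]] by blast
  qed
  then show "(\<lambda>x. c * v x + e * w x) \<in> Wr_space D r"
    "Wr_norm D r (\<lambda>x. c * v x + e * w x) \<le> Wr_norm D r v + Wr_norm D r w" by auto
qed

lemma Wr_triangle_rev:
  assumes r: "0 < r" "r \<le> 1" and v: "v \<in> Wr_space D r" and w: "w \<in> Wr_space D r"
  shows "\<bar>Wr_norm D r v - Wr_norm D r w\<bar> \<le> Wr_norm D r (\<lambda>x. v x - w x)"
proof -
  have 1: "(\<lambda>x. v x - w x) \<in> Wr_space D r" using Wr_triangle(1)[OF r v w, of 1 "-1"] by simp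
  have "Wr_norm D r v \<le> Wr_norm D r (\<lambda>x. v x - w x) + Wr_norm D r w"
    using Wr_triangle(2)[OF r 1 w, of 1 1] by simp
  moreover have "Wr_norm D r w \<le> Wr_norm D r (\<lambda>x. v x - w x) + Wr_norm D r v"
    using Wr_triangle(2)[OF r 1 v, of "-1" 1] by simp
  ultimately show ?thesis by linarith
qed

text \<open>The supremum is split at z = \<delta>: below it z^(r' - r) is at most \<delta>^(r' - r),
  above it the K-functional is at most the V norm. With \<delta> free, boundedness in the stronger
  space and convergence in V give convergence in between.\<close>

lemma Wr_interpolation:
  assumes r: "0 < r" "r < r'" "r' < 1" and v: "v \<in> Wr_space D r'" and \<delta>: "\<delta> > 0"
  shows "v \<in> Wr_space D r" "Wr_norm D r v \<le> \<delta> powr (r' - r) * Wr_norm D r' v + \<delta> powr (- r) * V_norm D v"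
proof -
  have "z powr (- r) * K_functional D v z \<le> \<delta> powr (r' - r) * Wr_norm D r' v + \<delta> powr (- r) * V_norm D v" if z: "z > 0" for z
  proof (cases "z \<le> \<delta>")
    case True
    have "z powr (- r) * K_functional D v z = z powr (r' - r) * (z powr (- r') * K_functional D v z)"
      using z by (simp add: powr_add[symmetric] mult.assoc[symmetric])
    also have "\<dots> \<le> \<delta> powr (r' - r) * Wr_norm D r' v"
      using z True r K_nonneg[of z v] by (intro mult_mono Wr_D v powr_mono2) auto
    finally show ?thesis by (simp add: add_increasing2)
  next
    case False
    have "z powr (- r) * K_functional D v z \<le> \<delta> powr (- r) * V_norm D v"
      using z False r \<delta> K_nonneg[of z v] by (intro mult_mono K_le_V powr_mono2') auto
    moreover have "0 \<le> \<delta> powr (r' - r) * Wr_norm D r' v" using Wr_norm_nonneg[OF v] by simp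
    ultimately show ?thesis by linarith
  qed
  with Wr_I[OF r(1) less_trans[OF r(2,3)] Wr_V[OF v]] show "v \<in> Wr_space D r"
    "Wr_norm D r v \<le> \<delta> powr (r' - r) * Wr_norm D r' v + \<delta> powr (- r) * V_norm D v" by blast+
qed

section \<open>Coefficients given by a multiscale series\<close>

text \<open>Pieces of frequency 2^j as in a Littlewood-Paley decomposition: differentiating costs a
  factor 2^j, and summability with the weight 2^(jr) measures smoothness r. Differentiability is
  global while the bounds concern D only, so that \<open>grad\<close> meets no boundary.\<close>

definition level_series :: "real \<Rightarrow> (nat \<Rightarrow> 'a \<Rightarrow> real) \<Rightarrow> (nat \<Rightarrow> real) \<Rightarrow> bool" where
  "level_series r \<beta> c \<longleftrightarrow> (\<forall>j. times_cont_diff 1 (\<beta> j)) \<and> (\<forall>j. 0 \<le> c j) \<and>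
     (\<forall>j. \<forall>x\<in>D. \<bar>\<beta> j x\<bar> \<le> c j) \<and>
     (\<forall>j. \<forall>x\<in>D. \<forall>e\<in>Basis. \<bar>partial_deriv e (\<beta> j) x\<bar> \<le> 2 ^ j * c j) \<and>
     summable (\<lambda>j. 2 powr (real j * r) * c j)"

definition level_norm :: "real \<Rightarrow> (nat \<Rightarrow> real) \<Rightarrow> real" where
  "level_norm r c = (\<Sum>j. 2 powr (real j * r) * c j)"

definition level_sum :: "(nat \<Rightarrow> 'a \<Rightarrow> real) \<Rightarrow> 'a \<Rightarrow> real" where
  "level_sum \<beta> x = (\<Sum>j. \<beta> j x)"

text \<open>The termwise gradient. It is used for r = 1, where the series of gradients converges
  uniformly on D.\<close>

definition level_grad :: "(nat \<Rightarrow> 'a \<Rightarrow> real) \<Rightarrow> 'a \<Rightarrow> 'a" where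
  "level_grad \<beta> x = (\<Sum>j. grad (\<beta> j) x)"

context
  fixes r :: real and \<beta> :: "nat \<Rightarrow> 'a \<Rightarrow> real" and c :: "nat \<Rightarrow> real"
  assumes lev: "level_series r \<beta> c" and r0: "0 \<le> r"
begin

lemma level_tcd: "times_cont_diff 1 (\<beta> j)"
  and level_nonneg: "0 \<le> c j"
  and level_abs: "x \<in> D \<Longrightarrow> \<bar>\<beta> j x\<bar> \<le> c j"
  and level_partial: "x \<in> D \<Longrightarrow> e \<in> Basis \<Longrightarrow> \<bar>partial_deriv e (\<beta> j) x\<bar> \<le> 2 ^ j * c j"
  and level_summable: "summable (\<lambda>j. 2 powr (real j * r) * c j)"
  using lev by (auto simp: level_series_def)

lemma level_le: "c j \<le> 2 powr (real j * r) * c j"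
proof -
  have "1 * c j \<le> 2 powr (real j * r) * c j"
    using r0 level_nonneg[of j] by (intro mult_right_mono ge_one_powr_ge_zero) auto
  then show ?thesis by simp
qed

lemma level_summable0: "summable c"
  by (rule summable_comparison_test'[OF level_summable, of 0]) (use level_le level_nonneg in auto)

lemma level_norm_nonneg: "0 \<le> level_norm r c"
  unfolding level_norm_def by (intro suminf_nonneg level_summable) (use level_nonneg in auto)

lemma level_norm_partial: "finite I \<Longrightarrow> (\<Sum>j\<in>I. 2 powr (real j * r) * c j) \<le> level_norm r c"
  unfolding level_norm_def by (intro sum_le_suminf level_summable) (use level_nonneg in auto)

lemma level_sum_summable: "x \<in> D \<Longrightarrow> summable (\<lambda>j. \<beta> j x)"
  by (rule summable_comparison_test'[OF level_summable0, of 0]) (use level_abs in auto)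

text \<open>On the levels j \<ge> J the weight 2^(jr) is at least 2^(Jr), so the tail is at most
  2^(-Jr) times the weighted norm. The instance J = 0 is the sup bound.\<close>

lemma level_sum_diff:
  assumes "x \<in> D"
  shows "\<bar>level_sum \<beta> x - (\<Sum>j<J. \<beta> j x)\<bar> \<le> 2 powr (- (real J * r)) * level_norm r c"
proof -
  have s1: "summable (\<lambda>j. \<beta> (j + J) x)" using summable_ignore_initial_segment[OF level_sum_summable[OF assms]] .
  have s2: "summable (\<lambda>j. 2 powr (real (j + J) * r) * c (j + J))"
    using summable_ignore_initial_segment[OF level_summable, of J] by simp
  have le: "\<bar>\<beta> (j + J) x\<bar> \<le> 2 powr (- (real J * r)) * (2 powr (real (j + J) * r) * c (j + J))" for j
  proof -
    have "\<bar>\<beta> (j + J) x\<bar> \<le> 1 * c (j + J)" using level_abs[OF assms] by simp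
    also have "\<dots> \<le> 2 powr (real j * r) * c (j + J)"
      using r0 level_nonneg by (intro mult_right_mono ge_one_powr_ge_zero) auto
    also have "2 powr (real j * r) = 2 powr (- (real J * r)) * 2 powr (real (j + J) * r)"
      by (simp add: powr_add[symmetric] algebra_simps)
    finally show ?thesis by (simp add: mult.assoc)
  qed
  have "level_sum \<beta> x - (\<Sum>j<J. \<beta> j x) = (\<Sum>j. \<beta> (j + J) x)"
    unfolding level_sum_def using suminf_minus_initial_segment[OF level_sum_summable[OF assms], of J] by simp
  also have "\<bar>\<dots>\<bar> \<le> (\<Sum>j. 2 powr (- (real J * r)) * (2 powr (real (j + J) * r) * c (j + J)))"
  proof -
    have sn: "summable (\<lambda>j. \<bar>\<beta> (j + J) x\<bar>)"
      by (rule summable_comparison_test'[OF summable_mult[OF s2], of 0]) (use le in auto)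
    have "\<bar>\<Sum>j. \<beta> (j + J) x\<bar> \<le> (\<Sum>j. \<bar>\<beta> (j + J) x\<bar>)" by (rule summable_rabs[OF sn])
    also have "\<dots> \<le> (\<Sum>j. 2 powr (- (real J * r)) * (2 powr (real (j + J) * r) * c (j + J)))"
      by (intro suminf_le le sn summable_mult s2)
    finally show ?thesis .
  qed
  also have "\<dots> = 2 powr (- (real J * r)) * (\<Sum>j. 2 powr (real (j + J) * r) * c (j + J))"
    by (rule suminf_mult[OF s2])
  also have "\<dots> \<le> 2 powr (- (real J * r)) * level_norm r c"
  proof (intro mult_left_mono)
    have "level_norm r c = (\<Sum>j. 2 powr (real (j + J) * r) * c (j + J)) + (\<Sum>j<J. 2 powr (real j * r) * c j)"
      unfolding level_norm_def using suminf_split_initial_segment[OF level_summable, of J] by simp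
    moreover have "0 \<le> (\<Sum>j<J. 2 powr (real j * r) * c j)" using level_nonneg by (intro sum_nonneg) auto
    ultimately show "(\<Sum>j. 2 powr (real (j + J) * r) * c (j + J)) \<le> level_norm r c" by linarith
  qed simp
  finally show ?thesis .
qed

lemma level_sum_abs: "x \<in> D \<Longrightarrow> \<bar>level_sum \<beta> x\<bar> \<le> level_norm r c"
  using level_sum_diff[of x 0] by simp

lemma level_sum_measurable: "level_sum \<beta> \<in> borel_measurable L"
  unfolding level_sum_def[abs_def]
  by (intro borel_measurable_suminf continuous_measurable_L tcd_continuous[OF level_tcd])

lemma level_sum_elliptic:
  "elliptic (exp (- level_norm r c)) (exp (level_norm r c)) (\<lambda>x. exp (level_sum \<beta> x))"
  unfolding elliptic_def using level_sum_abs level_sum_measurable by (fastforce simp: abs_le_iff)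

lemma level_grad_norm: "x \<in> D \<Longrightarrow> norm (grad (\<beta> j) x) \<le> real DIM('a) * (2 ^ j * c j)"
proof -
  assume x: "x \<in> D"
  have "norm (grad (\<beta> j) x) \<le> (\<Sum>b\<in>Basis. \<bar>grad (\<beta> j) x \<bullet> b\<bar>)" by (rule norm_le_l1)
  also have "\<dots> \<le> (\<Sum>b\<in>(Basis::'a set). 2 ^ j * c j)"
    by (intro sum_mono) (simp add: grad_inner level_partial x)
  finally show ?thesis by simp
qed

lemma level_partial_tcd: "times_cont_diff 1 (\<lambda>x. \<Sum>j<J. \<beta> j x)"
  by (intro tcd_sum level_tcd)

lemma level_partial_grad: "grad (\<lambda>x. \<Sum>j<J. \<beta> j x) x = (\<Sum>j<J. grad (\<beta> j) x)"
proof -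
  have "\<beta> j differentiable (at x)" for j using level_tcd[of j] by simp
  then show ?thesis
    unfolding grad_def by (simp add: partial_deriv_sum scaleR_sum_left) (rule sum.swap)
qed

lemma level_partial_abs: "x \<in> D \<Longrightarrow> \<bar>\<Sum>j<J. \<beta> j x\<bar> \<le> level_norm r c"
proof -
  assume x: "x \<in> D"
  have "\<bar>\<Sum>j<J. \<beta> j x\<bar> \<le> (\<Sum>j<J. 2 powr (real j * r) * c j)"
    by (rule order_trans[OF sum_abs]) (intro sum_mono order_trans[OF level_abs[OF x] level_le])
  also have "\<dots> \<le> level_norm r c" by (rule level_norm_partial) simp
  finally show ?thesis .
qed

lemma level_partial_elliptic:
  "elliptic (exp (- level_norm r c)) (exp (level_norm r c)) (\<lambda>x. exp (\<Sum>j<J. \<beta> j x))"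
  unfolding elliptic_def
proof (intro conjI ballI)
  show "(\<lambda>x. exp (\<Sum>j<J. \<beta> j x)) \<in> borel_measurable L"
    by (rule continuous_measurable_L[OF tcd_continuous[OF tcd_exp[OF level_partial_tcd]]])
  fix x assume "x \<in> D"
  from level_partial_abs[OF this, of J]
  have "- level_norm r c \<le> (\<Sum>j<J. \<beta> j x)" "(\<Sum>j<J. \<beta> j x) \<le> level_norm r c" by linarith+
  then show "exp (- level_norm r c) \<le> exp (\<Sum>j<J. \<beta> j x)" "exp (\<Sum>j<J. \<beta> j x) \<le> exp (level_norm r c)"
    by simp_all
qed simp

end

end

text \<open>Comparison with a summable majorant; the instance n = 0 estimates the full sum.\<close>

lemma suminf_tail_le:
  fixes f :: "nat \<Rightarrow> 'b::banach"
  assumes g: "summable g" and le: "\<And>j. norm (f j) \<le> g j"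
  shows "norm (suminf f - (\<Sum>j<n. f j)) \<le> suminf g - (\<Sum>j<n. g j)"
proof -
  have f: "summable f" by (rule summable_comparison_test'[OF g, of 0]) (use le in auto)
  have sn: "summable (\<lambda>j. norm (f (j + n)))"
    by (rule summable_comparison_test'[OF summable_ignore_initial_segment[OF g, of n], of 0]) (use le in auto)
  have "norm (\<Sum>j. f (j + n)) \<le> (\<Sum>j. norm (f (j + n)))" by (rule summable_norm[OF sn])
  also have "\<dots> \<le> (\<Sum>j. g (j + n))"
    by (intro suminf_le le sn summable_ignore_initial_segment[OF g])
  finally show ?thesis
    using suminf_minus_initial_segment[OF f, of n] suminf_minus_initial_segment[OF g, of n] by simp
qed

section \<open>Bounds for solutions with a multiscale exponent\<close>

context unit_domain
begin

lemma laplacian_norm_bound: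
  assumes f: "f \<in> H_space D" and u: "u \<in> V_space D"
    and l: "is_weak_laplacian D u (\<lambda>x. - (exp (- b x) * f x + G x \<bullet> wgrad u x))"
    and b: "b \<in> borel_measurable L" "\<And>x. x \<in> D \<Longrightarrow> \<bar>b x\<bar> \<le> S"
    and G: "G \<in> borel_measurable L" "\<And>x. x \<in> D \<Longrightarrow> norm (G x) \<le> \<Gamma>" "\<Gamma> \<ge> 0"
  shows "u \<in> W_space D" "W_norm D u \<le> exp S * H_norm D f + \<Gamma> * V_norm D u"
proof -
  show "u \<in> W_space D" using l u by (auto simp: W_space_def)
  have f2: "f \<in> L2_space L" using f by (simp add: H_space_def)
  have g1: "(\<lambda>x. exp (- b x) *\<^sub>R f x) \<in> L2_space L" "L2_norm L (\<lambda>x. exp (- b x) *\<^sub>R f x) \<le> exp S * L2_norm L f"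
    using L2_mult_bounded[OF f2, of "\<lambda>x. exp (- b x)" "exp S"] b by (auto simp: abs_le_iff)
  note [measurable] = L2_measurable[OF V_grad_L2[OF u]] G(1)
  have m: "(\<lambda>x. G x \<bullet> wgrad u x) \<in> borel_measurable L" by measurable
  have ae: "AE x in L. norm (G x \<bullet> wgrad u x) \<le> \<Gamma> * norm (wgrad u x)"
    using G(2) by (intro AE_I2) (auto intro!: order_trans[OF Cauchy_Schwarz_ineq2] mult_right_mono)
  have g2: "(\<lambda>x. G x \<bullet> wgrad u x) \<in> L2_space L" "L2_norm L (\<lambda>x. G x \<bullet> wgrad u x) \<le> \<Gamma> * L2_norm L (wgrad u)"
    by (rule L2_dominated[OF m V_grad_L2[OF u] ae]) (rule L2_norm_le[OF m V_grad_L2[OF u] ae G(3)])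
  have "W_norm D u = L2_norm L (\<lambda>x. - 1 *\<^sub>R (exp (- b x) *\<^sub>R f x + G x \<bullet> wgrad u x))"
    unfolding W_norm_eq[OF l] by simp
  also have "\<dots> \<le> L2_norm L (\<lambda>x. exp (- b x) *\<^sub>R f x) + L2_norm L (\<lambda>x. G x \<bullet> wgrad u x)"
    unfolding L2_norm_scale using L2_triangle[OF g1(1) g2(1)] by simp
  finally show "W_norm D u \<le> exp S * H_norm D f + \<Gamma> * V_norm D u"
    using g1(2) g2(2) by (simp add: H_norm_def V_norm_def)
qed

context
  fixes r :: real and \<beta> :: "nat \<Rightarrow> 'a \<Rightarrow> real" and c :: "nat \<Rightarrow> real"
  assumes lev: "level_series r \<beta> c" and r0: "0 \<le> r"
begin

lemma level_V_bound:
  assumes u: "weak_solution D (\<lambda>x. exp (level_sum \<beta> x)) F u"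
    and F: "\<And>v. v \<in> V_space D \<Longrightarrow> \<bar>F v\<bar> \<le> C * V_norm D v" and C: "C \<ge> 0"
  shows "V_norm D u \<le> C * exp (level_norm r c)"
  using weak_solution_bound[OF level_sum_elliptic[OF lev r0] u F C] by (simp add: exp_minus divide_inverse)

text \<open>The truncated exponent is C1 and serves as its own constant approximating sequence with
  error 0. The factor 2 stems from the Poincare inequality inside
  \<open>H_functional_bound\<close>.\<close>

lemma level_partial_W:
  assumes f: "f \<in> H_space D" and w: "weak_solution D (\<lambda>x. exp (\<Sum>j<J. \<beta> j x)) (H_functional D f) w"
    and \<Gamma>: "(\<Sum>j<J. 2 ^ j * c j) \<le> \<Gamma>"
  shows "w \<in> W_space D" "W_norm D w \<le> exp (level_norm r c) * (1 + 2 * real DIM('a) * \<Gamma>) * H_norm D f"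
proof -
  let ?b = "\<lambda>x. \<Sum>j<J. \<beta> j x"
  let ?A = "level_norm r c"
  have t: "times_cont_diff 1 ?b" by (rule level_partial_tcd[OF lev r0])
  have m: "?b \<in> borel_measurable L" by (rule continuous_measurable_L[OF tcd_continuous[OF t]])
  have mg: "grad ?b \<in> borel_measurable L" by (rule continuous_measurable_L[OF continuous_grad[OF t]])
  have \<Gamma>0: "0 \<le> real DIM('a) * \<Gamma>"
  proof -
    have "0 \<le> (\<Sum>j<J. 2 ^ j * c j)" using level_nonneg[OF lev r0] by (intro sum_nonneg) auto
    then show ?thesis using \<Gamma> by simp
  qed
  have gb: "norm (grad ?b x) \<le> real DIM('a) * \<Gamma>" if x: "x \<in> D" for x
  proof -
    have "norm (grad ?b x) \<le> (\<Sum>j<J. real DIM('a) * (2 ^ j * c j))"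
      unfolding level_partial_grad[OF lev r0]
      by (rule order_trans[OF norm_sum]) (intro sum_mono level_grad_norm[OF lev r0 x])
    also have "\<dots> = real DIM('a) * (\<Sum>j<J. 2 ^ j * c j)" by (simp add: sum_distrib_left)
    also have "\<dots> \<le> real DIM('a) * \<Gamma>" using \<Gamma> by (intro mult_left_mono) auto
    finally show ?thesis .
  qed
  have V: "w \<in> V_space D" using w by (simp add: weak_solution_def)
  have l: "is_weak_laplacian D w (\<lambda>x. - (exp (- ?b x) * f x + grad ?b x \<bullet> wgrad w x))"
    by (rule weak_solution_laplacian[OF f w m level_partial_abs[OF lev r0], where B="\<lambda>n. ?b" and \<epsilon>="\<lambda>n. 0" and E=0])
      (use t mg gb in auto)
  note W = laplacian_norm_bound[OF f V l m level_partial_abs[OF lev r0] mg gb \<Gamma>0]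
  show "w \<in> W_space D" by (rule W)
  have "V_norm D w \<le> 2 * H_norm D f * exp ?A"
    using weak_solution_bound[OF level_partial_elliptic[OF lev r0] w H_functional_bound[OF f]]
    by (simp add: exp_minus divide_inverse H_norm_def)
  then have "real DIM('a) * \<Gamma> * V_norm D w \<le> real DIM('a) * \<Gamma> * (2 * H_norm D f * exp ?A)"
    using \<Gamma>0 by (rule mult_left_mono)
  with W(2) show "W_norm D w \<le> exp ?A * (1 + 2 * real DIM('a) * \<Gamma>) * H_norm D f"
    by (simp add: algebra_simps)
qed

text \<open>The truncation J is chosen with 2^(-J) of the order of z.\<close>

lemma level_K_bound:
  assumes f: "f \<in> H_space D" and u: "weak_solution D (\<lambda>x. exp (level_sum \<beta> x)) (H_functional D f) u"
    and r1: "r < 1" and z: "z > 0"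
  shows "z powr (- r) * K_functional D u z \<le> 2 * exp ((5 + 2 * real DIM('a)) * level_norm r c) * H_norm D f"
proof -
  define A where "A = level_norm r c"
  have A: "A \<ge> 0" unfolding A_def by (rule level_norm_nonneg[OF lev r0])
  have fn: "H_norm D f \<ge> 0" by (simp add: H_norm_def)
  have V: "u \<in> V_space D" using u by (simp add: weak_solution_def)
  have Vu: "V_norm D u \<le> 2 * H_norm D f * exp A"
    unfolding A_def by (rule level_V_bound[OF u H_functional_bound[OF f]]) (simp_all add: H_norm_def)
  show ?thesis
    unfolding A_def[symmetric]
  proof (cases "z \<le> 1")
    case False
    \<comment> \<open>For z > 1 the competitor w = 0 suffices.\<close>
    then have "z powr (- r) \<le> 1" using r0 powr_mono2'[of "- r" 1 z] by simp
    then have "z powr (- r) * K_functional D u z \<le> 1 * V_norm D u"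
      using z K_nonneg[of z u] by (intro mult_mono K_le_V) auto
    also have "\<dots> \<le> 2 * H_norm D f * exp A" using Vu by simp
    also have "\<dots> \<le> 2 * H_norm D f * exp ((5 + 2 * real DIM('a)) * A)"
    proof (intro mult_left_mono)
      have "1 * A \<le> (5 + 2 * real DIM('a)) * A" using A by (intro mult_right_mono) auto
      then show "exp A \<le> exp ((5 + 2 * real DIM('a)) * A)" by simp
    qed (use fn in auto)
    finally show "z powr (- r) * K_functional D u z \<le> 2 * exp ((5 + 2 * real DIM('a)) * A) * H_norm D f"
      by (simp add: mult_ac)
  next
    case True
    obtain n where n: "1 / z \<le> 2 ^ n" using real_arch_pow[of 2 "1/z"] by (auto intro: less_imp_le)
    \<comment> \<open>The least level with 2^(-J) \<le> z; minimality gives 2^j \<le> 1/z on all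
      retained levels j < J.\<close>
    define J where "J = (LEAST n. 1 / z \<le> 2 ^ n)"
    have J: "1 / z \<le> 2 ^ J" unfolding J_def by (rule LeastI[of _ n]) (rule n)
    have J': "2 ^ j \<le> 1 / z" if "j < J" for j
      using not_less_Least[of j "\<lambda>n. 1 / z \<le> 2 ^ n"] that unfolding J_def by simp
    have Jr: "2 powr (- (real J * r)) \<le> z powr r"
    proof -
      have "inverse (2 ^ J) \<le> z" using J z by (simp add: field_simps)
      then have "(inverse (2 ^ J)) powr r \<le> z powr r" using r0 by (intro powr_mono2) auto
      moreover have "(inverse (2 ^ J)) powr r = 2 powr (- (real J * r))"
        by (simp add: powr_realpow[symmetric] powr_minus[symmetric] powr_powr)
      ultimately show ?thesis by simp
    qed
    \<comment> \<open>Since 2^j = 2^(j(1-r)) 2^(jr) and 2^j \<le> 1/z on the retained levels, the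
      gradient of the truncated exponent is of the order z^(r-1) at most.\<close>
    define \<Gamma> where "\<Gamma> = z powr (r - 1) * A"
    have \<Gamma>: "(\<Sum>j<J. 2 ^ j * c j) \<le> \<Gamma>"
    proof -
      have "(\<Sum>j<J. 2 ^ j * c j) \<le> (\<Sum>j<J. z powr (r - 1) * (2 powr (real j * r) * c j))"
      proof (rule sum_mono)
        fix j assume "j \<in> {..<J}"
        then have "(2 ^ j) powr (1 - r) \<le> (1 / z) powr (1 - r)" using J'[of j] r1 by (intro powr_mono2) auto
        moreover have "(1 / z) powr (1 - r) = z powr (r - 1)"
          using z powr_minus[of z "r - 1"] by (simp add: powr_divide divide_inverse inverse_powr powr_minus[symmetric])
        moreover have "(2 ^ j) powr (1 - r) * 2 powr (real j * r) = (2::real) ^ j"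
          by (simp add: powr_realpow[symmetric] powr_powr powr_add[symmetric] algebra_simps)
        ultimately have "2 ^ j \<le> z powr (r - 1) * 2 powr (real j * r)"
          by (metis mult_right_mono powr_ge_zero)
        then show "2 ^ j * c j \<le> z powr (r - 1) * (2 powr (real j * r) * c j)"
          using level_nonneg[OF lev r0, of j] by (metis mult.assoc mult_right_mono)
      qed
      also have "\<dots> = z powr (r - 1) * (\<Sum>j<J. 2 powr (real j * r) * c j)" by (simp add: sum_distrib_left)
      also have "\<dots> \<le> \<Gamma>"
        unfolding \<Gamma>_def A_def by (intro mult_left_mono level_norm_partial[OF lev r0]) auto
      finally show ?thesis .
    qed
    obtain w where w: "weak_solution D (\<lambda>x. exp (\<Sum>j<J. \<beta> j x)) (H_functional D f) w"
      using weak_solution_exists[OF level_partial_elliptic[OF lev r0] H_functional_V_dual[OF f]] by blast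
    have wV: "w \<in> V_space D" using w by (simp add: weak_solution_def)
    note W = level_partial_W[OF f w \<Gamma>]
    \<comment> \<open>Stability is applied with \<open>u\<close> as the second solution, so that the
      norm on the right is the one already bounded by \<open>Vu\<close>.\<close>
    have d1: "V_norm D (\<lambda>x. w x - u x) \<le> (exp A * (z powr r * A)) * V_norm D u / exp (- A)"
      unfolding A_def
    proof (rule weak_solution_stability[OF level_partial_elliptic[OF lev r0] level_sum_elliptic[OF lev r0] w u])
      fix x assume x: "x \<in> D"
      have "\<bar>exp (\<Sum>j<J. \<beta> j x) - exp (level_sum \<beta> x)\<bar> \<le> exp (level_norm r c) * \<bar>(\<Sum>j<J. \<beta> j x) - level_sum \<beta> x\<bar>"
        using level_partial_abs[OF lev r0 x, of J] level_sum_abs[OF lev r0 x] by (intro abs_exp_diff_le) linarith+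
      also have "\<dots> \<le> exp (level_norm r c) * (2 powr (- (real J * r)) * level_norm r c)"
        using level_sum_diff[OF lev r0 x, of J] by (intro mult_left_mono) (auto simp: abs_minus_commute)
      also have "\<dots> \<le> exp (level_norm r c) * (z powr r * level_norm r c)"
        using A Jr by (intro mult_left_mono mult_right_mono) (auto simp: A_def)
      finally show "\<bar>exp (\<Sum>j<J. \<beta> j x) - exp (level_sum \<beta> x)\<bar> \<le> exp (level_norm r c) * (z powr r * level_norm r c)" .
    qed (use A in \<open>simp add: A_def\<close>)
    have "V_norm D (\<lambda>x. u x - w x) = V_norm D (\<lambda>x. w x - u x)"
      unfolding V_diff(3)[OF V wV] V_diff(3)[OF wV V] by (rule L2_norm_minus_commute)
    also have "\<dots> \<le> (exp A * (z powr r * A)) * (2 * H_norm D f * exp A) * exp A"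
    proof -
      have "(exp A * (z powr r * A)) * V_norm D u * exp A \<le> (exp A * (z powr r * A)) * (2 * H_norm D f * exp A) * exp A"
        using Vu A by (intro mult_right_mono mult_left_mono) auto
      moreover have "V_norm D (\<lambda>x. w x - u x) \<le> (exp A * (z powr r * A)) * V_norm D u * exp A"
        using d1 by (simp add: exp_minus divide_inverse)
      ultimately show ?thesis by (rule order_trans[rotated])
    qed
    also have "\<dots> = z powr r * (2 * A * exp (3 * A) * H_norm D f)"
      by (simp add: mult_ac exp_add[symmetric])
    finally have e1: "z powr (- r) * V_norm D (\<lambda>x. u x - w x) \<le> 2 * A * exp (3 * A) * H_norm D f"
      using z by (simp add: powr_minus field_simps)
    have "z * W_norm D w \<le> z * (exp A * (1 + 2 * real DIM('a) * \<Gamma>) * H_norm D f)"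
      using W(2) z unfolding A_def by (intro mult_left_mono) auto
    then have "z powr (- r) * (z * W_norm D w) \<le> z powr (- r) * (z * (exp A * (1 + 2 * real DIM('a) * \<Gamma>) * H_norm D f))"
      by (rule mult_left_mono[OF _ powr_ge_zero])
    also have "\<dots> = (z powr (- r) * z + 2 * real DIM('a) * A * (z powr (- r) * z * z powr (r - 1))) * exp A * H_norm D f"
      by (simp add: \<Gamma>_def algebra_simps)
    also have "z powr (- r) * z = z powr (1 - r)"
      using z by (simp add: powr_diff powr_minus divide_inverse)
    also have "z powr (1 - r) * z powr (r - 1) = 1"
      using z by (simp add: powr_add[symmetric])
    also have "(z powr (1 - r) + 2 * real DIM('a) * A * 1) * exp A * H_norm D f \<le> (1 + 2 * real DIM('a) * A) * exp A * H_norm D f"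
      using z True r1 fn powr_le1[of "1 - r" z] by (intro mult_right_mono) auto
    finally have e2: "z powr (- r) * (z * W_norm D w) \<le> (1 + 2 * real DIM('a) * A) * exp A * H_norm D f" .
    have "z powr (- r) * K_functional D u z \<le> z powr (- r) * (V_norm D (\<lambda>x. u x - w x) + z * W_norm D w)"
      using K_le[OF W(1), of z u] z by (intro mult_left_mono) auto
    also have "\<dots> \<le> (2 * A * exp (3 * A) + (1 + 2 * real DIM('a) * A) * exp A) * H_norm D f"
      using e1 e2 by (simp add: algebra_simps)
    \<comment> \<open>The linear factors are absorbed into the exponential: 2 A \<le> exp (2 A)
      raises the exponent to 5 A, and 1 + 2 d A \<le> exp (2 d A) raises it to (1 + 2 d) A. The
      constant 5 + 2 d covers both.\<close>
    also have "\<dots> \<le> (2 * exp ((5 + 2 * real DIM('a)) * A)) * H_norm D f"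
    proof (intro mult_right_mono fn)
      have "2 * A * exp (3 * A) \<le> exp (2 * A) * exp (3 * A)"
      proof (intro mult_right_mono)
        show "2 * A \<le> exp (2 * A)" using exp_ge_add_one_self[of "2 * A"] by linarith
      qed simp
      also have "\<dots> = exp (5 * A)" by (simp add: exp_add[symmetric])
      also have "\<dots> \<le> exp ((5 + 2 * real DIM('a)) * A)" using A by (simp add: mult_right_mono)
      finally have 1: "2 * A * exp (3 * A) \<le> exp ((5 + 2 * real DIM('a)) * A)" .
      have "(1 + 2 * real DIM('a) * A) * exp A \<le> exp (2 * real DIM('a) * A) * exp A"
        by (intro mult_right_mono exp_ge_add_one_self) auto
      also have "\<dots> = exp ((1 + 2 * real DIM('a)) * A)" by (simp add: exp_add[symmetric] algebra_simps)
      also have "\<dots> \<le> exp ((5 + 2 * real DIM('a)) * A)" using A by (simp add: mult_right_mono)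
      finally show "2 * A * exp (3 * A) + (1 + 2 * real DIM('a) * A) * exp A \<le> 2 * exp ((5 + 2 * real DIM('a)) * A)"
        using 1 by simp
    qed
    finally show "z powr (- r) * K_functional D u z \<le> 2 * exp ((5 + 2 * real DIM('a)) * A) * H_norm D f" .
  qed
qed

end

text \<open>One sequence bounds the errors of the partial sums and of their gradients, because
  \<open>weak_solution_laplacian\<close> takes a single \<epsilon>.\<close>

lemma level_grad_tail:
  assumes lev: "level_series 1 \<beta> c" and x: "x \<in> D"
  shows "norm (level_grad \<beta> x - grad (\<lambda>x. \<Sum>j<n. \<beta> j x) x) \<le> real DIM('a) * (level_norm 1 c - (\<Sum>j<n. 2 ^ j * c j))"
    "norm (level_sum \<beta> x - (\<Sum>j<n. \<beta> j x)) \<le> real DIM('a) * (level_norm 1 c - (\<Sum>j<n. 2 ^ j * c j))"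
proof -
  note l = lev zero_le_one
  have eq: "2 powr (real j * 1) * c j = 2 ^ j * c j" for j by (simp add: powr_realpow)
  have s: "summable (\<lambda>j. 2 ^ j * c j)" using level_summable[OF l] unfolding eq .
  have S: "level_norm 1 c = (\<Sum>j. 2 ^ j * c j)" unfolding level_norm_def eq ..
  have eq2: "real DIM('a) * (level_norm 1 c - (\<Sum>j<n. 2 ^ j * c j)) =
      (\<Sum>j. real DIM('a) * (2 ^ j * c j)) - (\<Sum>j<n. real DIM('a) * (2 ^ j * c j))"
    unfolding S suminf_mult[OF s] sum_distrib_left[symmetric] by (simp add: right_diff_distrib)
  show "norm (level_grad \<beta> x - grad (\<lambda>x. \<Sum>j<n. \<beta> j x) x) \<le> real DIM('a) * (level_norm 1 c - (\<Sum>j<n. 2 ^ j * c j))"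
    unfolding level_grad_def level_partial_grad[OF l] eq2
    by (intro suminf_tail_le summable_mult s level_grad_norm[OF l x])
  have "norm (\<beta> j x) \<le> real DIM('a) * (2 ^ j * c j)" for j
  proof -
    have "norm (\<beta> j x) \<le> 1 * (1 * c j)" using level_abs[OF l x] by simp
    also have "\<dots> \<le> real DIM('a) * (2 ^ j * c j)"
      using level_nonneg[OF l, of j] DIM_positive[where 'a='a] by (intro mult_mono) auto
    finally show ?thesis .
  qed
  then show "norm (level_sum \<beta> x - (\<Sum>j<n. \<beta> j x)) \<le> real DIM('a) * (level_norm 1 c - (\<Sum>j<n. 2 ^ j * c j))"
    unfolding level_sum_def eq2 by (intro suminf_tail_le summable_mult s)
qed

lemma level_grad_bound:
  assumes lev: "level_series 1 \<beta> c" and x: "x \<in> D"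
  shows "norm (level_grad \<beta> x) \<le> real DIM('a) * level_norm 1 c"
  using level_grad_tail(1)[OF assms, of 0] by (simp add: partial_deriv_const grad_def)

lemma level_grad_measurable:
  assumes lev: "level_series 1 \<beta> c"
  shows "level_grad \<beta> \<in> borel_measurable L"
  unfolding level_grad_def[abs_def]
  by (intro borel_measurable_suminf continuous_measurable_L continuous_grad level_tcd[OF lev zero_le_one])

lemma level_laplacian:
  assumes lev: "level_series 1 \<beta> c" and f: "f \<in> H_space D"
    and u: "weak_solution D (\<lambda>x. exp (level_sum \<beta> x)) (H_functional D f) u"
  shows "is_weak_laplacian D u (\<lambda>x. - (exp (- level_sum \<beta> x) * f x + level_grad \<beta> x \<bullet> wgrad u x))"
proof -
  note l = lev zero_le_one
  let ?e = "\<lambda>n. real DIM('a) * (level_norm 1 c - (\<Sum>j<n. 2 ^ j * c j))"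
  have eq: "2 powr (real j * 1) * c j = 2 ^ j * c j" for j by (simp add: powr_realpow)
  have s: "summable (\<lambda>j. 2 ^ j * c j)" using level_summable[OF l] unfolding eq .
  have S: "level_norm 1 c = (\<Sum>j. 2 ^ j * c j)" unfolding level_norm_def eq ..
  have "(\<lambda>n. real DIM('a) * (level_norm 1 c - (\<Sum>j<n. 2 ^ j * c j))) \<longlonglongrightarrow> real DIM('a) * (level_norm 1 c - level_norm 1 c)"
    unfolding S by (intro tendsto_intros summable_LIMSEQ s)
  then have e0: "?e \<longlonglongrightarrow> 0" by simp
  have eE: "?e n \<le> real DIM('a) * level_norm 1 c" for n
    using level_nonneg[OF l] by (intro mult_left_mono) (auto intro: sum_nonneg)
  show ?thesis
  proof (rule weak_solution_laplacian[OF f u level_sum_measurable[OF l] level_sum_abs[OF l] level_partial_tcd[OF l] _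
        level_grad_measurable[OF lev] level_grad_bound[OF lev] _ e0 eE])
    fix n x assume x: "x \<in> D"
    show "\<bar>(\<Sum>j<n. \<beta> j x) - level_sum \<beta> x\<bar> \<le> ?e n"
      using level_grad_tail(2)[OF lev x, of n] by (simp add: abs_minus_commute)
    show "norm (grad (\<lambda>x. \<Sum>j<n. \<beta> j x) x - level_grad \<beta> x) \<le> ?e n"
      using level_grad_tail(1)[OF lev x, of n] by (simp add: norm_minus_commute)
  qed
qed

text \<open>For r = 1 the gradient series converges uniformly and the Laplacian is bounded directly;
  the resulting constant is enlarged so that both cases share one bound.\<close>

lemma level_Wr:
  assumes lev: "level_series r \<beta> c" and r: "0 < r" "r \<le> 1" and f: "f \<in> H_space D"
    and u: "weak_solution D (\<lambda>x. exp (level_sum \<beta> x)) (H_functional D f) u"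
  shows "u \<in> Wr_space D r" "Wr_norm D r u \<le> 2 * exp ((5 + 2 * real DIM('a)) * level_norm r c) * H_norm D f"
proof -
  have V: "u \<in> V_space D" using u by (simp add: weak_solution_def)
  have "u \<in> Wr_space D r \<and> Wr_norm D r u \<le> 2 * exp ((5 + 2 * real DIM('a)) * level_norm r c) * H_norm D f"
  proof (cases "r = 1")
    case False
    then have r1: "r < 1" using r by simp
    show ?thesis
      using Wr_I[OF r(1) r1 V level_K_bound[OF lev _ f u r1]] r by simp
  next
    case True
    have lev1: "level_series 1 \<beta> c" using lev True by simp
    note l = lev1 zero_le_one
    define A where "A = level_norm 1 c"
    have A: "A \<ge> 0" unfolding A_def by (rule level_norm_nonneg[OF l])
    have fn: "H_norm D f \<ge> 0" by (simp add: H_norm_def)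
    have Vu: "V_norm D u \<le> 2 * H_norm D f * exp A"
      unfolding A_def by (rule level_V_bound[OF l u H_functional_bound[OF f]]) (simp_all add: H_norm_def)
    note W = laplacian_norm_bound[OF f V level_laplacian[OF lev1 f u] level_sum_measurable[OF l] level_sum_abs[OF l]
        level_grad_measurable[OF lev1] level_grad_bound[OF lev1]]
    have p: "0 \<le> real DIM('a) * level_norm 1 c" using A by (simp add: A_def)
    have "W_norm D u \<le> exp A * H_norm D f + real DIM('a) * A * V_norm D u"
      using W(2)[OF _ _ p] by (simp add: A_def)
    also have "\<dots> \<le> exp A * H_norm D f + real DIM('a) * A * (2 * H_norm D f * exp A)"
      using Vu A by (intro add_mono mult_left_mono) auto
    also have "\<dots> = (1 + 2 * real DIM('a) * A) * exp A * H_norm D f" by (simp add: algebra_simps)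
    also have "\<dots> \<le> 2 * exp ((5 + 2 * real DIM('a)) * A) * H_norm D f"
    proof (intro mult_right_mono fn)
      have "(1 + 2 * real DIM('a) * A) * exp A \<le> exp (2 * real DIM('a) * A) * exp A"
        by (intro mult_right_mono exp_ge_add_one_self) auto
      also have "\<dots> = exp ((1 + 2 * real DIM('a)) * A)" by (simp add: exp_add[symmetric] algebra_simps)
      also have "\<dots> \<le> exp ((5 + 2 * real DIM('a)) * A)" using A by (simp add: mult_right_mono)
      finally show "(1 + 2 * real DIM('a) * A) * exp A \<le> 2 * exp ((5 + 2 * real DIM('a)) * A)"
        using exp_gt_zero[of "(5 + 2 * real DIM('a)) * A"] by linarith
    qed
    finally show ?thesis using W(1)[OF _ _ p] True by (simp add: Wr_space_def Wr_norm_def A_def)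
  qed
  then show "u \<in> Wr_space D r" "Wr_norm D r u \<le> 2 * exp ((5 + 2 * real DIM('a)) * level_norm r c) * H_norm D f" by auto
qed

section \<open>Stability under convergence of the coefficients\<close>

text \<open>One majorant c serves the limit and all approximations, and the errors \<eta> are
  dominated by 2 c while tending to 0 level by level: the setting of dominated convergence for
  series.\<close>

context
  fixes r :: real and \<beta> :: "nat \<Rightarrow> 'a \<Rightarrow> real" and \<beta>n :: "nat \<Rightarrow> nat \<Rightarrow> 'a \<Rightarrow> real"
    and c :: "nat \<Rightarrow> real" and \<eta> :: "nat \<Rightarrow> nat \<Rightarrow> real"
  assumes lev: "level_series r \<beta> c" and levn: "\<And>n. level_series r (\<beta>n n) c" and r0: "0 \<le> r"
    and \<eta>: "\<And>n j. 0 \<le> \<eta> n j" "\<And>n j. \<eta> n j \<le> 2 * c j" "\<And>j. (\<lambda>n. \<eta> n j) \<longlonglongrightarrow> 0"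
    and diff: "\<And>n j x. x \<in> D \<Longrightarrow> \<bar>\<beta> j x - \<beta>n n j x\<bar> \<le> \<eta> n j"
      "\<And>n j x e. x \<in> D \<Longrightarrow> e \<in> Basis \<Longrightarrow> \<bar>partial_deriv e (\<beta> j) x - partial_deriv e (\<beta>n n j) x\<bar> \<le> 2 ^ j * \<eta> n j"
begin

lemma level_diff_summable: "summable (\<lambda>j. 2 powr (real j * r) * \<eta> n j)"
proof (rule summable_comparison_test'[OF summable_mult[OF level_summable[OF lev r0], of 2], of 0])
  show "norm (2 powr (real j * r) * \<eta> n j) \<le> 2 * (2 powr (real j * r) * c j)" for j
    using \<eta>(1)[of n j] \<eta>(2)[of n j] mult_left_mono[OF \<eta>(2)[of n j], of "2 powr (real j * r)"] by (simp add: mult_ac)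
qed

lemma level_diff_tendsto: "(\<lambda>n. level_norm r (\<eta> n)) \<longlonglongrightarrow> 0"
proof -
  have "((\<lambda>n. \<Sum>k. 2 powr (real k * r) * \<eta> n k) \<longlongrightarrow> (\<Sum>k. (0::real))) sequentially"
  proof (rule tannerys_theorem[where M="\<lambda>j. 2 * (2 powr (real j * r) * c j)", THEN conjunct2, THEN conjunct2])
    show "(\<lambda>n. 2 powr (real k * r) * \<eta> n k) \<longlonglongrightarrow> 0" for k
      using tendsto_mult_left[OF \<eta>(3)[of k], of "2 powr (real k * r)"] by simp
    show "\<forall>\<^sub>F (k, n) in sequentially \<times>\<^sub>F sequentially. norm (2 powr (real k * r) * \<eta> n k) \<le> 2 * (2 powr (real k * r) * c k)"
    proof (intro always_eventually allI, clarify)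
      fix k n
      show "norm (2 powr (real k * r) * \<eta> n k) \<le> 2 * (2 powr (real k * r) * c k)"
        using \<eta>(1)[of n k] mult_left_mono[OF \<eta>(2)[of n k], of "2 powr (real k * r)"] by (simp add: mult_ac)
    qed
  qed (use summable_mult[OF level_summable[OF lev r0], of 2] in auto)
  then show ?thesis by (simp add: level_norm_def)
qed

lemma level_sum_diff_le:
  assumes "x \<in> D"
  shows "\<bar>level_sum \<beta> x - level_sum (\<beta>n n) x\<bar> \<le> level_norm r (\<eta> n)"
proof -
  have "level_sum \<beta> x - level_sum (\<beta>n n) x = (\<Sum>j. \<beta> j x - \<beta>n n j x)"
    unfolding level_sum_def by (rule suminf_diff[OF level_sum_summable[OF lev r0 assms] level_sum_summable[OF levn r0 assms]])
  moreover have "norm (\<beta> j x - \<beta>n n j x) \<le> 2 powr (real j * r) * \<eta> n j" for j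
  proof -
    have "1 * \<eta> n j \<le> 2 powr (real j * r) * \<eta> n j"
      using r0 \<eta>(1)[of n j] by (intro mult_right_mono ge_one_powr_ge_zero) auto
    then show ?thesis using diff(1)[OF assms, of j n] by simp
  qed
  ultimately show ?thesis
    using suminf_tail_le[OF level_diff_summable[of n], of "\<lambda>j. \<beta> j x - \<beta>n n j x" 0] by (simp add: level_norm_def)
qed

lemma level_V_tendsto:
  assumes F: "F \<in> V_dual D" and u: "weak_solution D (\<lambda>x. exp (level_sum \<beta> x)) F u"
    and un: "\<And>n. weak_solution D (\<lambda>x. exp (level_sum (\<beta>n n) x)) F (un n)"
  shows "(\<lambda>n. V_norm D (\<lambda>x. u x - un n x)) \<longlonglongrightarrow> 0"
proof (rule Lim_null_comparison)
  define A where "A = level_norm r c"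
  show "\<forall>\<^sub>F n in sequentially. norm (V_norm D (\<lambda>x. u x - un n x)) \<le> level_norm r (\<eta> n) * (exp A * (V_dual_norm D F * exp A) / exp (- A))"
  proof (intro always_eventually allI)
    fix n
    have e0: "0 \<le> level_norm r (\<eta> n)"
      unfolding level_norm_def by (intro suminf_nonneg level_diff_summable) (use \<eta>(1) in auto)
    have "V_norm D (\<lambda>x. u x - un n x) \<le> (exp A * level_norm r (\<eta> n)) * V_norm D (un n) / exp (- A)"
      unfolding A_def
    proof (rule weak_solution_stability[OF level_sum_elliptic[OF lev r0] level_sum_elliptic[OF levn r0] u un])
      fix x assume x: "x \<in> D"
      have "\<bar>exp (level_sum \<beta> x) - exp (level_sum (\<beta>n n) x)\<bar> \<le> exp (level_norm r c) * \<bar>level_sum \<beta> x - level_sum (\<beta>n n) x\<bar>"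
        using level_sum_abs[OF lev r0 x] level_sum_abs[OF levn r0 x, of n] by (intro abs_exp_diff_le) linarith+
      then show "\<bar>exp (level_sum \<beta> x) - exp (level_sum (\<beta>n n) x)\<bar> \<le> exp (level_norm r c) * level_norm r (\<eta> n)"
        using level_sum_diff_le[OF x, of n] by (meson exp_ge_zero mult_left_mono order_trans)
    qed (use e0 in simp)
    also have "\<dots> \<le> (exp A * level_norm r (\<eta> n)) * (V_dual_norm D F * exp A) / exp (- A)"
      using level_V_bound[OF levn r0 un V_dual_norm_bound(2)[OF F] V_dual_norm_bound(1)[OF F], of n] e0
      by (intro divide_right_mono mult_left_mono) (auto simp: A_def)
    finally show "norm (V_norm D (\<lambda>x. u x - un n x)) \<le> level_norm r (\<eta> n) * (exp A * (V_dual_norm D F * exp A) / exp (- A))"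
      by (simp add: mult_ac)
  qed
  show "(\<lambda>n. level_norm r (\<eta> n) * (exp A * (V_dual_norm D F * exp A) / exp (- A))) \<longlonglongrightarrow> 0"
    using tendsto_mult_right[OF level_diff_tendsto] by fastforce
qed

lemma level_Wr_tendsto_less:
  assumes f: "f \<in> H_space D" and u: "weak_solution D (\<lambda>x. exp (level_sum \<beta> x)) (H_functional D f) u"
    and un: "\<And>n. weak_solution D (\<lambda>x. exp (level_sum (\<beta>n n) x)) (H_functional D f) (un n)"
    and q: "0 < q" "q < r" "r < 1"
  shows "un n \<in> Wr_space D q" "(\<lambda>n. Wr_norm D q (\<lambda>x. u x - un n x)) \<longlonglongrightarrow> 0"
proof -
  have r: "0 < r" "r \<le> 1" using q by auto
  define C where "C = 2 * exp ((5 + 2 * real DIM('a)) * level_norm r c) * H_norm D f"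
  have C: "C \<ge> 0" by (simp add: C_def H_norm_def)
  note U = level_Wr[OF lev r f u, folded C_def] and Un = level_Wr[OF levn r f un, folded C_def]
  show "un n \<in> Wr_space D q" by (rule Wr_interpolation(1)[OF q Un(1) zero_less_one])
  have dW: "(\<lambda>x. u x - un n x) \<in> Wr_space D r" for n
    using Wr_triangle(1)[OF r U(1) Un(1), of 1 "-1"] by simp
  have dN: "Wr_norm D r (\<lambda>x. u x - un n x) \<le> 2 * C" for n
    using Wr_triangle(2)[OF r U(1) Un(1), of 1 "-1" n] U(2) Un(2)[of n] by simp
  have lim: "(\<lambda>n. V_norm D (\<lambda>x. u x - un n x)) \<longlonglongrightarrow> 0"
    by (rule level_V_tendsto[OF H_functional_V_dual[OF f] u un])
  show "(\<lambda>n. Wr_norm D q (\<lambda>x. u x - un n x)) \<longlonglongrightarrow> 0"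
  proof (rule LIMSEQ_I)
    fix e :: real assume e: "e > 0"
    \<comment> \<open>\<delta> is chosen with \<delta>^(r - q) = k, so that the stronger norm, which
      is at most 2 C, contributes at most e/2. The added 1 covers C = 0.\<close>
    define k where "k = e / (2 * (2 * C + 1))"
    define \<delta> where "\<delta> = k powr (1 / (r - q))"
    have p: "k > 0" using e C by (simp add: k_def)
    then have \<delta>: "\<delta> > 0" by (simp add: \<delta>_def)
    have "\<delta> powr (r - q) = k"
      unfolding \<delta>_def powr_powr using q p by simp
    moreover have "k * (2 * C) \<le> e / 2"
    proof -
      have "2 * (2 * C + 1) > 0" using C by (intro mult_pos_pos add_nonneg_pos mult_nonneg_nonneg) simp_all
      then have "2 * (2 * C + 1) \<noteq> 0" by (rule less_imp_neq[symmetric])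
      from nonzero_eq_divide_eq[THEN iffD1, OF this k_def] have "k * (2 * C) + k = e / 2" by (simp add: algebra_simps)
      then show ?thesis using p by linarith
    qed
    ultimately have d1: "\<delta> powr (r - q) * (2 * C) \<le> e / 2" by simp
    have "\<forall>\<^sub>F n in sequentially. V_norm D (\<lambda>x. u x - un n x) < e / 2 * \<delta> powr q"
      using order_tendstoD(2)[OF lim, of "e / 2 * \<delta> powr q"] e \<delta> by simp
    then obtain N where N: "\<And>n. n \<ge> N \<Longrightarrow> V_norm D (\<lambda>x. u x - un n x) < e / 2 * \<delta> powr q"
      by (auto simp: eventually_sequentially)
    have "norm (Wr_norm D q (\<lambda>x. u x - un n x) - 0) < e" if n: "n \<ge> N" for n
    proof -
      have "Wr_norm D q (\<lambda>x. u x - un n x) \<le> \<delta> powr (r - q) * Wr_norm D r (\<lambda>x. u x - un n x) + \<delta> powr (- q) * V_norm D (\<lambda>x. u x - un n x)"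
        by (rule Wr_interpolation(2)[OF q dW \<delta>])
      also have "\<dots> < \<delta> powr (r - q) * (2 * C) + \<delta> powr (- q) * (e / 2 * \<delta> powr q)"
        using dN[of n] N[OF n] \<delta> by (intro add_le_less_mono mult_left_mono mult_strict_left_mono) auto
      also have "\<delta> powr (- q) * (e / 2 * \<delta> powr q) = e / 2"
        using \<delta> by (simp add: powr_minus field_simps)
      finally have "Wr_norm D q (\<lambda>x. u x - un n x) < e" using d1 by simp
      moreover have "0 \<le> Wr_norm D q (\<lambda>x. u x - un n x)"
        by (intro Wr_norm_nonneg Wr_interpolation(1)[OF q dW zero_less_one])
      ultimately show ?thesis by simp
    qed
    then show "\<exists>no. \<forall>n\<ge>no. norm (Wr_norm D q (\<lambda>x. u x - un n x) - 0) < e" by blast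
  qed
qed

text \<open>At the endpoint no stronger space is at hand to interpolate with, so the explicit
  Laplacians are subtracted: p carries the change of exp (- b), q the change of the drift, and t the
  change of the solution.\<close>

lemma level_W_tendsto:
  assumes f: "f \<in> H_space D" and u: "weak_solution D (\<lambda>x. exp (level_sum \<beta> x)) (H_functional D f) u"
    and un: "\<And>n. weak_solution D (\<lambda>x. exp (level_sum (\<beta>n n) x)) (H_functional D f) (un n)"
    and r1: "r = 1"
  shows "(\<lambda>n. W_norm D (\<lambda>x. u x - un n x)) \<longlonglongrightarrow> 0"
proof (rule Lim_null_comparison)
  have lev1: "level_series 1 \<beta> c" and levn1: "\<And>n. level_series 1 (\<beta>n n) c" using lev levn r1 by auto
  note l = lev1 zero_le_one and ln = levn1 zero_le_one
  have V: "u \<in> V_space D" and Vn: "\<And>n. un n \<in> V_space D" using u un by (auto simp: weak_solution_def)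
  have f2: "f \<in> L2_space L" using f by (simp add: H_space_def)
  define A where "A = level_norm 1 c"
  have A: "A \<ge> 0" unfolding A_def by (rule level_norm_nonneg[OF l])
  define E where "E n = level_norm 1 (\<eta> n)" for n
  have eq: "2 powr (real j * 1) * \<eta> n j = 2 ^ j * \<eta> n j" for j n by (simp add: powr_realpow)
  have sE: "summable (\<lambda>j. 2 ^ j * \<eta> n j)" for n using level_diff_summable[of n] unfolding r1 eq .
  have E: "E n \<ge> 0" for n unfolding E_def level_norm_def eq by (intro suminf_nonneg sE) (use \<eta>(1) in auto)
  have E0: "E \<longlonglongrightarrow> 0" using level_diff_tendsto unfolding E_def[abs_def] r1 .
  let ?G = "level_grad \<beta>" and ?Gn = "\<lambda>n. level_grad (\<beta>n n)"
  have dG: "norm (?G x - ?Gn n x) \<le> real DIM('a) * E n" if x: "x \<in> D" for x n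
  proof -
    have s: "summable (\<lambda>j. grad (\<beta> j) x)" if lv: "level_series 1 \<beta> c" for \<beta>
    proof (rule summable_comparison_test'[of "\<lambda>j. real DIM('a) * (2 powr (real j * 1) * c j)" 0])
      show "summable (\<lambda>j. real DIM('a) * (2 powr (real j * 1) * c j))"
        by (intro summable_mult level_summable[OF lv zero_le_one])
      show "norm (grad (\<beta> j) x) \<le> real DIM('a) * (2 powr (real j * 1) * c j)" for j
        using level_grad_norm[OF lv zero_le_one x, of j] by (simp add: powr_realpow)
    qed
    have "norm (grad (\<beta> j) x - grad (\<beta>n n j) x) \<le> real DIM('a) * (2 ^ j * \<eta> n j)" for j
    proof -
      have "norm (grad (\<beta> j) x - grad (\<beta>n n j) x) \<le> (\<Sum>b\<in>Basis. \<bar>(grad (\<beta> j) x - grad (\<beta>n n j) x) \<bullet> b\<bar>)"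
        by (rule norm_le_l1)
      also have "\<dots> \<le> (\<Sum>b\<in>(Basis::'a set). 2 ^ j * \<eta> n j)"
        by (intro sum_mono) (simp add: inner_diff_left grad_inner diff(2) x)
      finally show ?thesis by simp
    qed
    moreover have "?G x - ?Gn n x = (\<Sum>j. grad (\<beta> j) x - grad (\<beta>n n j) x)"
      unfolding level_grad_def by (rule suminf_diff[OF s[OF lev1] s[OF levn1]])
    ultimately show ?thesis
      using suminf_tail_le[OF summable_mult[OF sE[of n], of "real DIM('a)"], of "\<lambda>j. grad (\<beta> j) x - grad (\<beta>n n j) x" 0]
      by (simp add: E_def level_norm_def powr_realpow suminf_mult[OF sE])
  qed
  note m = level_sum_measurable[OF l] level_sum_measurable[OF ln] level_grad_measurable[OF lev1] level_grad_measurable[OF levn1]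
    L2_measurable[OF V_grad_L2[OF V]] L2_measurable[OF V_grad_L2[OF Vn]] L2_measurable[OF f2]
  note [measurable] = m
  define p where "p n x = (exp (- level_sum (\<beta>n n) x) - exp (- level_sum \<beta> x)) *\<^sub>R f x" for n x
  define q where "q n x = (?Gn n x - ?G x) \<bullet> wgrad u x" for n x
  define t where "t n x = ?Gn n x \<bullet> (wgrad (un n) x - wgrad u x)" for n x
  have p: "p n \<in> L2_space L" "L2_norm L (p n) \<le> (exp A * E n) * L2_norm L f" for n
  proof -
    have *: "\<bar>exp (- level_sum (\<beta>n n) x) - exp (- level_sum \<beta> x)\<bar> \<le> exp A * E n" if x: "x \<in> D" for x
    proof -
      have "\<bar>exp (- level_sum (\<beta>n n) x) - exp (- level_sum \<beta> x)\<bar> \<le> exp A * \<bar>- level_sum (\<beta>n n) x - - level_sum \<beta> x\<bar>"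
        using level_sum_abs[OF l x] level_sum_abs[OF ln x, of n] unfolding A_def by (intro abs_exp_diff_le) linarith+
      also have "\<dots> \<le> exp A * E n"
        using level_sum_diff_le[OF x, of n] r1 by (intro mult_left_mono) (auto simp: E_def)
      finally show ?thesis .
    qed
    have mm: "(\<lambda>x. exp (- level_sum (\<beta>n n) x) - exp (- level_sum \<beta> x)) \<in> borel_measurable L" by measurable
    show "p n \<in> L2_space L" "L2_norm L (p n) \<le> (exp A * E n) * L2_norm L f"
      unfolding p_def[abs_def] using L2_mult_bounded[OF f2 mm *] E by auto
  qed
  have dot: "(\<lambda>x. h x \<bullet> w x) \<in> L2_space L \<and> L2_norm L (\<lambda>x. h x \<bullet> w x) \<le> k * L2_norm L w"
    if h: "h \<in> borel_measurable L" "\<And>x. x \<in> D \<Longrightarrow> norm (h x) \<le> k" and w: "w \<in> L2_space L" and k: "k \<ge> 0" for h w :: "'a \<Rightarrow> 'a" and k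
  proof -
    have 1: "(\<lambda>x. h x \<bullet> w x) \<in> borel_measurable L" using h(1) L2_measurable[OF w] by measurable
    have 2: "AE x in L. norm (h x \<bullet> w x) \<le> k * norm (w x)"
      using h(2) by (intro AE_I2) (auto intro!: order_trans[OF Cauchy_Schwarz_ineq2] mult_right_mono)
    show ?thesis using L2_dominated[OF 1 w 2] L2_norm_le[OF 1 w 2 k] by simp
  qed
  have q: "q n \<in> L2_space L" "L2_norm L (q n) \<le> real DIM('a) * E n * L2_norm L (wgrad u)" for n
    unfolding q_def[abs_def]
    using dot[of "\<lambda>x. ?Gn n x - ?G x" "real DIM('a) * E n" "wgrad u"] dG[of _ n] V_grad_L2[OF V] E[of n]
    by (auto simp: norm_minus_commute)
  have t: "t n \<in> L2_space L" "L2_norm L (t n) \<le> real DIM('a) * A * V_norm D (\<lambda>x. u x - un n x)" for n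
    unfolding t_def[abs_def] V_diff(3)[OF V Vn] L2_norm_minus_commute[of L "wgrad u"]
    using dot[of "?Gn n" "real DIM('a) * A" "\<lambda>x. wgrad (un n) x - wgrad u x"] level_grad_bound[OF levn1, of _ n]
      L2_diff[OF V_grad_L2[OF Vn] V_grad_L2[OF V], of n] A
    by (auto simp: A_def)
  show "\<forall>\<^sub>F n in sequentially. norm (W_norm D (\<lambda>x. u x - un n x)) \<le>
      exp A * E n * L2_norm L f + real DIM('a) * E n * L2_norm L (wgrad u) + real DIM('a) * A * V_norm D (\<lambda>x. u x - un n x)"
  proof (intro always_eventually allI)
    fix n
    have "is_weak_laplacian D (\<lambda>x. 1 * u x + (-1) * un n x)
      (\<lambda>x. 1 * - (exp (- level_sum \<beta> x) * f x + ?G x \<bullet> wgrad u x) + (-1) * - (exp (- level_sum (\<beta>n n) x) * f x + ?Gn n x \<bullet> wgrad (un n) x))"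
      by (intro weak_laplacian_lincomb V_L2 V Vn level_laplacian[OF lev1 f u] level_laplacian[OF levn1 f un])
    moreover have "(\<lambda>x. 1 * - (exp (- level_sum \<beta> x) * f x + ?G x \<bullet> wgrad u x) + (-1) * - (exp (- level_sum (\<beta>n n) x) * f x + ?Gn n x \<bullet> wgrad (un n) x))
        = (\<lambda>x. p n x + (q n x + t n x))"
      by (auto simp: p_def q_def t_def inner_diff_left inner_diff_right algebra_simps)
    ultimately have "is_weak_laplacian D (\<lambda>x. u x - un n x) (\<lambda>x. p n x + (q n x + t n x))" by simp
    from W_norm_eq[OF this] have "W_norm D (\<lambda>x. u x - un n x) \<le> L2_norm L (p n) + (L2_norm L (q n) + L2_norm L (t n))"
      using L2_triangle[OF p(1) L2_add[OF q(1) t(1)], of n n n] L2_triangle[OF q(1) t(1), of n n] by linarith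
    then show "norm (W_norm D (\<lambda>x. u x - un n x)) \<le>
        exp A * E n * L2_norm L f + real DIM('a) * E n * L2_norm L (wgrad u) + real DIM('a) * A * V_norm D (\<lambda>x. u x - un n x)"
      using p(2)[of n] q(2)[of n] t(2)[of n] by simp
  qed
  have lim: "(\<lambda>n. V_norm D (\<lambda>x. u x - un n x)) \<longlonglongrightarrow> 0"
    by (rule level_V_tendsto[OF H_functional_V_dual[OF f] u un])
  have "(\<lambda>n. exp A * E n * L2_norm L f + real DIM('a) * E n * L2_norm L (wgrad u) + real DIM('a) * A * V_norm D (\<lambda>x. u x - un n x))
      \<longlonglongrightarrow> exp A * 0 * L2_norm L f + real DIM('a) * 0 * L2_norm L (wgrad u) + real DIM('a) * A * 0"
    by (intro tendsto_intros E0 lim)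
  then show "(\<lambda>n. exp A * E n * L2_norm L f + real DIM('a) * E n * L2_norm L (wgrad u) + real DIM('a) * A * V_norm D (\<lambda>x. u x - un n x)) \<longlonglongrightarrow> 0"
    by simp
qed

end

end

section \<open>Periodised wavelets on the unit cube\<close>

lemma Holder_C1:
  assumes H: "Holder_smooth \<alpha> f" and \<alpha>: "\<alpha> \<ge> 1"
  shows "(f has_real_derivative deriv f x) (at x)" "continuous_on UNIV (deriv f)"
proof -
  define n where "n = nat \<lfloor>\<alpha>\<rfloor>"
  have n: "n \<ge> 1" using \<alpha> by (simp add: n_def le_nat_iff)
  have d: "\<And>m x. m < n \<Longrightarrow> (deriv ^^ m) f field_differentiable (at x)" and c: "continuous_on UNIV ((deriv ^^ n) f)"
    using H unfolding Holder_smooth_def Let_def n_def by blast+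
  show "(f has_real_derivative deriv f x) (at x)"
    using d[of 0 x] n by (simp add: DERIV_deriv_iff_field_differentiable)
  show "continuous_on UNIV (deriv f)"
  \<comment> \<open>For n = 1 the derivative is the top one and continuous by definition; for larger
    n it is itself differentiable.\<close>
  proof (cases "n = 1")
    case True
    then show ?thesis using c by simp
  next
    case False
    then have "(deriv ^^ 1) f field_differentiable (at x)" for x using n d[of 1 x] by simp
    then show ?thesis
      by (intro continuous_at_imp_continuous_on ballI) (simp add: field_differentiable_imp_continuous_at)
  qed
qed

text \<open>\<open>R\<close> is a natural number because it enters the count (2 R + 1)^d of integer
  points.\<close>

definition wavelet_factor :: "nat \<Rightarrow> real \<Rightarrow> (real \<Rightarrow> real) \<Rightarrow> bool" where
  "wavelet_factor R B g \<longleftrightarrow> continuous_on UNIV (deriv g) \<and> (\<forall>x. (g has_real_derivative deriv g x) (at x)) \<and>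
     (\<forall>x. \<bar>x\<bar> > real R \<longrightarrow> g x = 0 \<and> deriv g x = 0) \<and> (\<forall>x. \<bar>g x\<bar> \<le> B \<and> \<bar>deriv g x\<bar> \<le> B)"

lemma wavelet_factor_exists:
  assumes H: "Holder_smooth \<alpha> f" and \<alpha>: "\<alpha> \<ge> 1" and K: "compact (closure {x. f x \<noteq> 0})"
  shows "\<exists>R B. wavelet_factor R B f"
proof -
  note C1 = Holder_C1[OF H \<alpha>]
  obtain R0 where R0: "\<And>x. x \<in> closure {x. f x \<noteq> 0} \<Longrightarrow> norm x \<le> R0"
    using compact_imp_bounded[OF K] by (auto simp: bounded_iff)
  obtain R :: nat where R: "R0 \<le> R" using real_arch_simple by blast
  have z: "f x = 0" if "\<bar>x\<bar> > real R" for x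
    using R0[of x] R that closure_subset[of "{x. f x \<noteq> 0}"] by force
  have z': "deriv f x = 0" if "\<bar>x\<bar> > real R" for x
  proof -
    have "open {x :: real. \<bar>x\<bar> > R}" by (intro open_Collect_less continuous_intros)
    then have "\<forall>\<^sub>F y in nhds x. f y = 0" using that z by (auto simp: eventually_nhds)
    then have "(f has_real_derivative 0) (at x)"
      using DERIV_cong_ev[of x x f "\<lambda>_. 0" 0 0] by simp
    then show ?thesis by (rule DERIV_imp_deriv)
  qed
  have cf: "continuous_on UNIV f" using C1(1) by (meson DERIV_isCont continuous_at_imp_continuous_on)
  have out: "x \<notin> cbox (- real R) R \<Longrightarrow> \<bar>x\<bar> > R" for x :: real by auto
  obtain B1 where "\<And>x. norm (f x) \<le> B1"
    using compact_support_bounded[OF cf compact_cbox z[OF out]] by blast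
  moreover obtain B2 where "\<And>x. norm (deriv f x) \<le> B2"
    using compact_support_bounded[OF C1(2) compact_cbox z'[OF out]] by blast
  ultimately have "\<bar>f x\<bar> \<le> max B1 B2 \<and> \<bar>deriv f x\<bar> \<le> max B1 B2" for x
    by (simp add: le_max_iff_disj)
  then show ?thesis
    unfolding wavelet_factor_def using C1 z z' by blast
qed

lemma wavelet_factor_mono:
  "wavelet_factor R B g \<Longrightarrow> R \<le> R' \<Longrightarrow> B \<le> B' \<Longrightarrow> wavelet_factor R' B' g"
  unfolding wavelet_factor_def by (meson less_le_trans of_nat_mono order_trans le_less_trans)

lemma wavelet_system_factors:
  assumes "wavelet_system \<alpha> \<phi> \<psi>" "\<alpha> \<ge> 1"
  shows "\<exists>R B. B \<ge> 1 \<and> wavelet_factor R B \<phi> \<and> wavelet_factor R B \<psi>"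
proof -
  obtain R1 B1 R2 B2 where w: "wavelet_factor R1 B1 \<phi>" "wavelet_factor R2 B2 \<psi>"
    using assms wavelet_factor_exists unfolding wavelet_system_def by meson
  show ?thesis
    by (intro exI[of _ "max R1 R2"] exI[of _ "max 1 (max B1 B2)"] conjI
        wavelet_factor_mono[OF w(1)] wavelet_factor_mono[OF w(2)]) auto
qed

section \<open>Counting the wavelets that overlap at a point\<close>

lemma vec_set_finite_card:
  fixes S :: "'d::finite \<Rightarrow> 'a set"
  assumes "\<And>i. finite (S i)"
  shows "finite {m :: 'a ^ 'd. \<forall>i. m $ i \<in> S i}" "card {m :: 'a ^ 'd. \<forall>i. m $ i \<in> S i} = (\<Prod>i\<in>UNIV. card (S i))"
proof -
  have b: "bij_betw vec_lambda (Pi\<^sub>E UNIV S) {m :: 'a ^ 'd. \<forall>i. m $ i \<in> S i}"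
    by (rule bij_betw_byWitness[where f'=vec_nth]) (auto simp: vec_lambda_inverse vec_nth_inverse)
  have f: "finite (Pi\<^sub>E UNIV S)" using assms by (intro finite_PiE) auto
  show "finite {m :: 'a ^ 'd. \<forall>i. m $ i \<in> S i}" using bij_betw_finite[OF b] f by simp
  show "card {m :: 'a ^ 'd. \<forall>i. m $ i \<in> S i} = (\<Prod>i\<in>UNIV. card (S i))"
    using bij_betw_same_card[OF b] by (simp add: card_PiE)
qed

definition near :: "nat \<Rightarrow> real ^ 'd \<Rightarrow> (int ^ 'd) set" where
  "near R y = {m. \<forall>i. \<bar>y $ i - of_int (m $ i)\<bar> \<le> R}"

lemma near_finite_card:
  fixes y :: "real ^ 'd::finite"
  shows "finite (near R y)" "card (near R y) \<le> (2 * R + 1) ^ CARD('d)"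
proof -
  define S where "S i = {\<lceil>y $ i - R\<rceil>..\<lfloor>y $ i + R\<rfloor>}" for i
  have eq: "near R y = {m. \<forall>i. m $ i \<in> S i}"
  proof -
    have "\<bar>y $ i - of_int k\<bar> \<le> R \<longleftrightarrow> k \<in> S i" for i k
      unfolding S_def atLeastAtMost_iff ceiling_le_iff le_floor_iff by linarith
    then show ?thesis by (simp add: near_def)
  qed
  have f: "finite (S i)" for i by (simp add: S_def)
  show "finite (near R y)" unfolding eq by (rule vec_set_finite_card[OF f])
  have "card (S i) \<le> 2 * R + 1" for i
  proof -
    have "\<lfloor>y $ i + R\<rfloor> - \<lceil>y $ i - R\<rceil> \<le> 2 * int R"
      by linarith
    then show ?thesis by (simp add: S_def)
  qed
  then have "(\<Prod>i\<in>UNIV. card (S i)) \<le> (\<Prod>i\<in>(UNIV::'d set). 2 * R + 1)" by (intro prod_mono) auto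
  then show "card (near R y) \<le> (2 * R + 1) ^ CARD('d)"
    unfolding eq using vec_set_finite_card(2)[of S, OF f] by simp
qed

definition shifts :: "nat \<Rightarrow> (int ^ 'd) set" where
  "shifts N = {n. \<forall>i. n $ i \<in> {- int N..int N}}"

lemma finite_shifts: "finite (shifts N :: (int ^ 'd::finite) set)"
  unfolding shifts_def by (rule vec_set_finite_card) simp

lemma finite_wavelet_positions: "finite (wavelet_positions j :: (int ^ 'd::finite) set)"
  using vec_set_finite_card(1)[of "\<lambda>i::'d. {0..<2 ^ j :: int}"] by (simp add: wavelet_positions_def)

lemma wavelet_types_finite_card:
  "finite (wavelet_types j :: (nat ^ 'd::finite) set)" "card (wavelet_types j :: (nat ^ 'd) set) \<le> 2 ^ CARD('d)"
proof -
  let ?S = "{l :: nat ^ 'd. \<forall>i. l $ i \<in> {0, 1}}"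
  have s: "wavelet_types j \<subseteq> ?S" by (auto simp: wavelet_types_def)
  have f: "finite ?S" and c: "card ?S = 2 ^ CARD('d)"
    using vec_set_finite_card[of "\<lambda>i::'d. {0, 1 :: nat}"] by (auto simp: numeral_2_eq_2)
  show "finite (wavelet_types j :: (nat ^ 'd) set)" using finite_subset[OF s f] .
  show "card (wavelet_types j :: (nat ^ 'd) set) \<le> 2 ^ CARD('d)" using card_mono[OF f s] c by simp
qed

definition dilate_shift :: "nat \<Rightarrow> int ^ 'd \<Rightarrow> int ^ 'd \<Rightarrow> int ^ 'd" where
  "dilate_shift j k n = (\<chi> i. 2 ^ j * n $ i + k $ i)"

text \<open>k is the remainder of 2^j n + k modulo 2^j. So pairs of a position and a period
  correspond to distinct integer points, and a double sum over such pairs becomes a count of integer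
  points near 2^j x.\<close>

lemma dilate_shift_inj: "inj_on (\<lambda>(k, n). dilate_shift j k n) (wavelet_positions j \<times> UNIV)"
proof (rule inj_onI, clarify)
  fix k n k' n' :: "int ^ 'd"
  assume k: "k \<in> wavelet_positions j" "k' \<in> wavelet_positions j" and e: "dilate_shift j k n = dilate_shift j k' n'"
  have "k $ i = k' $ i \<and> n $ i = n' $ i" for i
  proof -
    have e1: "2 ^ j * n $ i + k $ i = 2 ^ j * n' $ i + k' $ i"
      using arg_cong[OF e, of "\<lambda>v. v $ i"] by (simp add: dilate_shift_def)
    have kk: "0 \<le> k $ i" "k $ i < 2 ^ j" "0 \<le> k' $ i" "k' $ i < 2 ^ j" using k by (auto simp: wavelet_positions_def)
    have "k $ i = (2 ^ j * n $ i + k $ i) mod 2 ^ j" "k' $ i = (2 ^ j * n' $ i + k' $ i) mod 2 ^ j"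
      using kk by (simp_all add: mod_pos_pos_trivial)
    then have "k $ i = k' $ i" using e1 by simp
    then show ?thesis using e1 by simp
  qed
  then show "k = k' \<and> n = n'" by (simp add: vec_eq_iff)
qed

text \<open>The factor functions are a parameter since a partial derivative replaces one of them by
  its derivative, see \<open>dfactor\<close>.\<close>

definition local_product :: "('d \<Rightarrow> real \<Rightarrow> real) \<Rightarrow> nat \<Rightarrow> int ^ 'd \<Rightarrow> int ^ 'd \<Rightarrow> real ^ 'd \<Rightarrow> real" where
  "local_product h j k n x = (\<Prod>i\<in>UNIV. h i (2 ^ j * (x $ i - of_int (n $ i)) - of_int (k $ i)))"

text \<open>For fixed x only the integer points 2^j n + k within distance R of 2^j x contribute.\<close>

lemma local_product_sum:
  fixes h :: "'d::finite \<Rightarrow> real \<Rightarrow> real"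
  assumes h: "\<And>i x. \<bar>h i x\<bar> \<le> B" "\<And>i x. real R < \<bar>x\<bar> \<Longrightarrow> h i x = 0" and B: "B \<ge> 0" and F: "finite F"
  shows "(\<Sum>k\<in>wavelet_positions j. \<Sum>n\<in>F. \<bar>local_product h j k n x\<bar>) \<le> (B * (2 * real R + 1)) ^ CARD('d)"
proof -
  let ?y = "\<chi> i. 2 ^ j * x $ i"
  have le: "\<bar>local_product h j k n x\<bar> \<le> (if dilate_shift j k n \<in> near R ?y then B ^ CARD('d) else 0)" for k n
  proof (cases "dilate_shift j k n \<in> near R ?y")
    case True
    have "\<bar>local_product h j k n x\<bar> \<le> (\<Prod>i\<in>(UNIV::'d set). B)"
      unfolding local_product_def abs_prod by (intro prod_mono conjI h) auto
    then show ?thesis using True by simp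
  next
    case False
    then obtain i where "\<bar>2 ^ j * x $ i - of_int (2 ^ j * n $ i + k $ i)\<bar> > R"
      by (auto simp: near_def dilate_shift_def not_le)
    then have "h i (2 ^ j * (x $ i - of_int (n $ i)) - of_int (k $ i)) = 0"
      by (intro h) (simp add: algebra_simps)
    then have "local_product h j k n x = 0" unfolding local_product_def by (intro prod_zero) auto
    then show ?thesis using B by simp
  qed
  let ?S = "{z \<in> wavelet_positions j \<times> F. (\<lambda>(k, n). dilate_shift j k n) z \<in> near R ?y}"
  have fin: "finite (wavelet_positions j \<times> F)" using F finite_wavelet_positions by auto
  have "(\<Sum>k\<in>wavelet_positions j. \<Sum>n\<in>F. \<bar>local_product h j k n x\<bar>)
      \<le> (\<Sum>k\<in>wavelet_positions j. \<Sum>n\<in>F. if dilate_shift j k n \<in> near R ?y then B ^ CARD('d) else 0)"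
    by (intro sum_mono le)
  also have "\<dots> = (\<Sum>z\<in>wavelet_positions j \<times> F. if (\<lambda>(k, n). dilate_shift j k n) z \<in> near R ?y then B ^ CARD('d) else 0)"
    by (simp add: sum.cartesian_product split_beta)
  also have "\<dots> = real (card ?S) * B ^ CARD('d)"
    by (subst sum.inter_filter[symmetric, OF fin]) simp
  also have "\<dots> \<le> real ((2 * R + 1) ^ CARD('d)) * B ^ CARD('d)"
  proof (intro mult_right_mono of_nat_mono)
    have "card ?S = card ((\<lambda>(k, n). dilate_shift j k n) ` ?S)"
      by (rule card_image[symmetric], rule inj_on_subset[OF dilate_shift_inj]) auto
    also have "\<dots> \<le> card (near R ?y)" by (intro card_mono near_finite_card) auto
    also have "\<dots> \<le> (2 * R + 1) ^ CARD('d)" by (rule near_finite_card)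
    finally show "card ?S \<le> (2 * R + 1) ^ CARD('d)" .
  qed (use B in auto)
  also have "\<dots> = (B * (2 * real R + 1)) ^ CARD('d)" by (simp add: power_mult_distrib mult_ac add_ac)
  finally show ?thesis .
qed

text \<open>\<open>dummy\<close> fixes the type of coordinate directions, hence the dimension, which
  the types of the other parameters do not mention.\<close>

locale wavelets =
  fixes \<phi> \<psi> :: "real \<Rightarrow> real" and R :: nat and B :: real and p s :: real
    and dummy :: "'d::{finite,linorder} itself"
  assumes B1: "B \<ge> 1" and \<phi>: "wavelet_factor R B \<phi>" and \<psi>: "wavelet_factor R B \<psi>"
begin

definition factor :: "(nat, 'd) vec \<Rightarrow> 'd \<Rightarrow> real \<Rightarrow> real" where
  "factor l i = (if l $ i = 0 then \<phi> else \<psi>)"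

lemma factor: "wavelet_factor R B (factor l i)"
  using \<phi> \<psi> by (simp add: factor_def)

text \<open>A finite sum that agrees with the periodised wavelet on the unit cube and is C1 on the
  whole space, as \<open>level_series\<close> demands.\<close>

definition local_wavelet :: "'d wavelet_index \<Rightarrow> (real, 'd) vec \<Rightarrow> real" where
  "local_wavelet = (\<lambda>(j, k, l) x. 2 powr (real CARD('d) * real j / 2) * (\<Sum>n\<in>shifts (R + 2). local_product (factor l) j k n x))"

lemma tensor_eq: "tensor_wavelet \<phi> \<psi> (j, k, l) (\<chi> i. x $ i - of_int (n $ i)) = 2 powr (real CARD('d) * real j / 2) * local_product (factor l) j k n x"
  for k n :: "(int, 'd) vec"
  by (simp add: tensor_wavelet_def local_product_def factor_def)

lemma periodic_eq_local:
  assumes \<iota>: "\<iota> \<in> wavelet_indices" and x: "x \<in> cbox 0 1"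
  shows "periodic_wavelet \<phi> \<psi> \<iota> x = local_wavelet \<iota> x"
proof -
  obtain j k l where \<iota>': "\<iota> = (j, k, l)" by (metis prod_cases3)
  have k: "0 \<le> k $ i" "k $ i < 2 ^ j" for i using \<iota> by (auto simp: \<iota>' wavelet_indices_def wavelet_positions_def)
  \<comment> \<open>The origin of R + 2: for other shifts some coordinate has |x_i - n_i| \<ge> R +
    2 on the unit cube, and after subtracting k_i \<le> 2^j the argument is still at least 2^j (R +
    1) > R in modulus.\<close>
  have z: "tensor_wavelet \<phi> \<psi> \<iota> (\<chi> i. x $ i - of_int (n $ i)) = 0" if n: "n \<notin> shifts (R + 2)" for n :: "(int, 'd) vec"
  proof -
    obtain i where i: "n $ i \<notin> {- int (R + 2)..int (R + 2)}" using n by (auto simp: shifts_def)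
    then have "int R + 3 \<le> \<bar>n $ i\<bar>" by auto
    then have ni: "real R + 3 \<le> \<bar>real_of_int (n $ i)\<bar>" by linarith
    have xi: "0 \<le> x $ i" "x $ i \<le> 1" using x by (auto simp: mem_box_cart)
    have kj: "0 \<le> real_of_int (k $ i)" "real_of_int (k $ i) \<le> 2 ^ j"
    proof -
      show "0 \<le> real_of_int (k $ i)" using k(1)[of i] by simp
      have "real_of_int (k $ i) \<le> real_of_int (2 ^ j)" using k(2)[of i] by linarith
      then show "real_of_int (k $ i) \<le> 2 ^ j" by simp
    qed
    have "(2 ^ j :: real) * (real R + 2) \<le> 2 ^ j * \<bar>x $ i - of_int (n $ i)\<bar>"
      using ni xi by (intro mult_left_mono) auto
    then have "(2 ^ j :: real) * (real R + 1) \<le> \<bar>2 ^ j * (x $ i - of_int (n $ i))\<bar> - 2 ^ j"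
      unfolding abs_mult by (simp add: distrib_left)
    moreover have "real R + 1 \<le> 2 ^ j * (real R + 1)"
    proof -
      have "0 \<le> (2 ^ j - 1 :: real) * (real R + 1)" by (intro mult_nonneg_nonneg) auto
      then show ?thesis by (simp add: algebra_simps)
    qed
    ultimately have "\<bar>2 ^ j * (x $ i - of_int (n $ i)) - of_int (k $ i)\<bar> > R"
      using kj by linarith
    then have "factor l i (2 ^ j * (x $ i - of_int (n $ i)) - of_int (k $ i)) = 0"
      using factor[of l i] by (simp add: wavelet_factor_def)
    then have "local_product (factor l) j k n x = 0" unfolding local_product_def by (intro prod_zero) auto
    then show ?thesis unfolding \<iota>' tensor_eq by simp
  qed
  have "periodic_wavelet \<phi> \<psi> \<iota> x = infsum (\<lambda>n. tensor_wavelet \<phi> \<psi> \<iota> (\<chi> i. x $ i - of_int (n $ i))) (shifts (R + 2))"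
    unfolding periodic_wavelet_def by (rule infsum_cong_neutral) (use z in auto)
  also have "\<dots> = (\<Sum>n\<in>shifts (R + 2). tensor_wavelet \<phi> \<psi> \<iota> (\<chi> i. x $ i - of_int (n $ i)))"
    by (rule infsum_finite[OF finite_shifts])
  also have "\<dots> = local_wavelet \<iota> x"
    unfolding \<iota>' tensor_eq local_wavelet_def by (simp add: sum_distrib_left)
  finally show ?thesis .
qed

section \<open>Size and derivatives of the level functions\<close>

lemma local_product_has_derivative:
  "(local_product (factor l) j k n has_derivative
     (\<lambda>y. \<Sum>i\<in>UNIV. (2 ^ j * y $ i * deriv (factor l i) (2 ^ j * (x $ i - of_int (n $ i)) - of_int (k $ i))) *
       (\<Prod>i'\<in>UNIV - {i}. factor l i' (2 ^ j * (x $ i' - of_int (n $ i')) - of_int (k $ i'))))) (at x)"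
proof -
  have "((\<lambda>x. factor l i (2 ^ j * (x $ i - of_int (n $ i)) - of_int (k $ i))) has_derivative
      (\<lambda>y. 2 ^ j * y $ i * deriv (factor l i) (2 ^ j * (x $ i - of_int (n $ i)) - of_int (k $ i)))) (at x)" for i
  proof -
    have "(factor l i has_real_derivative deriv (factor l i) t) (at t)" for t
      using factor[of l i] by (simp add: wavelet_factor_def)
    from has_derivative_along[OF this, of "2 ^ j" "axis i 1" "- (2 ^ j) * of_int (n $ i) - of_int (k $ i)" x]
    show ?thesis by (simp add: inner_axis algebra_simps)
  qed
  from has_derivative_prod[where I=UNIV, OF this] show ?thesis
    unfolding local_product_def[abs_def] .
qed

lemma local_product_tcd: "times_cont_diff 1 (local_product (factor l) j k n)"
proof -
  have "times_cont_diff 1 (\<lambda>x. factor l i (2 ^ j * (x $ i - of_int (n $ i)) - of_int (k $ i)))" for i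
  proof -
    let ?d = "- (2 ^ j) * of_int (n $ i) - of_int (k $ i)"
    have D: "(factor l i has_real_derivative deriv (factor l i) t) (at t)" and c: "continuous_on UNIV (deriv (factor l i))" for t
      using factor[of l i] by (auto simp: wavelet_factor_def)
    have "times_cont_diff 1 (\<lambda>x :: (real, 'd) vec. factor l i (2 ^ j * (x \<bullet> axis i 1) + ?d))"
    proof (rule tcd_1I)
      show "((\<lambda>x. factor l i (2 ^ j * (x \<bullet> axis i 1) + ?d)) has_derivative
          (\<lambda>h. h \<bullet> ((2 ^ j * deriv (factor l i) (2 ^ j * (x \<bullet> axis i 1) + ?d)) *\<^sub>R axis i 1))) (at x)" for x :: "(real, 'd) vec"
        using has_derivative_along[OF D, of "2 ^ j" "axis i 1" ?d x] by (simp add: mult_ac)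
      show "continuous_on UNIV (\<lambda>x :: (real, 'd) vec. (2 ^ j * deriv (factor l i) (2 ^ j * (x \<bullet> axis i 1) + ?d)) *\<^sub>R (axis i 1 :: (real, 'd) vec))"
        by (rule continuous_on_scaleR[OF continuous_on_mult_left[OF continuous_on_compose2[OF c]] continuous_on_const])
          (auto intro!: continuous_intros)
    qed
    then show ?thesis by (simp add: inner_axis algebra_simps)
  qed
  then show ?thesis unfolding local_product_def[abs_def] by (rule tcd_prod)
qed

definition dfactor :: "'d \<Rightarrow> (nat, 'd) vec \<Rightarrow> 'd \<Rightarrow> real \<Rightarrow> real" where
  "dfactor e l i = (if i = e then deriv (factor l i) else factor l i)"

lemma local_product_partial:
  "partial_deriv (axis e 1) (local_product (factor l) j k n) x = 2 ^ j * local_product (dfactor e l) j k n x"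
proof -
  let ?t = "\<lambda>i. 2 ^ j * (x $ i - of_int (n $ i)) - of_int (k $ i)"
  have "partial_deriv (axis e 1) (local_product (factor l) j k n) x =
      (\<Sum>i\<in>UNIV. (2 ^ j * axis e 1 $ i * deriv (factor l i) (?t i)) * (\<Prod>i'\<in>UNIV - {i}. factor l i' (?t i')))"
    by (rule partial_deriv_eq[OF local_product_has_derivative])
  also have "\<dots> = (\<Sum>i\<in>UNIV. if i = e then 2 ^ j * deriv (factor l e) (?t e) * (\<Prod>i'\<in>UNIV - {e}. factor l i' (?t i')) else 0)"
    by (intro sum.cong) (auto simp: axis_def)
  also have "\<dots> = 2 ^ j * (deriv (factor l e) (?t e) * (\<Prod>i'\<in>UNIV - {e}. factor l i' (?t i')))"
    by simp
  also have "deriv (factor l e) (?t e) * (\<Prod>i'\<in>UNIV - {e}. factor l i' (?t i')) = local_product (dfactor e l) j k n x"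
    unfolding local_product_def by (subst prod.remove[of UNIV e]) (auto simp: dfactor_def intro!: prod.cong)
  finally show ?thesis .
qed

text \<open>2^d bounds the number of wavelet types, and (B (2 R + 1))^d the sum over all translates
  of one type at a point.\<close>

definition wconst :: real where
  "wconst = (2 * (B * (2 * real R + 1))) ^ CARD('d)"

lemma wconst_pos: "wconst > 0"
  unfolding wconst_def using B1 by (intro zero_less_power mult_pos_pos) auto

definition level_set :: "nat \<Rightarrow> (((int, 'd) vec) \<times> ((nat, 'd) vec)) set" where
  "level_set j = wavelet_positions j \<times> wavelet_types j"

lemma finite_level_set: "finite (level_set j)"
  unfolding level_set_def using finite_wavelet_positions wavelet_types_finite_card by auto

lemma wavelet_indices_Sigma: "wavelet_indices = Sigma UNIV level_set"
  by (auto simp: wavelet_indices_def level_set_def)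

definition scaling :: "nat \<Rightarrow> real" where
  "scaling j = 2 powr (- real j * (s + real CARD('d) / 2 - real CARD('d) / p))"

definition term_size :: "((nat, 'd) vec \<Rightarrow> 'd \<Rightarrow> real \<Rightarrow> real) \<Rightarrow> nat \<Rightarrow> (int, 'd) vec \<Rightarrow> (nat, 'd) vec \<Rightarrow> (real, 'd) vec \<Rightarrow> real" where
  "term_size h j k l x = 2 powr (real CARD('d) * real j / 2) * (\<Sum>n\<in>shifts (R + 2). \<bar>local_product (h l) j k n x\<bar>)"

text \<open>At a fixed point the overlap is bounded independently of j, so summing over positions
  costs a constant only. The L2 normalisation 2^(dj/2) cancels against the same power in
  \<open>scaling\<close>, which leaves 2^(-j (s - d/p)).\<close>

lemma level_abs_sum:
  assumes h: "\<And>l i x. \<bar>h l i x\<bar> \<le> B" "\<And>l i x. real R < \<bar>x\<bar> \<Longrightarrow> h l i x = 0"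
    and m: "\<And>k l. (k, l) \<in> level_set j \<Longrightarrow> \<bar>c (j, k, l)\<bar> \<le> m" and m0: "m \<ge> 0"
  shows "(\<Sum>(k, l)\<in>level_set j. scaling j * \<bar>c (j, k, l)\<bar> * term_size h j k l x) \<le> wconst * 2 powr (- real j * (s - real CARD('d) / p)) * m"
proof -
  let ?P = "2 powr (real CARD('d) * real j / 2)"
  have pos: "0 \<le> (\<Sum>n\<in>shifts (R + 2). \<bar>local_product (h l) j k n x\<bar>)" for k l by (intro sum_nonneg) auto
  have sc: "0 \<le> scaling j" by (simp add: scaling_def)
  have "(\<Sum>(k, l)\<in>level_set j. scaling j * \<bar>c (j, k, l)\<bar> * term_size h j k l x)
      \<le> (\<Sum>(k, l)\<in>level_set j. scaling j * m * ?P * (\<Sum>n\<in>shifts (R + 2). \<bar>local_product (h l) j k n x\<bar>))"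
  proof (rule sum_mono, clarify)
    fix k l assume "(k, l) \<in> level_set j"
    from m[OF this] have "scaling j * \<bar>c (j, k, l)\<bar> * term_size h j k l x \<le> scaling j * m * term_size h j k l x"
      unfolding term_size_def using sc pos by (intro mult_right_mono mult_left_mono mult_nonneg_nonneg) auto
    then show "scaling j * \<bar>c (j, k, l)\<bar> * term_size h j k l x \<le> scaling j * m * ?P * (\<Sum>n\<in>shifts (R + 2). \<bar>local_product (h l) j k n x\<bar>)"
      by (simp add: term_size_def mult.assoc)
  qed
  also have "\<dots> = scaling j * m * ?P * (\<Sum>l\<in>wavelet_types j. \<Sum>k\<in>wavelet_positions j. \<Sum>n\<in>shifts (R + 2). \<bar>local_product (h l) j k n x\<bar>)"
    unfolding level_set_def sum.cartesian_product[symmetric] by (subst sum.swap) (simp add: sum_distrib_left)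
  also have "\<dots> \<le> scaling j * m * ?P * (\<Sum>l\<in>(wavelet_types j :: ((nat, 'd) vec) set). (B * (2 * real R + 1)) ^ CARD('d))"
    using sc m0 B1 by (intro mult_left_mono sum_mono local_product_sum h finite_shifts) auto
  also have "\<dots> = scaling j * m * ?P * (real (card (wavelet_types j :: ((nat, 'd) vec) set)) * (B * (2 * real R + 1)) ^ CARD('d))"
    by simp
  also have "\<dots> \<le> scaling j * m * ?P * (real (2 ^ CARD('d)) * (B * (2 * real R + 1)) ^ CARD('d))"
    using sc m0 B1 wavelet_types_finite_card(2)[where 'd='d, of j]
    by (intro mult_left_mono mult_right_mono of_nat_mono mult_nonneg_nonneg) auto
  also have "\<dots> = wconst * (scaling j * ?P) * m"
    unfolding wconst_def power_mult_distrib[of 2 "B * (2 * real R + 1)"] by (simp add: mult_ac)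
  also have "scaling j * ?P = 2 powr (- real j * (s - real CARD('d) / p))"
    unfolding scaling_def by (simp add: powr_add[symmetric] algebra_simps)
  finally show ?thesis .
qed

definition level_fun :: "('d wavelet_index \<Rightarrow> real) \<Rightarrow> nat \<Rightarrow> (real, 'd) vec \<Rightarrow> real" where
  "level_fun c j x = (\<Sum>(k, l)\<in>level_set j. scaling j * c (j, k, l) * local_wavelet (j, k, l) x)"

lemma factor_bounds: "\<bar>factor l i x\<bar> \<le> B" "\<bar>x\<bar> > real R \<Longrightarrow> factor l i x = 0"
  "\<bar>dfactor e l i x\<bar> \<le> B" "\<bar>x\<bar> > real R \<Longrightarrow> dfactor e l i x = 0"
  using factor[of l i] by (auto simp: wavelet_factor_def dfactor_def)

lemma local_wavelet_abs: "\<bar>local_wavelet (j, k, l) x\<bar> \<le> term_size factor j k l x"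
  unfolding local_wavelet_def term_size_def by (simp add: abs_mult sum_abs)

lemma local_wavelet_tcd: "times_cont_diff 1 (local_wavelet \<iota>)"
proof -
  obtain j k l where \<iota>': "\<iota> = (j, k, l)" by (metis prod_cases3)
  show ?thesis unfolding \<iota>' local_wavelet_def prod.case by (intro tcd_scale tcd_sum local_product_tcd)
qed

lemma local_wavelet_partial: "\<bar>partial_deriv (axis e 1) (local_wavelet (j, k, l)) x\<bar> \<le> 2 ^ j * term_size (dfactor e) j k l x"
proof -
  have d: "local_product (factor l) j k n differentiable (at x)" for n
    using local_product_tcd[of l j k n] by simp
  have ds: "(\<lambda>x. \<Sum>n\<in>shifts (R + 2). local_product (factor l) j k n x) differentiable (at x)"
    by (intro differentiable_sum) (use d finite_shifts in auto)
  have "partial_deriv (axis e 1) (local_wavelet (j, k, l)) x =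
      2 powr (real CARD('d) * real j / 2) * (\<Sum>n\<in>shifts (R + 2). 2 ^ j * local_product (dfactor e l) j k n x)"
    unfolding local_wavelet_def prod.case partial_deriv_scale[OF ds] partial_deriv_sum[OF d] local_product_partial ..
  also have "\<bar>\<dots>\<bar> = 2 powr (real CARD('d) * real j / 2) * \<bar>\<Sum>n\<in>shifts (R + 2). 2 ^ j * local_product (dfactor e l) j k n x\<bar>"
    by (simp add: abs_mult)
  also have "\<dots> \<le> 2 powr (real CARD('d) * real j / 2) * (\<Sum>n\<in>shifts (R + 2). \<bar>2 ^ j * local_product (dfactor e l) j k n x\<bar>)"
    by (intro mult_left_mono sum_abs) auto
  also have "\<dots> = 2 ^ j * term_size (dfactor e) j k l x"
    by (simp add: term_size_def abs_mult sum_distrib_left mult_ac)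
  finally show ?thesis .
qed

lemma level_fun_tcd: "times_cont_diff 1 (level_fun c j)"
  unfolding level_fun_def[abs_def] split_beta by (intro tcd_sum tcd_scale local_wavelet_tcd)

lemma level_fun_abs_terms:
  assumes m: "\<And>k l. (k, l) \<in> level_set j \<Longrightarrow> \<bar>c (j, k, l)\<bar> \<le> m" and m0: "m \<ge> 0"
  shows "(\<Sum>(k, l)\<in>level_set j. \<bar>scaling j * c (j, k, l) * local_wavelet (j, k, l) x\<bar>) \<le> wconst * 2 powr (- real j * (s - real CARD('d) / p)) * m"
proof -
  have "(\<Sum>(k, l)\<in>level_set j. \<bar>scaling j * c (j, k, l) * local_wavelet (j, k, l) x\<bar>)
      \<le> (\<Sum>(k, l)\<in>level_set j. scaling j * \<bar>c (j, k, l)\<bar> * term_size factor j k l x)"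
    by (rule sum_mono) (auto simp: abs_mult scaling_def intro!: mult_left_mono local_wavelet_abs)
  also have "\<dots> \<le> wconst * 2 powr (- real j * (s - real CARD('d) / p)) * m"
    by (rule level_abs_sum[of factor j c m x, OF factor_bounds(1,2) m m0])
  finally show ?thesis .
qed

lemma level_fun_abs:
  assumes m: "\<And>k l. (k, l) \<in> level_set j \<Longrightarrow> \<bar>c (j, k, l)\<bar> \<le> m" and m0: "m \<ge> 0"
  shows "\<bar>level_fun c j x\<bar> \<le> wconst * 2 powr (- real j * (s - real CARD('d) / p)) * m"
proof -
  have "\<bar>level_fun c j x\<bar> \<le> (\<Sum>(k, l)\<in>level_set j. \<bar>scaling j * c (j, k, l) * local_wavelet (j, k, l) x\<bar>)"
    unfolding level_fun_def by (rule order_trans[OF sum_abs]) (simp add: split_beta)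
  with level_fun_abs_terms[of j c m x, OF m m0] show ?thesis by simp
qed

lemma level_fun_partial:
  assumes m: "\<And>k l. (k, l) \<in> level_set j \<Longrightarrow> \<bar>c (j, k, l)\<bar> \<le> m" and m0: "m \<ge> 0" and e: "e \<in> Basis"
  shows "\<bar>partial_deriv e (level_fun c j) x\<bar> \<le> 2 ^ j * (wconst * 2 powr (- real j * (s - real CARD('d) / p)) * m)"
proof -
  obtain i where e': "e = axis i 1" using e by (auto simp: Basis_vec_def)
  have dl: "local_wavelet \<iota> differentiable (at x)" for \<iota> using local_wavelet_tcd[of \<iota>] by simp
  have d: "(\<lambda>x. a * local_wavelet \<iota> x) differentiable (at x)" for \<iota> a
    by (rule tcd_1_differentiable[OF tcd_scale[OF local_wavelet_tcd]])
  have "partial_deriv e (level_fun c j) x = (\<Sum>z\<in>level_set j. scaling j * c (j, z) * partial_deriv e (local_wavelet (j, z)) x)"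
    unfolding level_fun_def[abs_def] split_beta prod.collapse
    by (subst partial_deriv_sum[OF d]) (simp add: partial_deriv_scale[OF dl])
  also have "\<bar>\<dots>\<bar> \<le> (\<Sum>z\<in>level_set j. scaling j * \<bar>c (j, z)\<bar> * (2 ^ j * term_size (dfactor i) j (fst z) (snd z) x))"
  proof (rule order_trans[OF sum_abs], rule sum_mono)
    fix z assume "z \<in> level_set j"
    have "\<bar>partial_deriv e (local_wavelet (j, z)) x\<bar> \<le> 2 ^ j * term_size (dfactor i) j (fst z) (snd z) x"
      using local_wavelet_partial[of i j "fst z" "snd z" x] by (simp add: e')
    then show "\<bar>scaling j * c (j, z) * partial_deriv e (local_wavelet (j, z)) x\<bar> \<le> scaling j * \<bar>c (j, z)\<bar> * (2 ^ j * term_size (dfactor i) j (fst z) (snd z) x)"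
      by (simp add: abs_mult scaling_def mult_left_mono)
  qed
  also have "\<dots> = 2 ^ j * (\<Sum>(k, l)\<in>level_set j. scaling j * \<bar>c (j, k, l)\<bar> * term_size (dfactor i) j k l x)"
    unfolding split_beta prod.collapse by (simp add: sum_distrib_left mult_ac)
  also have "\<dots> \<le> 2 ^ j * (wconst * 2 powr (- real j * (s - real CARD('d) / p)) * m)"
    by (intro mult_left_mono level_abs_sum[of "dfactor i" j c m x, OF factor_bounds(3,4) m m0]) auto
  finally show ?thesis .
qed

lemma level_fun_diff:
  "level_fun c j x - level_fun c' j x = level_fun (\<lambda>\<iota>. c \<iota> - c' \<iota>) j x"
  unfolding level_fun_def by (simp add: sum_subtractf[symmetric] split_beta algebra_simps)

lemma level_fun_partial_diff:
  assumes "e \<in> Basis"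
  shows "partial_deriv e (level_fun c j) x - partial_deriv e (level_fun c' j) x = partial_deriv e (level_fun (\<lambda>\<iota>. c \<iota> - c' \<iota>) j) x"
proof -
  have d: "level_fun c j differentiable (at x)" for c using level_fun_tcd[of c j] by simp
  have "level_fun c j = (\<lambda>x. level_fun (\<lambda>\<iota>. c \<iota> - c' \<iota>) j x + level_fun c' j x)"
    using level_fun_diff[of c j _ c'] by (auto simp: fun_eq_iff algebra_simps)
  then have "partial_deriv e (level_fun c j) x = partial_deriv e (level_fun (\<lambda>\<iota>. c \<iota> - c' \<iota>) j) x + partial_deriv e (level_fun c' j) x"
    using partial_deriv_add[OF d d] by simp
  then show ?thesis by simp
qed

lemma tree_indices_subset: "tree_indices t \<subseteq> (wavelet_indices :: 'd wavelet_index set)"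
  by (auto simp: tree_indices_def wavelet_indices_def wavelet_positions_def number_position_def)

text \<open>The tree enters as zero coefficients off it. Absolute summability over all indices
  permits regrouping the unordered sum by levels.\<close>

lemma besov_tree_field_levels:
  fixes X :: "'d wavelet_index \<Rightarrow> 'w \<Rightarrow> real" and T :: "'w \<Rightarrow> nat list set" and \<omega> :: 'w
  defines "c \<equiv> \<lambda>\<iota>. if \<iota> \<in> tree_indices (T \<omega>) then X \<iota> \<omega> else 0"
  assumes m: "\<And>j k l. (k, l) \<in> level_set j \<Longrightarrow> \<bar>c (j, k, l)\<bar> \<le> m j" and m0: "\<And>j. m j \<ge> 0"
    and sum: "summable (\<lambda>j. 2 powr (- real j * (s - real CARD('d) / p)) * m j)" and x: "x \<in> cbox 0 1"
  shows "besov_tree_field \<phi> \<psi> p s X T \<omega> x = (\<Sum>j. level_fun c j x)"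
proof -
  let ?g = "\<lambda>\<iota>. scaling (fst \<iota>) * c \<iota> * local_wavelet \<iota> x"
  have sum': "summable (\<lambda>j. wconst * 2 powr (- real j * (s - real CARD('d) / p)) * m j)"
    using summable_mult[OF sum, of wconst] by (simp add: mult.assoc)
  have "besov_tree_field \<phi> \<psi> p s X T \<omega> x = infsum ?g wavelet_indices"
    unfolding besov_tree_field_def
    by (rule infsum_cong_neutral)
      (use tree_indices_subset[of "T \<omega>"] periodic_eq_local[OF _ x] in \<open>auto simp: c_def scaling_def\<close>)
  also have "\<dots> = infsum (\<lambda>j. infsum (\<lambda>z. ?g (j, z)) (level_set j)) UNIV"
  proof -
    have fin: "infsum (\<lambda>z. norm (?g (j, z))) (level_set j) = (\<Sum>z\<in>level_set j. norm (?g (j, z)))" for j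
      by (rule infsum_finite[OF finite_level_set])
    have le: "(\<Sum>z\<in>level_set j. norm (?g (j, z))) \<le> wconst * 2 powr (- real j * (s - real CARD('d) / p)) * m j" for j
      using level_fun_abs_terms[of j c "m j" x] m m0 by (simp add: split_beta)
    have "summable (\<lambda>j. norm (\<Sum>z\<in>level_set j. norm (?g (j, z))))"
      by (rule summable_comparison_test'[OF sum', of 0]) (use le in \<open>simp add: sum_nonneg\<close>)
    then have "(\<lambda>j. norm (\<Sum>z\<in>level_set j. norm (?g (j, z)))) summable_on UNIV"
      by (intro norm_summable_imp_summable_on) simp
    then have "(\<lambda>\<iota>. norm (?g \<iota>)) summable_on Sigma UNIV level_set"
      by (intro Infinite_Sum.abs_summable_on_Sigma_iff[THEN iffD2] conjI ballI summable_on_finite[OF finite_level_set]) (simp only: fin)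
    then have "?g summable_on Sigma UNIV level_set" by (rule abs_summable_summable)
    then show ?thesis unfolding wavelet_indices_Sigma by (rule infsum_Sigma_banach[symmetric])
  qed
  also have "\<dots> = infsum (\<lambda>j. level_fun c j x) UNIV"
    by (rule infsum_cong) (simp add: infsum_finite[OF finite_level_set] level_fun_def split_beta)
  also have "\<dots> = (\<Sum>j. level_fun c j x)"
  proof -
    have n: "summable (\<lambda>j. norm (level_fun c j x))"
    proof (rule summable_comparison_test'[OF sum', of 0])
      show "norm (norm (level_fun c j x)) \<le> wconst * 2 powr (- real j * (s - real CARD('d) / p)) * m j" for j
        using level_fun_abs[of j c "m j" x] m m0 by simp
    qed
    from norm_summable_imp_has_sum[OF n summable_sums[OF summable_norm_cancel[OF n]]]
    show ?thesis by (rule infsumI)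
  qed
  finally show ?thesis .
qed

end

section \<open>Measurability of tree events\<close>

text \<open>A tree at distance less than 2^(-n) from t, with n the length of the node, agrees with t
  at least up to level n and hence contains the node too.\<close>

lemma tree_node_open:
  "openin (Metric_space.mtopology tree_space tree_dist) {t \<in> tree_space. \<nn> \<in> t}"
proof -
  interpret Metric_space tree_space tree_dist by (rule Metric_space_tree)
  show ?thesis
    unfolding openin_mtopology
  proof (intro conjI ballI allI impI)
    fix t assume "t \<in> {t \<in> tree_space. \<nn> \<in> t}"
    then have t: "t \<in> tree_space" "\<nn> \<in> t" by auto
    show "\<exists>r>0. mball t r \<subseteq> {t \<in> tree_space. \<nn> \<in> t}"
    proof (intro exI[of _ "2 powr (- real (length \<nn>))"] conjI subsetI)
      fix t' assume "t' \<in> mball t (2 powr (- real (length \<nn>)))"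
      then have t': "t' \<in> tree_space" "tree_dist t t' < 2 powr (- real (length \<nn>))" by auto
      show "t' \<in> {t \<in> tree_space. \<nn> \<in> t}"
      proof (cases "t = t'")
        case False
        let ?A = "{n. tree_trunc n t = tree_trunc n t'}"
        have "?A \<noteq> {}" using tree_trunc_0[OF t(1)] tree_trunc_0[OF t'(1)] by auto
        then have "Sup ?A \<in> ?A"
          using Max_in[OF tree_trunc_agree_finite[OF False]] by (simp add: Sup_nat_def)
        then have "tree_trunc (Sup ?A) t = tree_trunc (Sup ?A) t'" by simp
        moreover have "length \<nn> < Sup ?A" using t'(2) False by (simp add: tree_dist_def)
        ultimately have "tree_trunc (length \<nn>) t = tree_trunc (length \<nn>) t'"
          using tree_trunc_mono by (meson less_imp_le)
        moreover have "\<nn> \<in> tree_trunc (length \<nn>) t" using t by (simp add: tree_trunc_def)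
        ultimately show ?thesis using t'(1) by (auto simp: tree_trunc_def)
      qed (use t t' in auto)
    qed simp
  qed auto
qed

text \<open>A countable union of node events, which are preimages of open sets.\<close>

lemma tree_indices_measurable:
  fixes \<iota> :: "'d::{finite,linorder} wavelet_index"
  assumes T: "T \<in> measurable M tree_borel"
  shows "{\<omega> \<in> space M. \<iota> \<in> tree_indices (T \<omega>)} \<in> sets M"
proof -
  let ?O = "{B. openin (Metric_space.mtopology tree_space tree_dist) B}"
  have sub: "?O \<subseteq> Pow tree_space"
    using Metric_space.topspace_mtopology[OF Metric_space_tree] openin_subset by fastforce
  have sp: "space tree_borel = tree_space" unfolding tree_borel_def using sub by (rule space_measure_of)
  have node: "{\<omega> \<in> space M. \<nn> \<in> T \<omega>} \<in> sets M" for \<nn>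
  proof -
    have "{t \<in> tree_space. \<nn> \<in> t} \<in> sets tree_borel"
      unfolding tree_borel_def sets_measure_of[OF sub] using tree_node_open by (intro sigma_sets.Basic) simp
    from measurable_sets[OF T this] show ?thesis
      using measurable_space[OF T] sp by (auto intro: back_subst[of "\<lambda>A. A \<in> sets M"])
  qed
  obtain j k l where \<iota>': "\<iota> = (j, k, l)" by (metis prod_cases3)
  have "{\<omega> \<in> space M. \<iota> \<in> tree_indices (T \<omega>)} = (\<Union>\<nn>\<in>{\<nn>. l \<in> wavelet_types j \<and> j = length \<nn> \<and> k = number_position j (node_number CARD('d) \<nn>)}. {\<omega> \<in> space M. \<nn> \<in> T \<omega>})"
    by (auto simp: \<iota>' tree_indices_def)
  also have "\<dots> \<in> sets M" by (intro sets.countable_UN'' node) auto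
  finally show ?thesis .
qed

section \<open>Measurability and moments\<close>

text \<open>Completeness is what makes norms of almost sure limits measurable, see
  \<open>bochner_Lq_bound\<close>.\<close>

lemma (in complete_measure) measurable_AE_cong:
  fixes f g :: "'a \<Rightarrow> 'b::topological_space"
  assumes g: "g \<in> borel_measurable M" and ae: "AE x in M. f x = g x"
  shows "f \<in> borel_measurable M"
proof (rule measurableI)
  fix A :: "'b set" assume A: "A \<in> sets borel"
  obtain N where N: "N \<in> null_sets M" "{x \<in> space M. f x \<noteq> g x} \<subseteq> N"
    using ae by (auto simp: eventually_ae_filter)
  have *: "Z \<in> sets M" if "Z \<subseteq> N" for Z by (rule complete[OF that N(1)])
  have "f -` A \<inter> space M = ((g -` A \<inter> space M) - {x \<in> space M. f x \<noteq> g x}) \<union> {x \<in> space M. f x \<noteq> g x \<and> f x \<in> A}"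
    by auto
  also have "\<dots> \<in> sets M"
  proof (intro sets.Un sets.Diff measurable_sets[OF g A])
    show "{x \<in> space M. f x \<noteq> g x} \<in> sets M" by (rule *[OF N(2)])
    show "{x \<in> space M. f x \<noteq> g x \<and> f x \<in> A} \<in> sets M" by (rule *) (use N(2) in auto)
  qed
  finally show "f -` A \<inter> space M \<in> sets M" .
qed simp

text \<open>The reverse triangle inequality turns convergence of the simple functions into
  convergence of their norms, which makes the norm of \<open>u\<close> measurable; the moment bound
  follows by domination.\<close>

lemma bochner_Lq_bound:
  assumes M: "complete_measure M" and u: "strongly_measurable M S N u"
    and N: "\<And>v w. v \<in> S \<Longrightarrow> w \<in> S \<Longrightarrow> \<bar>N v - N w\<bar> \<le> N (\<lambda>x. v x - w x)"
    and h: "integrable M h" and K: "K \<ge> 0" and q: "q \<ge> 1"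
    and bound: "AE \<omega> in M. N (u \<omega>) powr q \<le> K powr q * h \<omega>"
  shows "u \<in> bochner_Lq q M S N" "bochner_Lq_norm q M N u \<le> K * (LINT \<omega>|M. \<bar>h \<omega>\<bar>) powr (1 / q)"
proof -
  interpret complete_measure M by (rule M)
  obtain g where g0: "(\<forall>n. simple_function M (g n) \<and> g n ` space M \<subseteq> S) \<and>
     (AE \<omega> in M. u \<omega> \<in> S \<and> (\<lambda>n. N (\<lambda>x. u \<omega> x - g n \<omega> x)) \<longlonglongrightarrow> 0)"
    using u unfolding strongly_measurable_def by (rule exE)
  have g: "\<And>n. simple_function M (g n)" "\<And>n. g n ` space M \<subseteq> S"
    "AE \<omega> in M. u \<omega> \<in> S \<and> (\<lambda>n. N (\<lambda>x. u \<omega> x - g n \<omega> x)) \<longlonglongrightarrow> 0"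
    by (simp_all only: g0[THEN conjunct1, rule_format] g0[THEN conjunct2])
  have m: "(\<lambda>\<omega>. N (g n \<omega>)) \<in> borel_measurable M" for n
    by (rule borel_measurable_simple_function[OF simple_function_compose1[OF g(1)]])
  have lim: "AE \<omega> in M. N (u \<omega>) = lim (\<lambda>n. N (g n \<omega>))"
    using g(3) AE_space
  proof eventually_elim
    case (elim \<omega>)
    then have S: "u \<omega> \<in> S" "\<And>n. g n \<omega> \<in> S" using g(2) by auto
    have "(\<lambda>n. N (u \<omega>) - N (g n \<omega>)) \<longlonglongrightarrow> 0"
      by (rule Lim_null_comparison[of _ "\<lambda>n. N (\<lambda>x. u \<omega> x - g n \<omega> x)"]) (use N S elim in auto)
    then have "(\<lambda>n. N (u \<omega>) - (N (u \<omega>) - N (g n \<omega>))) \<longlonglongrightarrow> N (u \<omega>) - 0"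
      by (intro tendsto_intros)
    then show ?case by (simp add: limI)
  qed
  have mu: "(\<lambda>\<omega>. N (u \<omega>)) \<in> borel_measurable M"
    by (rule measurable_AE_cong[OF _ lim]) (use m in measurable)
  have i: "integrable M (\<lambda>\<omega>. N (u \<omega>) powr q)"
  proof (rule Bochner_Integration.integrable_bound[of M "\<lambda>\<omega>. K powr q * h \<omega>"])
    show "integrable M (\<lambda>\<omega>. K powr q * h \<omega>)" using h by simp
    show "AE \<omega> in M. norm (N (u \<omega>) powr q) \<le> norm (K powr q * h \<omega>)"
      using bound by eventually_elim simp
  qed (use mu in measurable)
  then show "u \<in> bochner_Lq q M S N" using u by (simp add: bochner_Lq_def)
  have "(LINT \<omega>|M. N (u \<omega>) powr q) \<le> (LINT \<omega>|M. K powr q * \<bar>h \<omega>\<bar>)"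
  proof (rule integral_mono_AE[OF i])
    show "integrable M (\<lambda>\<omega>. K powr q * \<bar>h \<omega>\<bar>)" using h by simp
    show "AE \<omega> in M. N (u \<omega>) powr q \<le> K powr q * \<bar>h \<omega>\<bar>"
      using bound by eventually_elim (meson abs_ge_self mult_left_mono order_trans powr_ge_zero)
  qed
  then have "(LINT \<omega>|M. N (u \<omega>) powr q) powr (1 / q) \<le> (K powr q * (LINT \<omega>|M. \<bar>h \<omega>\<bar>)) powr (1 / q)"
    using q by (intro powr_mono2) auto
  also have "\<dots> = K * (LINT \<omega>|M. \<bar>h \<omega>\<bar>) powr (1 / q)"
    using K q by (simp add: powr_mult powr_powr)
  finally show "bochner_Lq_norm q M N u \<le> K * (LINT \<omega>|M. \<bar>h \<omega>\<bar>) powr (1 / q)"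
    by (simp add: bochner_Lq_norm_def)
qed

section \<open>Exponential moments of the coefficient density\<close>

lemma nn_integral_exp_abs_finite:
  fixes c :: real
  assumes c: "c > 0"
  shows "(\<integral>\<^sup>+y. ennreal (exp (- c * \<bar>y\<bar>)) \<partial>lborel) < \<infinity>"
proof -
  interpret E: prob_space "density lborel (exponential_density c)" by (rule prob_space_exponential_density[OF c])
  have 1: "(\<integral>\<^sup>+y. ennreal (exponential_density c y) \<partial>lborel) = 1"
    using E.emeasure_space_1 by (simp add: emeasure_density)
  have 2: "(\<integral>\<^sup>+y. ennreal (exponential_density c (- y)) \<partial>lborel) = 1"
    using nn_integral_real_affine[of "\<lambda>y. ennreal (exponential_density c y)" "-1" 0] 1 by simp
  \<comment> \<open>The exponential density and its reflection together dominate the two-sided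
    exponential.\<close>
  have le: "ennreal (exp (- c * \<bar>y\<bar>)) \<le> ennreal (1 / c) * (ennreal (exponential_density c y) + ennreal (exponential_density c (- y)))" for y
  proof -
    have "exp (- c * \<bar>y\<bar>) \<le> 1 / c * (exponential_density c y + exponential_density c (- y))"
      using c by (auto simp: erlang_density_def field_simps abs_if)
    then show ?thesis using c by (simp add: ennreal_plus[symmetric] ennreal_mult[symmetric] ennreal_leI del: ennreal_plus)
  qed
  have "(\<integral>\<^sup>+y. ennreal (exp (- c * \<bar>y\<bar>)) \<partial>lborel) \<le>
      (\<integral>\<^sup>+y. ennreal (1 / c) * (ennreal (exponential_density c y) + ennreal (exponential_density c (- y))) \<partial>lborel)"
    by (rule nn_integral_mono) (rule le)
  also have "\<dots> = ennreal (1 / c) * (1 + 1)"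
    by (subst nn_integral_cmult, measurable, subst nn_integral_add, measurable) (simp only: 1 2)
  also have "\<dots> < \<infinity>" by (simp add: ennreal_mult_less_top)
  finally show ?thesis .
qed

definition exp_moment :: "real \<Rightarrow> real \<Rightarrow> real \<Rightarrow> ennreal" where
  "exp_moment p \<kappa> \<mu> = (\<integral>\<^sup>+y. ennreal (coeff_density p \<kappa> y) * ennreal (exp (\<mu> * \<bar>y\<bar>)) \<partial>lborel)"

text \<open>The source of the difference between p = 1 and p > 1. For p = 1 the slack is 1/\<kappa>
  - \<mu>. For p > 1 the power wins eventually: \<open>t0\<close> is the point where t^p / \<kappa>
  = (\<mu> + 1) t.\<close>

lemma coeff_exponent_bound:
  fixes \<kappa> p \<mu> :: real
  assumes \<kappa>: "\<kappa> > 0" and p: "p \<ge> 1" and \<mu>: "\<mu> > 0" and p1: "p = 1 \<Longrightarrow> \<mu> < 1 / \<kappa>"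
  shows "\<exists>c>0. \<exists>C. \<forall>t\<ge>0. \<mu> * t - t powr p / \<kappa> \<le> C - c * t"
proof (cases "p = 1")
  case True
  have "1 / \<kappa> - \<mu> > 0" by (rule diff_gt_0_iff_gt[THEN iffD2, OF p1[OF True]])
  then show ?thesis using True by (intro exI[of _ "1 / \<kappa> - \<mu>"] conjI exI[of _ 0]) (auto simp: algebra_simps)
next
  case False
  then have p: "p > 1" using p by simp
  define t0 where "t0 = (\<kappa> * (\<mu> + 1)) powr (1 / (p - 1))"
  have "\<mu> * t - t powr p / \<kappa> \<le> (\<mu> + 1) * t0 - 1 * t" if t: "t \<ge> 0" for t
  proof (cases "t \<ge> t0")
    case True
    have "t0 powr (p - 1) \<le> t powr (p - 1)" using True p by (intro powr_mono2) (auto simp: t0_def)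
    moreover have "t0 powr (p - 1) = \<kappa> * (\<mu> + 1)" unfolding t0_def powr_powr using p \<kappa> \<mu> by simp
    ultimately have "\<kappa> * (\<mu> + 1) * t \<le> t powr (p - 1) * t" using t by (intro mult_right_mono) auto
    also have "\<dots> = t powr p"
      using t p by (cases "t = 0") (auto simp: powr_mult_base[symmetric] mult.commute powr_diff)
    finally have "(\<mu> + 1) * t \<le> t powr p / \<kappa>" using \<kappa> by (simp add: field_simps)
    moreover have "0 \<le> (\<mu> + 1) * t0" using \<mu> by (simp add: t0_def)
    ultimately show ?thesis by (simp add: algebra_simps)
  next
    case False
    then have "(\<mu> + 1) * t \<le> (\<mu> + 1) * t0" using \<mu> by (intro mult_left_mono) auto
    moreover have "0 \<le> t powr p / \<kappa>" using \<kappa> by simp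
    ultimately show ?thesis by (simp add: algebra_simps)
  qed
  then show ?thesis by (intro exI[of _ 1] conjI exI[of _ "(\<mu> + 1) * t0"]) auto
qed

lemma exp_moment_finite:
  fixes \<kappa> p \<mu> :: real
  assumes "\<kappa> > 0" "p \<ge> 1" "\<mu> > 0" "p = 1 \<Longrightarrow> \<mu> < 1 / \<kappa>"
  shows "exp_moment p \<kappa> \<mu> < \<infinity>"
proof -
  obtain c C where c: "c > 0" and C: "\<And>t. t \<ge> 0 \<Longrightarrow> \<mu> * t - t powr p / \<kappa> \<le> C - c * t"
    using coeff_exponent_bound[OF assms] by blast
  let ?Z = "LINT y|lborel. exp (- (\<bar>y\<bar> powr p) / \<kappa>)"
  \<comment> \<open>Nonnegativity is enough: if \<open>?Z\<close> were 0, both sides below would be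
    0 by the convention for division.\<close>
  have Z: "?Z \<ge> 0" by simp
  have le: "ennreal (coeff_density p \<kappa> y) * ennreal (exp (\<mu> * \<bar>y\<bar>)) \<le> ennreal (exp C / ?Z) * ennreal (exp (- c * \<bar>y\<bar>))" for y
  proof -
    have "coeff_density p \<kappa> y * exp (\<mu> * \<bar>y\<bar>) = exp (\<mu> * \<bar>y\<bar> - \<bar>y\<bar> powr p / \<kappa>) / ?Z"
      by (simp add: coeff_density_def exp_add[symmetric] exp_diff exp_minus divide_inverse mult_ac)
    also have "\<dots> \<le> exp (C - c * \<bar>y\<bar>) / ?Z"
      using C[of "\<bar>y\<bar>"] Z by (intro divide_right_mono) auto
    also have "\<dots> = exp C / ?Z * exp (- c * \<bar>y\<bar>)"
      by (simp add: exp_diff exp_minus divide_inverse mult_ac)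
    finally have "coeff_density p \<kappa> y * exp (\<mu> * \<bar>y\<bar>) \<le> exp C / ?Z * exp (- c * \<bar>y\<bar>)" .
    moreover have "0 \<le> coeff_density p \<kappa> y" using Z by (simp add: coeff_density_def)
    moreover have "0 \<le> exp C / ?Z" using Z by simp
    ultimately show ?thesis by (simp only: ennreal_mult[symmetric] exp_ge_zero ennreal_leI)
  qed
  have "exp_moment p \<kappa> \<mu> \<le> (\<integral>\<^sup>+y. ennreal (exp C / ?Z) * ennreal (exp (- c * \<bar>y\<bar>)) \<partial>lborel)"
    unfolding exp_moment_def by (rule nn_integral_mono) (rule le)
  also have "\<dots> = ennreal (exp C / ?Z) * (\<integral>\<^sup>+y. ennreal (exp (- c * \<bar>y\<bar>)) \<partial>lborel)"
    by (rule nn_integral_cmult) measurable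
  also have "\<dots> < \<infinity>"
    using nn_integral_exp_abs_finite[OF c] by (simp add: ennreal_mult_less_top)
  finally show ?thesis .
qed

text \<open>A family with finitely many simple entries and a fixed value elsewhere again takes
  finitely many values; entries are added one at a time by function update.\<close>

lemma simple_function_family:
  fixes F :: "'i \<Rightarrow> 'a \<Rightarrow> real"
  assumes I: "finite I" and F: "\<And>i. i \<in> I \<Longrightarrow> simple_function M (F i)"
  shows "simple_function M (\<lambda>\<omega> i. if i \<in> I then F i \<omega> else 0)"
  using I F
proof (induction I rule: finite_induct)
  case (insert i I)
  have "simple_function M (\<lambda>\<omega>. (\<lambda>j. if j \<in> I then F j \<omega> else 0)(i := F i \<omega>))"
    using insert by (intro simple_function_compose2[where h="\<lambda>f y. f(i := y)"]) auto
  moreover have "(\<lambda>j. if j \<in> I then F j \<omega> else 0)(i := F i \<omega>) = (\<lambda>j. if j \<in> insert i I then F j \<omega> else 0)" for \<omega>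
    using insert(2) by auto
  ultimately show ?case by simp
qed simp

lemma summable_geometric_weight:
  fixes \<delta> :: real
  assumes "\<delta> > 0"
  shows "summable (\<lambda>j. 2 powr (- real j * \<delta>))" "summable (\<lambda>j. real j * 2 powr (- real j * \<delta>))"
proof -
  let ?z = "2 powr (- \<delta>)"
  have z: "norm ?z < 1" using assms by (simp add: powr_less_one)
  have eq: "2 powr (- real j * \<delta>) = ?z ^ j" for j
    by (simp add: powr_realpow[symmetric] powr_powr mult.commute)
  show s: "summable (\<lambda>j. 2 powr (- real j * \<delta>))" unfolding eq by (rule summable_geometric[OF z])
  \<comment> \<open>The termwise derivative of the geometric series.\<close>
  have "summable (\<lambda>n. of_nat (Suc n) * ?z ^ n)" using geometric_deriv_sums[OF z] by (rule sums_summable)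
  from summable_diff[OF this s[unfolded eq]]
  show "summable (\<lambda>j. real j * 2 powr (- real j * \<delta>))" unfolding eq by (simp add: algebra_simps)
qed

section \<open>The random coefficients\<close>

context wavelets
begin

text \<open>Almost surely, level j of the series is at most of the order (1 + j) 2^(-j eps), so
  every smoothness r < \<open>eps\<close> is available.\<close>

definition eps :: real where "eps = s - real CARD('d) / p"

text \<open>\<open>A1\<close> sums the contribution of the term j (d + 1) in
  \<open>coef_bound\<close>, the price for the number of wavelets on a level. \<open>A2\<close> sums
  that of ln (1 + Z), and therefore it alone decides which exponent t suffices.\<close>

definition A1 :: "real \<Rightarrow> real" where
  "A1 r = wconst * (real CARD('d) + 1) * (\<Sum>j. real j * 2 powr (- real j * (eps - r)))"

definition A2 :: "real \<Rightarrow> real" where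
  "A2 r = wconst * (\<Sum>j. 2 powr (- real j * (eps - r)))"

lemma A2_pos: "r < eps \<Longrightarrow> A2 r > 0"
  unfolding A2_def using wconst_pos summable_geometric_weight(1)[of "eps - r"]
  by (intro mult_pos_pos suminf_pos) auto

end

locale besov_prior = wavelets \<phi> \<psi> R B p s dummy + unit_domain D + prob_space M
  for \<phi> \<psi> :: "real \<Rightarrow> real" and R :: nat and B p s :: real and dummy :: "'d::{finite,linorder} itself"
    and D :: "(real, 'd) vec set" and M :: "'w measure" +
  fixes \<kappa> :: real and X :: "'d wavelet_index \<Rightarrow> 'w \<Rightarrow> real" and T :: "'w \<Rightarrow> nat list set"
  assumes D01: "D \<subseteq> cbox 0 1" and p: "p \<ge> 1" and sp: "s * p > real CARD('d)" and \<kappa>: "\<kappa> > 0"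
    and X: "\<And>\<iota>. \<iota> \<in> wavelet_indices \<Longrightarrow> distributed M lborel (X \<iota>) (\<lambda>x. ennreal (coeff_density p \<kappa> x))"
    and T: "T \<in> measurable M tree_borel"
begin

lemma eps_pos: "eps > 0"
  using p sp by (simp add: eps_def field_simps)

section \<open>Logarithmic bounds for the random coefficients\<close>

definition coefs :: "'w \<Rightarrow> 'd wavelet_index \<Rightarrow> real" where
  "coefs \<omega> \<iota> = (if \<iota> \<in> tree_indices (T \<omega>) then X \<iota> \<omega> else 0)"

definition field :: "'w \<Rightarrow> (real, 'd) vec \<Rightarrow> real" where
  "field \<omega> = besov_tree_field \<phi> \<psi> p s X T \<omega>"

lemma level_set_index: "z \<in> level_set j \<Longrightarrow> (j, z) \<in> wavelet_indices"
  unfolding wavelet_indices_Sigma by simp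

lemma X_measurable: "\<iota> \<in> wavelet_indices \<Longrightarrow> X \<iota> \<in> borel_measurable M"
  using distributed_measurable[OF X] by simp

lemma coefs_measurable:
  assumes "\<iota> \<in> wavelet_indices"
  shows "(\<lambda>\<omega>. coefs \<omega> \<iota>) \<in> borel_measurable M"
  unfolding coefs_def
  by (rule measurable_If[OF X_measurable[OF assms] measurable_const]) (auto intro: tree_indices_measurable[OF T])

text \<open>A union bound in integrated form: the weight 2^(-j (d + 1)) against at most 2^(jd) 2^d
  wavelets on level j leaves an expectation of order 2^(-j).\<close>

definition Zsum :: "real \<Rightarrow> 'w \<Rightarrow> ennreal" where
  "Zsum t \<omega> = (\<Sum>j. \<Sum>z\<in>level_set j. ennreal ((1/2) ^ (j * (CARD('d) + 1)) * exp (t * \<bar>X (j, z) \<omega>\<bar>)))"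

lemma card_level_set: "card (level_set j) \<le> 2 ^ (j * CARD('d)) * 2 ^ CARD('d)"
proof -
  have "card (wavelet_positions j :: (int, 'd) vec set) = (2 ^ j) ^ CARD('d)"
    using vec_set_finite_card(2)[of "\<lambda>i::'d. {0..<2 ^ j :: int}"] by (simp add: wavelet_positions_def nat_power_eq)
  then show ?thesis
    unfolding level_set_def card_cartesian_product using wavelet_types_finite_card(2)[where 'd='d, of j]
    by (simp add: power_mult)
qed

lemma Zsum_finite:
  assumes t: "t > 0" "p = 1 \<Longrightarrow> t < 1 / \<kappa>"
  shows "Zsum t \<in> borel_measurable M" "(\<integral>\<^sup>+\<omega>. Zsum t \<omega> \<partial>M) < \<infinity>"
proof -
  let ?d = "CARD('d)"
  have m: "(\<lambda>\<omega>. \<Sum>z\<in>level_set j. ennreal ((1/2) ^ (j * (?d + 1)) * exp (t * \<bar>X (j, z) \<omega>\<bar>))) \<in> borel_measurable M" for j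
    using X_measurable[OF level_set_index] by (intro borel_measurable_sum) measurable
  show "Zsum t \<in> borel_measurable M"
    unfolding Zsum_def[abs_def] by (rule borel_measurable_suminf_order[OF m])
  define E where "E = enn2real (exp_moment p \<kappa> t)"
  have E: "exp_moment p \<kappa> t = ennreal E"
    using exp_moment_finite[OF \<kappa> p t] by (simp add: E_def)
  have E0: "E \<ge> 0" by (simp add: E_def)
  have mom: "(\<integral>\<^sup>+\<omega>. ennreal (exp (t * \<bar>X \<iota> \<omega>\<bar>)) \<partial>M) = ennreal E" if "\<iota> \<in> wavelet_indices" for \<iota>
    using distributed_nn_integral[OF X[OF that], of "\<lambda>y. ennreal (exp (t * \<bar>y\<bar>))"] E
    by (simp add: exp_moment_def)
  have "(\<integral>\<^sup>+\<omega>. Zsum t \<omega> \<partial>M) = (\<Sum>j. \<integral>\<^sup>+\<omega>. (\<Sum>z\<in>level_set j. ennreal ((1/2) ^ (j * (?d + 1)) * exp (t * \<bar>X (j, z) \<omega>\<bar>))) \<partial>M)"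
    unfolding Zsum_def by (rule nn_integral_suminf[OF m])
  also have "\<dots> \<le> (\<Sum>j. ennreal (2 ^ ?d * E * (1/2) ^ j))"
  proof (rule suminf_le)
    fix j
    have "(\<integral>\<^sup>+\<omega>. (\<Sum>z\<in>level_set j. ennreal ((1/2) ^ (j * (?d + 1)) * exp (t * \<bar>X (j, z) \<omega>\<bar>))) \<partial>M) =
        (\<Sum>z\<in>level_set j. \<integral>\<^sup>+\<omega>. ennreal ((1/2) ^ (j * (?d + 1)) * exp (t * \<bar>X (j, z) \<omega>\<bar>)) \<partial>M)"
      using X_measurable[OF level_set_index] by (intro nn_integral_sum) measurable
    also have "\<dots> = (\<Sum>z\<in>level_set j. ennreal ((1/2) ^ (j * (?d + 1)) * E))"
    proof (rule sum.cong[OF refl])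
      fix z assume z: "z \<in> level_set j"
      have [measurable]: "X (j, z) \<in> borel_measurable M" by (rule X_measurable[OF level_set_index[OF z]])
      have "(\<integral>\<^sup>+\<omega>. ennreal ((1/2) ^ (j * (?d + 1)) * exp (t * \<bar>X (j, z) \<omega>\<bar>)) \<partial>M) =
          ennreal ((1/2) ^ (j * (?d + 1))) * (\<integral>\<^sup>+\<omega>. ennreal (exp (t * \<bar>X (j, z) \<omega>\<bar>)) \<partial>M)"
        by (subst nn_integral_cmult[symmetric]) (auto simp: ennreal_mult)
      then show "(\<integral>\<^sup>+\<omega>. ennreal ((1/2) ^ (j * (?d + 1)) * exp (t * \<bar>X (j, z) \<omega>\<bar>)) \<partial>M) = ennreal ((1/2) ^ (j * (?d + 1)) * E)"
        using mom[OF level_set_index[OF z]] E0 by (simp add: ennreal_mult)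
    qed
    also have "\<dots> = ennreal (real (card (level_set j)) * ((1/2) ^ (j * (?d + 1)) * E))"
      using E0 by (simp add: ennreal_mult ennreal_of_nat_eq_real_of_nat)
    also have "\<dots> \<le> ennreal (2 ^ ?d * E * (1/2) ^ j)"
    proof (rule ennreal_leI)
      have "real (card (level_set j)) * ((1/2) ^ (j * (?d + 1)) * E) \<le> real (2 ^ (j * ?d) * 2 ^ ?d) * ((1/2) ^ (j * (?d + 1)) * E)"
        using E0 by (intro mult_right_mono of_nat_mono card_level_set) auto
      also have "\<dots> = 2 ^ ?d * E * (1/2) ^ j"
        by (simp add: power_add power_divide)
      finally show "real (card (level_set j)) * ((1/2) ^ (j * (?d + 1)) * E) \<le> 2 ^ ?d * E * (1/2) ^ j" .
    qed
    finally show "(\<integral>\<^sup>+\<omega>. (\<Sum>z\<in>level_set j. ennreal ((1/2) ^ (j * (?d + 1)) * exp (t * \<bar>X (j, z) \<omega>\<bar>))) \<partial>M) \<le> ennreal (2 ^ ?d * E * (1/2) ^ j)" .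
  qed auto
  also have "\<dots> < \<infinity>"
    using E0 by (subst suminf_ennreal2) (auto intro!: summable_mult)
  finally show "(\<integral>\<^sup>+\<omega>. Zsum t \<omega> \<partial>M) < \<infinity>" .
qed

text \<open>\<open>enn2real\<close> sends infinity to 0; for admissible t this concerns only the
  null set of \<open>AE_Zsum\<close>.\<close>

definition Zr :: "real \<Rightarrow> 'w \<Rightarrow> real" where
  "Zr t \<omega> = enn2real (Zsum t \<omega>)"

lemma AE_Zsum:
  assumes t: "t > 0" "p = 1 \<Longrightarrow> t < 1 / \<kappa>"
  shows "AE \<omega> in M. Zsum t \<omega> \<noteq> \<infinity>" "integrable M (Zr t)"
proof -
  show "AE \<omega> in M. Zsum t \<omega> \<noteq> \<infinity>"
    by (rule nn_integral_PInf_AE[OF Zsum_finite(1)[OF t]]) (use Zsum_finite(2)[OF t] in auto)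
  show "integrable M (Zr t)"
  proof (rule integrableI_bounded)
    show "Zr t \<in> borel_measurable M" unfolding Zr_def[abs_def] using Zsum_finite(1)[OF t] by measurable
    have "(\<integral>\<^sup>+\<omega>. ennreal (norm (Zr t \<omega>)) \<partial>M) \<le> (\<integral>\<^sup>+\<omega>. Zsum t \<omega> \<partial>M)"
      by (intro nn_integral_mono) (simp add: Zr_def ennreal_enn2real_if)
    then show "(\<integral>\<^sup>+\<omega>. ennreal (norm (Zr t \<omega>)) \<partial>M) < \<infinity>" using Zsum_finite(2)[OF t] by simp
  qed
qed

lemma Zr_nonneg: "0 \<le> Zr t \<omega>"
  by (simp add: Zr_def)

text \<open>A logarithmic bound in terms of the integrable variable Zr replaces moments of suprema.\<close>

definition coef_bound :: "real \<Rightarrow> 'w \<Rightarrow> nat \<Rightarrow> real" where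
  "coef_bound t \<omega> j = (real j * (real CARD('d) + 1) + ln (1 + Zr t \<omega>)) / t"

text \<open>A single summand of \<open>Zsum\<close> is at most the whole sum. Taking logarithms
  gives the bound, with ln 2 replaced by 1 and Z by 1 + Z to keep the logarithm nonnegative.\<close>

lemma coef_bound:
  assumes t: "t > 0" and fin: "Zsum t \<omega> \<noteq> \<infinity>"
  shows "0 \<le> coef_bound t \<omega> j" "z \<in> level_set j \<Longrightarrow> \<bar>coefs \<omega> (j, z)\<bar> \<le> coef_bound t \<omega> j"
proof -
  have ln0: "0 \<le> ln (1 + Zr t \<omega>)" using Zr_nonneg[of t \<omega>] by simp
  show b0: "0 \<le> coef_bound t \<omega> j" unfolding coef_bound_def using t ln0 by (intro divide_nonneg_pos add_nonneg_nonneg) auto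
  assume z: "z \<in> level_set j"
  let ?N = "j * (CARD('d) + 1)"
  have "ennreal ((1/2) ^ ?N * exp (t * \<bar>X (j, z) \<omega>\<bar>)) \<le> (\<Sum>z\<in>level_set j. ennreal ((1/2) ^ ?N * exp (t * \<bar>X (j, z) \<omega>\<bar>)))"
    by (rule member_le_sum[OF z _ finite_level_set]) auto
  also have "\<dots> = (\<Sum>j\<in>{j}. \<Sum>z\<in>level_set j. ennreal ((1/2) ^ (j * (CARD('d) + 1)) * exp (t * \<bar>X (j, z) \<omega>\<bar>)))"
    by simp
  also have "\<dots> \<le> Zsum t \<omega>"
    unfolding Zsum_def by (rule sum_le_suminf) auto
  also have "Zsum t \<omega> = ennreal (Zr t \<omega>)" using fin by (simp add: Zr_def ennreal_enn2real less_top)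
  finally have "(1/2) ^ ?N * exp (t * \<bar>X (j, z) \<omega>\<bar>) \<le> Zr t \<omega>"
    using Zr_nonneg by (simp add: ennreal_le_iff)
  then have "exp (t * \<bar>X (j, z) \<omega>\<bar>) \<le> 2 ^ ?N * Zr t \<omega>" by (simp add: power_divide field_simps)
  also have "\<dots> \<le> 2 ^ ?N * (1 + Zr t \<omega>)" by simp
  finally have "ln (exp (t * \<bar>X (j, z) \<omega>\<bar>)) \<le> ln (2 ^ ?N * (1 + Zr t \<omega>))"
    using Zr_nonneg[of t \<omega>] by (intro ln_mono) auto
  then have "t * \<bar>X (j, z) \<omega>\<bar> \<le> real ?N * ln 2 + ln (1 + Zr t \<omega>)"
    using Zr_nonneg[of t \<omega>] by (simp add: ln_mult ln_realpow)
  also have "\<dots> \<le> real ?N * 1 + ln (1 + Zr t \<omega>)"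
    using ln_2_less_1 by (intro add_right_mono mult_left_mono) auto
  finally have "\<bar>X (j, z) \<omega>\<bar> \<le> coef_bound t \<omega> j"
    using t by (simp add: coef_bound_def pos_le_divide_eq mult.commute algebra_simps)
  then show "\<bar>coefs \<omega> (j, z)\<bar> \<le> coef_bound t \<omega> j" using b0 by (simp add: coefs_def)
qed

definition level_bound :: "(nat \<Rightarrow> real) \<Rightarrow> nat \<Rightarrow> real" where
  "level_bound m j = wconst * 2 powr (- real j * eps) * m j"

lemma level_series_fun:
  assumes m: "\<And>j z. z \<in> level_set j \<Longrightarrow> \<bar>c (j, z)\<bar> \<le> m j" and m0: "\<And>j. m j \<ge> 0"
    and sm: "summable (\<lambda>j. 2 powr (real j * r) * level_bound m j)"
  shows "level_series r (level_fun c) (level_bound m)"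
proof -
  have "0 \<le> level_bound m j" for j unfolding level_bound_def using m0[of j] wconst_pos by simp
  moreover have "\<bar>level_fun c j x\<bar> \<le> level_bound m j" for j x
    unfolding level_bound_def eps_def by (rule level_fun_abs[of j c "m j"]) (use m m0 in auto)
  moreover have "\<bar>partial_deriv e (level_fun c j) x\<bar> \<le> 2 ^ j * level_bound m j" if "e \<in> Basis" for e j x
    unfolding level_bound_def eps_def by (rule level_fun_partial[of j c "m j"]) (use m m0 that in auto)
  ultimately show ?thesis using level_fun_tcd sm by (simp add: level_series_def)
qed

lemma level_bound_sums:
  assumes r: "r < eps"
  shows "(\<lambda>j. 2 powr (real j * r) * level_bound (coef_bound t \<omega>) j) sums ((A1 r + A2 r * ln (1 + Zr t \<omega>)) / t)"
proof -
  have \<delta>: "eps - r > 0" using r by simp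
  let ?w = "\<lambda>j. 2 powr (- real j * (eps - r))"
  have "(\<lambda>j. (wconst * (real CARD('d) + 1) * (real j * ?w j) + wconst * ?w j * ln (1 + Zr t \<omega>)) / t)
      sums ((A1 r + A2 r * ln (1 + Zr t \<omega>)) / t)"
    unfolding A1_def A2_def
    by (intro sums_divide sums_add sums_mult sums_mult2 summable_sums summable_geometric_weight \<delta>)
  moreover have "(wconst * (real CARD('d) + 1) * (real j * ?w j) + wconst * ?w j * ln (1 + Zr t \<omega>)) / t =
      2 powr (real j * r) * level_bound (coef_bound t \<omega>) j" for j
  proof -
    have "?w j = 2 powr (real j * r) * 2 powr (- real j * eps)" by (simp add: powr_add[symmetric] algebra_simps)
    then show ?thesis by (simp add: level_bound_def coef_bound_def algebra_simps add_divide_distrib)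
  qed
  ultimately show ?thesis by simp
qed

lemma level_norm_coef: "r < eps \<Longrightarrow> level_norm r (level_bound (coef_bound t \<omega>)) = (A1 r + A2 r * ln (1 + Zr t \<omega>)) / t"
  unfolding level_norm_def by (rule sums_unique[symmetric, OF level_bound_sums])

lemma level_series_coefs:
  assumes t: "t > 0" and fin: "Zsum t \<omega> \<noteq> \<infinity>" and r: "r < eps"
  shows "level_series r (level_fun (coefs \<omega>)) (level_bound (coef_bound t \<omega>))"
  by (rule level_series_fun[OF coef_bound(2)[OF t fin] coef_bound(1)[OF t fin] sums_summable[OF level_bound_sums[OF r]]])

lemma field_level_sum:
  assumes t: "t > 0" and fin: "Zsum t \<omega> \<noteq> \<infinity>" and x: "x \<in> D"
  shows "field \<omega> x = level_sum (level_fun (coefs \<omega>)) x"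
proof -
  have "summable (\<lambda>j. 2 powr (real j * 0) * level_bound (coef_bound t \<omega>) j)"
    using level_bound_sums[OF eps_pos] by (rule sums_summable)
  then have "summable (\<lambda>j. wconst * (2 powr (- real j * eps) * coef_bound t \<omega> j))"
    by (simp add: level_bound_def mult.assoc)
  then have "summable (\<lambda>j. 2 powr (- real j * (s - real CARD('d) / p)) * coef_bound t \<omega> j)"
    using wconst_pos summable_mult[of "\<lambda>j. wconst * (2 powr (- real j * eps) * coef_bound t \<omega> j)" "inverse wconst"]
    by (simp add: eps_def mult.assoc[symmetric])
  from besov_tree_field_levels[of T \<omega> X "coef_bound t \<omega>", OF _ _ this, of x]
  show ?thesis
    using coef_bound[OF t fin] x D01 unfolding field_def level_sum_def coefs_def[abs_def] by auto
qed

lemma weak_solution_field: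
  assumes t: "t > 0" and fin: "Zsum t \<omega> \<noteq> \<infinity>"
  shows "weak_solution D (\<lambda>x. exp (field \<omega> x)) F u \<longleftrightarrow> weak_solution D (\<lambda>x. exp (level_sum (level_fun (coefs \<omega>)) x)) F u"
  by (rule weak_solution_cong) (simp add: field_level_sum[OF t fin])

subsection \<open>Simple approximations\<close>

text \<open>A measurable real function is a limit of simple ones dominated by twice its modulus.
  Cutting at level n leaves finitely many random entries, so the whole family is simple.\<close>

lemma simple_coefs_exist:
  "\<exists>cn :: nat \<Rightarrow> 'w \<Rightarrow> 'd wavelet_index \<Rightarrow> real. (\<forall>n. simple_function M (cn n)) \<and>
     (\<forall>n \<omega> j z. n \<le> j \<longrightarrow> cn n \<omega> (j, z) = 0) \<and>
     (\<forall>n. \<forall>\<omega>\<in>space M. \<forall>j. \<forall>z\<in>level_set j. \<bar>cn n \<omega> (j, z)\<bar> \<le> 2 * \<bar>coefs \<omega> (j, z)\<bar>) \<and>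
     (\<forall>\<omega>\<in>space M. \<forall>j. \<forall>z\<in>level_set j. (\<lambda>n. cn n \<omega> (j, z)) \<longlonglongrightarrow> coefs \<omega> (j, z))"
proof -
  have "\<forall>\<iota>\<in>wavelet_indices. \<exists>F. (\<forall>i. simple_function M (F i)) \<and> (\<forall>\<omega>\<in>space M. (\<lambda>i. F i \<omega>) \<longlonglongrightarrow> coefs \<omega> \<iota>) \<and>
      (\<forall>i. \<forall>\<omega>\<in>space M. dist (F i \<omega>) 0 \<le> 2 * dist (coefs \<omega> \<iota>) 0)"
    by (intro ballI borel_measurable_implies_sequence_metric coefs_measurable)
  from bchoice[OF this] obtain F where F: "\<forall>\<iota>\<in>wavelet_indices. (\<forall>i. simple_function M (F \<iota> i)) \<and> (\<forall>\<omega>\<in>space M. (\<lambda>i. F \<iota> i \<omega>) \<longlonglongrightarrow> coefs \<omega> \<iota>) \<and>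
      (\<forall>i. \<forall>\<omega>\<in>space M. dist (F \<iota> i \<omega>) 0 \<le> 2 * dist (coefs \<omega> \<iota>) 0)" ..
  define I where "I n = Sigma {..<n} level_set" for n :: nat
  have I: "finite (I n)" "I n \<subseteq> wavelet_indices" for n
    unfolding I_def wavelet_indices_Sigma using finite_level_set by (auto intro: finite_SigmaI)
  define cn where "cn n \<omega> \<iota> = (if \<iota> \<in> I n then F \<iota> n \<omega> else 0)" for n \<omega> \<iota>
  show ?thesis
  proof (intro exI[of _ cn] conjI allI ballI impI)
    fix n
    have "simple_function M (F \<iota> n)" if "\<iota> \<in> I n" for \<iota> using F I(2)[of n] that by blast
    from simple_function_family[OF I(1) this] show "simple_function M (cn n)"
      unfolding cn_def[abs_def] .
  next
    fix n \<omega> j z assume "n \<le> (j::nat)"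
    then show "cn n \<omega> (j, z) = 0" by (simp add: cn_def I_def)
  next
    fix n \<omega> j z assume \<omega>: "\<omega> \<in> space M" and z: "z \<in> level_set j"
    then have "dist (F (j, z) n \<omega>) 0 \<le> 2 * dist (coefs \<omega> (j, z)) 0" using F level_set_index by blast
    then show "\<bar>cn n \<omega> (j, z)\<bar> \<le> 2 * \<bar>coefs \<omega> (j, z)\<bar>" by (simp add: cn_def)
  next
    fix \<omega> j z assume \<omega>: "\<omega> \<in> space M" and z: "z \<in> level_set j"
    then have l: "(\<lambda>n. F (j, z) n \<omega>) \<longlonglongrightarrow> coefs \<omega> (j, z)" using F level_set_index by blast
    have "\<forall>\<^sub>F n in sequentially. F (j, z) n \<omega> = cn n \<omega> (j, z)"
      using eventually_gt_at_top[of j] by eventually_elim (simp add: cn_def I_def z)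
    from Lim_transform_eventually[OF l this] show "(\<lambda>n. cn n \<omega> (j, z)) \<longlonglongrightarrow> coefs \<omega> (j, z)" .
  qed
qed

definition cn :: "nat \<Rightarrow> 'w \<Rightarrow> 'd wavelet_index \<Rightarrow> real" where
  "cn = (SOME cn. (\<forall>n. simple_function M (cn n)) \<and>
     (\<forall>n \<omega> j z. n \<le> j \<longrightarrow> cn n \<omega> (j, z) = 0) \<and>
     (\<forall>n. \<forall>\<omega>\<in>space M. \<forall>j. \<forall>z\<in>level_set j. \<bar>cn n \<omega> (j, z)\<bar> \<le> 2 * \<bar>coefs \<omega> (j, z)\<bar>) \<and>
     (\<forall>\<omega>\<in>space M. \<forall>j. \<forall>z\<in>level_set j. (\<lambda>n. cn n \<omega> (j, z)) \<longlonglongrightarrow> coefs \<omega> (j, z)))"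

lemma cn:
  "simple_function M (cn n)" "n \<le> j \<Longrightarrow> cn n \<omega> (j, z) = 0"
  "\<omega> \<in> space M \<Longrightarrow> z \<in> level_set j \<Longrightarrow> \<bar>cn n \<omega> (j, z)\<bar> \<le> 2 * \<bar>coefs \<omega> (j, z)\<bar>"
  "\<omega> \<in> space M \<Longrightarrow> z \<in> level_set j \<Longrightarrow> (\<lambda>n. cn n \<omega> (j, z)) \<longlonglongrightarrow> coefs \<omega> (j, z)"
  using someI_ex[OF simple_coefs_exist, folded cn_def] by blast+

text \<open>Only levels below n are nonzero, so any weights are summable; this holds for every
  \<omega>, with no exceptional set.\<close>

lemma level_series_cn_finite: "\<exists>c. level_series r (level_fun (cn n \<omega>)) c"
proof -
  let ?m = "\<lambda>j. \<Sum>z\<in>level_set j. \<bar>cn n \<omega> (j, z)\<bar>"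
  have "level_series r (level_fun (cn n \<omega>)) (level_bound ?m)"
  proof (rule level_series_fun)
    show "\<bar>cn n \<omega> (j, z)\<bar> \<le> ?m j" if "z \<in> level_set j" for j z
      by (rule member_le_sum[OF that _ finite_level_set]) auto
    show "summable (\<lambda>j. 2 powr (real j * r) * level_bound ?m j)"
      by (rule summable_finite[of "{..<n}"]) (auto simp: level_bound_def cn(2))
  qed (auto intro: sum_nonneg)
  then show ?thesis by blast
qed

text \<open>The solution is chosen as a function of the coefficient family alone. Composition with a
  simple family is therefore simple, and no measurability is asked of the choice.\<close>

definition approx :: "(((real, 'd) vec \<Rightarrow> real) \<Rightarrow> real) \<Rightarrow> nat \<Rightarrow> 'w \<Rightarrow> (real, 'd) vec \<Rightarrow> real" where
  "approx F n \<omega> = (SOME u. weak_solution D (\<lambda>x. exp (level_sum (level_fun (cn n \<omega>)) x)) F u)"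

lemma approx_solution:
  assumes "F \<in> V_dual D"
  shows "weak_solution D (\<lambda>x. exp (level_sum (level_fun (cn n \<omega>)) x)) F (approx F n \<omega>)"
proof -
  obtain c where c: "level_series 0 (level_fun (cn n \<omega>)) c" using level_series_cn_finite by blast
  show ?thesis
    unfolding approx_def by (rule someI_ex[OF weak_solution_exists[OF level_sum_elliptic[OF c order_refl] assms]])
qed

lemma approx_simple: "simple_function M (approx F n)"
  unfolding approx_def[abs_def]
  by (rule simple_function_compose1[OF cn(1), of "\<lambda>c. SOME u. weak_solution D (\<lambda>x. exp (level_sum (level_fun c) x)) F u"])

lemma approx_convergence_data:
  assumes t: "t > 0" and fin: "Zsum t \<omega> \<noteq> \<infinity>" and r: "r < eps" and \<omega>: "\<omega> \<in> space M"
  obtains \<eta> where "level_series r (level_fun (coefs \<omega>)) (level_bound (\<lambda>j. 2 * coef_bound t \<omega> j))"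
    "\<And>n. level_series r (level_fun (cn n \<omega>)) (level_bound (\<lambda>j. 2 * coef_bound t \<omega> j))"
    "\<And>n j. 0 \<le> \<eta> n j" "\<And>n j. \<eta> n j \<le> 2 * level_bound (\<lambda>j. 2 * coef_bound t \<omega> j) j" "\<And>j. (\<lambda>n. \<eta> n j) \<longlonglongrightarrow> 0"
    "\<And>n j x. \<bar>level_fun (coefs \<omega>) j x - level_fun (cn n \<omega>) j x\<bar> \<le> \<eta> n j"
    "\<And>n j x e. e \<in> Basis \<Longrightarrow> \<bar>partial_deriv e (level_fun (coefs \<omega>) j) x - partial_deriv e (level_fun (cn n \<omega>) j) x\<bar> \<le> 2 ^ j * \<eta> n j"
proof -
  \<comment> \<open>Twice the bound, since \<open>cn\<close> is dominated only by twice the modulus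
    of \<open>coefs\<close>.\<close>
  define m where "m = (\<lambda>j. 2 * coef_bound t \<omega> j)"
  note cb = coef_bound[OF t fin]
  have m0: "m j \<ge> 0" for j using cb(1)[of j] by (simp add: m_def)
  have mc: "\<bar>coefs \<omega> (j, z)\<bar> \<le> m j" "\<bar>cn n \<omega> (j, z)\<bar> \<le> m j" if z: "z \<in> level_set j" for j z n
    using cb(2)[OF z] cb(1)[of j] cn(3)[OF \<omega> z, of n] by (auto simp: m_def)
  have eq: "2 powr (real j * r) * level_bound m j = 2 * (2 powr (real j * r) * level_bound (coef_bound t \<omega>) j)" for j
    by (simp add: level_bound_def m_def)
  have sm: "summable (\<lambda>j. 2 powr (real j * r) * level_bound m j)"
    unfolding eq by (intro summable_mult sums_summable[OF level_bound_sums[OF r]])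
  \<comment> \<open>The sum tends to 0 because the level is finite; the minimum with 2 m supplies
    the domination that convergence across all levels requires.\<close>
  define \<mu> where "\<mu> n j = min (2 * m j) (\<Sum>z\<in>level_set j. \<bar>coefs \<omega> (j, z) - cn n \<omega> (j, z)\<bar>)" for n j
  have \<mu>0: "0 \<le> \<mu> n j" for n j unfolding \<mu>_def using m0 by (auto intro!: sum_nonneg)
  have \<mu>d: "\<bar>coefs \<omega> (j, z) - cn n \<omega> (j, z)\<bar> \<le> \<mu> n j" if z: "z \<in> level_set j" for n j z
  proof -
    have "\<bar>coefs \<omega> (j, z) - cn n \<omega> (j, z)\<bar> \<le> (\<Sum>z\<in>level_set j. \<bar>coefs \<omega> (j, z) - cn n \<omega> (j, z)\<bar>)"
      by (rule member_le_sum[OF z _ finite_level_set]) auto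
    moreover have "\<bar>coefs \<omega> (j, z) - cn n \<omega> (j, z)\<bar> \<le> 2 * m j" using mc(1)[OF z] mc(2)[OF z, of n] by simp
    ultimately show ?thesis by (simp add: \<mu>_def)
  qed
  have \<mu>lim: "(\<lambda>n. \<mu> n j) \<longlonglongrightarrow> 0" for j
  proof -
    have "(\<lambda>n. min (2 * m j) (\<Sum>z\<in>level_set j. \<bar>coefs \<omega> (j, z) - cn n \<omega> (j, z)\<bar>)) \<longlonglongrightarrow> min (2 * m j) (\<Sum>z\<in>level_set j. \<bar>coefs \<omega> (j, z) - coefs \<omega> (j, z)\<bar>)"
      by (intro tendsto_min tendsto_const tendsto_sum tendsto_rabs tendsto_diff cn(4)[OF \<omega>])
    then show ?thesis unfolding \<mu>_def using m0[of j] by simp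
  qed
  define \<eta> where "\<eta> n = level_bound (\<mu> n)" for n
  have w: "0 \<le> wconst * 2 powr (- real j * eps)" for j using wconst_pos by simp
  show ?thesis
  proof (rule that[of \<eta>, folded m_def])
    show "level_series r (level_fun (coefs \<omega>)) (level_bound m)"
      by (rule level_series_fun[OF mc(1) m0 sm])
    show "level_series r (level_fun (cn n \<omega>)) (level_bound m)" for n
      by (rule level_series_fun[OF mc(2) m0 sm])
    show "0 \<le> \<eta> n j" for n j unfolding \<eta>_def level_bound_def by (rule mult_nonneg_nonneg[OF w \<mu>0])
    show "\<eta> n j \<le> 2 * level_bound m j" for n j
    proof -
      have "wconst * 2 powr (- real j * eps) * \<mu> n j \<le> wconst * 2 powr (- real j * eps) * (2 * m j)"
        using w by (intro mult_left_mono) (auto simp: \<mu>_def)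
      then show ?thesis by (simp add: \<eta>_def level_bound_def)
    qed
    show "(\<lambda>n. \<eta> n j) \<longlonglongrightarrow> 0" for j
      unfolding \<eta>_def level_bound_def using tendsto_mult_left[OF \<mu>lim[of j], of "wconst * 2 powr (- real j * eps)"] by simp
    show "\<bar>level_fun (coefs \<omega>) j x - level_fun (cn n \<omega>) j x\<bar> \<le> \<eta> n j" for n j x
      unfolding level_fun_diff \<eta>_def level_bound_def eps_def by (rule level_fun_abs[of j _ "\<mu> n j"]) (use \<mu>d \<mu>0 in auto)
    show "\<bar>partial_deriv e (level_fun (coefs \<omega>) j) x - partial_deriv e (level_fun (cn n \<omega>) j) x\<bar> \<le> 2 ^ j * \<eta> n j"
      if "e \<in> Basis" for n j x e
      unfolding level_fun_partial_diff[OF that] \<eta>_def level_bound_def eps_def by (rule level_fun_partial[of j _ "\<mu> n j"]) (use \<mu>d \<mu>0 that in auto)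
  qed
qed

lemma approx_V_tendsto:
  assumes t: "t > 0" and fin: "Zsum t \<omega> \<noteq> \<infinity>" and \<omega>: "\<omega> \<in> space M"
    and F: "F \<in> V_dual D" and u: "weak_solution D (\<lambda>x. exp (field \<omega> x)) F u"
  shows "(\<lambda>n. V_norm D (\<lambda>x. u x - approx F n \<omega> x)) \<longlonglongrightarrow> 0"
proof -
  obtain \<eta> where
    d: "level_series 0 (level_fun (coefs \<omega>)) (level_bound (\<lambda>j. 2 * coef_bound t \<omega> j))"
    "\<And>n. level_series 0 (level_fun (cn n \<omega>)) (level_bound (\<lambda>j. 2 * coef_bound t \<omega> j))"
    "\<And>n j. 0 \<le> \<eta> n j" "\<And>n j. \<eta> n j \<le> 2 * level_bound (\<lambda>j. 2 * coef_bound t \<omega> j) j" "\<And>j. (\<lambda>n. \<eta> n j) \<longlonglongrightarrow> 0"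
    "\<And>n j x. \<bar>level_fun (coefs \<omega>) j x - level_fun (cn n \<omega>) j x\<bar> \<le> \<eta> n j"
    "\<And>n j x e. e \<in> Basis \<Longrightarrow> \<bar>partial_deriv e (level_fun (coefs \<omega>) j) x - partial_deriv e (level_fun (cn n \<omega>) j) x\<bar> \<le> 2 ^ j * \<eta> n j"
    by (rule approx_convergence_data[OF t fin eps_pos \<omega>]) (rule that)
  show ?thesis
    by (rule level_V_tendsto[OF d(1,2) order_refl d(3,4,5,6,7) F u[unfolded weak_solution_field[OF t fin]] approx_solution[OF F]])
qed

lemma approx_Wr:
  assumes r: "0 < r" "r \<le> 1" and f: "f \<in> H_space D"
  shows "approx (H_functional D f) n \<omega> \<in> Wr_space D r"
proof -
  obtain c where c: "level_series r (level_fun (cn n \<omega>)) c" using level_series_cn_finite by blast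
  show ?thesis by (rule level_Wr(1)[OF c r f approx_solution[OF H_functional_V_dual[OF f]]])
qed

lemma approx_Wr_tendsto:
  assumes t: "t > 0" and fin: "Zsum t \<omega> \<noteq> \<infinity>" and \<omega>: "\<omega> \<in> space M" and r: "0 < r" "r \<le> 1" "r < eps"
    and f: "f \<in> H_space D" and u: "weak_solution D (\<lambda>x. exp (field \<omega> x)) (H_functional D f) u"
  shows "(\<lambda>n. Wr_norm D r (\<lambda>x. u x - approx (H_functional D f) n \<omega> x)) \<longlonglongrightarrow> 0"
proof -
  \<comment> \<open>For r < 1 there is room below both \<open>eps\<close> and 1 for a stronger
    exponent r' to interpolate with; for r = 1 the convergence of Laplacians is used at r' =
    1.\<close>
  obtain r' where r': "r \<le> r'" "r' < eps" "r' = 1 \<and> r = 1 \<or> r < r' \<and> r' < 1"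
  proof (cases "r = 1")
    case False
    then have "r < min eps 1" using r by simp
    then obtain r' where "r < r'" "r' < min eps 1" using dense by blast
    then show ?thesis by (intro that[of r']) auto
  qed (use r that[of 1] in auto)
  obtain \<eta> where
    d: "level_series r' (level_fun (coefs \<omega>)) (level_bound (\<lambda>j. 2 * coef_bound t \<omega> j))"
    "\<And>n. level_series r' (level_fun (cn n \<omega>)) (level_bound (\<lambda>j. 2 * coef_bound t \<omega> j))"
    "\<And>n j. 0 \<le> \<eta> n j" "\<And>n j. \<eta> n j \<le> 2 * level_bound (\<lambda>j. 2 * coef_bound t \<omega> j) j" "\<And>j. (\<lambda>n. \<eta> n j) \<longlonglongrightarrow> 0"
    "\<And>n j x. \<bar>level_fun (coefs \<omega>) j x - level_fun (cn n \<omega>) j x\<bar> \<le> \<eta> n j"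
    "\<And>n j x e. e \<in> Basis \<Longrightarrow> \<bar>partial_deriv e (level_fun (coefs \<omega>) j) x - partial_deriv e (level_fun (cn n \<omega>) j) x\<bar> \<le> 2 ^ j * \<eta> n j"
    by (rule approx_convergence_data[OF t fin r'(2) \<omega>]) (rule that)
  have r0: "0 \<le> r'" using r r' by simp
  note u' = u[unfolded weak_solution_field[OF t fin]] and ua = approx_solution[OF H_functional_V_dual[OF f]]
  from r'(3) show ?thesis
  proof
    assume "r' = 1 \<and> r = 1"
    then show ?thesis
      using level_W_tendsto[OF d(1,2) r0 d(3,4,5,6,7) f u' ua] by (simp add: Wr_norm_def)
  next
    assume "r < r' \<and> r' < 1"
    then show ?thesis
      using level_Wr_tendsto_less(2)[OF d(1,2) r0 d(3,4,5,6,7) f u' ua r(1)] by simp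
  qed
qed

section \<open>Solutions with random coefficients\<close>

text \<open>The almost sure statements need just one admissible exponent, and 1/(2 \<kappa>) is
  admissible for every p; the moment bounds choose t according to q.\<close>

lemma default_exponent: "1 / (2 * \<kappa>) > 0" "p = 1 \<Longrightarrow> 1 / (2 * \<kappa>) < 1 / \<kappa>"
  using \<kappa> by (auto simp: field_simps)

lemma AE_good: "AE \<omega> in M. Zsum (1 / (2 * \<kappa>)) \<omega> \<noteq> \<infinity>"
  by (rule AE_Zsum(1)[OF default_exponent])

lemma AE_solution:
  assumes F: "F \<in> V_dual D"
  shows "AE \<omega> in M. \<exists>u. weak_solution D (\<lambda>x. exp (field \<omega> x)) F u \<and>
    (\<forall>u'. weak_solution D (\<lambda>x. exp (field \<omega> x)) F u' \<longrightarrow> (AE x in lebesgue_on D. u' x = u x))"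
  using AE_good
proof eventually_elim
  case (elim \<omega>)
  note w = weak_solution_field[OF default_exponent(1) elim]
  note ell = level_sum_elliptic[OF level_series_coefs[OF default_exponent(1) elim eps_pos] order_refl]
  obtain u where u: "weak_solution D (\<lambda>x. exp (level_sum (level_fun (coefs \<omega>)) x)) F u"
    using weak_solution_exists[OF ell F] by blast
  then show ?case unfolding w using weak_solution_unique[OF ell u] by blast
qed

lemma solution_strongly_measurable:
  assumes F: "F \<in> V_dual D" and u: "AE \<omega> in M. weak_solution D (\<lambda>x. exp (field \<omega> x)) F (u \<omega>)"
  shows "strongly_measurable M (V_space D) (V_norm D) u"
  unfolding strongly_measurable_def
proof (intro exI[of _ "approx F"] conjI allI)
  show "simple_function M (approx F n)" for n by (rule approx_simple)
  show "approx F n ` space M \<subseteq> V_space D" for n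
    using approx_solution[OF F] by (auto simp: weak_solution_def)
  show "AE \<omega> in M. u \<omega> \<in> V_space D \<and> (\<lambda>n. V_norm D (\<lambda>x. u \<omega> x - approx F n \<omega> x)) \<longlonglongrightarrow> 0"
    using u AE_good AE_space
  proof eventually_elim
    case (elim \<omega>)
    then show ?case
      using approx_V_tendsto[OF default_exponent(1) elim(2,3) F elim(1)] by (simp add: weak_solution_def)
  qed
qed

lemma solution_strongly_measurable_Wr:
  assumes f: "f \<in> H_space D" and r: "0 < r" "r \<le> 1" "r < eps"
    and u: "AE \<omega> in M. weak_solution D (\<lambda>x. exp (field \<omega> x)) (H_functional D f) (u \<omega>)"
  shows "strongly_measurable M (Wr_space D r) (Wr_norm D r) u"
  unfolding strongly_measurable_def
proof (intro exI[of _ "approx (H_functional D f)"] conjI allI)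
  show "simple_function M (approx (H_functional D f) n)" for n by (rule approx_simple)
  show "approx (H_functional D f) n ` space M \<subseteq> Wr_space D r" for n
    using approx_Wr[OF r(1,2) f] by auto
  show "AE \<omega> in M. u \<omega> \<in> Wr_space D r \<and> (\<lambda>n. Wr_norm D r (\<lambda>x. u \<omega> x - approx (H_functional D f) n \<omega> x)) \<longlonglongrightarrow> 0"
    using u AE_good AE_space
  proof eventually_elim
    case (elim \<omega>)
    note lev = level_series_coefs[OF default_exponent(1) elim(2) r(3)]
    show ?case
      using approx_Wr_tendsto[OF default_exponent(1) elim(2,3) r f elim(1)]
        level_Wr(1)[OF lev r(1,2) f elim(1)[unfolded weak_solution_field[OF default_exponent(1) elim(2)]]] by simp
  qed
qed

text \<open>After raising to the power q, the factor 1 + Z carries the exponent q k A2 / t. The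
  condition on t makes it at most 1, so that integrability of Z is enough.\<close>

lemma exp_level_norm_powr:
  assumes t: "t > 0" and r: "r < eps" and q: "q \<ge> 0" and k: "k \<ge> 0" and tq: "q * k * A2 r \<le> t"
  shows "exp (k * level_norm r (level_bound (coef_bound t \<omega>))) powr q \<le> exp (q * k * A1 r / t) * (1 + Zr t \<omega>)"
proof -
  have z: "ln (1 + Zr t \<omega>) \<ge> 0" using Zr_nonneg[of t \<omega>] by simp
  have "exp (k * level_norm r (level_bound (coef_bound t \<omega>))) powr q = exp (q * k * A1 r / t + (q * k * A2 r / t) * ln (1 + Zr t \<omega>))"
    unfolding level_norm_coef[OF r] by (simp add: powr_def algebra_simps add_divide_distrib)
  also have "\<dots> \<le> exp (q * k * A1 r / t + 1 * ln (1 + Zr t \<omega>))"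
  proof (subst exp_le_cancel_iff, intro add_left_mono mult_right_mono z)
    show "q * k * A2 r / t \<le> 1" using t tq by simp
  qed
  also have "\<dots> = exp (q * k * A1 r / t) * (1 + Zr t \<omega>)"
    using Zr_nonneg[of t \<omega>] by (simp add: exp_add)
  finally show ?thesis .
qed

lemma solution_V_moments:
  assumes cm: "complete_measure M" and q: "q \<ge> 1" and pq: "p = 1 \<Longrightarrow> q * A2 0 < 1 / \<kappa>"
  shows "\<exists>C>0. \<forall>F\<in>V_dual D. \<forall>u. (AE \<omega> in M. weak_solution D (\<lambda>x. exp (field \<omega> x)) F (u \<omega>)) \<longrightarrow>
      u \<in> bochner_Lq q M (V_space D) (V_norm D) \<and> bochner_Lq_norm q M (V_norm D) u \<le> C * V_dual_norm D F"
proof -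
  \<comment> \<open>The smallest exponent for which \<open>exp_level_norm_powr\<close> applies with
    k = 1; smoothness 0 suffices because the V bound involves only the supremum of the
    exponent.\<close>
  define t where "t = q * A2 0"
  have t: "t > 0" "p = 1 \<Longrightarrow> t < 1 / \<kappa>" using q A2_pos[OF eps_pos] pq by (auto simp: t_def)
  define h where "h \<omega> = exp (q * 1 * A1 0 / t) * (1 + Zr t \<omega>)" for \<omega>
  have ae: "AE \<omega> in M. Zsum t \<omega> \<noteq> \<infinity>" by (rule AE_Zsum(1)[OF t])
  have "integrable M (Zr t)" by (rule AE_Zsum(2)[OF t])
  then have h: "integrable M h" unfolding h_def by simp
  \<comment> \<open>The integral involves neither the right-hand side nor the solution, which makes
    C uniform in both; the added 1 makes it positive.\<close>
  define C where "C = (LINT \<omega>|M. \<bar>h \<omega>\<bar>) powr (1 / q) + 1"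
  have "u \<in> bochner_Lq q M (V_space D) (V_norm D) \<and> bochner_Lq_norm q M (V_norm D) u \<le> C * V_dual_norm D F"
    if F: "F \<in> V_dual D" and u: "AE \<omega> in M. weak_solution D (\<lambda>x. exp (field \<omega> x)) F (u \<omega>)" for F u
  proof -
    note K = V_dual_norm_bound[OF F]
    have N: "\<bar>V_norm D v - V_norm D w\<bar> \<le> V_norm D (\<lambda>x. v x - w x)" if "v \<in> V_space D" "w \<in> V_space D" for v w
      unfolding V_diff(3)[OF that] unfolding V_norm_def by (intro L2_triangle_rev V_grad_L2 that)
    have "AE \<omega> in M. V_norm D (u \<omega>) powr q \<le> V_dual_norm D F powr q * h \<omega>"
      using u ae
    proof eventually_elim
      case (elim \<omega>)
      note lev = level_series_coefs[OF t(1) elim(2) eps_pos]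
      have "V_norm D (u \<omega>) \<le> V_dual_norm D F * exp (level_norm 0 (level_bound (coef_bound t \<omega>)))"
        by (rule level_V_bound[OF lev order_refl elim(1)[unfolded weak_solution_field[OF t(1) elim(2)]] K(2,1)])
      then have "V_norm D (u \<omega>) powr q \<le> (V_dual_norm D F * exp (level_norm 0 (level_bound (coef_bound t \<omega>)))) powr q"
        using q by (intro powr_mono2) auto
      also have "\<dots> = V_dual_norm D F powr q * exp (1 * level_norm 0 (level_bound (coef_bound t \<omega>))) powr q"
        using K(1) by (simp add: powr_mult)
      also have "\<dots> \<le> V_dual_norm D F powr q * h \<omega>"
        unfolding h_def using q by (intro mult_left_mono exp_level_norm_powr t eps_pos) (auto simp: t_def)
      finally show ?case .
    qed
    note b = bochner_Lq_bound[OF cm solution_strongly_measurable[OF F u] N h K(1) q this]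
    have "V_dual_norm D F * (LINT \<omega>|M. \<bar>h \<omega>\<bar>) powr (1 / q) \<le> C * V_dual_norm D F"
      by (subst mult.commute, rule mult_right_mono[OF _ K(1)]) (simp add: C_def)
    then show ?thesis by (intro conjI b(1) order_trans[OF b(2)])
  qed
  moreover have "C > 0" unfolding C_def by (intro add_nonneg_pos) auto
  ultimately show ?thesis by blast
qed

lemma solution_Wr_moments:
  assumes cm: "complete_measure M" and r: "0 < r" "r \<le> 1" "r < eps" and q: "q \<ge> 1"
    and pq: "p = 1 \<Longrightarrow> q * (5 + 2 * real CARD('d)) * A2 r < 1 / \<kappa>"
  shows "\<exists>C>0. \<forall>f\<in>H_space D. \<forall>u. (AE \<omega> in M. weak_solution D (\<lambda>x. exp (field \<omega> x)) (H_functional D f) (u \<omega>)) \<longrightarrow>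
      u \<in> bochner_Lq q M (Wr_space D r) (Wr_norm D r) \<and> bochner_Lq_norm q M (Wr_norm D r) u \<le> C * H_norm D f"
proof -
  let ?k = "5 + 2 * real CARD('d)"
  \<comment> \<open>The factor \<open>?k\<close> is the multiple of the level norm inside the
    exponential of \<open>level_Wr\<close>.\<close>
  define t where "t = q * ?k * A2 r"
  have t: "t > 0" "p = 1 \<Longrightarrow> t < 1 / \<kappa>"
    using q A2_pos[OF r(3)] pq by (auto simp: t_def intro!: mult_pos_pos add_pos_nonneg)
  define h where "h \<omega> = exp (q * ?k * A1 r / t) * (1 + Zr t \<omega>)" for \<omega>
  have ae: "AE \<omega> in M. Zsum t \<omega> \<noteq> \<infinity>" by (rule AE_Zsum(1)[OF t])
  have "integrable M (Zr t)" by (rule AE_Zsum(2)[OF t])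
  then have h: "integrable M h" unfolding h_def by simp
  define C where "C = 2 * (LINT \<omega>|M. \<bar>h \<omega>\<bar>) powr (1 / q) + 1"
  have "u \<in> bochner_Lq q M (Wr_space D r) (Wr_norm D r) \<and> bochner_Lq_norm q M (Wr_norm D r) u \<le> C * H_norm D f"
    if f: "f \<in> H_space D" and u: "AE \<omega> in M. weak_solution D (\<lambda>x. exp (field \<omega> x)) (H_functional D f) (u \<omega>)" for f u
  proof -
    have fn: "0 \<le> H_norm D f" by (simp add: H_norm_def)
    have "AE \<omega> in M. Wr_norm D r (u \<omega>) powr q \<le> (2 * H_norm D f) powr q * h \<omega>"
      using u ae
    proof eventually_elim
      case (elim \<omega>)
      note lev = level_series_coefs[OF t(1) elim(2) r(3)]
      let ?A = "level_norm r (level_bound (coef_bound t \<omega>))"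
      note W = level_Wr[OF lev r(1,2) f elim(1)[unfolded weak_solution_field[OF t(1) elim(2)]]]
      have "Wr_norm D r (u \<omega>) \<le> (2 * H_norm D f) * exp (?k * ?A)"
        using W(2) by (simp add: mult_ac)
      then have "Wr_norm D r (u \<omega>) powr q \<le> ((2 * H_norm D f) * exp (?k * ?A)) powr q"
        using q Wr_norm_nonneg[OF W(1)] by (intro powr_mono2) auto
      also have "\<dots> = (2 * H_norm D f) powr q * exp (?k * ?A) powr q"
        using fn by (simp only: powr_mult)
      also have "\<dots> \<le> (2 * H_norm D f) powr q * h \<omega>"
        unfolding h_def using q by (intro mult_left_mono exp_level_norm_powr t r) (auto simp: t_def)
      finally show ?case .
    qed
    note b = bochner_Lq_bound[OF cm solution_strongly_measurable_Wr[OF f r u] Wr_triangle_rev[OF r(1,2)] h _ q this]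
    have fn2: "0 \<le> 2 * H_norm D f" using fn by simp
    have "2 * H_norm D f * (LINT \<omega>|M. \<bar>h \<omega>\<bar>) powr (1 / q) = H_norm D f * (2 * (LINT \<omega>|M. \<bar>h \<omega>\<bar>) powr (1 / q))"
      by (simp only: mult_ac)
    also have "\<dots> \<le> C * H_norm D f"
      by (subst mult.commute, rule mult_right_mono[OF _ fn]) (simp add: C_def)
    finally show ?thesis by (intro conjI b(1) order_trans[OF b(2)] fn2)
  qed
  moreover have "C > 0" unfolding C_def by (intro add_nonneg_pos) auto
  ultimately show ?thesis by blast
qed

end

text \<open>Solutions are unique only up to null sets, so measurability and moments are asserted for
  every family \<open>u\<close> that solves the equation almost surely. The constants C are chosen
  before the right-hand side and the solution.\<close>

theorem theorem3p9:
  fixes D :: "(real ^ ('d::{finite,linorder})) set"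
    and M :: "'w measure"
    and \<alpha> p s \<gamma> :: real
    and \<phi> \<psi> :: "real \<Rightarrow> real"
  defines "d \<equiv> CARD('d)"
  defines "\<beta> \<equiv> 2 powr (\<gamma> - real d)"
  defines "a \<equiv> \<lambda>(X :: 'd wavelet_index \<Rightarrow> 'w \<Rightarrow> real) (T :: 'w \<Rightarrow> nat list set) \<omega> x.
                 exp (besov_tree_field \<phi> \<psi> p s X T \<omega> x)"
  assumes "d \<in> {1, 2, 3}"
    and "convex_polytopal_domain D" and "D \<subseteq> cbox 0 1"
    and "wavelet_system \<alpha> \<phi> \<psi>" and "\<alpha> \<ge> 1" and "\<alpha> \<ge> s"
    and "prob_space M" and "complete_measure M"
    and "p \<ge> 1" and "s > 0" and "s * p > real d" and "\<gamma> \<le> real d"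
  shows
    "(\<forall>\<kappa>>0. \<forall>X T. besov_tree_data M p \<kappa> \<beta> X T \<longrightarrow>
        (\<forall>f\<in>V_dual D.
           (AE \<omega> in M. \<exists>u. weak_solution D (a X T \<omega>) f u \<and>
              (\<forall>u'. weak_solution D (a X T \<omega>) f u' \<longrightarrow> (AE x in lebesgue_on D. u' x = u x))) \<and>
           (\<forall>u. (AE \<omega> in M. weak_solution D (a X T \<omega>) f (u \<omega>)) \<longrightarrow>
              strongly_measurable M (V_space D) (V_norm D) u)))
     \<and>
     (\<exists>\<kappa>0>0. \<forall>\<kappa>\<in>{0<..<\<kappa>0}. \<forall>X T. besov_tree_data M p \<kappa> \<beta> X T \<longrightarrow>
        (\<exists>qbar>1. \<forall>q\<ge>1. (p = 1 \<longrightarrow> q < qbar) \<longrightarrow>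
           (\<exists>C>0. \<forall>f\<in>V_dual D. \<forall>u. (AE \<omega> in M. weak_solution D (a X T \<omega>) f (u \<omega>)) \<longrightarrow>
              u \<in> bochner_Lq q M (V_space D) (V_norm D) \<and>
              bochner_Lq_norm q M (V_norm D) u \<le> C * V_dual_norm D f)))
     \<and>
     (\<forall>r\<in>{0<..<s - real d / p} \<inter> {0<..1}.
      \<exists>\<kappa>0>0. \<forall>\<kappa>\<in>{0<..<\<kappa>0}. \<forall>X T. besov_tree_data M p \<kappa> \<beta> X T \<longrightarrow>
        (\<exists>qbar>1. \<forall>q\<ge>1. (p = 1 \<longrightarrow> q < qbar) \<longrightarrow>
           (\<exists>C>0. \<forall>f\<in>H_space D. \<forall>u. (AE \<omega> in M. weak_solution D (a X T \<omega>) (H_functional D f) (u \<omega>)) \<longrightarrow>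
              u \<in> bochner_Lq q M (Wr_space D r) (Wr_norm D r) \<and>
              bochner_Lq_norm q M (Wr_norm D r) u \<le> C * H_norm D f)))"
proof -
  \<comment> \<open>Drops the three defining equations, so that the numbering starts with the
    assumption on the dimension.\<close>
  note assms = assms(4-)
  obtain R B where RB: "B \<ge> 1" "wavelet_factor R B \<phi>" "wavelet_factor R B \<psi>"
    using wavelet_system_factors[OF assms(4,5)] by blast
  interpret W: wavelets \<phi> \<psi> R B p s "TYPE('d)"
    by unfold_locales (use RB in auto)
  interpret P: prob_space M by fact
  have D01: "D \<subseteq> cbox 0 1" by fact
  interpret U: unit_domain D
  proof
    show "open D" using assms(2) by (simp add: convex_polytopal_domain_def)
    fix x b :: "(real, 'd) vec" assume x: "x \<in> D" and "b \<in> Basis"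
    then obtain i where "b = axis i 1" by (auto simp: Basis_vec_def)
    then show "\<bar>x \<bullet> b\<bar> \<le> 1" using D01 x by (auto simp: inner_axis mem_box_cart)
  qed
  have prior: "besov_prior \<phi> \<psi> R B p s D M \<kappa> X T" if "\<kappa> > 0" "besov_tree_data M p \<kappa> \<beta> X T" for \<kappa> :: real and X :: "'d wavelet_index \<Rightarrow> 'w \<Rightarrow> real" and T
    using that assms D01 by unfold_locales (auto simp: besov_tree_data_def GW_tree_def d_def)
  have eps: "W.eps = s - real d / p" by (simp add: W.eps_def d_def)
  have eps_pos: "W.eps > 0" using assms by (simp add: eps field_simps)
  \<comment> \<open>With k the factor of q in the moment lemmas, \<kappa> < 1/k leaves the nonempty
    range 1 \<le> q < 1/(\<kappa> k) on which q k < 1/\<kappa> holds.\<close>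
  have kappa: "1 / (\<kappa> * k) > 1 \<and> (\<forall>q<1 / (\<kappa> * k). q * k < 1 / \<kappa>)"
    if "\<kappa> \<in> {0<..<1 / k}" "k > 0" for \<kappa> k :: real
    using that by (auto simp: field_simps)
  show ?thesis
  proof (intro conjI ballI)
    show "\<forall>\<kappa>>0. \<forall>X T. besov_tree_data M p \<kappa> \<beta> X T \<longrightarrow>
        (\<forall>f\<in>V_dual D.
           (AE \<omega> in M. \<exists>u. weak_solution D (a X T \<omega>) f u \<and>
              (\<forall>u'. weak_solution D (a X T \<omega>) f u' \<longrightarrow> (AE x in lebesgue_on D. u' x = u x))) \<and>
           (\<forall>u. (AE \<omega> in M. weak_solution D (a X T \<omega>) f (u \<omega>)) \<longrightarrow>
              strongly_measurable M (V_space D) (V_norm D) u))"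
    proof (intro allI impI ballI)
      fix \<kappa> :: real and X :: "'d wavelet_index \<Rightarrow> 'w \<Rightarrow> real" and T f assume "\<kappa> > 0" "besov_tree_data M p \<kappa> \<beta> X T" and f: "f \<in> V_dual D"
      then interpret besov_prior \<phi> \<psi> R B p s "TYPE('d)" D M \<kappa> X T by (intro prior)
      have a: "a X T \<omega> = (\<lambda>x. exp (field \<omega> x))" for \<omega> by (simp add: a_def field_def)
      show "(AE \<omega> in M. \<exists>u. weak_solution D (a X T \<omega>) f u \<and>
              (\<forall>u'. weak_solution D (a X T \<omega>) f u' \<longrightarrow> (AE x in lebesgue_on D. u' x = u x))) \<and>
           (\<forall>u. (AE \<omega> in M. weak_solution D (a X T \<omega>) f (u \<omega>)) \<longrightarrow>
              strongly_measurable M (V_space D) (V_norm D) u)"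
        unfolding a using AE_solution[OF f] solution_strongly_measurable[OF f] by blast
    qed
    let ?k = "W.A2 0"
    have k: "?k > 0" by (rule W.A2_pos[OF eps_pos])
    show "\<exists>\<kappa>0>0. \<forall>\<kappa>\<in>{0<..<\<kappa>0}. \<forall>X T. besov_tree_data M p \<kappa> \<beta> X T \<longrightarrow>
        (\<exists>qbar>1. \<forall>q\<ge>1. (p = 1 \<longrightarrow> q < qbar) \<longrightarrow>
           (\<exists>C>0. \<forall>f\<in>V_dual D. \<forall>u. (AE \<omega> in M. weak_solution D (a X T \<omega>) f (u \<omega>)) \<longrightarrow>
              u \<in> bochner_Lq q M (V_space D) (V_norm D) \<and>
              bochner_Lq_norm q M (V_norm D) u \<le> C * V_dual_norm D f))"
    proof (rule exI[of _ "1 / ?k"], intro conjI ballI allI impI)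
      show "1 / ?k > 0" using k by simp
      fix \<kappa> :: real and X :: "'d wavelet_index \<Rightarrow> 'w \<Rightarrow> real" and T assume \<kappa>_less: "\<kappa> \<in> {0<..<1 / ?k}" and "besov_tree_data M p \<kappa> \<beta> X T"
      then interpret besov_prior \<phi> \<psi> R B p s "TYPE('d)" D M \<kappa> X T by (intro prior) auto
      have a: "a X T \<omega> = (\<lambda>x. exp (field \<omega> x))" for \<omega> by (simp add: a_def field_def)
      show "\<exists>qbar>1. \<forall>q\<ge>1. (p = 1 \<longrightarrow> q < qbar) \<longrightarrow>
           (\<exists>C>0. \<forall>f\<in>V_dual D. \<forall>u. (AE \<omega> in M. weak_solution D (a X T \<omega>) f (u \<omega>)) \<longrightarrow>
              u \<in> bochner_Lq q M (V_space D) (V_norm D) \<and>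
              bochner_Lq_norm q M (V_norm D) u \<le> C * V_dual_norm D f)"
        unfolding a
      proof (rule exI[of _ "1 / (\<kappa> * ?k)"], intro conjI allI impI)
        show "1 < 1 / (\<kappa> * ?k)" using kappa[OF \<kappa>_less k] by blast
        fix q :: real assume q: "1 \<le> q" "p = 1 \<longrightarrow> q < 1 / (\<kappa> * ?k)"
        then have "q * ?k < 1 / \<kappa>" if "p = 1" using that kappa[OF \<kappa>_less k] by blast
        then show "\<exists>C>0. \<forall>f\<in>V_dual D. \<forall>u. (AE \<omega> in M. weak_solution D (\<lambda>x. exp (field \<omega> x)) f (u \<omega>)) \<longrightarrow>
              u \<in> bochner_Lq q M (V_space D) (V_norm D) \<and>
              bochner_Lq_norm q M (V_norm D) u \<le> C * V_dual_norm D f"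
          by (rule solution_V_moments[OF \<open>complete_measure M\<close> q(1)])
      qed
    qed
  next
    fix r assume "r \<in> {0<..<s - real d / p} \<inter> {0<..1}"
    then have r: "0 < r" "r \<le> 1" "r < W.eps" by (auto simp: eps)
    let ?k = "(5 + 2 * real CARD('d)) * W.A2 r"
    have k: "?k > 0" using W.A2_pos[OF r(3)] by (intro mult_pos_pos add_pos_nonneg) auto
    show "\<exists>\<kappa>0>0. \<forall>\<kappa>\<in>{0<..<\<kappa>0}. \<forall>X T. besov_tree_data M p \<kappa> \<beta> X T \<longrightarrow>
        (\<exists>qbar>1. \<forall>q\<ge>1. (p = 1 \<longrightarrow> q < qbar) \<longrightarrow>
           (\<exists>C>0. \<forall>f\<in>H_space D. \<forall>u. (AE \<omega> in M. weak_solution D (a X T \<omega>) (H_functional D f) (u \<omega>)) \<longrightarrow>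
              u \<in> bochner_Lq q M (Wr_space D r) (Wr_norm D r) \<and>
              bochner_Lq_norm q M (Wr_norm D r) u \<le> C * H_norm D f))"
    proof (rule exI[of _ "1 / ?k"], intro conjI ballI allI impI)
      show "1 / ?k > 0" using k by (rule divide_pos_pos[OF zero_less_one])
      fix \<kappa> :: real and X :: "'d wavelet_index \<Rightarrow> 'w \<Rightarrow> real" and T assume \<kappa>_less: "\<kappa> \<in> {0<..<1 / ?k}" and "besov_tree_data M p \<kappa> \<beta> X T"
      then interpret besov_prior \<phi> \<psi> R B p s "TYPE('d)" D M \<kappa> X T by (intro prior) auto
      have a: "a X T \<omega> = (\<lambda>x. exp (field \<omega> x))" for \<omega> by (simp add: a_def field_def)
      show "\<exists>qbar>1. \<forall>q\<ge>1. (p = 1 \<longrightarrow> q < qbar) \<longrightarrow>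
           (\<exists>C>0. \<forall>f\<in>H_space D. \<forall>u. (AE \<omega> in M. weak_solution D (a X T \<omega>) (H_functional D f) (u \<omega>)) \<longrightarrow>
              u \<in> bochner_Lq q M (Wr_space D r) (Wr_norm D r) \<and>
              bochner_Lq_norm q M (Wr_norm D r) u \<le> C * H_norm D f)"
        unfolding a
      proof (rule exI[of _ "1 / (\<kappa> * ?k)"], intro conjI allI impI)
        show "1 < 1 / (\<kappa> * ?k)" using kappa[OF \<kappa>_less k] by blast
        fix q :: real assume q: "1 \<le> q" "p = 1 \<longrightarrow> q < 1 / (\<kappa> * ?k)"
        then have "q * (5 + 2 * real CARD('d)) * W.A2 r < 1 / \<kappa>" if "p = 1"
          using that kappa[OF \<kappa>_less k] by (simp only: mult.assoc)
        then show "\<exists>C>0. \<forall>f\<in>H_space D. \<forall>u. (AE \<omega> in M. weak_solution D (\<lambda>x. exp (field \<omega> x)) (H_functional D f) (u \<omega>)) \<longrightarrow>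
              u \<in> bochner_Lq q M (Wr_space D r) (Wr_norm D r) \<and>
              bochner_Lq_norm q M (Wr_norm D r) u \<le> C * H_norm D f"
          by (rule solution_Wr_moments[OF \<open>complete_measure M\<close> r q(1)])
      qed
    qed
  qed
qed

end
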